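(* Let $\mathbb{K}$ be $\mathbb{R}$ or $\mathbb{C}$, and let $E_1,\dots,E_s,F$ be Archimedean vector lattices over $\mathbb{K}$ with $F$ Dedekind complete. (1) For any $s_{\mathbb{K}}$-linear map of order bounded variation $T:\times_{k=1}^sE_k\to F$ there exists a unique order bounded $\mathbb{K}$-linear map $T^{\bar\otimes}:\bar\otimes_{k=1}^sE_k\to F$ such that $T(f_1,\dots,f_s)=T^{\bar\otimes}(f_1\bar\otimes\dots\bar\otimes f_s)$ for every $f_k\in E_k$ $(k\in\{1,\dots,s\})$. (2) $\mathcal{L}_{bv}(E_1,\dots,E_s;F)$ is a Dedekind complete Archimedean vector lattice over $\mathbb{K}$, and the correspondence $T\mapsto T^{\bar\otimes}$ is a vector lattice isomorphism from $\mathcal{L}_{bv}(E_1,\dots,E_s;F)$ onto $\mathcal{L}_b(\bar\otimes_{k=1}^sE_k,F)$. (3) For $T\in\mathcal{L}_{bv}(E_1,\dots,E_s;F)$, $$|T|(a_1,\dots,a_s)=\sup\Bigl\{\sum_{n_1,\dots,n_s}|T(x^1_{n_1},\dots,x^s_{n_s})|: x^k\in\textstyle\prod a_k\ (k\in\{1,\dots,s\})\Bigr\}$$ for all $a_k\in E_k^+$ $(k\in\{1,\dots,s\})$.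
   Context: A modulus on a $\mathbb{K}$-vector space $E$ is a map $m:E\to E$ with $m\circ m=m$ such that (1) $m(\alpha f)=|\alpha|m(f)$ for $\alpha\in\mathbb{K}$, $f\in E$; (2) $m\bigl(m(m(f)+m(g))-m(f+g)\bigr)=m(f)+m(g)-m(f+g)$ for $f,g\in E$; (3) $E$ is the $\mathbb{K}$-linear hull of $m(E)$. It is Archimedean if, for $f,g\in E$, $m(m(g)-nm(f))=m(g)-nm(f)$ for all $n\in\mathbb{N}$ implies $f=0$. An Archimedean vector lattice over $\mathbb{K}$ is a $\mathbb{K}$-vector space with an Archimedean modulus, written $|\cdot|$. Put $E^+=\{f\in E:|f|=f\}$ (positive cone) and $E_\rho=E^+-E^+$; $f\le g$ means $g-f\in E^+$. Known facts (Mittelmeyer–Wolff): for $\mathbb{K}=\mathbb{R}$ these are exactly the usual Archimedean vector lattices with $|f|=f\vee(-f)$; for $\mathbb{K}=\mathbb{C}$, $E_\rho$ is an Archimedean real vector lattice with positive cone $E^+$, $E=E_\rho\oplus iE_\rho$, and $|f+ig|=\sup\{f\cos\theta+g\sin\theta:\theta\in[0,2\pi]\}$ (the supremum existing in $E_\rho$) for $f,g\in E_\rho$. $A\subseteq E$ is order bounded if there is $f\in E^+$ with $|a|\le f$ for all $a\in A$. $E$ is Dedekind complete if every nonempty order bounded subset of $E^+$ has a supremum in $E^+$. A vector lattice homomorphism is a $\mathbb{K}$-linear map $T$ with $T(|f|)=|T(f)|$; a vector lattice isomorphism is a bijective one. An $s_{\mathbb{K}}$-linear map is a map on $\times_{k=1}^sE_k$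 that is $\mathbb{K}$-linear in each variable separately; it is a vector lattice $s$-morphism if for each $k$ and all fixed $f_j\in E_j^+$ $(j\neq k)$ the map $f_k\mapsto T(f_1,\dots,f_s)$ is a vector lattice homomorphism; it is positive if it maps $\times_{k=1}^sE_k^+$ into $F^+$. The Archimedean vector lattice tensor product $(\bar\otimes_{k=1}^sE_k,\bar\otimes)$ is the essentially unique pair of an Archimedean vector lattice over $\mathbb{K}$ and a vector lattice $s$-morphism $\bar\otimes:\times_{k=1}^sE_k\to\bar\otimes_{k=1}^sE_k$ such that every vector lattice $s$-morphism $T$ from $\times_{k=1}^sE_k$ into an Archimedean vector lattice $G$ over $\mathbb{K}$ factors as $T=T^{\bar\otimes}\circ\bar\otimes$ for a unique vector lattice homomorphism $T^{\bar\otimes}:\bar\otimes_{k=1}^sE_k\to G$. Write $f_1\bar\otimes\dots\bar\otimes f_s=\bar\otimes(f_1,\dots,f_s)$. A partition of $a\in E^+$ is a finite sequence $x=(x_n)_{n=1}^N$ in $E^+$ with $\sum_nx_n=a$; $\prod a$ is the set of all partitions of $a$. An $s_{\mathbb{K}}$-linear map $T:\times_{k=1}^sE_k\to F$ is of order bounded variation if for all $a_k\in E_k^+$ the set $\{\sum_{n_1,\dots,n_s}|T(x^1_{n_1},\dots,x^s_{n_s})|:x^k\in\prod a_k\ (k=1,\dots,s)\}$ is order bounded. $\mathcal{L}_{bv}(E_1,\dots,E_s;F)$ is the $\mathbb{K}$-vector space of all such maps; its vector lattice structure is the one whose positive cone is the set of positive maps in it, and $|T|$ in (3) denotes the modulus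 for this structure. $\mathcal{L}_b(G,F)$ is the space of order bounded $\mathbb{K}$-linear maps $G\to F$ (mapping order bounded sets to order bounded sets), which for $F$ Dedekind complete is known to be a Dedekind complete Archimedean vector lattice over $\mathbb{K}$ with positive cone the positive linear maps. *)

theory Defs
  imports Complex_Main "HOL-Algebra.Algebraic_Closure_Type"
begin

section \<open>The scalar field\<close>

text \<open>The scalars are \<open>\<real>\<close> or \<open>\<complex>\<close>: a type whose field structure and norm are, up to an
  isometric field isomorphism, those of one of these two subfields of \<^typ>\<open>complex\<close>.\<close>

class real_or_complex = real_normed_field +
  assumes real_or_complex:
    "\<exists>\<phi> :: 'a \<Rightarrow> complex. inj \<phi> \<and> (range \<phi> = \<real> \<or> range \<phi> = UNIV) \<and>
       (\<forall>x y. \<phi> (x + y) = \<phi> x + \<phi> y) \<and> (\<forall>x y. \<phi> (x * y) = \<phi> x * \<phi> y) \<and>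
       (\<forall>x. norm (\<phi> x) = norm x)"

instance real :: real_or_complex
proof
  show "\<exists>\<phi> :: real \<Rightarrow> complex. inj \<phi> \<and> (range \<phi> = \<real> \<or> range \<phi> = UNIV) \<and>
       (\<forall>x y. \<phi> (x + y) = \<phi> x + \<phi> y) \<and> (\<forall>x y. \<phi> (x * y) = \<phi> x * \<phi> y) \<and>
       (\<forall>x. norm (\<phi> x) = norm x)"
    by (rule exI[of _ complex_of_real]) (auto simp: inj_def Reals_def)
qed

instance complex :: real_or_complex
proof
  show "\<exists>\<phi> :: complex \<Rightarrow> complex. inj \<phi> \<and> (range \<phi> = \<real> \<or> range \<phi> = UNIV) \<and>
       (\<forall>x y. \<phi> (x + y) = \<phi> x + \<phi> y) \<and> (\<forall>x y. \<phi> (x * y) = \<phi> x * \<phi> y) \<and>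
       (\<forall>x. norm (\<phi> x) = norm x)"
    by (rule exI[of _ id]) auto
qed


section \<open>Archimedean vector lattices\<close>

text \<open>A vector space is a \<^locale>\<open>module\<close> over the scalar field regarded as a ring record; the
  fields \<open>mult\<close> and \<open>one\<close> that a \<open>module\<close> record inherits from \<open>ring\<close> play no role.\<close>

record ('k, 'a) vlattice = "('k, 'a) module" +
  modulus :: "'a \<Rightarrow> 'a"

definition linear_hull :: "('k, 'a, 'm) module_scheme \<Rightarrow> 'a set \<Rightarrow> 'a set" where
  "linear_hull V A = {\<Oplus>\<^bsub>V\<^esub>x\<in>B. c x \<odot>\<^bsub>V\<^esub> x | B c. finite B \<and> B \<subseteq> A}"

locale archimedean_vector_lattice =
  module "ring_of_type_algebra :: 'k ring" V
  for V :: "('k :: real_or_complex, 'a) vlattice" +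
  assumes modulus_closed: "f \<in> carrier V \<Longrightarrow> modulus V f \<in> carrier V"
    and modulus_idem: "f \<in> carrier V \<Longrightarrow> modulus V (modulus V f) = modulus V f"
    and modulus_smult:
      "f \<in> carrier V \<Longrightarrow> modulus V (\<alpha> \<odot>\<^bsub>V\<^esub> f) = of_real (norm \<alpha>) \<odot>\<^bsub>V\<^esub> modulus V f"
    and modulus_triangle:
      "\<lbrakk>f \<in> carrier V; g \<in> carrier V\<rbrakk> \<Longrightarrow>
        modulus V (modulus V (modulus V f \<oplus>\<^bsub>V\<^esub> modulus V g) \<ominus>\<^bsub>V\<^esub> modulus V (f \<oplus>\<^bsub>V\<^esub> g))
          = modulus V f \<oplus>\<^bsub>V\<^esub> modulus V g \<ominus>\<^bsub>V\<^esub> modulus V (f \<oplus>\<^bsub>V\<^esub> g)"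
    and modulus_hull: "linear_hull V (modulus V ` carrier V) = carrier V"
    and archimedean:
      "\<lbrakk>f \<in> carrier V; g \<in> carrier V;
        \<And>n::nat. modulus V (modulus V g \<ominus>\<^bsub>V\<^esub> of_nat n \<odot>\<^bsub>V\<^esub> modulus V f)
                   = modulus V g \<ominus>\<^bsub>V\<^esub> of_nat n \<odot>\<^bsub>V\<^esub> modulus V f\<rbrakk> \<Longrightarrow> f = \<zero>\<^bsub>V\<^esub>"

definition pos_cone :: "('k, 'a) vlattice \<Rightarrow> 'a set" where
  "pos_cone V = {f \<in> carrier V. modulus V f = f}"

definition vl_le :: "('k, 'a) vlattice \<Rightarrow> 'a \<Rightarrow> 'a \<Rightarrow> bool" where
  "vl_le V f g \<longleftrightarrow> g \<ominus>\<^bsub>V\<^esub> f \<in> pos_cone V"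

definition cone_order :: "('k, 'a) vlattice \<Rightarrow> 'a gorder" where
  "cone_order V = \<lparr>carrier = pos_cone V, eq = (=), le = vl_le V\<rparr>"

text \<open>Supremum, in the positive cone, of a subset of the positive cone. For a nonempty subset this
  is also its supremum in the whole space, since every upper bound of it is then positive.\<close>

definition is_cone_sup :: "('k, 'a) vlattice \<Rightarrow> 'a set \<Rightarrow> 'a \<Rightarrow> bool" where
  "is_cone_sup V A u \<longleftrightarrow> A \<subseteq> pos_cone V \<and> least (cone_order V) u (Upper (cone_order V) A)"

definition order_bounded :: "('k, 'a) vlattice \<Rightarrow> 'a set \<Rightarrow> bool" where
  "order_bounded V A \<longleftrightarrow>
     A \<subseteq> carrier V \<and> (\<exists>f\<in>pos_cone V. \<forall>a\<in>A. vl_le V (modulus V a) f)"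

definition dedekind_complete :: "('k, 'a) vlattice \<Rightarrow> bool" where
  "dedekind_complete V \<longleftrightarrow>
     (\<forall>A. A \<subseteq> pos_cone V \<and> A \<noteq> {} \<and> order_bounded V A \<longrightarrow> (\<exists>u. is_cone_sup V A u))"


section \<open>Linear and multilinear maps\<close>

definition linear_map ::
  "('k, 'a, 'm) module_scheme \<Rightarrow> ('k, 'b, 'n) module_scheme \<Rightarrow> ('a \<Rightarrow> 'b) \<Rightarrow> bool" where
  "linear_map V W T \<longleftrightarrow> T \<in> carrier V \<rightarrow> carrier W \<and>
     (\<forall>f\<in>carrier V. \<forall>g\<in>carrier V. T (f \<oplus>\<^bsub>V\<^esub> g) = T f \<oplus>\<^bsub>W\<^esub> T g) \<and>
     (\<forall>\<alpha>. \<forall>f\<in>carrier V. T (\<alpha> \<odot>\<^bsub>V\<^esub> f) = \<alpha> \<odot>\<^bsub>W\<^esub> T f)"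

definition vl_hom :: "('k, 'a) vlattice \<Rightarrow> ('k, 'b) vlattice \<Rightarrow> ('a \<Rightarrow> 'b) \<Rightarrow> bool" where
  "vl_hom V W T \<longleftrightarrow> linear_map V W T \<and> (\<forall>f\<in>carrier V. T (modulus V f) = modulus W (T f))"

definition vl_iso :: "('k, 'a) vlattice \<Rightarrow> ('k, 'b) vlattice \<Rightarrow> ('a \<Rightarrow> 'b) \<Rightarrow> bool" where
  "vl_iso V W T \<longleftrightarrow> vl_hom V W T \<and> bij_betw T (carrier V) (carrier W)"

text \<open>A family \<open>E\<^sub>1, \<dots>, E\<^sub>s\<close> is a function \<open>E\<close> on \<open>nat\<close> of which only the values at \<open>1, \<dots>, s\<close>
  matter; the members have their own carriers and operations inside one common type. Elements of
  the product are extensional functions on \<open>{1..s}\<close>.\<close>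

definition tuples :: "nat \<Rightarrow> (nat \<Rightarrow> ('k, 'a) vlattice) \<Rightarrow> (nat \<Rightarrow> 'a) set" where
  "tuples s E = (\<Pi>\<^sub>E k\<in>{1..s}. carrier (E k))"

definition pos_tuples :: "nat \<Rightarrow> (nat \<Rightarrow> ('k, 'a) vlattice) \<Rightarrow> (nat \<Rightarrow> 'a) set" where
  "pos_tuples s E = (\<Pi>\<^sub>E k\<in>{1..s}. pos_cone (E k))"

definition multilinear_map ::
  "nat \<Rightarrow> (nat \<Rightarrow> ('k, 'a) vlattice) \<Rightarrow> ('k, 'b) vlattice \<Rightarrow> ((nat \<Rightarrow> 'a) \<Rightarrow> 'b) \<Rightarrow> bool" where
  "multilinear_map s E F T \<longleftrightarrow>
     (\<forall>k\<in>{1..s}. \<forall>f\<in>tuples s E. linear_map (E k) F (\<lambda>x. T (f(k := x))))"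

definition s_morphism ::
  "nat \<Rightarrow> (nat \<Rightarrow> ('k, 'a) vlattice) \<Rightarrow> ('k, 'b) vlattice \<Rightarrow> ((nat \<Rightarrow> 'a) \<Rightarrow> 'b) \<Rightarrow> bool" where
  "s_morphism s E F T \<longleftrightarrow> multilinear_map s E F T \<and>
     (\<forall>k\<in>{1..s}. \<forall>f\<in>tuples s E. (\<forall>j\<in>{1..s} - {k}. f j \<in> pos_cone (E j)) \<longrightarrow>
        vl_hom (E k) F (\<lambda>x. T (f(k := x))))"


section \<open>The tensor product\<close>

text \<open>A pair \<open>(P, t)\<close> with the universal property of the Archimedean vector lattice tensor product,
  where the target spaces \<open>G\<close> in that property range over the Archimedean vector lattices carried
  by the type \<open>'u\<close>: a proposition of HOL cannot quantify over all types. A tensor product in the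
  unrestricted sense satisfies this for every \<open>'u\<close>, so a statement that assumes it for one \<open>'u\<close>
  covers all tensor products in the unrestricted sense.\<close>

definition is_tensor_product ::
  "'u itself \<Rightarrow> nat \<Rightarrow> (nat \<Rightarrow> ('k :: real_or_complex, 'a) vlattice) \<Rightarrow>
     ('k, 'p) vlattice \<Rightarrow> ((nat \<Rightarrow> 'a) \<Rightarrow> 'p) \<Rightarrow> bool" where
  "is_tensor_product U s E P t \<longleftrightarrow>
     archimedean_vector_lattice P \<and> s_morphism s E P t \<and>
     (\<forall>(G :: ('k, 'u) vlattice) T. archimedean_vector_lattice G \<and> s_morphism s E G T \<longrightarrow>
        (\<exists>!h. h \<in> extensional (carrier P) \<and> vl_hom P G h \<and> (\<forall>f\<in>tuples s E. T f = h (t f))))"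

text \<open>With a small \<open>'u\<close> (such as \<^typ>\<open>unit\<close>) the predicate would not determine the tensor product.
  The following type is rich enough for maps of \<open>E\<^sub>1 \<times> \<dots> \<times> E\<^sub>s\<close> into spaces over \<open>'f\<close>: it
  carries the sublattices of \<open>P\<close> as well as the order bounded operators from spaces of maps
  \<open>E\<^sub>1 \<times> \<dots> \<times> E\<^sub>s \<rightarrow> F\<close> into \<open>F\<close>.\<close>

type_synonym ('a, 'p, 'f) test_universe = "'p + (((nat \<Rightarrow> 'a) \<Rightarrow> 'f) \<Rightarrow> 'f)"


section \<open>Order bounded variation\<close>

definition pos_partitions :: "('k, 'a) vlattice \<Rightarrow> 'a \<Rightarrow> 'a list set" where
  "pos_partitions V a =
     {xs. set xs \<subseteq> pos_cone V \<and> (\<Oplus>\<^bsub>V\<^esub>n\<in>{..<length xs}. xs ! n) = a}"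

definition variation_sums ::
  "nat \<Rightarrow> (nat \<Rightarrow> ('k, 'a) vlattice) \<Rightarrow> ('k, 'b) vlattice \<Rightarrow> ((nat \<Rightarrow> 'a) \<Rightarrow> 'b) \<Rightarrow> (nat \<Rightarrow> 'a) \<Rightarrow>
     'b set" where
  "variation_sums s E F T a =
     {\<Oplus>\<^bsub>F\<^esub>n\<in>(\<Pi>\<^sub>E k\<in>{1..s}. {..<length (x k)}). modulus F (T (\<lambda>k\<in>{1..s}. x k ! n k)) |
        x. \<forall>k\<in>{1..s}. x k \<in> pos_partitions (E k) (a k)}"

definition bounded_variation ::
  "nat \<Rightarrow> (nat \<Rightarrow> ('k, 'a) vlattice) \<Rightarrow> ('k, 'b) vlattice \<Rightarrow> ((nat \<Rightarrow> 'a) \<Rightarrow> 'b) \<Rightarrow> bool" where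
  "bounded_variation s E F T \<longleftrightarrow>
     (\<forall>a\<in>pos_tuples s E. order_bounded F (variation_sums s E F T a))"


section \<open>The lattices of maps\<close>

definition pointwise_space ::
  "'x set \<Rightarrow> ('x \<Rightarrow> 'b) set \<Rightarrow> ('k, 'b) vlattice \<Rightarrow> ('k, 'x \<Rightarrow> 'b) module" where
  "pointwise_space D H F =
     \<lparr>carrier = H, monoid.mult = undefined, monoid.one = undefined,
      ring.zero = (\<lambda>x\<in>D. \<zero>\<^bsub>F\<^esub>), ring.add = (\<lambda>S T. \<lambda>x\<in>D. S x \<oplus>\<^bsub>F\<^esub> T x),
      module.smult = (\<lambda>\<alpha> T. \<lambda>x\<in>D. \<alpha> \<odot>\<^bsub>F\<^esub> T x)\<rparr>"

definition attach_modulus :: "('k, 'a) module \<Rightarrow> ('a \<Rightarrow> 'a) \<Rightarrow> ('k, 'a) vlattice" where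
  "attach_modulus V m = module.extend V (vlattice.fields m)"

lemma attach_modulus_simps [simp]:
  "carrier (attach_modulus V m) = carrier V"
  "ring.zero (attach_modulus V m) = ring.zero V"
  "ring.add (attach_modulus V m) = ring.add V"
  "module.smult (attach_modulus V m) = module.smult V"
  "vlattice.modulus (attach_modulus V m) = m"
  by (simp_all add: attach_modulus_def module.defs vlattice.defs)

text \<open>The vector space \<open>V\<close> with the modulus whose positive cone is \<open>C\<close>.\<close>

definition lattice_of_cone ::
  "('k :: real_or_complex, 'a) module \<Rightarrow> 'a set \<Rightarrow> ('k, 'a) vlattice" where
  "lattice_of_cone V C = attach_modulus V
     (THE m. m \<in> extensional (carrier V) \<and> archimedean_vector_lattice (attach_modulus V m) \<and>
             pos_cone (attach_modulus V m) = C)"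

definition bv_maps ::
  "nat \<Rightarrow> (nat \<Rightarrow> ('k, 'a) vlattice) \<Rightarrow> ('k, 'b) vlattice \<Rightarrow> ((nat \<Rightarrow> 'a) \<Rightarrow> 'b) set" where
  "bv_maps s E F =
     {T \<in> extensional (tuples s E). multilinear_map s E F T \<and> bounded_variation s E F T}"

definition pos_bv_maps ::
  "nat \<Rightarrow> (nat \<Rightarrow> ('k, 'a) vlattice) \<Rightarrow> ('k, 'b) vlattice \<Rightarrow> ((nat \<Rightarrow> 'a) \<Rightarrow> 'b) set" where
  "pos_bv_maps s E F = {T \<in> bv_maps s E F. T \<in> pos_tuples s E \<rightarrow> pos_cone F}"

definition bv_lattice ::
  "nat \<Rightarrow> (nat \<Rightarrow> ('k :: real_or_complex, 'a) vlattice) \<Rightarrow> ('k, 'b) vlattice \<Rightarrow>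
     ('k, (nat \<Rightarrow> 'a) \<Rightarrow> 'b) vlattice" where
  "bv_lattice s E F =
     lattice_of_cone (pointwise_space (tuples s E) (bv_maps s E F) F) (pos_bv_maps s E F)"

definition ob_maps :: "('k, 'a) vlattice \<Rightarrow> ('k, 'b) vlattice \<Rightarrow> ('a \<Rightarrow> 'b) set" where
  "ob_maps G F =
     {S \<in> extensional (carrier G). linear_map G F S \<and>
        (\<forall>A. order_bounded G A \<longrightarrow> order_bounded F (S ` A))}"

definition pos_ob_maps :: "('k, 'a) vlattice \<Rightarrow> ('k, 'b) vlattice \<Rightarrow> ('a \<Rightarrow> 'b) set" where
  "pos_ob_maps G F = {S \<in> ob_maps G F. S \<in> pos_cone G \<rightarrow> pos_cone F}"

definition ob_lattice ::
  "('k :: real_or_complex, 'a) vlattice \<Rightarrow> ('k, 'b) vlattice \<Rightarrow> ('k, 'a \<Rightarrow> 'b) vlattice" where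
  "ob_lattice G F =
     lattice_of_cone (pointwise_space (carrier G) (ob_maps G F) F) (pos_ob_maps G F)"

text \<open>The map \<open>T\<^sup>\<otimes>\<close> induced by \<open>T\<close>.\<close>

definition tensor_extension ::
  "nat \<Rightarrow> (nat \<Rightarrow> ('k, 'a) vlattice) \<Rightarrow> ('k, 'p) vlattice \<Rightarrow> ((nat \<Rightarrow> 'a) \<Rightarrow> 'p) \<Rightarrow>
     ('k, 'b) vlattice \<Rightarrow> ((nat \<Rightarrow> 'a) \<Rightarrow> 'b) \<Rightarrow> 'p \<Rightarrow> 'b" where
  "tensor_extension s E P t F T =
     (THE S. S \<in> ob_maps P F \<and> (\<forall>f\<in>tuples s E. T f = S (t f)))"

end

(*
  The supremum of the variation sums of T is additive in each variable on the positive cones,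
  because partitions have common refinements; it therefore extends to a positive multilinear map
  |T|, and the maps of order bounded variation form a Dedekind complete vector lattice L.

  Evaluation f |-> (T |-> T f) is a vector lattice s-morphism into the order bounded operators
  from L to F: if x and y are disjoint elements of E k, a positive T is the sum of its components
  on and off the band of x, so the evaluations at x and y are disjoint; and a positive linear map
  that preserves disjointness preserves the modulus, over the complex numbers as well. The
  universal property yields a homomorphism h on the tensor product, and p |-> h p T extends T.

  For uniqueness, consider the elements that are limits, uniformly relative to one elementary
  tensor t e, of linear combinations of elementary tensors of positive tuples below e. Each e k
  has a partition into pieces such that the coefficients of a given combination are almost equal
  on pieces that are not disjoint; hence the modulus acts on such a combination, up to a small
  error, by replacing the coefficients by their absolute values. So these elements form a vector
  lattice containing all elementary tensors, which by the universal property is the whole tensor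
  product. An order bounded operator that vanishes on elementary tensors vanishes on it.
*)
theory Submission
  imports Defs
begin

section \<open>Scalars\<close>

text \<open>The universal property cannot be applied to \<open>T\<close> itself, which in general is
  no homomorphism in each variable. Evaluation is one because it looks at all maps at once, and
  positive maps can be cut along bands; the cut is a supremum taken in \<open>F\<close>. The spaces
  \<open>E k\<close> are only Archimedean and need not have band projections, so \<open>e k\<close>
  cannot be split into disjoint pieces at will. Hat functions replace them; they overlap with their
  neighbours, hence coefficients that are merely close on pieces that are not disjoint.

  The order has to be extracted from the modulus axioms. Over the complex numbers,
  \<open>rotations_le\<close> turns bounds for all rotations of an element into a bound for its
  modulus. Both fields are treated together: \<open>kI\<close> is 0 over the reals and a square root
  of -1 otherwise. An order bounded operator is a map of bounded variation in one variable, so both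
  lattices of maps come from one construction. The universal property is applied to
  \<open>P\<close>, to a sublattice of \<open>P\<close> and to one space of operators, which
  accounts for the two summands of \<open>test_universe\<close>.\<close>

definition scalar_structure :: "('k::real_or_complex \<Rightarrow> real) \<Rightarrow> ('k \<Rightarrow> real) \<Rightarrow> 'k \<Rightarrow> bool" where
  "scalar_structure re im j \<longleftrightarrow>
     (\<forall>\<alpha>. \<alpha> = of_real (re \<alpha>) + of_real (im \<alpha>) * j) \<and>
     (\<forall>a b. norm (of_real a + of_real b * j) = sqrt (a\<^sup>2 + b\<^sup>2) \<or> j = 0) \<and>
     (j = 0 \<and> im = (\<lambda>_. 0) \<or> j * j = -1)"

text \<open>Such a map fixes 1, hence all integers and their quotients. Being additive and isometric
  it is continuous, and the rationals are dense.\<close>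

lemma real_hom_of_real:
  fixes \<phi> :: "'k::real_or_complex \<Rightarrow> complex"
  assumes add: "\<And>x y. \<phi> (x + y) = \<phi> x + \<phi> y" and mult: "\<And>x y. \<phi> (x * y) = \<phi> x * \<phi> y"
    and iso: "\<And>x. norm (\<phi> x) = norm x"
  shows "\<phi> (of_real r) = of_real r"
proof -
  have one: "\<phi> 1 = 1"
  proof -
    have "\<phi> 1 * \<phi> 1 = \<phi> 1" using mult[of 1 1] by simp
    moreover have "\<phi> 1 \<noteq> 0" using iso[of 1] by auto
    ultimately show ?thesis by simp
  qed
  have z: "\<phi> 0 = 0" using add[of 0 0] by simp
  have neg: "\<phi> (-x) = - \<phi> x" for x using add[of x "-x"] z by (simp add: eq_neg_iff_add_eq_0 add.commute)
  have nat: "\<phi> (of_nat n) = of_nat n" for n by (induction n) (auto simp: z one add)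
  have int: "\<phi> (of_int n) = of_int n" for n by (cases n rule: int_cases2) (auto simp: nat neg)
  have rat: "\<phi> (of_real (of_int a / of_int b)) = of_real (of_int a / of_int b)" if "b \<noteq> 0" for a b
  proof -
    let ?q = "of_int a / of_int b :: real"
    have "\<phi> (of_real ?q) * \<phi> (of_real (of_int b)) = \<phi> (of_real (?q * of_int b))"
      by (simp only: mult of_real_mult)
    also have "?q * of_int b = of_int a" using that by simp
    finally have "\<phi> (of_real ?q) * of_int b = of_int a" by (simp only: int of_real_of_int_eq)
    thus ?thesis using that by (simp add: field_simps)
  qed
  have "norm (\<phi> (of_real r) - of_real r) \<le> e" if e: "e > 0" for e
  proof -
    obtain q where q: "q \<in> \<rat>" "r < q" "q < r + e/2" using Rats_dense_in_real[of r "r+e/2"] e by auto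
    obtain a b where ab: "b \<noteq> 0" "q = of_int a / of_int b" using q(1)
      by (metis Rats_cases' less_int_code(1))
    have q': "\<phi> (of_real q) = of_real q" unfolding ab(2) by (rule rat[OF ab(1)])
    have "\<phi> (of_real r) - of_real r = \<phi> (of_real (r - q)) + of_real (q - r)"
      using add[of "of_real (r - q)" "of_real q"] q' by simp
    also have "norm ... \<le> norm (of_real (r - q) :: 'k) + norm (of_real (q - r) :: complex)"
      using norm_triangle_ineq iso by metis
    also have "... \<le> e" using q by (simp del: of_real_diff)
    finally show ?thesis .
  qed
  hence "norm (\<phi> (of_real r) - of_real r) \<le> 0" by (meson field_le_epsilon add_0 dense_ge)
  thus ?thesis by simp
qed

text \<open>The element \<open>j\<close> is the preimage of the imaginary unit, or 0 if the range is
  the real line. With \<open>j = 0\<close> every term \<open>j * v\<close> vanishes, so that a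
  formula such as \<open>u + j * v\<close> can be written once for both fields.\<close>

lemma scalar_structure_exists: "\<exists>re im (j::'k::real_or_complex). scalar_structure re im j"
proof -
  obtain \<phi> :: "'k \<Rightarrow> complex" where inj: "inj \<phi>" and rng: "range \<phi> = \<real> \<or> range \<phi> = UNIV"
    and add: "\<And>x y. \<phi> (x + y) = \<phi> x + \<phi> y" and mult: "\<And>x y. \<phi> (x * y) = \<phi> x * \<phi> y"
    and iso: "\<And>x. norm (\<phi> x) = norm x"
    using real_or_complex by blast
  note r = real_hom_of_real[of \<phi>, OF add mult iso]
  have m1: "\<phi> (-1) = -1" using r[of "-1"] by simp
  show ?thesis
  proof (cases "range \<phi> = \<real>")
    case True
    have "\<alpha> = of_real (Re (\<phi> \<alpha>))" for \<alpha>
    proof -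
      have "\<phi> \<alpha> \<in> \<real>" using True by auto
      hence "\<phi> \<alpha> = of_real (Re (\<phi> \<alpha>))" by simp
      also have "... = \<phi> (of_real (Re (\<phi> \<alpha>)))" by (simp add: r)
      finally show ?thesis using inj by (simp add: inj_eq)
    qed
    hence "scalar_structure (\<lambda>\<alpha>. Re (\<phi> \<alpha>)) (\<lambda>_. 0) (0::'k)" by (auto simp: scalar_structure_def)
    thus ?thesis by blast
  next
    case False
    hence "range \<phi> = UNIV" using rng by simp
    then obtain j where j: "\<phi> j = \<i>" by (metis surj_def)
    have f: "\<phi> (of_real a + of_real b * j) = Complex a b" for a b
      by (simp add: add mult r j complex_eq_iff)
    have "\<alpha> = of_real (Re (\<phi> \<alpha>)) + of_real (Im (\<phi> \<alpha>)) * j" for \<alpha>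
      using inj f[of "Re (\<phi> \<alpha>)" "Im (\<phi> \<alpha>)"] by (simp add: inj_eq)
    moreover have "norm (of_real a + of_real b * j) = sqrt (a\<^sup>2 + b\<^sup>2)" for a b
      using iso[of "of_real a + of_real b * j"] by (simp add: f complex_norm)
    moreover have "j * j = -1"
    proof -
      have "\<phi> (j * j) = \<phi> (-1)" by (simp add: mult j m1)
      thus ?thesis using inj by (simp add: inj_eq)
    qed
    ultimately have "scalar_structure (\<lambda>\<alpha>. Re (\<phi> \<alpha>)) (\<lambda>\<alpha>. Im (\<phi> \<alpha>)) j"
      unfolding scalar_structure_def by blast
    thus ?thesis by blast
  qed
qed

text \<open>The three choices are nested: each asks only that the remaining data exist, so that in
  the end all three fit together in one \<open>scalar_structure\<close>.\<close>

definition kre :: "'k::real_or_complex \<Rightarrow> real" where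
  "kre = (SOME re. \<exists>im j. scalar_structure re im (j::'k))"
definition kim :: "'k::real_or_complex \<Rightarrow> real" where
  "kim = (SOME im. \<exists>j. scalar_structure kre im (j::'k))"
definition kI :: "'k::real_or_complex" where
  "kI = (SOME j. scalar_structure kre kim j)"

lemma scalar_structure_k: "scalar_structure kre kim (kI :: 'k::real_or_complex)"
proof -
  have "\<exists>im j. scalar_structure kre im (j::'k)"
    unfolding kre_def using scalar_structure_exists by (rule someI_ex)
  hence "\<exists>j. scalar_structure kre kim (j::'k)" unfolding kim_def by (rule someI_ex)
  thus ?thesis unfolding kI_def by (rule someI_ex)
qed

lemma k_decomp: "(\<alpha>::'k::real_or_complex) = of_real (kre \<alpha>) + of_real (kim \<alpha>) * kI"
  using scalar_structure_k unfolding scalar_structure_def by blast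

lemma kI_cases: obtains "(kI::'k::real_or_complex) = 0" | "(kI::'k) * kI = -1"
  using scalar_structure_k[where 'k='k] unfolding scalar_structure_def by blast

lemma norm_k: "(kI::'k::real_or_complex) \<noteq> 0 ==> norm (of_real a + of_real b * kI :: 'k) = sqrt (a\<^sup>2 + b\<^sup>2)"
  using scalar_structure_k[where 'k='k] unfolding scalar_structure_def by blast

lemma norm_k_le: "norm (of_real a + of_real b * kI :: 'k::real_or_complex) \<le> sqrt (a\<^sup>2 + b\<^sup>2)"
  by (cases "(kI::'k) = 0") (auto simp: norm_k)

lemma norm_kI: "norm (kI::'k::real_or_complex) \<le> 1"
  using norm_k_le[of 0 1, where 'k='k] by simp

section \<open>Linear functionals separate points\<close>

lemma carrier_ring_of_type_algebra [simp]:
  "carrier (ring_of_type_algebra :: 'k::comm_ring_1 ring) = UNIV"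
  "\<zero>\<^bsub>ring_of_type_algebra\<^esub> = (0::'k)" "\<one>\<^bsub>ring_of_type_algebra\<^esub> = (1::'k)"
  "x \<oplus>\<^bsub>ring_of_type_algebra\<^esub> y = x + (y::'k)" "x \<otimes>\<^bsub>ring_of_type_algebra\<^esub> y = x * y"
  by (simp_all add: ring_of_type_algebra_def)

text \<open>Algebraic functionals, without continuity. They serve to verify vector identities: two
  vectors with the same value under every functional are equal, and under a functional an identity
  becomes one of scalars, which ring arithmetic decides.\<close>

definition functionals :: "('k::real_or_complex, 'a, 'm) module_scheme \<Rightarrow> ('a \<Rightarrow> 'k) set" where
  "functionals V = {\<phi>. (\<forall>x\<in>carrier V. \<forall>y\<in>carrier V. \<phi> (x \<oplus>\<^bsub>V\<^esub> y) = \<phi> x + \<phi> y) \<and>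
     (\<forall>\<alpha>. \<forall>x\<in>carrier V. \<phi> (\<alpha> \<odot>\<^bsub>V\<^esub> x) = \<alpha> * \<phi> x)}"

locale kmodule = module "ring_of_type_algebra :: 'k ring" V
  for V :: "('k :: real_or_complex, 'a, 'm) module_scheme" (structure)
begin

abbreviation Vc where "Vc \<equiv> carrier V"

lemma cl [simp, intro]:
  "\<zero> \<in> Vc" "x \<in> Vc ==> y \<in> Vc ==> x \<oplus> y \<in> Vc" "x \<in> Vc ==> y \<in> Vc ==> x \<ominus> y \<in> Vc"
  "x \<in> Vc ==> \<ominus> x \<in> Vc" "x \<in> Vc ==> \<alpha> \<odot> x \<in> Vc"
  by simp_all

lemma sm [simp]: "x \<in> Vc ==> 1 \<odot> x = x" "x \<in> Vc ==> 0 \<odot> x = \<zero>" "\<alpha> \<odot> \<zero> = \<zero>"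
  using smult_one[of x] smult_l_null[of x] smult_r_null[of \<alpha>] by simp_all

lemma smult_add_left: "x \<in> Vc ==> (\<alpha> + \<beta>) \<odot> x = \<alpha> \<odot> x \<oplus> \<beta> \<odot> x"
  using smult_l_distr[of \<alpha> \<beta> x] by simp

lemma smult_smult [simp]: "x \<in> Vc ==> \<alpha> \<odot> (\<beta> \<odot> x) = (\<alpha> * \<beta>) \<odot> x"
  using smult_assoc1[of \<alpha> \<beta> x] by simp

lemma fun_add [simp]: "\<phi> \<in> functionals V ==> x \<in> Vc ==> y \<in> Vc ==> \<phi> (x \<oplus> y) = \<phi> x + \<phi> y"
  and fun_smult [simp]: "\<phi> \<in> functionals V ==> x \<in> Vc ==> \<phi> (\<alpha> \<odot> x) = \<alpha> * \<phi> x"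
  by (auto simp: functionals_def)

lemma fun_zero [simp]: "\<phi> \<in> functionals V ==> \<phi> \<zero> = 0"
  using fun_add[of \<phi> \<zero> \<zero>] by simp

lemma fun_neg [simp]: "\<phi> \<in> functionals V ==> x \<in> Vc ==> \<phi> (\<ominus> x) = - \<phi> x"
  using fun_add[of \<phi> x "\<ominus> x"] by (simp add: M.r_neg eq_neg_iff_add_eq_0 add.commute)

lemma fun_minus [simp]: "\<phi> \<in> functionals V ==> x \<in> Vc ==> y \<in> Vc ==> \<phi> (x \<ominus> y) = \<phi> x - \<phi> y"
  by (simp add: a_minus_def)

lemma fun_sum [simp]:
  "\<phi> \<in> functionals V ==> f \<in> A \<rightarrow> Vc ==> \<phi> (\<Oplus>i\<in>A. f i) = (\<Sum>i\<in>A. \<phi> (f i))"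
proof (induction A rule: infinite_finite_induct)
  case (infinite A) thus ?case by (simp add: M.finsum_infinite)
next
  case empty thus ?case by simp
next
  case (insert x A)
  hence "f x \<in> Vc" "f \<in> A \<rightarrow> Vc" by auto
  thus ?case using insert by simp
qed

lemma minus_add: "x \<in> Vc ==> y \<in> Vc ==> x \<ominus> y \<oplus> y = x"
  by (simp add: a_minus_def M.a_assoc M.l_neg)

lemma smult_minus1: "x \<in> Vc ==> (-1) \<odot> x = \<ominus> x"
  using smult_add_left[of x "-1" 1] M.minus_equality[of "(-1) \<odot> x" x]
  by simp

text \<open>Zorn's lemma gives a subspace maximal among those that avoid \<open>x0\<close>.
  Maximality makes every vector the sum of an element of it and a multiple of \<open>x0\<close>; the
  coefficient of \<open>x0\<close> is the functional.\<close>

lemma functional_exists: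
  assumes x0: "x0 \<in> Vc" "x0 \<noteq> \<zero>"
  shows "\<exists>\<phi>\<in>functionals V. \<phi> x0 \<noteq> 0"
proof -
  define S where "S = {N. N \<subseteq> Vc \<and> \<zero> \<in> N \<and> (\<forall>x\<in>N. \<forall>y\<in>N. x \<oplus> y \<in> N) \<and> (\<forall>\<alpha>. \<forall>x\<in>N. \<alpha> \<odot> x \<in> N) \<and> x0 \<notin> N}"
  have "\<exists>M\<in>S. \<forall>Z\<in>S. M \<subseteq> Z \<longrightarrow> Z = M"
  proof (rule subset_Zorn_nonempty)
    have "{\<zero>} \<in> S" using x0 by (auto simp: S_def)
    thus "S \<noteq> {}" by auto
    fix C assume C: "C \<noteq> {}" "subset.chain S C"
    have sub: "N \<in> S" if "N \<in> C" for N using C(2) that by (auto simp: subset_chain_def)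
    have "x \<oplus> y \<in> \<Union>C" if xy: "x \<in> \<Union>C" "y \<in> \<Union>C" for x y
    proof -
      obtain A B where AB: "A \<in> C" "B \<in> C" "x \<in> A" "y \<in> B" using xy by auto
      have "A \<subseteq> B \<or> B \<subseteq> A" using C(2) AB(1,2) by (auto simp: subset_chain_def)
      then obtain N where "N \<in> C" "x \<in> N" "y \<in> N" using AB by blast
      thus ?thesis using sub[of N] unfolding S_def by blast
    qed
    note cAdd = this
    have p: "N \<subseteq> Vc" "\<zero> \<in> N" "\<alpha> \<odot> x \<in> N" "x0 \<notin> N" if "N \<in> C" "x \<in> N" for N \<alpha> x
      using sub[OF that(1)] that(2) unfolding S_def by auto
    have z: "\<zero> \<in> N" "N \<subseteq> Vc" "x0 \<notin> N" if "N \<in> C" for N using sub[OF that] unfolding S_def by auto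
    obtain N where N: "N \<in> C" using C(1) by auto
    have "\<Union>C \<subseteq> Vc" using z(2) by (rule Union_least)
    moreover have "\<zero> \<in> \<Union>C" using N z(1)[OF N] by (rule UnionI)
    moreover have "\<alpha> \<odot> x \<in> \<Union>C" if x: "x \<in> \<Union>C" for \<alpha> x
    proof -
      obtain N where "N \<in> C" "x \<in> N" using x by (rule UnionE)
      thus ?thesis using p(3) by (intro UnionI)
    qed
    moreover have "x0 \<notin> \<Union>C" using z(3) by simp
    ultimately show "\<Union>C \<in> S" unfolding S_def mem_Collect_eq using cAdd by simp
  qed
  then obtain N where N: "N \<in> S" and max: "\<And>Z. Z \<in> S ==> N \<subseteq> Z ==> Z = N" by blast
  have NX: "\<And>x. x \<in> N ==> x \<in> Vc" and N0: "\<zero> \<in> N" and Na: "\<And>x y. x \<in> N ==> y \<in> N ==> x \<oplus> y \<in> N"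
    and Ns: "\<And>\<alpha> x. x \<in> N ==> \<alpha> \<odot> x \<in> N" and x0N: "x0 \<notin> N" using N unfolding S_def by auto
  have x0N': "\<beta> = 0" if "\<beta> \<odot> x0 \<in> N" for \<beta>
  proof (rule ccontr)
    assume "\<beta> \<noteq> 0"
    hence "inverse \<beta> \<odot> (\<beta> \<odot> x0) = x0" using x0 by simp
    thus False using Ns[OF that, of "inverse \<beta>"] x0N by simp
  qed
  have neg: "\<ominus> x \<in> N" if "x \<in> N" for x using Ns[OF that, of "-1"] smult_minus1[OF NX[OF that]] by simp
  have ex: "\<exists>\<beta>. \<exists>n\<in>N. y = n \<oplus> \<beta> \<odot> x0" if y: "y \<in> Vc" for y
  proof (cases "y \<in> N")
    case True thus ?thesis using x0 y by (intro exI[of _ 0] bexI[of _ y]) auto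
  next
    case False
    \<comment> \<open>The span of \<open>N\<close> and \<open>y\<close> is a larger subspace, so by
      maximality it contains \<open>x0\<close>. The coefficient of \<open>y\<close> in
      \<open>x0\<close> is not 0, and the equation can be solved for \<open>y\<close>.\<close>
    define Z where "Z = {n \<oplus> \<beta> \<odot> y |n \<beta>. n \<in> N}"
    have "N \<subseteq> Z"
    proof
      fix n assume "n \<in> N" thus "n \<in> Z" unfolding Z_def using y NX by (auto intro!: exI[of _ n] exI[of _ 0])
    qed
    moreover have "y \<in> Z" unfolding Z_def using N0 y by (auto intro!: exI[of _ "\<zero>"] exI[of _ 1])
    ultimately have "Z \<notin> S" using max[of Z] False by auto
    moreover have "Z \<subseteq> Vc" unfolding Z_def using NX y by auto
    moreover have "\<zero> \<in> Z" using \<open>N \<subseteq> Z\<close> N0 by auto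
    moreover have "a \<oplus> b \<in> Z" if "a \<in> Z" "b \<in> Z" for a b
    proof -
      obtain n \<beta> n' \<beta>' where 1: "n \<in> N" "a = n \<oplus> \<beta> \<odot> y" "n' \<in> N" "b = n' \<oplus> \<beta>' \<odot> y" using \<open>a \<in> Z\<close> \<open>b \<in> Z\<close> unfolding Z_def by auto
      have "a \<oplus> b = (n \<oplus> n') \<oplus> (\<beta> + \<beta>') \<odot> y" using 1 NX y smult_add_left[of y \<beta> \<beta>']
        by (simp add: M.add.m_ac)
      thus ?thesis unfolding Z_def using 1 Na by blast
    qed
    moreover have "\<gamma> \<odot> a \<in> Z" if "a \<in> Z" for a \<gamma>
    proof -
      obtain n \<beta> where 1: "n \<in> N" "a = n \<oplus> \<beta> \<odot> y" using \<open>a \<in> Z\<close> unfolding Z_def by auto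
      have "\<gamma> \<odot> a = \<gamma> \<odot> n \<oplus> (\<gamma> * \<beta>) \<odot> y" using 1 NX y by (simp add: smult_r_distr)
      thus ?thesis unfolding Z_def using 1 Ns by blast
    qed
    ultimately have "x0 \<in> Z" unfolding S_def by blast
    then obtain n \<beta> where 1: "n \<in> N" "x0 = n \<oplus> \<beta> \<odot> y" unfolding Z_def by auto
    have "\<beta> \<noteq> 0" using 1 x0N y NX by auto
    have "inverse \<beta> \<odot> x0 = inverse \<beta> \<odot> n \<oplus> y"
      using 1 NX y \<open>\<beta> \<noteq> 0\<close> by (simp add: smult_r_distr)
    hence "y = \<ominus> (inverse \<beta> \<odot> n) \<oplus> inverse \<beta> \<odot> x0" using 1(1) NX y x0
      by (simp add: M.add.inv_solve_left' M.r_neg1)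
    thus ?thesis using neg Ns 1(1) by blast
  qed
  have uniq: "\<beta> = \<beta>'" if "n \<in> N" "n' \<in> N" "n \<oplus> \<beta> \<odot> x0 = n' \<oplus> \<beta>' \<odot> x0" for n n' \<beta> \<beta>'
  proof -
    have Vc: "n \<in> Vc" "n' \<in> Vc" using that NX by auto
    have "(\<beta> - \<beta>') \<odot> x0 \<oplus> \<beta>' \<odot> x0 = \<beta> \<odot> x0" using smult_add_left[of x0 "\<beta> - \<beta>'" \<beta>'] x0 by simp
    hence "n \<oplus> (\<beta> - \<beta>') \<odot> x0 \<oplus> \<beta>' \<odot> x0 = n' \<oplus> \<beta>' \<odot> x0" using that(3) Vc x0 by (simp add: M.add.m_assoc)
    hence "n \<oplus> (\<beta> - \<beta>') \<odot> x0 = n'" using Vc x0 by simp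
    hence "(\<beta> - \<beta>') \<odot> x0 = \<ominus> n \<oplus> n'" using Vc x0 by (auto simp: M.r_neg1)
    hence "(\<beta> - \<beta>') \<odot> x0 \<in> N" using Na neg that by auto
    thus ?thesis using x0N' by fastforce
  qed
  define \<phi> where "\<phi> y = (THE \<beta>. \<exists>n\<in>N. y = n \<oplus> \<beta> \<odot> x0)" for y
  have \<phi>: "\<phi> y = \<beta>" if "n \<in> N" "y = n \<oplus> \<beta> \<odot> x0" for y n \<beta>
    unfolding \<phi>_def using that uniq by (intro the_equality) blast+
  have "\<phi> \<in> functionals V" unfolding functionals_def mem_Collect_eq
  proof (intro conjI ballI allI)
    fix x y assume "x \<in> Vc" "y \<in> Vc"
    then obtain \<beta> n \<beta>' n' where 1: "n \<in> N" "x = n \<oplus> \<beta> \<odot> x0" "n' \<in> N" "y = n' \<oplus> \<beta>' \<odot> x0" using ex by metis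
    have "x \<oplus> y = (n \<oplus> n') \<oplus> (\<beta> + \<beta>') \<odot> x0" using 1 NX x0 smult_add_left[of x0 \<beta> \<beta>'] by (simp add: M.add.m_ac)
    thus "\<phi> (x \<oplus> y) = \<phi> x + \<phi> y" using 1 \<phi> Na by metis
  next
    fix \<gamma> x assume "x \<in> Vc"
    then obtain \<beta> n where 1: "n \<in> N" "x = n \<oplus> \<beta> \<odot> x0" using ex by metis
    have "\<gamma> \<odot> x = \<gamma> \<odot> n \<oplus> (\<gamma> * \<beta>) \<odot> x0" using 1 NX x0 by (simp add: smult_r_distr)
    thus "\<phi> (\<gamma> \<odot> x) = \<gamma> * \<phi> x" using 1 \<phi> Ns by metis
  qed
  moreover have "\<phi> x0 = 1" using \<phi>[OF N0, of x0 1] x0 by simp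
  hence "\<phi> x0 \<noteq> 0" by simp
  ultimately show ?thesis by (intro bexI[of _ \<phi>])
qed

lemma vec_eqI:
  assumes "x \<in> Vc" "y \<in> Vc" "\<And>\<phi>. \<phi> \<in> functionals V ==> \<phi> x = \<phi> y"
  shows "x = y"
proof (rule ccontr)
  assume "x \<noteq> y"
  hence "x \<ominus> y \<noteq> \<zero>" using assms(1,2) minus_add[of x y] by (metis M.l_zero)
  then obtain \<phi> where "\<phi> \<in> functionals V" "\<phi> (x \<ominus> y) \<noteq> 0" using functional_exists[of "x \<ominus> y"] assms by auto
  thus False using assms by simp
qed

end

section \<open>The ordered structure of an Archimedean vector lattice\<close>

locale avl = archimedean_vector_lattice V
  for V :: "('k :: real_or_complex, 'a) vlattice" (structure)

sublocale avl \<subseteq> kmodule V ..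

context avl
begin

abbreviation Cn where "Cn \<equiv> pos_cone V"
abbreviation am where "am \<equiv> modulus V"
abbreviation le (infix "\<preceq>" 50) where "x \<preceq> y \<equiv> vl_le V x y"
definition rs (infixr "*r" 72) where "r *r x = of_real r \<odot> x"

lemma rs_cl [simp]: "x \<in> Vc ==> r *r x \<in> Vc" by (simp add: rs_def)

lemma fun_rs [simp]: "\<phi> \<in> functionals V ==> x \<in> Vc ==> \<phi> (r *r x) = of_real r * \<phi> x"
  by (simp add: rs_def)

lemma rs_simps [simp]: "x \<in> Vc ==> 1 *r x = x" "x \<in> Vc ==> 0 *r x = \<zero>" "r *r \<zero> = \<zero>"
  "x \<in> Vc ==> a *r (b *r x) = (a * b) *r x"
  by (simp_all add: rs_def)

lemma CnD [simp]: "x \<in> Cn ==> x \<in> Vc" and Cn_am: "x \<in> Cn ==> am x = x"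
  unfolding pos_cone_def by blast+

lemma CnI: "x \<in> Vc ==> am x = x ==> x \<in> Cn"
  unfolding pos_cone_def by blast

lemma am_cl [simp]: "x \<in> Vc ==> am x \<in> Vc" by (rule modulus_closed)

lemma am_Cn [simp]: "x \<in> Vc ==> am x \<in> Cn" by (simp add: CnI modulus_idem)

lemma am_rs [simp]: "x \<in> Vc ==> am (r *r x) = \<bar>r\<bar> *r am x" by (simp add: rs_def modulus_smult)

lemma am_zero [simp]: "am \<zero> = \<zero>" using modulus_smult[of \<zero> 0] by simp

lemma am_neg: "x \<in> Vc ==> am (\<ominus> x) = am x"
  using modulus_smult[of x "-1"] by (simp add: smult_minus1)

lemma minus_self: "x \<in> Vc ==> x \<ominus> x = \<zero>" by (simp add: a_minus_def M.r_neg)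

lemma neg_zero [simp]: "\<ominus> \<zero> = \<zero>" by (rule vec_eqI) simp_all

lemma minus_zero [simp]: "x \<in> Vc ==> x \<ominus> \<zero> = x" by (rule vec_eqI) simp_all

lemma Cn_zero [simp]: "\<zero> \<in> Cn" by (simp add: CnI)

text \<open>For \<open>x\<close> and \<open>y\<close> in the cone the triangle axiom says that the
  modulus of \<open>|x + y| - |x + y|\<close>, which is 0, equals
  \<open>x + y - |x + y|\<close>.\<close>

lemma Cn_add [simp]: assumes "x \<in> Cn" "y \<in> Cn" shows "x \<oplus> y \<in> Cn"
proof -
  have "x \<oplus> y \<ominus> am (x \<oplus> y) = am (am (x \<oplus> y) \<ominus> am (x \<oplus> y))"
    using modulus_triangle[of x y] assms by (simp add: Cn_am)
  also have "... = \<zero>" using assms by (simp add: minus_self)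
  finally have "x \<oplus> y = am (x \<oplus> y)" using minus_add[of "x \<oplus> y" "am (x \<oplus> y)"] assms by simp
  thus ?thesis using assms by (intro CnI) simp_all
qed

lemma Cn_smult [simp]: "x \<in> Cn ==> 0 \<le> r ==> r *r x \<in> Cn"
  by (intro CnI) (simp_all add: Cn_am)

lemma Cn_sum [simp]: "f \<in> A \<rightarrow> Cn ==> (\<Oplus>i\<in>A. f i) \<in> Cn"
proof (induction A rule: infinite_finite_induct)
  case (insert x A)
  hence "f x \<in> Cn" "f \<in> A \<rightarrow> Cn" by auto
  moreover hence "f x \<in> Vc" "f \<in> A \<rightarrow> Vc" by (auto intro: CnD)
  ultimately show ?case using insert by simp
qed (simp_all add: M.finsum_infinite)

lemma Cn_by: "c \<in> Cn ==> y \<in> Vc ==> (\<And>\<phi>. \<phi> \<in> functionals V ==> \<phi> y = \<phi> c) ==> y \<in> Cn"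
  using vec_eqI[of y c] by auto

text \<open>The standard way to prove inequalities below: a certificate \<open>c\<close>, a sum of
  positive elements supplied by known inequalities, agrees with \<open>y - x\<close> under every
  functional.\<close>

lemma le_by: "c \<in> Cn ==> x \<in> Vc ==> y \<in> Vc ==> (\<And>\<phi>. \<phi> \<in> functionals V ==> \<phi> y - \<phi> x = \<phi> c) ==> x \<preceq> y"
  unfolding vl_le_def by (rule Cn_by[of c]) auto

text \<open>The modulus ignores the sign, so two opposite elements of the cone are equal.\<close>

lemma Cn_pointed: assumes "x \<in> Cn" "\<ominus> x \<in> Cn" shows "x = \<zero>"
proof -
  have "x = \<ominus> x" using assms am_neg[of x] by (simp add: Cn_am)
  hence "\<phi> x = - \<phi> x" if "\<phi> \<in> functionals V" for \<phi> using that assms fun_neg[of \<phi> x] by simp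
  thus ?thesis using assms by (intro vec_eqI) (simp_all add: equal_neg_zero)
qed

lemma leD: "x \<preceq> y ==> y \<ominus> x \<in> Cn" by (simp add: vl_le_def)

lemma le_refl [simp]: "x \<in> Vc ==> x \<preceq> x" by (rule le_by[of \<zero>]) auto

lemma le_trans: assumes "x \<preceq> y" "y \<preceq> z" "x \<in> Vc" "y \<in> Vc" "z \<in> Vc" shows "x \<preceq> z"
  by (rule le_by[of "(y \<ominus> x) \<oplus> (z \<ominus> y)"]) (use assms leD in auto)

lemma le_antisym: assumes "x \<preceq> y" "y \<preceq> x" "x \<in> Vc" "y \<in> Vc" shows "x = y"
proof -
  have "\<ominus> (y \<ominus> x) \<in> Cn" by (rule Cn_by[OF leD[OF assms(2)]]) (use assms in auto)
  hence "y \<ominus> x = \<zero>" using leD[OF assms(1)] Cn_pointed by blast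
  thus ?thesis using minus_add[of y x] assms by simp
qed

lemma le_add: assumes "x \<preceq> y" "u \<preceq> v" "x \<in> Vc" "y \<in> Vc" "u \<in> Vc" "v \<in> Vc" shows "x \<oplus> u \<preceq> y \<oplus> v"
  by (rule le_by[of "(y \<ominus> x) \<oplus> (v \<ominus> u)"]) (use assms leD in auto)

lemma le_smult: assumes "x \<preceq> y" "0 \<le> r" "x \<in> Vc" "y \<in> Vc" shows "r *r x \<preceq> r *r y"
  by (rule le_by[of "r *r (y \<ominus> x)"]) (use assms leD in \<open>auto simp: algebra_simps\<close>)

lemma le_rs_mono: assumes "a \<le> b" "x \<in> Cn" shows "a *r x \<preceq> b *r x"
  by (rule le_by[of "(b - a) *r x"]) (use assms in \<open>auto simp: algebra_simps\<close>)

lemma zero_le: "x \<in> Vc ==> \<zero> \<preceq> x \<longleftrightarrow> x \<in> Cn"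
  unfolding vl_le_def using minus_zero[of x] by simp

lemma Cn_le: assumes "x \<in> Cn" "x \<preceq> y" "y \<in> Vc" shows "y \<in> Cn"
  by (rule Cn_by[of "x \<oplus> (y \<ominus> x)"]) (use assms leD in auto)

lemma le_zero: assumes "x \<in> Cn" "x \<preceq> \<zero>" shows "x = \<zero>"
  using assms by (intro le_antisym) (auto simp: zero_le)

lemma le_addr [simp]: "x \<in> Vc ==> y \<in> Cn ==> x \<preceq> x \<oplus> y" by (rule le_by[of y]) auto
lemma le_addl [simp]: "x \<in> Vc ==> y \<in> Cn ==> x \<preceq> y \<oplus> x" by (rule le_by[of y]) auto
lemma le_minus [simp]: "x \<in> Vc ==> y \<in> Cn ==> x \<ominus> y \<preceq> x" by (rule le_by[of y]) auto

lemma le_move: assumes "x \<ominus> y \<preceq> z" "x \<in> Vc" "y \<in> Vc" "z \<in> Vc" shows "x \<preceq> z \<oplus> y"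
  by (rule le_by[OF leD[OF assms(1)]]) (use assms in auto)

lemma le_sum: "f \<in> A \<rightarrow> Vc ==> g \<in> A \<rightarrow> Vc ==> (\<And>i. i \<in> A ==> f i \<preceq> g i) ==> (\<Oplus>i\<in>A. f i) \<preceq> (\<Oplus>i\<in>A. g i)"
proof (induction A rule: infinite_finite_induct)
  case (insert x A)
  hence "f x \<in> Vc" "f \<in> A \<rightarrow> Vc" "g x \<in> Vc" "g \<in> A \<rightarrow> Vc" by auto
  thus ?case using insert by (auto intro!: le_add)
qed (simp_all add: M.finsum_infinite)

lemma am_triangle: assumes "x \<in> Vc" "y \<in> Vc" shows "am (x \<oplus> y) \<preceq> am x \<oplus> am y"
  unfolding vl_le_def using modulus_triangle[OF assms] assms by (intro CnI) (simp_all add: Cn_am)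

lemma am_triangle_minus: "x \<in> Vc ==> y \<in> Vc ==> am (x \<ominus> y) \<preceq> am x \<oplus> am y"
  using am_triangle[of x "\<ominus> y"] by (simp add: a_minus_def am_neg)

lemma am_triangle': assumes "x \<in> Vc" "y \<in> Vc" shows "am x \<preceq> am y \<oplus> am (x \<ominus> y)"
proof -
  have "y \<oplus> (x \<ominus> y) = x" using assms by (intro vec_eqI) auto
  thus ?thesis using am_triangle[of y "x \<ominus> y"] assms by simp
qed

lemma am_sum: "f \<in> A \<rightarrow> Vc ==> am (\<Oplus>i\<in>A. f i) \<preceq> (\<Oplus>i\<in>A. am (f i))"
proof (induction A rule: infinite_finite_induct)
  case (insert x A)
  hence f: "f x \<in> Vc" "f \<in> A \<rightarrow> Vc" by auto
  hence "(\<lambda>i. am (f i)) \<in> A \<rightarrow> Vc" by (auto simp: Pi_def)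
  with f have "am (f x \<oplus> (\<Oplus>i\<in>A. f i)) \<preceq> am (f x) \<oplus> (\<Oplus>i\<in>A. am (f i))"
    using insert.IH by (intro le_trans[OF am_triangle] le_add) auto
  thus ?case using insert f by (simp add: Pi_def)
qed (simp_all add: M.finsum_infinite)

lemma am_eq_zero: assumes "x \<in> Vc" "am x = \<zero>" shows "x = \<zero>"
  using archimedean[of x \<zero>] assms by (simp add: a_minus_def)

section \<open>Real elements, positive parts and lattice operations\<close>

definition Rl where "Rl = {a \<ominus> b | a b. a \<in> Cn \<and> b \<in> Cn}"

lemma RlD [simp]: "x \<in> Rl ==> x \<in> Vc" unfolding Rl_def by auto

lemma RlI: "a \<in> Cn ==> b \<in> Cn ==> x \<in> Vc ==> (\<And>\<phi>. \<phi> \<in> functionals V ==> \<phi> x = \<phi> a - \<phi> b) ==> x \<in> Rl"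
  unfolding Rl_def using vec_eqI[of x "a \<ominus> b"] by fastforce

lemma RlE: assumes "x \<in> Rl" obtains a b where "a \<in> Cn" "b \<in> Cn" "x = a \<ominus> b"
  using assms unfolding Rl_def by auto

lemma Cn_Rl [simp]: "x \<in> Cn ==> x \<in> Rl" by (rule RlI[of x \<zero>]) auto

lemma Rl_neg [simp]: assumes "x \<in> Rl" shows "\<ominus> x \<in> Rl"
proof -
  obtain a b where "a \<in> Cn" "b \<in> Cn" "x = a \<ominus> b" using RlE[OF assms] .
  thus ?thesis by (intro RlI[of b a]) auto
qed

lemma Rl_add [simp]: assumes "x \<in> Rl" "y \<in> Rl" shows "x \<oplus> y \<in> Rl"
proof -
  obtain a b where "a \<in> Cn" "b \<in> Cn" "x = a \<ominus> b" using RlE[OF assms(1)] .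
  moreover obtain c d where "c \<in> Cn" "d \<in> Cn" "y = c \<ominus> d" using RlE[OF assms(2)] .
  ultimately show ?thesis by (intro RlI[of "a \<oplus> c" "b \<oplus> d"]) auto
qed

lemma Rl_minus [simp]: "x \<in> Rl ==> y \<in> Rl ==> x \<ominus> y \<in> Rl" by (simp add: a_minus_def)

lemma Rl_smult [simp]: assumes "x \<in> Rl" shows "r *r x \<in> Rl"
proof -
  obtain a b where ab: "a \<in> Cn" "b \<in> Cn" "x = a \<ominus> b" using RlE[OF assms] .
  show ?thesis
  proof (cases "r \<ge> 0")
    case True thus ?thesis using ab by (intro RlI[of "r *r a" "r *r b"]) (auto simp: algebra_simps)
  next
    case False thus ?thesis using ab by (intro RlI[of "(-r) *r b" "(-r) *r a"]) (auto simp: algebra_simps)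
  qed
qed

text \<open>If \<open>x = a - b\<close>, then \<open>a = b + x\<close>, and the triangle inequality
  gives \<open>a \<le> b + |x|\<close>.\<close>

lemma le_am: assumes "x \<in> Rl" shows "x \<preceq> am x"
proof -
  obtain a b where ab: "a \<in> Cn" "b \<in> Cn" "x = a \<ominus> b" using RlE[OF assms] .
  have "b \<oplus> x = a" using ab by (intro vec_eqI) auto
  hence "a \<preceq> b \<oplus> am x" using am_triangle[of b x] ab by (simp add: Cn_am)
  from leD[OF this] show ?thesis using ab by (intro le_by[of "b \<oplus> am x \<ominus> a"]) auto
qed

lemma neg_le_am: "x \<in> Rl ==> \<ominus> x \<preceq> am x" using le_am[of "\<ominus> x"] by (simp add: am_neg)

text \<open>Both \<open>y + x\<close> and \<open>y - x\<close> are positive and their difference is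
  \<open>2 x\<close>; the triangle inequality gives \<open>2 |x| \<le> 2 y\<close>.\<close>

lemma am_lub: assumes "x \<in> Vc" "y \<in> Vc" "x \<preceq> y" "\<ominus> x \<preceq> y" shows "am x \<preceq> y"
proof -
  have c: "y \<ominus> x \<in> Cn" "y \<oplus> x \<in> Cn" using assms leD[of x y] leD[of "\<ominus> x" y] by (simp_all add: a_minus_def)
  have e: "(y \<oplus> x) \<ominus> (y \<ominus> x) = 2 *r x" using assms by (intro vec_eqI) auto
  have "am (2 *r x) \<preceq> (y \<oplus> x) \<oplus> (y \<ominus> x)" using am_triangle_minus[of "y \<oplus> x" "y \<ominus> x"] c by (simp add: Cn_am e)
  from leD[OF this] assms show ?thesis
    by (intro le_by[of "(1/2) *r ((y \<oplus> x) \<oplus> (y \<ominus> x) \<ominus> am (2 *r x))"]) (auto simp: algebra_simps)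
qed

text \<open>The positive part \<open>x^+\<close>. The infimum and the supremum of two real elements
  are recovered from it by the classical formulas \<open>a - (a - b)^+\<close> and
  \<open>b + (a - b)^+\<close>.\<close>

definition pp where "pp x = (1/2) *r (x \<oplus> am x)"
definition meet where "meet a b = a \<ominus> pp (a \<ominus> b)"
definition join where "join a b = b \<oplus> pp (a \<ominus> b)"

lemma pp_cl [simp]: "x \<in> Vc ==> pp x \<in> Vc" by (simp add: pp_def)

lemma pp_Cn [simp]: assumes "x \<in> Rl" shows "pp x \<in> Cn"
  using leD[OF neg_le_am[OF assms]] assms
  by - (rule Cn_by[of "(1/2) *r (am x \<ominus> \<ominus> x)"]; auto simp: pp_def algebra_simps)

lemma pp_diff: "x \<in> Vc ==> pp x \<ominus> pp (\<ominus> x) = x"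
  by (rule vec_eqI) (auto simp: pp_def am_neg field_simps)

lemma le_pp: assumes "x \<in> Rl" shows "x \<preceq> pp x"
proof (rule le_by[of "pp (\<ominus> x)"])
  fix \<phi> assume "\<phi> \<in> functionals V"
  thus "\<phi> (pp x) - \<phi> x = \<phi> (pp (\<ominus> x))" using assms by (simp add: pp_def am_neg field_simps)
qed (use assms in auto)

text \<open>Reduced to \<open>am_lub\<close>: both \<open>x\<close> and \<open>- x\<close> lie below
  \<open>2 q - x\<close>.\<close>

lemma pp_lub: assumes "x \<in> Rl" "q \<in> Cn" "x \<preceq> q" shows "pp x \<preceq> q"
proof -
  have "am x \<preceq> 2 *r q \<ominus> x"
    by (rule am_lub) (use assms leD[OF assms(3)] in \<open>auto intro: le_by[of "2 *r (q \<ominus> x)"] le_by[of "2 *r q"] simp: algebra_simps\<close>)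
  from leD[OF this] show ?thesis using assms
    by (intro le_by[of "(1/2) *r (2 *r q \<ominus> x \<ominus> am x)"]) (auto simp: pp_def algebra_simps)
qed

lemma pp_Cn_eq: "x \<in> Cn ==> pp x = x"
  by (rule vec_eqI) (auto simp: pp_def Cn_am field_simps)

lemma meet_cl [simp]: "a \<in> Vc ==> b \<in> Vc ==> meet a b \<in> Vc"
  and join_cl [simp]: "a \<in> Vc ==> b \<in> Vc ==> join a b \<in> Vc"
  by (simp_all add: meet_def join_def)

lemma meet_le1 [simp]: "a \<in> Rl ==> b \<in> Rl ==> meet a b \<preceq> a" by (simp add: meet_def)

lemma meet_le2 [simp]: assumes "a \<in> Rl" "b \<in> Rl" shows "meet a b \<preceq> b"
  using leD[OF le_pp[of "a \<ominus> b"]] assms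
  by (intro le_by[of "pp (a \<ominus> b) \<ominus> (a \<ominus> b)"]) (auto simp: meet_def)

lemma meet_glb: assumes "a \<in> Rl" "b \<in> Rl" "c \<in> Rl" "c \<preceq> a" "c \<preceq> b" shows "c \<preceq> meet a b"
proof -
  have "pp (a \<ominus> b) \<preceq> a \<ominus> c"
    by (rule pp_lub) (use assms leD[OF assms(4)] leD[OF assms(5)] in \<open>auto intro: le_by[of "b \<ominus> c"]\<close>)
  from leD[OF this] show ?thesis using assms
    by (intro le_by[of "a \<ominus> c \<ominus> pp (a \<ominus> b)"]) (auto simp: meet_def)
qed

lemma meet_Cn [simp]: "a \<in> Cn ==> b \<in> Cn ==> meet a b \<in> Cn"
  using meet_glb[of a b \<zero>] by (simp add: zero_le)

lemma join_ge1: assumes "a \<in> Rl" "b \<in> Rl" shows "a \<preceq> join a b"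
  using leD[OF le_pp[of "a \<ominus> b"]] assms
  by (intro le_by[of "pp (a \<ominus> b) \<ominus> (a \<ominus> b)"]) (auto simp: join_def)

lemma join_ge2: "a \<in> Rl ==> b \<in> Rl ==> b \<preceq> join a b" by (simp add: join_def)

lemma join_lub: assumes "a \<in> Rl" "b \<in> Rl" "c \<in> Rl" "a \<preceq> c" "b \<preceq> c" shows "join a b \<preceq> c"
proof -
  have "pp (a \<ominus> b) \<preceq> c \<ominus> b"
    by (rule pp_lub) (use assms leD[OF assms(4)] leD[OF assms(5)] in \<open>auto intro: le_by[of "c \<ominus> a"]\<close>)
  from leD[OF this] show ?thesis using assms
    by (intro le_by[of "c \<ominus> b \<ominus> pp (a \<ominus> b)"]) (auto simp: join_def)
qed

text \<open>The first piece is the infimum of \<open>y\<close> and \<open>a\<close>, the second the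
  excess \<open>(y - a)^+\<close>, which stays below \<open>b\<close>.\<close>

lemma riesz_decomposition:
  assumes "y \<in> Cn" "a \<in> Cn" "b \<in> Cn" "y \<preceq> a \<oplus> b"
  obtains y1 y2 where "y1 \<in> Cn" "y2 \<in> Cn" "y = y1 \<oplus> y2" "y1 \<preceq> a" "y2 \<preceq> b"
proof
  show "meet y a \<in> Cn" "pp (y \<ominus> a) \<in> Cn" "meet y a \<preceq> a" using assms by auto
  show "y = meet y a \<oplus> pp (y \<ominus> a)" using assms by (intro vec_eqI) (auto simp: meet_def)
  show "pp (y \<ominus> a) \<preceq> b"
    using assms leD[OF assms(4)] by (intro pp_lub) (auto intro: le_by[of "a \<oplus> b \<ominus> y"])
qed

section \<open>Disjoint positive elements\<close>

definition dj where "dj a b \<longleftrightarrow> (\<forall>y\<in>Cn. y \<preceq> a \<longrightarrow> y \<preceq> b \<longrightarrow> y = \<zero>)"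

lemma dj_sym: "dj a b ==> dj b a" unfolding dj_def by blast

lemma djD: "dj a b ==> y \<in> Cn ==> y \<preceq> a ==> y \<preceq> b ==> y = \<zero>" unfolding dj_def by blast

lemma dj_mono: "dj a b ==> c \<preceq> a ==> a \<in> Vc ==> c \<in> Vc ==> dj c b"
  unfolding dj_def by (meson CnD le_trans)

lemma dj_zero [simp]: "dj \<zero> b" unfolding dj_def using le_zero by blast

lemma dj_add: assumes "dj a c" "dj b c" "a \<in> Cn" "b \<in> Cn" "c \<in> Cn" shows "dj (a \<oplus> b) c"
  unfolding dj_def
proof (intro ballI impI)
  fix y assume y: "y \<in> Cn" "y \<preceq> a \<oplus> b" "y \<preceq> c"
  obtain y1 y2 where 1: "y1 \<in> Cn" "y2 \<in> Cn" "y = y1 \<oplus> y2" "y1 \<preceq> a" "y2 \<preceq> b"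
    using riesz_decomposition[OF y(1) assms(3,4) y(2)] .
  have "y1 \<preceq> y" "y2 \<preceq> y" using 1 by auto
  hence "y1 \<preceq> c" "y2 \<preceq> c" using 1 y assms by (meson CnD le_trans)+
  hence "y1 = \<zero>" "y2 = \<zero>" using assms(1,2) 1 by (auto intro: djD)
  thus "y = \<zero>" using 1 by simp
qed

text \<open>If \<open>y\<close> lies below \<open>r a\<close> and \<open>b\<close>, then
  \<open>y / (1 + r)\<close> lies below both \<open>a\<close> and \<open>b\<close>. Adding 1 to
  \<open>r\<close> makes the factor at most 1 and admits \<open>r = 0\<close>.\<close>

lemma dj_smult: assumes "dj a b" "a \<in> Cn" "b \<in> Vc" "0 \<le> r" shows "dj (r *r a) b"
  unfolding dj_def
proof (intro ballI impI)
  fix y assume y: "y \<in> Cn" "y \<preceq> r *r a" "y \<preceq> b"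
  define z where "z = (1/(1+r)) *r y"
  have "z \<preceq> 1 *r y" unfolding z_def using y assms by (intro le_rs_mono) simp_all
  hence z: "z \<in> Cn" "z \<preceq> y" using y assms unfolding z_def by simp_all
  have "z \<preceq> (1/(1+r)) *r (r *r a)" unfolding z_def using y assms by (intro le_smult) simp_all
  moreover have "(r/(1+r)) *r a \<preceq> 1 *r a" using assms by (intro le_rs_mono) simp_all
  hence "(1/(1+r)) *r (r *r a) \<preceq> a" using assms by simp
  ultimately have "z \<preceq> a" using z assms by (meson CnD rs_cl le_trans)
  moreover have "z \<preceq> b" using z y assms by (meson CnD le_trans)
  ultimately have "z = \<zero>" using assms(1) z by (auto intro: djD)
  hence "(1+r) *r z = \<zero>" by simp
  moreover have "(1+r) *r z = y" using assms(4) y unfolding z_def by simp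
  ultimately show "y = \<zero>" by simp
qed

lemma dj_sum: "finite A ==> f \<in> A \<rightarrow> Cn ==> c \<in> Cn ==> (\<And>i. i \<in> A ==> dj (f i) c) ==> dj (\<Oplus>i\<in>A. f i) c"
proof (induction A rule: finite_induct)
  case (insert x A)
  hence "f x \<in> Cn" "f \<in> A \<rightarrow> Cn" "dj (f x) c" by auto
  moreover hence "f x \<in> Vc" "f \<in> A \<rightarrow> Vc" by (auto intro: CnD)
  ultimately show ?case using insert by (simp add: dj_add)
qed simp

text \<open>If \<open>y\<close> lies below both parts, then \<open>x^+ - y\<close> is still positive
  and above \<open>x\<close>; minimality of \<open>x^+\<close> leaves \<open>y = 0\<close>.\<close>

lemma dj_pp: assumes "x \<in> Rl" shows "dj (pp x) (pp (\<ominus> x))"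
  unfolding dj_def
proof (intro ballI impI)
  fix y assume y: "y \<in> Cn" "y \<preceq> pp x" "y \<preceq> pp (\<ominus> x)"
  have "pp x \<preceq> pp x \<ominus> y"
  proof (rule pp_lub)
    show "x \<preceq> pp x \<ominus> y"
    proof (rule le_by[OF leD[OF y(3)]])
      fix \<phi> assume "\<phi> \<in> functionals V"
      thus "\<phi> (pp x \<ominus> y) - \<phi> x = \<phi> (pp (\<ominus> x) \<ominus> y)" using assms y(1) by (simp add: pp_def am_neg field_simps)
    qed (use assms y(1) in auto)
  qed (use assms leD[OF y(2)] in auto)
  from leD[OF this] have "\<ominus> y \<in> Cn" using y assms by - (rule Cn_by[of "pp x \<ominus> y \<ominus> pp x"]; simp)
  thus "y = \<zero>" using y Cn_pointed by blast
qed

lemma dj_meet: assumes "dj a b" "a \<in> Cn" "b \<in> Cn" shows "meet a b = \<zero>"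
  using assms by (intro djD[OF assms(1)]) auto

text \<open>A zero infimum means \<open>(a - b)^+ = a\<close>, and the definition of the positive
  part then determines the modulus.\<close>

lemma dj_am: assumes "dj a b" "a \<in> Cn" "b \<in> Cn" shows "am (a \<ominus> b) = a \<oplus> b"
proof -
  have "\<phi> (pp (a \<ominus> b)) = \<phi> a" if "\<phi> \<in> functionals V" for \<phi>
    using dj_meet[OF assms] assms that fun_minus[of \<phi> a "pp (a \<ominus> b)"] by (simp add: meet_def)
  thus ?thesis using assms unfolding pp_def
    by (intro vec_eqI) (auto simp: field_simps)
qed

lemma dj_am_iff: "x \<in> Rl ==> \<exists>a b. a \<in> Cn \<and> b \<in> Cn \<and> dj a b \<and> x = a \<ominus> b"
  using dj_pp[of x] pp_diff[of x] by (metis RlD Rl_neg pp_Cn)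

lemma archimedean_Cn:
  assumes "f \<in> Cn" "g \<in> Cn" "\<And>n::nat. real n *r f \<preceq> g" shows "f = \<zero>"
  using archimedean[of f g] assms leD[OF assms(3)] by (simp add: Cn_am rs_def)

text \<open>Taking \<open>e = 1 / n\<close> bounds all multiples \<open>n x^+\<close> by
  \<open>g\<close>, and the Archimedean axiom applies to \<open>x^+\<close>.\<close>

lemma le_zero_archimedean:
  assumes x: "x \<in> Rl" "g \<in> Cn" and le: "\<And>e. e > 0 ==> x \<preceq> e *r g" shows "x \<preceq> \<zero>"
proof -
  have "real n *r pp x \<preceq> g" for n
  proof (cases "n = 0")
    case True thus ?thesis using x by (simp add: zero_le)
  next
    case False
    have "pp x \<preceq> (1/n) *r g" using False le[of "1/n"] x by (intro pp_lub) auto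
    hence "real n *r pp x \<preceq> real n *r ((1/n) *r g)" using x by (intro le_smult) auto
    also have "real n *r ((1/n) *r g) = g" using x False by simp
    finally show ?thesis .
  qed
  hence "pp x = \<zero>" using x by (intro archimedean_Cn[of "pp x" g]) auto
  thus ?thesis using le_pp[of x] x by simp
qed

lemma le_archimedean:
  assumes "x \<in> Rl" "y \<in> Rl" "g \<in> Cn" and le: "\<And>e. e > 0 ==> x \<preceq> y \<oplus> e *r g" shows "x \<preceq> y"
proof -
  have "x \<ominus> y \<preceq> \<zero>"
  proof (rule le_zero_archimedean)
    fix e :: real assume "e > 0"
    from leD[OF le[OF this]] show "x \<ominus> y \<preceq> e *r g"
      using assms by (intro le_by[of "y \<oplus> e *r g \<ominus> x"]) auto
  qed (use assms in auto)
  from le_move[OF this] show ?thesis using assms by simp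
qed

end

section \<open>Real and imaginary parts\<close>

context avl
begin

lemma am_smult: "x \<in> Vc ==> am (\<alpha> \<odot> x) = norm \<alpha> *r am x"
  by (simp add: modulus_smult rs_def)

text \<open>By the hull axiom a vector is a finite combination of positive elements; the real and
  the imaginary parts of the coefficients are collected separately.\<close>

lemma real_imag_exists: assumes "x \<in> Vc" shows "\<exists>u\<in>Rl. \<exists>v\<in>Rl. x = u \<oplus> kI \<odot> v"
proof -
  obtain B c where B: "finite B" "B \<subseteq> am ` Vc" and x: "x = (\<Oplus>b\<in>B. c b \<odot> b)"
    using assms modulus_hull unfolding linear_hull_def by blast
  have "B \<subseteq> Cn" using B by auto
  with B(1) have "\<exists>u\<in>Rl. \<exists>v\<in>Rl. (\<Oplus>b\<in>B. c b \<odot> b) = u \<oplus> kI \<odot> v"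
  proof (induction B rule: finite_induct)
    case empty
    have "\<zero> = \<zero> \<oplus> kI \<odot> \<zero>" by simp
    thus ?case by (auto intro!: bexI[of _ \<zero>])
  next
    case (insert b B)
    then obtain u v where uv: "u \<in> Rl" "v \<in> Rl" "(\<Oplus>b\<in>B. c b \<odot> b) = u \<oplus> kI \<odot> v" by auto
    have b: "b \<in> Cn" using insert by auto
    have "x \<in> Vc" if "x \<in> B" for x using insert that by (auto intro!: CnD)
    hence B: "(\<lambda>b. c b \<odot> b) \<in> B \<rightarrow> Vc" by auto
    have "c b \<odot> b \<oplus> (u \<oplus> kI \<odot> v) = (kre (c b) *r b \<oplus> u) \<oplus> kI \<odot> (kim (c b) *r b \<oplus> v)"
    proof (rule vec_eqI)
      fix \<phi> assume "\<phi> \<in> functionals V"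
      moreover have "c b * \<phi> b = of_real (kre (c b)) * \<phi> b + kI * (of_real (kim (c b)) * \<phi> b)"
        using k_decomp[of "c b"] by (metis (no_types, lifting) distrib_right mult.assoc mult.commute)
      ultimately show "\<phi> (c b \<odot> b \<oplus> (u \<oplus> kI \<odot> v)) = \<phi> ((kre (c b) *r b \<oplus> u) \<oplus> kI \<odot> (kim (c b) *r b \<oplus> v))"
        using b uv by (simp add: algebra_simps)
    qed (use b uv in auto)
    hence "(\<Oplus>b\<in>insert b B. c b \<odot> b) = (kre (c b) *r b \<oplus> u) \<oplus> kI \<odot> (kim (c b) *r b \<oplus> v)"
      using insert b B uv by simp
    thus ?case using b uv by (intro bexI[of _ "kre (c b) *r b \<oplus> u"] bexI[of _ "kim (c b) *r b \<oplus> v"]) auto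
  qed
  thus ?thesis using x by simp
qed

text \<open>If \<open>u = - kI v\<close> over the complex numbers, then \<open>u\<close> and
  \<open>v\<close> have one modulus \<open>w\<close>, while \<open>u + v\<close> and
  \<open>u - v\<close> have modulus \<open>sqrt 2 w\<close>, since \<open>1 - kI\<close> and
  \<open>- 1 - kI\<close> have norm \<open>sqrt 2\<close>. For real elements this forces
  \<open>2 w \<le> sqrt 2 w\<close>.\<close>

lemma real_imag_zero: assumes u: "u \<in> Rl" and v: "v \<in> Rl" and z: "u \<oplus> kI \<odot> v = \<zero>" shows "u = \<zero>" "kI \<odot> v = \<zero>"
proof -
  have fz: "\<phi> u = - (kI * \<phi> v)" if "\<phi> \<in> functionals V" for \<phi>
    using arg_cong[OF z, of \<phi>] that u v by (simp add: eq_neg_iff_add_eq_0)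
  have "u = \<zero> \<and> kI \<odot> v = \<zero>"
  proof (cases "(kI::'k) = 0")
    case True thus ?thesis using u v z by simp
  next
    case False
    have n: "norm (kI::'k) = 1" "norm (1 - kI::'k) = sqrt 2" "norm (- 1 - kI::'k) = sqrt 2"
      using norm_k[OF False, of 0 1] norm_k[OF False, of 1 "-1"] norm_k[OF False, of "-1" "-1"] by simp_all
    have 1: "u = (- kI) \<odot> v" using u v fz by (intro vec_eqI) auto
    have 2: "u \<oplus> v = (1 - kI) \<odot> v" "u \<ominus> v = (- 1 - kI) \<odot> v"
      using u v by (intro vec_eqI; simp add: fz algebra_simps)+
    define w where "w = am v"
    define s where "s = sqrt 2 *r w"
    have w: "am u = w" "am (u \<oplus> v) = s" "am (u \<ominus> v) = s" "am v = w"
    proof -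
      have "am ((- kI) \<odot> v) = 1 *r am v" using v n by (subst am_smult) auto
      thus "am u = w" unfolding w_def 1 using v by simp
      show "am (u \<oplus> v) = s" unfolding 2 s_def w_def using v n by (subst am_smult) auto
      show "am (u \<ominus> v) = s" unfolding 2 s_def w_def using v n by (subst am_smult) auto
    qed (simp add: w_def)
    have wC: "w \<in> Cn" "s \<in> Cn" unfolding w_def s_def using v by auto
    \<comment> \<open>All sign combinations of \<open>u\<close> and \<open>v\<close> lie below
      \<open>s\<close>. Hence \<open>|v|\<close> lies below both \<open>s - u\<close> and
      \<open>s + u\<close>, and therefore \<open>|u|\<close> below \<open>s - w\<close>.\<close>
    have q: "u \<oplus> v \<preceq> s" "\<ominus> (u \<oplus> v) \<preceq> s" "u \<ominus> v \<preceq> s" "\<ominus> (u \<ominus> v) \<preceq> s"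
      using le_am[of "u \<oplus> v"] neg_le_am[of "u \<oplus> v"] le_am[of "u \<ominus> v"] neg_le_am[of "u \<ominus> v"] u v w by auto
    have "w \<preceq> s \<ominus> u" unfolding w_def
      by (rule am_lub; use u v wC leD[OF q(1)] leD[OF q(3)] in \<open>auto intro: le_by[OF leD[OF q(1)]] le_by[OF leD[OF q(3)]]\<close>)
    moreover have "w \<preceq> s \<oplus> u" unfolding w_def
      by (rule am_lub; use u v wC leD[OF q(2)] leD[OF q(4)] in \<open>auto intro: le_by[OF leD[OF q(2)]] le_by[OF leD[OF q(4)]]\<close>)
    ultimately have r: "s \<ominus> u \<ominus> w \<in> Cn" "s \<oplus> u \<ominus> w \<in> Cn" using leD by auto
    have "w \<preceq> s \<ominus> w" unfolding w(1)[symmetric]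
      by (rule am_lub; use u v wC w(1) in \<open>auto intro: le_by[OF r(1)] le_by[OF r(2)]\<close>)
    from leD[OF this] have "s \<ominus> w \<ominus> w \<in> Cn" .
    hence "\<ominus> ((2 - sqrt 2) *r w) \<in> Cn" using wC
      by - (rule Cn_by[of "s \<ominus> w \<ominus> w"]; simp add: s_def algebra_simps)
    moreover have "sqrt 2 < 2" by (rule real_less_lsqrt) auto
    hence "(2 - sqrt 2) *r w \<in> Cn" using wC by simp
    ultimately have "(2 - sqrt 2) *r w = \<zero>" using Cn_pointed by blast
    hence "(1 / (2 - sqrt 2)) *r ((2 - sqrt 2) *r w) = \<zero>" by simp
    hence "w = \<zero>" using wC \<open>sqrt 2 < 2\<close> by simp
    hence "am u = \<zero>" "am v = \<zero>" using w(1,4) by simp_all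
    hence "u = \<zero>" "v = \<zero>" using am_eq_zero[OF RlD[OF u]] am_eq_zero[OF RlD[OF v]] by blast+
    thus ?thesis by simp
  qed
  thus "u = \<zero>" "kI \<odot> v = \<zero>" by auto
qed

text \<open>The summand \<open>u\<close> is unique by \<open>real_imag_unique\<close>, whereas over
  the reals \<open>v\<close> is arbitrary. \<open>Ip\<close> is read off after multiplication by
  \<open>- kI\<close>, which makes it 0 over the reals.\<close>

definition Rp where "Rp x = (THE u. u \<in> Rl \<and> (\<exists>v\<in>Rl. x = u \<oplus> kI \<odot> v))"
definition Ip where "Ip x = Rp ((- kI) \<odot> x)"

lemma real_imag_unique:
  assumes "u \<in> Rl" "v \<in> Rl" "u' \<in> Rl" "v' \<in> Rl" "u \<oplus> kI \<odot> v = u' \<oplus> kI \<odot> v'" shows "u = u'"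
proof -
  have "(u \<ominus> u') \<oplus> kI \<odot> (v \<ominus> v') = (u \<oplus> kI \<odot> v) \<ominus> (u' \<oplus> kI \<odot> v')"
    using assms(1-4) by (intro vec_eqI) (auto simp: algebra_simps)
  hence "(u \<ominus> u') \<oplus> kI \<odot> (v \<ominus> v') = \<zero>" using assms by (simp add: minus_self)
  hence "u \<ominus> u' = \<zero>" using real_imag_zero[of "u \<ominus> u'" "v \<ominus> v'"] assms by simp
  thus ?thesis using assms minus_add[of u u'] by simp
qed

lemma Rp_eq: assumes "u \<in> Rl" "v \<in> Rl" shows "Rp (u \<oplus> kI \<odot> v) = u"
  unfolding Rp_def
proof (rule the_equality)
  show "u \<in> Rl \<and> (\<exists>va\<in>Rl. u \<oplus> kI \<odot> v = u \<oplus> kI \<odot> va)" using assms by auto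
  fix u' assume "u' \<in> Rl \<and> (\<exists>va\<in>Rl. u \<oplus> kI \<odot> v = u' \<oplus> kI \<odot> va)"
  thus "u' = u" using assms real_imag_unique by metis
qed

lemma Rp_Rl [simp]: "x \<in> Vc ==> Rp x \<in> Rl"
  using real_imag_exists Rp_eq by metis

lemma Ip_Rl [simp]: "x \<in> Vc ==> Ip x \<in> Rl" by (simp add: Ip_def)

lemma Rp_real: "x \<in> Rl ==> Rp x = x" using Rp_eq[of x \<zero>] by simp

lemma Rp_Ip: assumes "x \<in> Vc" shows "x = Rp x \<oplus> kI \<odot> Ip x"
proof -
  obtain u v where uv: "u \<in> Rl" "v \<in> Rl" "x = u \<oplus> kI \<odot> v" using real_imag_exists[OF assms] by auto
  show ?thesis
  proof (cases rule: kI_cases[where 'k='k])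
    case 1 thus ?thesis using uv Rp_real by (simp add: Ip_def)
  next
    case 2
    have "(- kI) \<odot> x = v \<oplus> kI \<odot> (\<ominus> u)" unfolding uv(3) using uv 2
      by (intro vec_eqI) (simp_all add: algebra_simps mult.assoc[symmetric])
    hence "Ip x = v" unfolding Ip_def using uv Rp_eq by simp
    thus ?thesis using uv Rp_eq by simp
  qed
qed

lemma Rp_by: assumes "u \<in> Rl" "v \<in> Rl" "x \<in> Vc" "\<And>\<phi>. \<phi> \<in> functionals V ==> \<phi> x = \<phi> u + kI * \<phi> v" shows "Rp x = u"
  using Rp_eq[of u v] vec_eqI[of x "u \<oplus> kI \<odot> v"] assms by auto

lemma fun_Rp_Ip: "\<phi> \<in> functionals V ==> x \<in> Vc ==> \<phi> x = \<phi> (Rp x) + kI * \<phi> (Ip x)"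
  using arg_cong[OF Rp_Ip, of x \<phi>] by simp

lemma Rp_add: "x \<in> Vc ==> y \<in> Vc ==> Rp (x \<oplus> y) = Rp x \<oplus> Rp y"
  by (rule Rp_by[of _ "Ip x \<oplus> Ip y"]) (simp_all add: fun_Rp_Ip[of _ x] fun_Rp_Ip[of _ y] algebra_simps)

lemma Rp_complex: assumes "x \<in> Vc"
  shows "Rp ((of_real a + of_real b * kI) \<odot> x) = a *r Rp x \<ominus> b *r Ip x"
proof (cases rule: kI_cases[where 'k='k])
  case 1
  have "Rp \<zero> = \<zero>" using Rp_real[of \<zero>] by simp
  thus ?thesis using 1 assms by (intro Rp_by[of _ \<zero>]) (auto simp: Ip_def fun_Rp_Ip[of _ x])
next
  case 2
  show ?thesis
  proof (rule Rp_by[of _ "a *r Ip x \<oplus> b *r Rp x"])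
    fix \<phi> assume \<phi>: "\<phi> \<in> functionals V"
    have "of_real b * kI * (kI * \<phi> (Ip x)) = of_real b * (kI * kI) * \<phi> (Ip x)" by (simp only: mult.assoc)
    also have "... = - (of_real b * \<phi> (Ip x))" using 2 by simp
    finally show "\<phi> ((of_real a + of_real b * kI) \<odot> x) = \<phi> (a *r Rp x \<ominus> b *r Ip x) + kI * \<phi> (a *r Ip x \<oplus> b *r Rp x)"
      using \<phi> assms by (simp add: fun_Rp_Ip[of _ x] algebra_simps)
  qed (use assms in auto)
qed

lemma Ip_complex: assumes "x \<in> Vc" "(kI::'k) * kI = -1"
  shows "Ip ((of_real a + of_real b * kI) \<odot> x) = a *r Ip x \<oplus> b *r Rp x"
proof -
  have "(- kI) * (of_real a + of_real b * kI) = of_real b + of_real (- a) * (kI::'k)"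
  proof -
    have "(- kI) * (of_real a + of_real b * kI) = - (of_real a * kI) - of_real b * (kI * (kI::'k))"
      by (simp add: algebra_simps)
    thus ?thesis using assms(2) by simp
  qed
  hence "Ip ((of_real a + of_real b * kI) \<odot> x) = b *r Rp x \<ominus> (- a) *r Ip x"
    unfolding Ip_def[of "_ \<odot> x"] using Rp_complex[OF assms(1), of b "-a"] assms(1) by (simp del: of_real_minus)
  also have "... = a *r Ip x \<oplus> b *r Rp x" using assms(1) by (intro vec_eqI) auto
  finally show ?thesis .
qed

lemma Rp_rs: "x \<in> Vc ==> Rp (r *r x) = r *r Rp x"
  using Rp_complex[of x r 0] by (simp add: rs_def[symmetric])

lemma Rp_neg: "x \<in> Vc ==> Rp (\<ominus> x) = \<ominus> Rp x"
  using Rp_rs[of x "-1"] by (simp add: rs_def smult_minus1)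

lemma am_le_Rp_Ip: assumes "x \<in> Vc" shows "am x \<preceq> am (Rp x) \<oplus> am (Ip x)"
proof -
  have "am x \<preceq> am (Rp x) \<oplus> am (kI \<odot> Ip x)" using am_triangle[of "Rp x" "kI \<odot> Ip x"] Rp_Ip[OF assms] assms by simp
  also have "am (kI \<odot> Ip x) = norm (kI::'k) *r am (Ip x)" using assms by (simp add: am_smult)
  finally have 1: "am x \<preceq> am (Rp x) \<oplus> norm (kI::'k) *r am (Ip x)" .
  have "norm (kI::'k) *r am (Ip x) \<preceq> 1 *r am (Ip x)" using norm_kI assms by (intro le_rs_mono) auto
  hence "am (Rp x) \<oplus> norm (kI::'k) *r am (Ip x) \<preceq> am (Rp x) \<oplus> am (Ip x)" using assms by (intro le_add) auto
  with 1 show ?thesis using assms by (intro le_trans[OF 1]) auto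
qed

text \<open>If \<^term>\<open>v\<close> is small compared with \<^term>\<open>u\<close>, then \<^term>\<open>u \<ominus> kI \<odot> v\<close> is a combination of the
  vectors \<^term>\<open>(1 - \<delta> * kI)\<close> and \<^term>\<open>(1 + \<delta> * kI)\<close> with positive coefficients of sum \<^term>\<open>u\<close>.\<close>

lemma am_conj_le:
  assumes u: "u \<in> Rl" and v: "v \<in> Rl" and d: "d > 0" and le: "am v \<preceq> d *r u"
  shows "am (u \<ominus> kI \<odot> v) \<preceq> (1 + d\<^sup>2) *r u"
proof -
  define p where "p = (1/2) *r (u \<oplus> (1/d) *r v)"
  define q where "q = (1/2) *r (u \<ominus> (1/d) *r v)"
  have vle: "v \<preceq> d *r u" "\<ominus> v \<preceq> d *r u"
    using le_trans[OF le_am[OF v] le] le_trans[OF neg_le_am[OF v] le] u v by auto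
  have p: "p \<in> Cn" using leD[OF vle(2)] u v d
    by - (rule Cn_by[of "(1/(2*d)) *r (d *r u \<ominus> \<ominus> v)"]; simp add: p_def field_simps)
  have q: "q \<in> Cn" using leD[OF vle(1)] u v d
    by - (rule Cn_by[of "(1/(2*d)) *r (d *r u \<ominus> v)"]; simp add: q_def field_simps)
  let ?a = "of_real 1 + of_real (- d) * kI :: 'k" and ?b = "of_real 1 + of_real d * kI :: 'k"
  have e: "u \<ominus> kI \<odot> v = ?a \<odot> p \<oplus> ?b \<odot> q" "p \<oplus> q = u"
    using u v d unfolding p_def q_def by (intro vec_eqI; simp add: field_simps)+
  have s: "sqrt (1 + d\<^sup>2) \<le> 1 + d\<^sup>2" using self_le_power[of "1 + d\<^sup>2" 2] by (intro real_le_lsqrt) auto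
  have n: "norm ?a \<le> 1 + d\<^sup>2" "norm ?b \<le> 1 + d\<^sup>2"
    using norm_k_le[of 1 "-d", where 'k='k] norm_k_le[of 1 d, where 'k='k] s by (simp_all only: power_one power2_minus)
  have 1: "am (u \<ominus> kI \<odot> v) \<preceq> norm ?a *r p \<oplus> norm ?b *r q"
    using am_triangle[of "?a \<odot> p" "?b \<odot> q"] p q by (simp only: e(1)) (simp add: am_smult Cn_am)
  have 2: "norm ?a *r p \<oplus> norm ?b *r q \<preceq> (1 + d\<^sup>2) *r p \<oplus> (1 + d\<^sup>2) *r q"
    using n p q by (intro le_add le_rs_mono) auto
  have "(1 + d\<^sup>2) *r p \<oplus> (1 + d\<^sup>2) *r q = (1 + d\<^sup>2) *r (p \<oplus> q)"
    using p q by (intro vec_eqI) (auto simp: algebra_simps)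
  hence "(1 + d\<^sup>2) *r p \<oplus> (1 + d\<^sup>2) *r q = (1 + d\<^sup>2) *r u" by (simp only: e(2))
  with le_trans[OF 1 2] show ?thesis using p q u v by simp
qed

text \<open>Shifting \<open>u\<close> by a large multiple \<open>N h\<close> makes \<open>v\<close>
  small relative to \<open>w = N h + u\<close>, so that \<open>am_conj_le\<close> bounds
  \<open>|w - kI v|\<close> by \<open>(1 + d^2) w\<close>. The sum of the two conjugates is
  \<open>2 w\<close>, hence \<open>|w + kI v|\<close> is at least \<open>(1 - d^2) w\<close>;
  removing the shift leaves an error \<open>d^2 w\<close>. It is quadratic in
  \<open>d = 1 / M\<close> while the shift grows only like \<open>M\<close>, so the error tends to
  0.\<close>

lemma real_le_am_complex: assumes u: "u \<in> Rl" and v: "v \<in> Rl" shows "u \<preceq> am (u \<oplus> kI \<odot> v)"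
proof (rule le_archimedean)
  define h where "h = am u \<oplus> am v"
  show h: "h \<in> Cn" "u \<in> Rl" "am (u \<oplus> kI \<odot> v) \<in> Rl" using u v by (auto simp: h_def)
  fix e :: real assume e: "e > 0"
  obtain M :: nat where M: "M > 3 / e" using reals_Archimedean2 by blast
  have M0: "M \<ge> 1" using M e by (metis divide_pos_pos less_one linorder_not_le not_less_iff_gr_or_eq of_nat_0 zero_less_numeral)
  \<comment> \<open>One more than \<open>M\<close>: since \<open>u \<ge> - h\<close>, the shifted
    element \<open>w\<close> dominates \<open>M h\<close>, which gives
    \<open>|v| \<le> h \<le> d w\<close>.\<close>
  define N where "N = real M + 1"
  define d where "d = 1 / real M"
  have d: "d > 0" using M0 by (simp add: d_def)
  define w where "w = N *r h \<oplus> u"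
  have w: "w \<in> Rl" using u h by (simp add: w_def)
  have hu: "\<ominus> u \<preceq> h" "am v \<preceq> h" "u \<preceq> h"
    unfolding h_def using u v le_trans[OF neg_le_am[OF u], of h] le_trans[OF le_am[OF u], of h] by (simp_all add: h_def)
  have "real M *r h \<preceq> w" using leD[OF hu(1)] u h
    by (intro le_by[of "h \<ominus> \<ominus> u"]) (auto simp: w_def N_def algebra_simps)
  hence "d *r (real M *r h) \<preceq> d *r w" using d h w by (intro le_smult) auto
  hence "h \<preceq> d *r w" using h M0 by (simp add: d_def)
  hence vd: "am v \<preceq> d *r w" using hu(2) le_trans v h w by (meson CnD RlD am_cl rs_cl)
  have 1: "am (w \<ominus> kI \<odot> v) \<preceq> (1 + d\<^sup>2) *r w" by (rule am_conj_le[OF w v d vd])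
  have "(w \<oplus> kI \<odot> v) \<oplus> (w \<ominus> kI \<odot> v) = 2 *r w" using w v by (intro vec_eqI) auto
  hence 2: "2 *r am w \<preceq> am (w \<oplus> kI \<odot> v) \<oplus> am (w \<ominus> kI \<odot> v)"
    using am_triangle[of "w \<oplus> kI \<odot> v" "w \<ominus> kI \<odot> v"] w v by simp
  have 3: "w \<preceq> am w" using le_am w by simp
  have "w \<oplus> kI \<odot> v = N *r h \<oplus> (u \<oplus> kI \<odot> v)" using u v h by (intro vec_eqI) (auto simp: w_def)
  hence 4: "am (w \<oplus> kI \<odot> v) \<preceq> N *r h \<oplus> am (u \<oplus> kI \<odot> v)"
    using am_triangle[of "N *r h" "u \<oplus> kI \<odot> v"] u v h by (simp add: Cn_am N_def)
  have 5: "w \<preceq> (N + 1) *r h" using leD[OF hu(3)] h u by (intro le_by[of "h \<ominus> u"]) (auto simp: w_def algebra_simps)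
  have "d\<^sup>2 * (N + 1) \<le> 3 / real M" using M0
    by (simp add: d_def N_def power2_eq_square field_simps)
  also have "... \<le> e" using M e M0 by (simp add: field_simps)
  finally have 6: "d\<^sup>2 * (N + 1) \<le> e" .
  let ?c = "((1 + d\<^sup>2) *r w \<ominus> am (w \<ominus> kI \<odot> v)) \<oplus> (am (w \<oplus> kI \<odot> v) \<oplus> am (w \<ominus> kI \<odot> v) \<ominus> 2 *r am w) \<oplus>
     (2 *r (am w \<ominus> w)) \<oplus> (N *r h \<oplus> am (u \<oplus> kI \<odot> v) \<ominus> am (w \<oplus> kI \<odot> v)) \<oplus> d\<^sup>2 *r ((N + 1) *r h \<ominus> w) \<oplus> (e - d\<^sup>2 * (N + 1)) *r h"
  show "u \<preceq> am (u \<oplus> kI \<odot> v) \<oplus> e *r h"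
  proof (rule le_by[of ?c])
    show "?c \<in> Cn" using leD[OF 1] leD[OF 2] leD[OF 3] leD[OF 4] leD[OF 5] 6 h by (intro Cn_add Cn_smult) auto
    fix \<phi> assume "\<phi> \<in> functionals V"
    moreover from this have "\<phi> w = of_real N * \<phi> h + \<phi> u" using h u by (simp add: w_def)
    ultimately show "\<phi> (am (u \<oplus> kI \<odot> v) \<oplus> e *r h) - \<phi> u = \<phi> ?c"
      using u v h w by (simp add: algebra_simps)
  qed (use u v h in auto)
qed

lemma Rp_le_am: "x \<in> Vc ==> Rp x \<preceq> am x"
  using real_le_am_complex[of "Rp x" "Ip x"] Rp_Ip[of x] by simp

lemma am_Rp_le: assumes "x \<in> Vc" shows "am (Rp x) \<preceq> am x"
  using Rp_le_am[of x] Rp_le_am[of "\<ominus> x"] assms by (intro am_lub) (auto simp: Rp_neg am_neg)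

lemma am_Ip_le: assumes "x \<in> Vc" shows "am (Ip x) \<preceq> am x"
proof -
  have "am (Ip x) \<preceq> norm (kI::'k) *r am x" unfolding Ip_def using am_Rp_le[of "(- kI) \<odot> x"] assms by (simp add: am_smult)
  moreover have "norm (kI::'k) *r am x \<preceq> 1 *r am x" using norm_kI assms by (intro le_rs_mono) auto
  ultimately show ?thesis using assms le_trans[of "am (Ip x)" "norm (kI::'k) *r am x" "am x"] by simp
qed

text \<open>For real functions: a sequence that changes its sign after a period has, at every point, some
  \<open>j\<close> with \<open>s j \<le> 0 \<le> s (Suc j)\<close>, where the bound on \<open>y\<close> vanishes.\<close>

lemma sign_change_zero:
  assumes s: "\<And>j::nat. s j \<in> Rl" and per: "\<And>j. s (j + N) = \<ominus> s j"
    and y: "y \<in> Cn" and M: "M \<ge> 1" and le: "\<And>j. y \<preceq> M *r (pp (s j) \<oplus> pp (\<ominus> s (Suc j)))"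
  shows "y = \<zero>"
proof -
  \<comment> \<open>A positive \<open>z\<close> below \<open>y\<close> and the negative part of
    \<open>s i\<close> stays below \<open>M\<close> times the negative part of every later term: at
    each step \<open>z\<close> splits into a piece below the positive part of
    \<open>s (i + j)\<close>, which vanishes by disjointness, and a piece below the next negative
    part. After \<open>N\<close> steps the sign has changed, so \<open>z\<close> is also below a
    multiple of the positive part of \<open>s i\<close>.\<close>
  have neg: "dj y (pp (\<ominus> s i))" for i
    unfolding dj_def
  proof (intro ballI impI)
    fix z assume z: "z \<in> Cn" "z \<preceq> y" "z \<preceq> pp (\<ominus> s i)"
    have pC: "pp (s j) \<in> Cn" "pp (\<ominus> s j) \<in> Cn" for j using s by auto
    have "z \<preceq> M *r pp (\<ominus> s (i + j))" for j
    proof (induction j)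
      case 0
      have "1 *r pp (\<ominus> s i) \<preceq> M *r pp (\<ominus> s i)" using M pC by (intro le_rs_mono) auto
      thus ?case using z pC le_trans[of z "pp (\<ominus> s i)"] by simp
    next
      case (Suc j)
      have "z \<preceq> M *r pp (s (i + j)) \<oplus> M *r pp (\<ominus> s (Suc (i + j)))"
      proof -
        have "z \<preceq> M *r (pp (s (i + j)) \<oplus> pp (\<ominus> s (Suc (i + j))))" using le_trans[OF z(2) le] z y pC by simp
        also have "M *r (pp (s (i + j)) \<oplus> pp (\<ominus> s (Suc (i + j)))) = M *r pp (s (i + j)) \<oplus> M *r pp (\<ominus> s (Suc (i + j)))"
          using pC by (intro vec_eqI) (auto simp: algebra_simps)
        finally show ?thesis .
      qed
      then obtain z1 z2 where z12: "z1 \<in> Cn" "z2 \<in> Cn" "z = z1 \<oplus> z2" "z1 \<preceq> M *r pp (s (i + j))" "z2 \<preceq> M *r pp (\<ominus> s (Suc (i + j)))"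
        using riesz_decomposition[of z "M *r pp (s (i + j))" "M *r pp (\<ominus> s (Suc (i + j)))"] z pC M by auto
      have "z1 \<preceq> z" using z12 by auto
      hence "z1 \<preceq> M *r pp (\<ominus> s (i + j))" using Suc le_trans z12 z pC by (meson CnD rs_cl)
      moreover have "dj (M *r pp (\<ominus> s (i + j))) (pp (s (i + j)))"
        using dj_smult[OF dj_sym[OF dj_pp[OF s]], where r = M] pC M by simp
      hence "dj (M *r pp (s (i + j))) (M *r pp (\<ominus> s (i + j)))"
        using pC M by (intro dj_smult) (auto intro: dj_sym)
      ultimately have "z1 = \<zero>" using z12 by (auto intro: djD)
      thus ?case using z12 by simp
    qed
    hence "z \<preceq> M *r pp (s i)" using per s by (metis M.minus_minus RlD)
    moreover have "dj (M *r pp (s i)) (pp (\<ominus> s i))" using dj_smult[OF dj_pp[OF s]] pC M by auto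
    ultimately show "z = \<zero>" using z by (auto intro: djD)
  qed
  have "dj (pp (s i)) y" for i using neg[of "i + N"] s per by (metis M.minus_minus RlD dj_sym)
  hence "dj (pp (s 0) \<oplus> pp (\<ominus> s (Suc 0))) y" using neg dj_sym s y by (intro dj_add) auto
  hence "dj (M *r (pp (s 0) \<oplus> pp (\<ominus> s (Suc 0)))) y" using s y M by (intro dj_smult) auto
  thus ?thesis using y le[of 0] by (auto intro: djD)
qed

end

context avl
begin

text \<open>For scalars one would pick the angle at which \<open>v\<close> is rotated to 0; then
  \<open>z\<close> is at most the modulus of the rotated \<open>u\<close>, and this is at most
  \<open>w\<close>. In a lattice the angle would depend on the point. Instead angles
  \<open>j h\<close> are used, where \<open>h\<close> divides a half turn: wherever the rotated
  imaginary part changes sign between \<open>j\<close> and \<open>j + 1\<close>, it is at most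
  \<open>tan h\<close> times the real part. \<open>sign_change_zero\<close> replaces the choice of
  such a point.\<close>

lemma rotations_le:
  assumes u: "u \<in> Rl" and v: "v \<in> Rl" and z: "z \<in> Rl" and w: "w \<in> Cn"
    and zle: "\<And>\<theta>. z \<preceq> am (cos \<theta> *r u \<ominus> sin \<theta> *r v) \<oplus> am (cos \<theta> *r v \<oplus> sin \<theta> *r u)"
    and lew: "\<And>\<theta>. cos \<theta> *r u \<ominus> sin \<theta> *r v \<preceq> w"
  shows "z \<preceq> w"
proof (rule le_archimedean[where g = w])
  fix e :: real assume e: "e > 0"
  obtain N0 :: nat where N0: "real N0 > 2 * pi / e" using reals_Archimedean2 by blast
  \<comment> \<open>The summand 3 ensures \<open>h \<le> pi / 3\<close>, so
    \<open>cos h \<ge> 1 / 2\<close> and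
    \<open>tan h \<le> 2 sin h \<le> 2 h \<le> e\<close>.\<close>
  define N where "N = N0 + 3"
  define h where "h = pi / real N"
  have h: "0 < h" "h \<le> pi / 3" by (auto simp: h_def N_def field_simps)
  have "2 * pi / e < real N" using N0 by (simp add: N_def)
  hence "2 * h \<le> e" using e by (simp add: h_def N_def field_simps)
  have "cos (pi/3) \<le> cos h" using h by (intro cos_monotone_0_pi_le) auto
  hence c: "cos h \<ge> 1/2" by (simp add: cos_60)
  have s0: "sin h > 0" using h pi_gt_zero by (intro sin_gt_zero) (auto simp: field_simps)
  have "sin h \<le> h" using sin_x_le_x[of h] h by simp
  hence t: "sin h / cos h \<le> e"
  proof -
    have "sin h \<le> e * (1/2)" using \<open>sin h \<le> h\<close> \<open>2 * h \<le> e\<close> by simp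
    also have "... \<le> e * cos h" using c e by (intro mult_left_mono) auto
    finally show ?thesis using c by (simp add: field_simps)
  qed
  define t where "t = sin h / cos h"
  have t0: "t \<ge> 0" "t \<le> e" using t s0 c by (auto simp: t_def)
  define p where "p j = cos (real j * h) *r u \<ominus> sin (real j * h) *r v" for j :: nat
  define s where "s j = cos (real j * h) *r v \<oplus> sin (real j * h) *r u" for j :: nat
  have pR: "p j \<in> Rl" and sR: "s j \<in> Rl" for j using u v by (auto simp: p_def s_def)
  have per: "s (j + N) = \<ominus> s j" for j
  proof -
    have "real (j + N) * h = real j * h + pi" by (simp add: h_def N_def field_simps)
    thus ?thesis unfolding s_def using u v by (intro vec_eqI) (auto simp: algebra_simps)
  qed
  have step: "\<phi> (s (Suc j)) = of_real (cos h) * \<phi> (s j) + of_real (sin h) * \<phi> (p j)" if "\<phi> \<in> functionals V" for \<phi> j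
  proof -
    have "real (Suc j) * h = real j * h + h" by (simp add: algebra_simps)
    thus ?thesis unfolding s_def p_def using that u v by (simp add: cos_add sin_add algebra_simps)
  qed
  \<comment> \<open>Where \<open>s j \<le> 0 \<le> s (Suc j)\<close> the estimates give
    \<open>z \<le> (1 + t) p j\<close>. So the excess \<open>d\<close> should be controlled by the
    failure of these two signs, that is by \<open>pp (s j)\<close> and
    \<open>pp (\<ominus> s (Suc j))\<close>.\<close>
  define d where "d = z \<ominus> (1 + t) *r w"
  have dR: "d \<in> Rl" using z w by (simp add: d_def)
  \<comment> \<open>Large enough to absorb the coefficients with which \<open>P\<close> and
    \<open>Q\<close> enter the certificate \<open>?c\<close> below, and at least 1 as
    \<open>sign_change_zero\<close> requires.\<close>
  define M where "M = 2 * cos h / sin h + 2 + 2 / sin h + 1 / cos h"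
  have M: "M \<ge> 2 + 2 * cos h / sin h" "M \<ge> 2 / sin h + 1 / cos h" "M \<ge> 1"
    using c s0 by (auto simp: M_def intro!: add_nonneg_nonneg)
  have "d \<preceq> M *r (pp (s j) \<oplus> pp (\<ominus> s (Suc j)))" for j
  proof -
    define P where "P = pp (s j)"
    define Q where "Q = pp (\<ominus> s (Suc j))"
    have PQ: "P \<in> Cn" "Q \<in> Cn" using sR by (auto simp: P_def Q_def)
    define B where "B = (1 / sin h) *r Q \<oplus> (cos h / sin h) *r P"
    have B: "B \<in> Cn" using PQ c s0 by (simp add: B_def)
    have 1: "P \<ominus> s j \<in> Cn" unfolding P_def by (rule leD[OF le_pp[OF sR]])
    have "Q \<ominus> \<ominus> s (Suc j) \<in> Cn" unfolding Q_def by (rule leD[OF le_pp]) (simp add: sR)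
    hence 2: "Q \<oplus> cos h *r s j \<oplus> sin h *r p j \<in> Cn" using PQ sR pR
      by - (rule Cn_by[of "Q \<ominus> \<ominus> s (Suc j)"]; simp add: step algebra_simps)
    \<comment> \<open>Solving \<open>s (Suc j) = cos h * s j + sin h * p j\<close> for
      \<open>p j\<close> shows \<open>- p j \<le> B\<close>: the real part is nearly positive where
      \<open>P\<close> and \<open>Q\<close> vanish.\<close>
    have 3: "am (p j) \<preceq> p j \<oplus> 2 *r B"
    proof (rule am_lub)
      show "\<ominus> p j \<preceq> p j \<oplus> 2 *r B"
      proof (rule le_by[of "(2 / sin h) *r ((Q \<oplus> cos h *r s j \<oplus> sin h *r p j) \<oplus> cos h *r (P \<ominus> s j))"])
        show "(2 / sin h) *r ((Q \<oplus> cos h *r s j \<oplus> sin h *r p j) \<oplus> cos h *r (P \<ominus> s j)) \<in> Cn"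
          using s0 c by (intro Cn_smult[OF Cn_add[OF 2 Cn_smult[OF 1]]]) simp_all
        fix \<phi> assume "\<phi> \<in> functionals V"
        thus "\<phi> (p j \<oplus> 2 *r B) - \<phi> (\<ominus> p j) = \<phi> ((2 / sin h) *r ((Q \<oplus> cos h *r s j \<oplus> sin h *r p j) \<oplus> cos h *r (P \<ominus> s j)))"
          using PQ pR sR s0 by (simp add: B_def field_simps)
      qed (use pR PQ B in auto)
    qed (use pR B in auto)
    have 4: "z \<preceq> am (p j) \<oplus> am (s j)" unfolding p_def s_def by (rule zle)
    have 5: "p j \<preceq> w" unfolding p_def by (rule lew)
    have ams: "\<phi> (am (s j)) = 2 * \<phi> P - \<phi> (s j)" if "\<phi> \<in> functionals V" for \<phi>
      using that sR by (simp add: P_def pp_def field_simps)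
    let ?c = "(am (p j) \<oplus> am (s j) \<ominus> z) \<oplus> (p j \<oplus> 2 *r B \<ominus> am (p j)) \<oplus> (1 / cos h) *r (Q \<oplus> cos h *r s j \<oplus> sin h *r p j)
       \<oplus> (1 + t) *r (w \<ominus> p j) \<oplus> (M - (2 + 2 * cos h / sin h)) *r P \<oplus> (M - (2 / sin h + 1 / cos h)) *r Q"
    show ?thesis unfolding P_def[symmetric] Q_def[symmetric]
    proof (rule le_by[of ?c])
      show "?c \<in> Cn" using M PQ c t0
        by (intro Cn_add[OF Cn_add[OF Cn_add[OF Cn_add[OF Cn_add[OF leD[OF 4] leD[OF 3]] Cn_smult[OF 2]] Cn_smult[OF leD[OF 5]]]]]
              Cn_smult) simp_all
      fix \<phi> assume \<phi>: "\<phi> \<in> functionals V"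
      have c0: "cos h \<noteq> 0" "sin h \<noteq> 0" using c s0 by auto
      show "\<phi> (M *r (P \<oplus> Q)) - \<phi> d = \<phi> ?c"
        using \<phi> PQ pR sR z w c0 B by (simp add: ams d_def t_def B_def) (simp add: field_simps)
    qed (use dR PQ in auto)
  qed
  hence "pp d \<preceq> M *r (pp (s j) \<oplus> pp (\<ominus> s (Suc j)))" for j
    using M sR dR by (intro pp_lub) auto
  hence "pp d = \<zero>" using dR by (intro sign_change_zero[where s = s and N = N, OF sR per _ M(3)]) auto
  hence "d \<preceq> \<zero>" using le_pp[OF dR] by simp
  from leD[OF this] show "z \<preceq> w \<oplus> e *r w" using t0 z w
    by (intro le_by[of "(\<zero> \<ominus> d) \<oplus> (e - t) *r w"]) (auto simp: d_def algebra_simps)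
qed (use z w in auto)

definition rot :: "real \<Rightarrow> 'k" where "rot \<theta> = of_real (cos \<theta>) + of_real (sin \<theta>) * kI"

lemma norm_rot: "(kI::'k) \<noteq> 0 ==> norm (rot \<theta>) = 1"
  using norm_k[of "cos \<theta>" "sin \<theta>", where 'k='k] by (simp add: rot_def)

lemma Rp_rot: "x \<in> Vc ==> Rp (rot \<theta> \<odot> x) = cos \<theta> *r Rp x \<ominus> sin \<theta> *r Ip x"
  unfolding rot_def by (rule Rp_complex)

lemma Ip_rot: "x \<in> Vc ==> (kI::'k) * kI = -1 ==> Ip (rot \<theta> \<odot> x) = cos \<theta> *r Ip x \<oplus> sin \<theta> *r Rp x"
  unfolding rot_def by (rule Ip_complex)

lemma Rp_rot_le: "x \<in> Vc ==> (kI::'k) \<noteq> 0 ==> cos \<theta> *r Rp x \<ominus> sin \<theta> *r Ip x \<preceq> am x"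
  using Rp_le_am[of "rot \<theta> \<odot> x"] by (simp add: Rp_rot am_smult norm_rot)

text \<open>A rotation preserves the modulus, so \<open>am_le_Rp_Ip\<close> may be applied to the
  rotated element. Together with \<open>Rp_rot_le\<close> this provides the two hypotheses of
  \<open>rotations_le\<close>.\<close>

lemma am_rot_le: assumes "x \<in> Vc" "(kI::'k) * kI = -1"
  shows "am x \<preceq> am (cos \<theta> *r Rp x \<ominus> sin \<theta> *r Ip x) \<oplus> am (cos \<theta> *r Ip x \<oplus> sin \<theta> *r Rp x)"
proof -
  have "(kI::'k) \<noteq> 0" using assms(2) by auto
  thus ?thesis using am_le_Rp_Ip[of "rot \<theta> \<odot> x"] assms by (simp add: Rp_rot Ip_rot am_smult norm_rot)
qed

lemma real_field_all_real: "(kI::'k) = 0 ==> x \<in> Vc ==> x \<in> Rl"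
  using real_imag_exists[of x] by force

end

section \<open>Positive linear maps\<close>

locale avl_map = V: avl V + W: avl W
  for V :: "('k :: real_or_complex, 'a) vlattice" and W :: "('k, 'b) vlattice" +
  fixes T :: "'a \<Rightarrow> 'b"
  assumes lin: "linear_map V W T"
begin

lemma T_cl [simp]: "x \<in> carrier V ==> T x \<in> carrier W"
  and T_add: "x \<in> carrier V ==> y \<in> carrier V ==> T (x \<oplus>\<^bsub>V\<^esub> y) = T x \<oplus>\<^bsub>W\<^esub> T y"
  and T_smult: "x \<in> carrier V ==> T (\<alpha> \<odot>\<^bsub>V\<^esub> x) = \<alpha> \<odot>\<^bsub>W\<^esub> T x"
  using lin unfolding linear_map_def by auto

lemma T_zero: "T \<zero>\<^bsub>V\<^esub> = \<zero>\<^bsub>W\<^esub>"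
  using T_smult[of "\<zero>\<^bsub>V\<^esub>" 0] by simp

lemma T_neg: "x \<in> carrier V ==> T (\<ominus>\<^bsub>V\<^esub> x) = \<ominus>\<^bsub>W\<^esub> T x"
  using T_smult[of x "-1"] by (simp add: V.smult_minus1 W.smult_minus1)

lemma T_minus: "x \<in> carrier V ==> y \<in> carrier V ==> T (x \<ominus>\<^bsub>V\<^esub> y) = T x \<ominus>\<^bsub>W\<^esub> T y"
  by (simp add: a_minus_def T_add T_neg)

lemma T_rs: "x \<in> carrier V ==> T (V.rs r x) = W.rs r (T x)"
  by (simp add: V.rs_def W.rs_def T_smult)

lemmas T_simps = T_add T_smult T_zero T_neg T_minus T_rs

context
  assumes pos: "T \<in> pos_cone V \<rightarrow> pos_cone W"
begin

lemma T_Cn [simp]: "x \<in> pos_cone V ==> T x \<in> pos_cone W" using pos by auto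

lemma T_Rl [simp]: assumes "x \<in> V.Rl" shows "T x \<in> W.Rl"
proof -
  obtain a b where "a \<in> pos_cone V" "b \<in> pos_cone V" "x = a \<ominus>\<^bsub>V\<^esub> b" using V.RlE[OF assms] .
  thus ?thesis by (simp add: T_minus)
qed

lemma T_mono: "vl_le V x y ==> x \<in> carrier V ==> y \<in> carrier V ==> vl_le W (T x) (T y)"
  using T_Cn[of "y \<ominus>\<^bsub>V\<^esub> x"] by (simp add: vl_le_def T_minus)

lemma am_T_le_real: assumes "x \<in> V.Rl" shows "vl_le W (modulus W (T x)) (T (modulus V x))"
proof (rule W.am_lub)
  show "vl_le W (T x) (T (modulus V x))" using V.le_am[OF assms] assms by (intro T_mono) auto
  have "vl_le W (T (\<ominus>\<^bsub>V\<^esub> x)) (T (modulus V x))" using V.neg_le_am[OF assms] assms by (intro T_mono) auto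
  thus "vl_le W (\<ominus>\<^bsub>W\<^esub> T x) (T (modulus V x))" using assms by (simp add: T_neg)
qed (use assms in auto)

lemma Rp_T: "x \<in> carrier V ==> W.Rp (T x) = T (V.Rp x)"
  using W.Rp_eq[of "T (V.Rp x)" "T (V.Ip x)"] arg_cong[OF V.Rp_Ip[of x], of T] by (simp add: T_simps)

lemma Ip_T: "x \<in> carrier V ==> W.Ip (T x) = T (V.Ip x)"
  using Rp_T[of "(- kI) \<odot>\<^bsub>V\<^esub> x"] by (simp add: V.Ip_def W.Ip_def T_smult)

text \<open>\<open>T\<close> commutes with real and imaginary parts, hence with rotations. So
  \<open>rotations_le\<close> applies with the modulus of \<open>T x\<close> as \<open>z\<close> and
  the image of the modulus of \<open>x\<close> as \<open>w\<close>.\<close>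

lemma am_T_le: assumes x: "x \<in> carrier V" shows "vl_le W (modulus W (T x)) (T (modulus V x))"
proof (cases rule: kI_cases[where 'k='k])
  case 1 thus ?thesis using am_T_le_real V.real_field_all_real x by blast
next
  case 2
  hence k0: "(kI::'k) \<noteq> 0" by auto
  show ?thesis
  proof (rule W.rotations_le[of "T (V.Rp x)" "T (V.Ip x)"])
    fix \<theta>
    show "vl_le W (modulus W (T x)) (modulus W (W.rs (cos \<theta>) (T (V.Rp x)) \<ominus>\<^bsub>W\<^esub> W.rs (sin \<theta>) (T (V.Ip x))) \<oplus>\<^bsub>W\<^esub>
      modulus W (W.rs (cos \<theta>) (T (V.Ip x)) \<oplus>\<^bsub>W\<^esub> W.rs (sin \<theta>) (T (V.Rp x))))"
      using W.am_rot_le[of "T x" \<theta>] 2 x by (simp add: Rp_T Ip_T)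
    have "vl_le W (T (V.rs (cos \<theta>) (V.Rp x) \<ominus>\<^bsub>V\<^esub> V.rs (sin \<theta>) (V.Ip x))) (T (modulus V x))"
      using V.Rp_rot_le[OF x k0] x by (intro T_mono) auto
    thus "vl_le W (W.rs (cos \<theta>) (T (V.Rp x)) \<ominus>\<^bsub>W\<^esub> W.rs (sin \<theta>) (T (V.Ip x))) (T (modulus V x))"
      using x by (simp add: T_simps)
  qed (use x in auto)
qed

text \<open>A real element is the difference of its two disjoint parts and its modulus is their sum.
  Over the complex numbers one inequality is \<open>am_T_le\<close>; for the other
  \<open>rotations_le\<close> is used with the two sides exchanged, the real case turning
  \<open>T |y|\<close> into \<open>|T y|\<close> for the real and imaginary parts of the
  rotations.\<close>

lemma vl_hom_if_disjoint:
  assumes dj: "\<And>a b. a \<in> pos_cone V ==> b \<in> pos_cone V ==> V.dj a b ==> W.dj (T a) (T b)"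
  shows "vl_hom V W T"
proof -
  have re: "modulus W (T x) = T (modulus V x)" if x: "x \<in> V.Rl" for x
  proof -
    obtain a b where ab: "a \<in> pos_cone V" "b \<in> pos_cone V" "V.dj a b" "x = a \<ominus>\<^bsub>V\<^esub> b"
      using V.dj_am_iff[OF x] by auto
    have "modulus V x = a \<oplus>\<^bsub>V\<^esub> b" using V.dj_am[OF ab(3,1,2)] ab(4) by simp
    moreover have "modulus W (T x) = T a \<oplus>\<^bsub>W\<^esub> T b" using W.dj_am[OF dj[OF ab(1-3)]] ab by (simp add: T_minus)
    ultimately show ?thesis using ab by (simp add: T_add)
  qed
  have "T (modulus V x) = modulus W (T x)" if x: "x \<in> carrier V" for x
  proof (cases rule: kI_cases[where 'k='k])
    case 1 thus ?thesis using re V.real_field_all_real x by simp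
  next
    case 2
    hence k0: "(kI::'k) \<noteq> 0" by auto
    have "vl_le W (T (modulus V x)) (modulus W (T x))"
    proof (rule W.rotations_le[of "T (V.Rp x)" "T (V.Ip x)"])
      fix \<theta>
      have "vl_le W (T (modulus V x)) (T (modulus V (V.rs (cos \<theta>) (V.Rp x) \<ominus>\<^bsub>V\<^esub> V.rs (sin \<theta>) (V.Ip x)) \<oplus>\<^bsub>V\<^esub>
        modulus V (V.rs (cos \<theta>) (V.Ip x) \<oplus>\<^bsub>V\<^esub> V.rs (sin \<theta>) (V.Rp x))))"
        using V.am_rot_le[OF x 2] x by (intro T_mono) auto
      thus "vl_le W (T (modulus V x)) (modulus W (W.rs (cos \<theta>) (T (V.Rp x)) \<ominus>\<^bsub>W\<^esub> W.rs (sin \<theta>) (T (V.Ip x))) \<oplus>\<^bsub>W\<^esub>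
        modulus W (W.rs (cos \<theta>) (T (V.Ip x)) \<oplus>\<^bsub>W\<^esub> W.rs (sin \<theta>) (T (V.Rp x))))"
        using x by (simp add: T_simps re[symmetric])
      show "vl_le W (W.rs (cos \<theta>) (T (V.Rp x)) \<ominus>\<^bsub>W\<^esub> W.rs (sin \<theta>) (T (V.Ip x))) (modulus W (T x))"
        using W.Rp_rot_le[of "T x" \<theta>] k0 x by (simp add: Rp_T Ip_T)
    qed (use x in auto)
    thus ?thesis using am_T_le[OF x] x by (intro W.le_antisym) auto
  qed
  thus ?thesis using lin by (simp add: vl_hom_def)
qed

end
end

text \<open>The inverse is positive as well, so \<open>am_T_le\<close> holds for both maps, and the
  two inequalities combine to equality of the moduli.\<close>

lemma vl_iso_if_cone_iso:
  assumes "archimedean_vector_lattice V" "archimedean_vector_lattice W" "linear_map V W T"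
    and bij: "bij_betw T (carrier V) (carrier W)"
    and pos: "\<And>x. x \<in> carrier V ==> T x \<in> pos_cone W \<longleftrightarrow> x \<in> pos_cone V"
  shows "vl_iso V W T"
proof -
  interpret T: avl_map V W T using assms by (intro avl_map.intro avl.intro avl_map_axioms.intro)
  define S where "S = inv_into (carrier V) T"
  have S: "S y \<in> carrier V" "T (S y) = y" if "y \<in> carrier W" for y
    using bij that unfolding S_def bij_betw_def by (auto intro: inv_into_into f_inv_into_f)
  have ST: "S (T x) = x" if "x \<in> carrier V" for x
    using bij that unfolding S_def bij_betw_def by simp
  have "linear_map W V S" unfolding linear_map_def
  proof (intro conjI ballI allI Pi_I)
    fix x y assume "x \<in> carrier W" "y \<in> carrier W"
    thus "S (x \<oplus>\<^bsub>W\<^esub> y) = S x \<oplus>\<^bsub>V\<^esub> S y" using S ST[of "S x \<oplus>\<^bsub>V\<^esub> S y"] by (simp add: T.T_add)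
  next
    fix \<alpha> x assume "x \<in> carrier W"
    thus "S (\<alpha> \<odot>\<^bsub>W\<^esub> x) = \<alpha> \<odot>\<^bsub>V\<^esub> S x" using S ST[of "\<alpha> \<odot>\<^bsub>V\<^esub> S x"] by (simp add: T.T_smult)
  qed (use S in auto)
  then interpret S: avl_map W V S using assms by (intro avl_map.intro avl.intro avl_map_axioms.intro)
  have Tp: "T \<in> pos_cone V \<rightarrow> pos_cone W" using pos T.V.CnD by blast
  have Sp: "S \<in> pos_cone W \<rightarrow> pos_cone V"
  proof
    fix x assume "x \<in> pos_cone W" thus "S x \<in> pos_cone V" using pos[of "S x"] S[of x] by simp
  qed
  have "T (modulus V x) = modulus W (T x)" if x: "x \<in> carrier V" for x
  proof -
    have "vl_le V (modulus V x) (S (modulus W (T x)))" using S.am_T_le[OF Sp, of "T x"] x ST by simp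
    from T.T_mono[OF Tp this] have "vl_le W (T (modulus V x)) (modulus W (T x))" using S x by simp
    thus ?thesis using T.am_T_le[OF Tp x] x by (intro T.W.le_antisym) auto
  qed
  thus ?thesis using assms bij by (simp add: vl_iso_def vl_hom_def)
qed

text \<open>The identity preserves the cone in both directions, so it preserves the modulus. This
  uniqueness makes the definite description in \<open>lattice_of_cone\<close> meaningful.\<close>

lemma attach_modulus_cong_am:
  assumes "archimedean_vector_lattice (attach_modulus V m)" "archimedean_vector_lattice (attach_modulus V n)"
    "pos_cone (attach_modulus V m) = pos_cone (attach_modulus V n)" "x \<in> carrier V"
  shows "m x = n x"
proof -
  have "vl_iso (attach_modulus V m) (attach_modulus V n) id"
    using assms by (intro vl_iso_if_cone_iso) (auto simp: linear_map_def)
  thus ?thesis using assms(4) by (auto simp: vl_iso_def vl_hom_def)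
qed

lemma lattice_of_cone_eq:
  assumes "archimedean_vector_lattice (attach_modulus V m)" "pos_cone (attach_modulus V m) = C"
    "m \<in> extensional (carrier V)"
  shows "lattice_of_cone V C = attach_modulus V m"
proof -
  have "(THE m. m \<in> extensional (carrier V) \<and> archimedean_vector_lattice (attach_modulus V m) \<and>
             pos_cone (attach_modulus V m) = C) = m"
    using assms attach_modulus_cong_am[of V _ m] by (intro the_equality) (auto intro: extensionalityI)
  thus ?thesis by (simp add: lattice_of_cone_def)
qed

section \<open>Constructing Archimedean vector lattices\<close>

lemma kmoduleI:
  fixes V :: "('k :: real_or_complex, 'a, 'm) module_scheme" (structure)
  assumes "\<zero> \<in> carrier V" "\<And>x y. x \<in> carrier V ==> y \<in> carrier V ==> x \<oplus> y \<in> carrier V"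
    "\<And>\<alpha> x. x \<in> carrier V ==> \<alpha> \<odot> x \<in> carrier V"
    "\<And>x y z. x \<in> carrier V ==> y \<in> carrier V ==> z \<in> carrier V ==> x \<oplus> y \<oplus> z = x \<oplus> (y \<oplus> z)"
    "\<And>x y. x \<in> carrier V ==> y \<in> carrier V ==> x \<oplus> y = y \<oplus> x"
    "\<And>x. x \<in> carrier V ==> \<zero> \<oplus> x = x" "\<And>x. x \<in> carrier V ==> (-1) \<odot> x \<oplus> x = \<zero>"
    "\<And>\<alpha> \<beta> x. x \<in> carrier V ==> (\<alpha> + \<beta>) \<odot> x = \<alpha> \<odot> x \<oplus> \<beta> \<odot> x"
    "\<And>\<alpha> x y. x \<in> carrier V ==> y \<in> carrier V ==> \<alpha> \<odot> (x \<oplus> y) = \<alpha> \<odot> x \<oplus> \<alpha> \<odot> y"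
    "\<And>\<alpha> \<beta> x. x \<in> carrier V ==> (\<alpha> * \<beta>) \<odot> x = \<alpha> \<odot> (\<beta> \<odot> x)"
    "\<And>x. x \<in> carrier V ==> 1 \<odot> x = x"
  shows "kmodule V"
proof -
  have "abelian_group V"
  proof (rule abelian_groupI)
    fix x assume "x \<in> carrier V"
    thus "\<exists>y\<in>carrier V. y \<oplus> x = \<zero>" using assms(3,7) by (intro bexI[of _ "(-1) \<odot> x"]) simp_all
  qed (fact assms)+
  thus ?thesis unfolding kmodule_def using assms by (intro moduleI cring_from_type_algebra) simp_all
qed

lemma kmodule_attach:
  assumes "kmodule V" shows "kmodule (attach_modulus V m)"
proof -
  interpret kmodule V by fact
  show ?thesis by (rule kmoduleI) (simp_all add: M.add.m_ac smult_add_left smult_r_distr smult_minus1 M.r_neg)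
qed

text \<open>The axioms are restated for an intended cone \<open>C\<close> onto which
  \<open>m\<close> retracts the space. \<open>gen\<close> implies the hull axiom, and
  \<open>tri\<close> and \<open>arch\<close> are the triangle and Archimedean axioms expressed as
  membership in \<open>C\<close>.\<close>

lemma archimedean_vector_lattice_attachI:
  fixes V :: "('k :: real_or_complex, 'a) module"
  assumes V: "kmodule V" and CV: "C \<subseteq> carrier V"
    and mC: "\<And>x. x \<in> carrier V ==> m x \<in> C" and m_id: "\<And>x. x \<in> C ==> m x = x"
    and Cadd: "\<And>x y. x \<in> C ==> y \<in> C ==> x \<oplus>\<^bsub>V\<^esub> y \<in> C"
    and m_smult: "\<And>\<alpha> x. x \<in> carrier V ==> m (\<alpha> \<odot>\<^bsub>V\<^esub> x) = of_real (norm \<alpha>) \<odot>\<^bsub>V\<^esub> m x"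
    and tri: "\<And>x y. x \<in> carrier V ==> y \<in> carrier V ==> m x \<oplus>\<^bsub>V\<^esub> m y \<ominus>\<^bsub>V\<^esub> m (x \<oplus>\<^bsub>V\<^esub> y) \<in> C"
    and gen: "\<And>x. x \<in> carrier V ==> \<exists>a\<in>C. \<exists>b\<in>C. \<exists>c\<in>C. \<exists>d\<in>C. x = (a \<ominus>\<^bsub>V\<^esub> b) \<oplus>\<^bsub>V\<^esub> kI \<odot>\<^bsub>V\<^esub> (c \<ominus>\<^bsub>V\<^esub> d)"
    and arch: "\<And>f g. f \<in> C ==> g \<in> C ==> (\<And>n::nat. g \<ominus>\<^bsub>V\<^esub> of_nat n \<odot>\<^bsub>V\<^esub> f \<in> C) ==> f = \<zero>\<^bsub>V\<^esub>"
    and m_zero: "\<And>x. x \<in> carrier V ==> m x = \<zero>\<^bsub>V\<^esub> ==> x = \<zero>\<^bsub>V\<^esub>"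
  shows "archimedean_vector_lattice (attach_modulus V m)" "pos_cone (attach_modulus V m) = C"
proof -
  interpret V: kmodule V by fact
  let ?W = "attach_modulus V m"
  interpret W: kmodule ?W by (rule kmodule_attach[OF V])
  have neg: "\<ominus>\<^bsub>?W\<^esub> x = \<ominus>\<^bsub>V\<^esub> x" if "x \<in> carrier V" for x
    using W.smult_minus1[of x] V.smult_minus1[of x] that by simp
  have minus: "x \<ominus>\<^bsub>?W\<^esub> y = x \<ominus>\<^bsub>V\<^esub> y" if "y \<in> carrier V" for x y
    using neg[OF that] by (simp add: a_minus_def)
  have C_iff: "x \<in> C \<longleftrightarrow> x \<in> carrier V \<and> m x = x" for x using CV mC m_id by (metis subsetD)
  have Cc: "x \<in> C ==> x \<in> carrier V" for x using CV by auto
  show "pos_cone ?W = C" unfolding pos_cone_def attach_modulus_simps using C_iff by blast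
  show "archimedean_vector_lattice ?W"
  proof (rule archimedean_vector_lattice.intro[OF W.module_axioms], unfold_locales)
    fix f assume "f \<in> carrier ?W"
    thus "modulus ?W f \<in> carrier ?W" "modulus ?W (modulus ?W f) = modulus ?W f" using mC m_id Cc by auto
    show "modulus ?W (\<alpha> \<odot>\<^bsub>?W\<^esub> f) = of_real (norm \<alpha>) \<odot>\<^bsub>?W\<^esub> modulus ?W f" for \<alpha> using m_smult \<open>f \<in> _\<close> by simp
  next
    fix f g assume "f \<in> carrier ?W" "g \<in> carrier ?W"
    hence fg: "f \<in> carrier V" "g \<in> carrier V" by auto
    have "m (m f \<oplus>\<^bsub>V\<^esub> m g) = m f \<oplus>\<^bsub>V\<^esub> m g" using fg mC Cadd m_id by simp
    thus "modulus ?W (modulus ?W (modulus ?W f \<oplus>\<^bsub>?W\<^esub> modulus ?W g) \<ominus>\<^bsub>?W\<^esub> modulus ?W (f \<oplus>\<^bsub>?W\<^esub> g))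
          = modulus ?W f \<oplus>\<^bsub>?W\<^esub> modulus ?W g \<ominus>\<^bsub>?W\<^esub> modulus ?W (f \<oplus>\<^bsub>?W\<^esub> g)"
      using fg mC Cc tri[OF fg] m_id by (simp add: minus)
  next
    show "linear_hull ?W (modulus ?W ` carrier ?W) = carrier ?W"
    proof (rule equalityI)
      show "linear_hull ?W (modulus ?W ` carrier ?W) \<subseteq> carrier ?W"
      proof
        fix x assume "x \<in> linear_hull ?W (modulus ?W ` carrier ?W)"
        then obtain B c where B: "B \<subseteq> m ` carrier V" and x: "x = (\<Oplus>\<^bsub>?W\<^esub>y\<in>B. c y \<odot>\<^bsub>V\<^esub> y)"
          unfolding linear_hull_def by auto
        have "y \<in> carrier V" if "y \<in> B" for y using B mC Cc that by auto
        hence "(\<lambda>y. c y \<odot>\<^bsub>V\<^esub> y) \<in> B \<rightarrow> carrier ?W" by auto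
        thus "x \<in> carrier ?W" unfolding x by (rule W.M.finsum_closed)
      qed
      show "carrier ?W \<subseteq> linear_hull ?W (modulus ?W ` carrier ?W)"
      proof
        fix x assume "x \<in> carrier ?W"
        then obtain a b c d where C: "a \<in> C" "b \<in> C" "c \<in> C" "d \<in> C"
          and x: "x = (a \<ominus>\<^bsub>V\<^esub> b) \<oplus>\<^bsub>V\<^esub> kI \<odot>\<^bsub>V\<^esub> (c \<ominus>\<^bsub>V\<^esub> d)" using gen[of x] by auto
        \<comment> \<open>The hull is formed from sums over sets, and \<open>a\<close>,
          \<open>b\<close>, \<open>c\<close>, \<open>d\<close> may coincide. The coefficient of
          \<open>y\<close> therefore adds up the contributions of all positions at which
          \<open>y\<close> occurs.\<close>
        define q :: "'a \<Rightarrow> 'k" where "q y = (if y = a then 1 else 0) - (if y = b then 1 else 0) + kI * ((if y = c then 1 else 0) - (if y = d then 1 else 0))" for y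
        have fin: "finite {a,b,c,d}" and sub: "{a,b,c,d} \<subseteq> carrier V" using C Cc by auto
        have "x = (\<Oplus>\<^bsub>?W\<^esub>y\<in>{a,b,c,d}. q y \<odot>\<^bsub>?W\<^esub> y)"
        proof (rule W.vec_eqI)
          show "x \<in> carrier ?W" using C Cc x by auto
          show "(\<Oplus>\<^bsub>?W\<^esub>y\<in>{a,b,c,d}. q y \<odot>\<^bsub>?W\<^esub> y) \<in> carrier ?W" using sub by (intro W.M.finsum_closed) auto
          fix \<phi> assume \<phi>: "\<phi> \<in> functionals ?W"
          hence \<phi>': "\<phi> \<in> functionals V" by (simp only: functionals_def attach_modulus_simps)
          have "\<phi> (\<Oplus>\<^bsub>?W\<^esub>y\<in>{a,b,c,d}. q y \<odot>\<^bsub>?W\<^esub> y) = (\<Sum>y\<in>{a,b,c,d}. \<phi> (q y \<odot>\<^bsub>?W\<^esub> y))" using \<phi> sub by (intro W.fun_sum) auto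
          also have "... = (\<Sum>y\<in>{a,b,c,d}. q y * \<phi> y)" using \<phi>' sub by (intro sum.cong) auto
          also have "... = (\<Sum>y\<in>{a,b,c,d}. (if y = a then \<phi> y else 0)) - (\<Sum>y\<in>{a,b,c,d}. (if y = b then \<phi> y else 0)) +
             kI * ((\<Sum>y\<in>{a,b,c,d}. (if y = c then \<phi> y else 0)) - (\<Sum>y\<in>{a,b,c,d}. (if y = d then \<phi> y else 0)))"
            unfolding sum_distrib_left sum_subtractf[symmetric] sum.distrib[symmetric]
            by (intro sum.cong) (auto simp: q_def algebra_simps)
          also have "... = \<phi> a - \<phi> b + kI * (\<phi> c - \<phi> d)" by (simp only: sum.delta[OF fin]) simp
          also have "... = \<phi> x" using \<phi>' C Cc x by simp
          finally show "\<phi> x = \<phi> (\<Oplus>\<^bsub>?W\<^esub>y\<in>{a,b,c,d}. q y \<odot>\<^bsub>?W\<^esub> y)" by simp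
        qed
        moreover have "{a,b,c,d} \<subseteq> modulus ?W ` carrier ?W"
        proof
          fix y assume "y \<in> {a,b,c,d}"
          hence "y \<in> C" using C by auto
          thus "y \<in> modulus ?W ` carrier ?W" using Cc m_id by (intro image_eqI[of _ _ y]) auto
        qed
        ultimately show "x \<in> linear_hull ?W (modulus ?W ` carrier ?W)" unfolding linear_hull_def using fin by blast
      qed
    qed
  next
    fix f g assume fg: "f \<in> carrier ?W" "g \<in> carrier ?W"
      and le: "\<And>n::nat. modulus ?W (modulus ?W g \<ominus>\<^bsub>?W\<^esub> of_nat n \<odot>\<^bsub>?W\<^esub> modulus ?W f) = modulus ?W g \<ominus>\<^bsub>?W\<^esub> of_nat n \<odot>\<^bsub>?W\<^esub> modulus ?W f"
    have "m f = \<zero>\<^bsub>V\<^esub>"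
    proof (rule arch[of "m f" "m g"])
      fix n :: nat
      show "m g \<ominus>\<^bsub>V\<^esub> of_nat n \<odot>\<^bsub>V\<^esub> m f \<in> C"
        using le[of n] fg mC Cc unfolding C_iff by (simp add: minus)
    qed (use fg mC in auto)
    thus "f = \<zero>\<^bsub>?W\<^esub>" using m_zero fg by simp
  qed
qed

section \<open>Sums over lists and over grids\<close>

text \<open>Sums over a product of lists run over index tuples, so that repeated entries count with
  multiplicity. The grid only records which tuples of entries occur, for the side conditions of such
  sums.\<close>

definition grid :: "nat set \<Rightarrow> (nat \<Rightarrow> 'c list) \<Rightarrow> (nat \<Rightarrow> 'c) set" where
  "grid I Xs = (\<Pi>\<^sub>E k\<in>I. set (Xs k))"

context kmodule
begin

definition lsum where "lsum xs = (\<Oplus>n\<in>{..<length xs}. xs ! n)"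

lemma lsum_cl [simp]: "set xs \<subseteq> Vc ==> lsum xs \<in> Vc"
  unfolding lsum_def by (intro M.finsum_closed) (auto simp: subset_eq)

lemma fun_lsum [simp]: "\<phi> \<in> functionals V ==> set xs \<subseteq> Vc ==> \<phi> (lsum xs) = sum_list (map \<phi> xs)"
  unfolding lsum_def by (subst fun_sum) (auto simp: subset_eq sum_list_sum_nth atLeast0LessThan intro!: sum.cong)

lemma lsum_Nil [simp]: "lsum [] = \<zero>" by (simp add: lsum_def)

lemma lsum_Cons: "x \<in> Vc ==> set xs \<subseteq> Vc ==> lsum (x # xs) = x \<oplus> lsum xs"
  by (rule vec_eqI) simp_all

lemma lsum_append: "set xs \<subseteq> Vc ==> set ys \<subseteq> Vc ==> lsum (xs @ ys) = lsum xs \<oplus> lsum ys"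
  by (rule vec_eqI) simp_all

lemma lsum_mset: "mset xs = mset ys ==> set xs \<subseteq> Vc ==> lsum xs = lsum ys"
proof (rule vec_eqI)
  assume a: "mset xs = mset ys" "set xs \<subseteq> Vc"
  hence ys: "set ys \<subseteq> Vc" using mset_eq_setD[OF a(1)] by simp
  thus "lsum xs \<in> Vc" "lsum ys \<in> Vc" using a by simp_all
  fix \<phi> assume "\<phi> \<in> functionals V"
  moreover have "sum_list (map \<phi> xs) = sum_list (map \<phi> ys)" using a(1) by (metis mset_map sum_mset_sum_list)
  ultimately show "\<phi> (lsum xs) = \<phi> (lsum ys)" using a ys by simp
qed

definition gsum :: "nat set \<Rightarrow> (nat \<Rightarrow> 'c list) \<Rightarrow> ((nat \<Rightarrow> 'c) \<Rightarrow> 'a) \<Rightarrow> 'a" where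
  "gsum I Xs g = (\<Oplus>n\<in>(\<Pi>\<^sub>E k\<in>I. {..<length (Xs k)}). g (\<lambda>k\<in>I. Xs k ! n k))"

lemma grid_nth: "n \<in> (\<Pi>\<^sub>E k\<in>I. {..<length (Xs k)}) ==> (\<lambda>k\<in>I. Xs k ! n k) \<in> grid I Xs"
  by (auto simp: grid_def PiE_def Pi_def)

lemma Pi_grid_nth:
  "g \<in> grid I Xs \<rightarrow> A ==> (\<lambda>n. g (\<lambda>k\<in>I. Xs k ! n k)) \<in> (\<Pi>\<^sub>E k\<in>I. {..<length (Xs k)}) \<rightarrow> A"
  by (rule Pi_I, erule Pi_mem) (rule grid_nth)

lemma gsum_cl [simp]: "g \<in> grid I Xs \<rightarrow> Vc ==> gsum I Xs g \<in> Vc"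
  unfolding gsum_def by (intro M.finsum_closed Pi_grid_nth)

lemma fun_gsum: "\<phi> \<in> functionals V ==> g \<in> grid I Xs \<rightarrow> Vc ==>
  \<phi> (gsum I Xs g) = (\<Sum>n\<in>(\<Pi>\<^sub>E k\<in>I. {..<length (Xs k)}). \<phi> (g (\<lambda>k\<in>I. Xs k ! n k)))"
  unfolding gsum_def by (intro fun_sum Pi_grid_nth)

lemma grid_upd: "k \<in> I ==> x \<in> set xs ==> grid I (Xs(k := [x])) \<subseteq> grid I (Xs(k := xs))"
  unfolding grid_def by (intro PiE_mono) auto

text \<open>Singles out one variable: everything about sums over several partitions is reduced to
  sums over one list, with the other lists fixed.\<close>

lemma gsum_sep:
  assumes k: "k \<in> I" and g: "g \<in> grid I (Xs(k := xs)) \<rightarrow> Vc"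
  shows "gsum I (Xs(k := xs)) g = lsum (map (\<lambda>x. gsum I (Xs(k := [x])) g) xs)"
proof (rule vec_eqI)
  have g': "g \<in> grid I (Xs(k := [x])) \<rightarrow> Vc" if "x \<in> set xs" for x using g grid_upd[OF k that] by blast
  show "gsum I (Xs(k := xs)) g \<in> Vc" using g by simp
  have sub: "set (map (\<lambda>x. gsum I (Xs(k := [x])) g) xs) \<subseteq> Vc" using g' by auto
  thus "lsum (map (\<lambda>x. gsum I (Xs(k := [x])) g) xs) \<in> Vc" by simp
  fix \<phi> assume \<phi>: "\<phi> \<in> functionals V"
  let ?A = "\<lambda>Xs. (\<Pi>\<^sub>E k\<in>I. {..<length ((Xs) k)})"
  let ?h = "\<lambda>Xs n. \<phi> (g (\<lambda>k\<in>I. (Xs k) ! n k))"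
  have "\<phi> (lsum (map (\<lambda>x. gsum I (Xs(k := [x])) g) xs)) = (\<Sum>i<length xs. \<phi> (gsum I (Xs(k := [xs ! i])) g))"
    using \<phi> sub by (simp add: sum_list_sum_nth atLeast0LessThan)
  also have "... = (\<Sum>i<length xs. \<Sum>n\<in>?A (Xs(k := [xs ! i])). ?h (Xs(k := [xs ! i])) n)"
    by (intro sum.cong[OF refl] fun_gsum \<phi> g' nth_mem) simp
  \<comment> \<open>The index set depends only on the length of the list at \<open>k\<close>, so an
    arbitrary entry may represent it.\<close>
  also have "... = (\<Sum>i<length xs. \<Sum>n\<in>?A (Xs(k := [undefined])). ?h (Xs(k := [xs ! i])) n)"
    by (intro sum.cong) (auto intro!: PiE_cong)
  also have "... = (\<Sum>(i, n)\<in>{..<length xs} \<times> ?A (Xs(k := [undefined])). ?h (Xs(k := [xs ! i])) n)"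
    by (simp add: sum.cartesian_product)
  also have "... = (\<Sum>n\<in>?A (Xs(k := xs)). ?h (Xs(k := xs)) n)"
  \<comment> \<open>An index tuple corresponds to its value at \<open>k\<close> and the tuple with
    that value reset to 0, the only index of a singleton list.\<close>
  proof (rule sum.reindex_bij_witness[where i = "\<lambda>n. (n k, n(k := 0))" and j = "\<lambda>(i, n). n(k := i)"])
    fix a assume "a \<in> {..<length xs} \<times> ?A (Xs(k := [undefined]))"
    then obtain i n where a: "a = (i, n)" "i < length xs" "n \<in> ?A (Xs(k := [undefined]))" by auto
    have n0: "n k = 0" using a(3) k by (auto simp: PiE_iff dest!: bspec[of _ _ k])
    show "(case a of (i, n) \<Rightarrow> n(k := i)) \<in> ?A (Xs(k := xs))" using a k by (auto simp: PiE_iff extensional_def)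
    show "((case a of (i, n) \<Rightarrow> n(k := i)) k, (case a of (i, n) \<Rightarrow> n(k := i))(k := 0)) = a" using a n0 by auto
    have "(\<lambda>j\<in>I. (Xs(k := xs)) j ! (n(k := i)) j) = (\<lambda>j\<in>I. (Xs(k := [xs ! i])) j ! n j)" using n0 by auto
    thus "?h (Xs(k := xs)) (case a of (i, n) \<Rightarrow> n(k := i)) = (case a of (i, n) \<Rightarrow> ?h (Xs(k := [xs ! i])) n)"
      using a by (simp only: prod.case)
  next
    fix n assume n: "n \<in> ?A (Xs(k := xs))"
    show "(case (n k, n(k := 0)) of (i, n) \<Rightarrow> n(k := i)) = n" by simp
    show "(n k, n(k := 0)) \<in> {..<length xs} \<times> ?A (Xs(k := [undefined]))"
      using n k by (auto simp: PiE_iff extensional_def dest: bspec[of _ _ k])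
  qed
  also have "... = \<phi> (gsum I (Xs(k := xs)) g)" using fun_gsum[OF \<phi> g] by simp
  finally show "\<phi> (gsum I (Xs(k := xs)) g) = \<phi> (lsum (map (\<lambda>x. gsum I (Xs(k := [x])) g) xs))" by simp
qed

lemma gsum_single: assumes "\<And>k. k \<in> I ==> Xs k = [x k]" "g (restrict x I) \<in> Vc" shows "gsum I Xs g = g (restrict x I)"
proof -
  have "(\<Pi>\<^sub>E k\<in>I. {..<length (Xs k)}) = (\<Pi>\<^sub>E k\<in>I. {0})" using assms by (intro PiE_cong) auto
  also have "... = {\<lambda>k\<in>I. 0}" by (auto simp: PiE_iff extensional_def fun_eq_iff)
  finally have "gsum I Xs g = g (\<lambda>k\<in>I. Xs k ! (\<lambda>k\<in>I. 0) k)" using assms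
    unfolding gsum_def by (simp add: restrict_def cong: if_cong)
  also have "(\<lambda>k\<in>I. Xs k ! (\<lambda>k\<in>I. 0) k) = restrict x I" using assms by auto
  finally show ?thesis .
qed

lemma gsum_cong: "(\<And>y. y \<in> grid I Xs ==> g y = h y) ==> h \<in> grid I Xs \<rightarrow> Vc ==> gsum I Xs g = gsum I Xs h"
  unfolding gsum_def by (intro M.finsum_cong') (auto intro: grid_nth)

lemma gsum_add: "g \<in> grid I Xs \<rightarrow> Vc ==> h \<in> grid I Xs \<rightarrow> Vc ==>
  gsum I Xs (\<lambda>y. g y \<oplus> h y) = gsum I Xs g \<oplus> gsum I Xs h"
  by (rule vec_eqI) (auto simp: fun_gsum Pi_iff sum.distrib[symmetric] grid_nth intro!: sum.cong)

lemma gsum_smult: "g \<in> grid I Xs \<rightarrow> Vc ==> gsum I Xs (\<lambda>y. \<alpha> \<odot> g y) = \<alpha> \<odot> gsum I Xs g"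
  by (rule vec_eqI) (auto simp: fun_gsum Pi_iff sum_distrib_left grid_nth intro!: sum.cong)

end

context avl
begin

lemma lsum_Cn [simp]: "set xs \<subseteq> Cn ==> lsum xs \<in> Cn"
  unfolding lsum_def by (intro Cn_sum) (auto simp: subset_eq)

lemma gsum_Cn: "g \<in> grid I Xs \<rightarrow> Cn ==> gsum I Xs g \<in> Cn"
  unfolding gsum_def by (intro Cn_sum Pi_grid_nth)

lemma gsum_mono: "g \<in> grid I Xs \<rightarrow> Vc ==> h \<in> grid I Xs \<rightarrow> Vc ==> (\<And>y. y \<in> grid I Xs ==> g y \<preceq> h y) ==> gsum I Xs g \<preceq> gsum I Xs h"
  unfolding gsum_def by (intro le_sum Pi_grid_nth) (auto intro: grid_nth)

lemma Cn_subset: "xs \<subseteq> Cn ==> xs \<subseteq> Vc" by (auto intro: CnD)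

section \<open>Partitions and the Riesz refinement property\<close>

lemma pos_partitions_iff: "xs \<in> pos_partitions V a \<longleftrightarrow> set xs \<subseteq> Cn \<and> lsum xs = a"
  by (simp add: pos_partitions_def lsum_def)

lemma pos_partitions_single [simp]: "a \<in> Cn ==> [a] \<in> pos_partitions V a"
  by (simp add: pos_partitions_iff lsum_Cons)

text \<open>The Riesz decomposition is applied to one entry of \<open>ys\<close> after the other:
  \<open>us\<close> is the part taken by \<open>x\<close>, and \<open>vs\<close> is what
  remains.\<close>

lemma list_decomposition:
  "x \<in> Cn ==> set ys \<subseteq> Cn ==> x \<preceq> lsum ys ==>
   \<exists>us vs. length us = length vs \<and> set us \<subseteq> Cn \<and> set vs \<subseteq> Cn \<and> lsum us = x \<and>
     ys = map2 (\<lambda>u v. u \<oplus> v) us vs"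
proof (induction ys arbitrary: x)
  case Nil
  hence "x = \<zero>" using le_zero by simp
  thus ?case by (intro exI[of _ "[]"]) simp
next
  case (Cons y ys)
  hence C: "y \<in> Cn" "set ys \<subseteq> Cn" by auto
  hence "x \<preceq> y \<oplus> lsum ys" using Cons by (simp add: lsum_Cons Cn_subset)
  then obtain x1 x2 where x: "x1 \<in> Cn" "x2 \<in> Cn" "x = x1 \<oplus> x2" "x1 \<preceq> y" "x2 \<preceq> lsum ys"
    using riesz_decomposition[of x y "lsum ys"] Cons C by auto
  obtain us vs where uv: "length us = length vs" "set us \<subseteq> Cn" "set vs \<subseteq> Cn" "lsum us = x2"
    "ys = map2 (\<lambda>u v. u \<oplus> v) us vs" using Cons.IH[OF x(2) C(2) x(5)] by blast
  have y: "y \<ominus> x1 \<in> Cn" "x1 \<oplus> (y \<ominus> x1) = y" using leD[OF x(4)] x C by (auto intro!: vec_eqI)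
  have "lsum (x1 # us) = x" using x uv by (simp add: lsum_Cons Cn_subset)
  moreover have "y # ys = map2 (\<lambda>u v. u \<oplus> v) (x1 # us) ((y \<ominus> x1) # vs)" using y uv by simp
  ultimately show ?case using x uv y
    by (intro exI[of _ "x1 # us"] exI[of _ "(y \<ominus> x1) # vs"]) simp
qed

lemma sum_list_map2_fun:
  "length us = length vs ==> set us \<subseteq> Vc ==> set vs \<subseteq> Vc ==> \<phi> \<in> functionals V ==>
   sum_list (map \<phi> (map2 (\<lambda>u v. u \<oplus> v) us vs)) = sum_list (map \<phi> us) + sum_list (map \<phi> vs)"
  by (induction us vs rule: list_induct2) auto

lemma map2_cl: "length us = length vs ==> set us \<subseteq> Vc ==> set vs \<subseteq> Vc ==> set (map2 (\<lambda>u v. u \<oplus> v) us vs) \<subseteq> Vc"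
  by (induction us vs rule: list_induct2) auto

lemma lsum_map2:
  "length us = length vs ==> set us \<subseteq> Vc ==> set vs \<subseteq> Vc ==> lsum (map2 (\<lambda>u v. u \<oplus> v) us vs) = lsum us \<oplus> lsum vs"
  using map2_cl by (intro vec_eqI) (simp_all add: sum_list_map2_fun del: map_map)

lemma split_partition:
  assumes "xs \<in> pos_partitions V (b \<oplus> c)" "b \<in> Cn" "c \<in> Cn"
  shows "\<exists>us\<in>pos_partitions V b. \<exists>vs\<in>pos_partitions V c. length us = length vs \<and> xs = map2 (\<lambda>u v. u \<oplus> v) us vs"
proof -
  have xs: "set xs \<subseteq> Cn" "lsum xs = b \<oplus> c" using assms(1) by (auto simp: pos_partitions_iff)
  obtain us vs where uv: "length us = length vs" "set us \<subseteq> Cn" "set vs \<subseteq> Cn" "lsum us = b"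
    "xs = map2 (\<lambda>u v. u \<oplus> v) us vs" using list_decomposition[OF assms(2) xs(1)] xs(2) assms by (metis CnD le_addr)
  have "b \<oplus> lsum vs = b \<oplus> c" using lsum_map2[of us vs] uv xs(2) by (simp add: Cn_subset)
  hence "lsum vs = c" using assms uv by (simp add: Cn_subset)
  hence "us \<in> pos_partitions V b" "vs \<in> pos_partitions V c" using uv by (auto simp only: pos_partitions_iff)
  thus ?thesis using uv(1,5) by (rule_tac bexI[of _ us], rule_tac bexI[of _ vs]) simp_all
qed

text \<open>Multisets instead of lists, because a common refinement of two partitions lists its
  pieces in different orders for the two. The sums considered do not depend on the order.\<close>

definition finer where
  "finer xs zs \<longleftrightarrow> (\<exists>zss. list_all2 (\<lambda>x l. l \<in> pos_partitions V x) xs zss \<and> mset zs = mset (concat zss))"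

lemma finer_refl: assumes "set xs \<subseteq> Cn" shows "finer xs xs"
proof -
  have "list_all2 (\<lambda>x l. l \<in> pos_partitions V x) xs (map (\<lambda>x. [x]) xs)"
    using assms by (auto simp: list_all2_conv_all_nth subset_eq)
  moreover have "mset xs = mset (concat (map (\<lambda>x. [x]) xs))" by (induction xs) auto
  ultimately show ?thesis unfolding finer_def by blast
qed

lemma concat_partition:
  "list_all2 (\<lambda>x l. l \<in> pos_partitions V x) xs zss ==> set (concat zss) \<subseteq> Cn \<and> lsum (concat zss) = lsum xs \<and> set xs \<subseteq> Cn"
proof (induction rule: list_all2_induct)
  case (Cons x xs l zss)
  hence l: "set l \<subseteq> Cn" "lsum l = x" by (auto simp: pos_partitions_iff)
  hence "x \<in> Cn" by auto
  thus ?case using Cons l by (simp add: lsum_Cons lsum_append Cn_subset)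
qed simp

lemma finer_partition: assumes "finer xs zs" "xs \<in> pos_partitions V a" shows "zs \<in> pos_partitions V a"
proof -
  obtain zss where z: "list_all2 (\<lambda>x l. l \<in> pos_partitions V x) xs zss" "mset zs = mset (concat zss)"
    using assms unfolding finer_def by auto
  from concat_partition[OF z(1)] have "set zs \<subseteq> Cn" using mset_eq_setD[OF z(2)] by auto
  thus ?thesis using concat_partition[OF z(1)] lsum_mset[OF z(2)] assms(2)
    by (simp add: pos_partitions_iff Cn_subset)
qed

lemma lsum_zero: "set ys \<subseteq> Cn ==> lsum ys = \<zero> ==> list_all2 (\<lambda>x l. l \<in> pos_partitions V x) ys (map (\<lambda>_. []) ys)"
proof (induction ys)
  case (Cons y ys)
  hence C: "y \<in> Cn" "lsum ys \<in> Cn" "y \<oplus> lsum ys = \<zero>" by (auto simp: lsum_Cons Cn_subset)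
  hence "y \<preceq> \<zero>" "lsum ys \<preceq> \<zero>" using le_addr[of y "lsum ys"] le_addl[of "lsum ys" y] by auto
  hence "y = \<zero>" "lsum ys = \<zero>" using C le_zero by auto
  thus ?case using Cons by (simp add: pos_partitions_iff)
qed simp

text \<open>The first entry \<open>x\<close> is distributed over the entries of \<open>ys\<close>.
  What is left of \<open>ys\<close> has the same sum as the remaining \<open>xs\<close>, so the
  induction hypothesis refines these two, and the pieces of \<open>x\<close> are added in
  front.\<close>

lemma common_finer_aux:
  "set xs \<subseteq> Cn ==> set ys \<subseteq> Cn ==> lsum xs = lsum ys ==> \<exists>zs. finer xs zs \<and> finer ys zs"
proof (induction xs arbitrary: ys)
  case Nil
  have "finer ys []" unfolding finer_def
    using lsum_zero[of ys] Nil by (intro exI[of _ "map (\<lambda>_. []) ys"]) auto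
  moreover have "finer [] []" using finer_refl[of "[]"] by simp
  ultimately show ?case by blast
next
  case (Cons x xs)
  hence C: "x \<in> Cn" "set xs \<subseteq> Cn" by auto
  have e: "x \<oplus> lsum xs = lsum ys" using Cons C by (simp add: lsum_Cons Cn_subset)
  have le: "x \<preceq> lsum ys" unfolding e[symmetric] using C by simp
  then obtain us vs where uv: "length us = length vs" "set us \<subseteq> Cn" "set vs \<subseteq> Cn" "lsum us = x"
    "ys = map2 (\<lambda>u v. u \<oplus> v) us vs" using list_decomposition[OF C(1) Cons.prems(2) le] by blast
  have "x \<oplus> lsum xs = x \<oplus> lsum vs" using lsum_map2[of us vs] uv e by (simp add: Cn_subset)
  hence "lsum xs = lsum vs" using C uv by (simp add: Cn_subset)
  then obtain zs where z: "finer xs zs" "finer vs zs" using Cons.IH[of vs] C uv by auto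
  obtain zss where zss: "list_all2 (\<lambda>x l. l \<in> pos_partitions V x) xs zss" "mset zs = mset (concat zss)"
    using z(1) unfolding finer_def by auto
  obtain wss where wss: "list_all2 (\<lambda>x l. l \<in> pos_partitions V x) vs wss" "mset zs = mset (concat wss)"
    using z(2) unfolding finer_def by auto
  have "finer (x # xs) (us @ zs)" unfolding finer_def
    using zss uv by (intro exI[of _ "us # zss"]) (auto simp: pos_partitions_iff)
  \<comment> \<open>The block of an entry of \<open>ys\<close> consists of its share in
    \<open>x\<close> followed by the pieces of what was left of it.\<close>
  moreover have "finer ys (us @ zs)" unfolding finer_def
  proof (intro exI[of _ "map2 (\<lambda>u l. u # l) us wss"] conjI)
    have l: "length wss = length vs" using wss(1) by (simp add: list_all2_lengthD)
    show "list_all2 (\<lambda>x l. l \<in> pos_partitions V x) ys (map2 (\<lambda>u l. u # l) us wss)"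
      unfolding list_all2_conv_all_nth
    proof (intro conjI allI impI)
      have ly: "length ys = length vs" using uv by simp
      show "length ys = length (map2 (\<lambda>u l. u # l) us wss)" using l ly uv(1) by simp
      fix i assume "i < length ys"
      hence i: "i < length vs" using ly by simp
      have w: "wss ! i \<in> pos_partitions V (vs ! i)" using wss(1) i by (simp add: list_all2_conv_all_nth)
      have u: "us ! i \<in> Cn" using uv(1,2) i by (auto simp: subset_eq)
      have y: "ys ! i = us ! i \<oplus> vs ! i" using uv(1) i by (subst uv(5)) simp
      show "map2 (\<lambda>u l. u # l) us wss ! i \<in> pos_partitions V (ys ! i)"
        using w u y i l uv(1) by (simp add: pos_partitions_iff lsum_Cons Cn_subset)
    qed
    have "length us = length wss" using l uv by simp
    hence "mset (concat (map2 (\<lambda>u l. u # l) us wss)) = mset us + mset (concat wss)"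
      by (induction us wss rule: list_induct2) auto
    thus "mset (us @ zs) = mset (concat (map2 (\<lambda>u l. u # l) us wss))" using wss(2) by simp
  qed
  ultimately show ?case by blast
qed

lemma common_finer:
  assumes "xs \<in> pos_partitions V a" "ys \<in> pos_partitions V a"
  obtains zs where "zs \<in> pos_partitions V a" "finer xs zs" "finer ys zs"
  using common_finer_aux[of xs ys] assms finer_partition by (auto simp: pos_partitions_iff)

end

locale cone_fun = V: avl V + W: avl W
  for V :: "('k :: real_or_complex, 'a) vlattice" and W :: "('k, 'b) vlattice" +
  fixes g :: "'a \<Rightarrow> 'b"
  assumes g_Cn [simp]: "x \<in> pos_cone V ==> g x \<in> pos_cone W"
    and g_zero: "g \<zero>\<^bsub>V\<^esub> = \<zero>\<^bsub>W\<^esub>"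

text \<open>Subadditivity bounds the value at an entry by the sum over the block that refines it.
  The vanishing of \<open>g\<close> at 0 covers empty blocks.\<close>

lemma (in cone_fun) lsum_subadditive:
  assumes sub: "\<And>x y. x \<in> pos_cone V ==> y \<in> pos_cone V ==> vl_le W (g (x \<oplus>\<^bsub>V\<^esub> y)) (g x \<oplus>\<^bsub>W\<^esub> g y)"
    and f: "V.finer xs zs"
  shows "vl_le W (W.lsum (map g xs)) (W.lsum (map g zs))"
proof -
  have gs: "set (map g l) \<subseteq> carrier W" if "set l \<subseteq> pos_cone V" for l using that by auto
  have 1: "vl_le W (g (V.lsum zs)) (W.lsum (map g zs))" if "set zs \<subseteq> pos_cone V" for zs
    using that
  proof (induction zs)
    case (Cons z zs)
    hence z: "z \<in> pos_cone V" "set zs \<subseteq> pos_cone V" by auto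
    have "vl_le W (g z \<oplus>\<^bsub>W\<^esub> g (V.lsum zs)) (g z \<oplus>\<^bsub>W\<^esub> W.lsum (map g zs))"
      using Cons z gs by (intro W.le_add) auto
    hence "vl_le W (g (z \<oplus>\<^bsub>V\<^esub> V.lsum zs)) (g z \<oplus>\<^bsub>W\<^esub> W.lsum (map g zs))"
      using W.le_trans[OF sub[of z "V.lsum zs"]] z gs by simp
    thus ?case using z gs[of zs] by (simp add: V.lsum_Cons W.lsum_Cons V.Cn_subset)
  qed (simp add: g_zero)
  obtain zss where z: "list_all2 (\<lambda>x l. l \<in> pos_partitions V x) xs zss" "mset zs = mset (concat zss)"
    using f unfolding V.finer_def by auto
  have "vl_le W (W.lsum (map g xs)) (W.lsum (map g (concat zss)))" using z(1)
  proof (induction rule: list_all2_induct)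
    case (Cons x xs l zss)
    have l: "set l \<subseteq> pos_cone V" "V.lsum l = x" using Cons(1) by (auto simp: V.pos_partitions_iff)
    have c: "set (concat zss) \<subseteq> pos_cone V" "set xs \<subseteq> pos_cone V" using V.concat_partition[OF Cons(2)] by auto
    have x: "g x \<in> carrier W" using V.lsum_Cn[OF l(1)] unfolding l(2) by simp
    have le: "vl_le W (g x) (W.lsum (map g l))" using 1[OF l(1)] unfolding l(2) .
    note cl = x W.lsum_cl[OF gs[OF l(1)]] W.lsum_cl[OF gs[OF c(1)]] W.lsum_cl[OF gs[OF c(2)]]
    have "vl_le W (g x \<oplus>\<^bsub>W\<^esub> W.lsum (map g xs)) (W.lsum (map g l) \<oplus>\<^bsub>W\<^esub> W.lsum (map g (concat zss)))"
      by (rule W.le_add[OF le Cons(3) cl(1,2,4,3)])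
    moreover have "W.lsum (map g (x # xs)) = g x \<oplus>\<^bsub>W\<^esub> W.lsum (map g xs)"
      using W.lsum_Cons[OF x gs[OF c(2)]] by simp
    moreover have "W.lsum (map g (concat (l # zss))) = W.lsum (map g l) \<oplus>\<^bsub>W\<^esub> W.lsum (map g (concat zss))"
      using W.lsum_append[OF gs[OF l(1)] gs[OF c(1)]] by simp
    ultimately show ?case by simp
  qed simp
  moreover have "set zs \<subseteq> pos_cone V" using V.concat_partition[OF z(1)] mset_eq_setD[OF z(2)] by auto
  hence "W.lsum (map g zs) = W.lsum (map g (concat zss))"
    using z(2) by (intro W.lsum_mset gs) auto
  ultimately show ?thesis by simp
qed

lemma (in cone_fun) lsum_additive:
  assumes add: "\<And>x y. x \<in> pos_cone V ==> y \<in> pos_cone V ==> g (x \<oplus>\<^bsub>V\<^esub> y) = g x \<oplus>\<^bsub>W\<^esub> g y"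
    and "set zs \<subseteq> pos_cone V"
  shows "g (V.lsum zs) = W.lsum (map g zs)"
  using assms(2)
proof (induction zs)
  case (Cons z zs)
  hence z: "z \<in> pos_cone V" "set zs \<subseteq> pos_cone V" by auto
  hence "set (map g zs) \<subseteq> carrier W" by auto
  thus ?case using Cons z by (simp add: add V.lsum_Cons W.lsum_Cons V.Cn_subset)
qed (simp add: g_zero)

section \<open>Suprema in a Dedekind complete lattice\<close>

context avl
begin

lemma is_cone_sup_iff:
  "is_cone_sup V A u \<longleftrightarrow> A \<subseteq> Cn \<and> u \<in> Cn \<and> (\<forall>a\<in>A. a \<preceq> u) \<and> (\<forall>w\<in>Cn. (\<forall>a\<in>A. a \<preceq> w) \<longrightarrow> u \<preceq> w)"
  unfolding is_cone_sup_def cone_order_def least_def Upper_def by (simp add: subset_iff) blast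

definition bdd where "bdd A \<longleftrightarrow> A \<subseteq> Cn \<and> A \<noteq> {} \<and> (\<exists>b\<in>Cn. \<forall>a\<in>A. a \<preceq> b)"

definition csup where "csup A = (SOME u. is_cone_sup V A u)"

lemma order_bounded_Cn: "A \<subseteq> Cn ==> order_bounded V A \<longleftrightarrow> (\<exists>b\<in>Cn. \<forall>a\<in>A. a \<preceq> b)"
  unfolding order_bounded_def using Cn_am by (auto simp: subset_eq)

end

locale dc_avl = avl +
  assumes dc: "dedekind_complete V"
begin

lemma csup: assumes "bdd A" shows "is_cone_sup V A (csup A)"
proof -
  have "\<exists>u. is_cone_sup V A u" using dc assms order_bounded_Cn[of A]
    unfolding dedekind_complete_def bdd_def by blast
  thus ?thesis unfolding csup_def by (rule someI_ex)
qed

lemma csup_Cn [simp]: "bdd A ==> csup A \<in> Cn"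
  and csup_upper: "bdd A ==> a \<in> A ==> a \<preceq> csup A"
  and csup_least: "bdd A ==> w \<in> Cn ==> (\<And>a. a \<in> A ==> a \<preceq> w) ==> csup A \<preceq> w"
  using csup[of A] unfolding is_cone_sup_iff by auto

lemma bddI: "A \<subseteq> Cn ==> A \<noteq> {} ==> b \<in> Cn ==> (\<And>a. a \<in> A ==> a \<preceq> b) ==> bdd A" unfolding bdd_def by blast

lemma bddD: "bdd A ==> a \<in> A ==> a \<in> Cn" unfolding bdd_def by auto

text \<open>The bound is moved to the other side twice, first for a fixed element of
  \<open>A\<close> and then for the supremum of \<open>B\<close>. Suprema are relative to the cone,
  so each translated bound must be positive; it is, because it lies above a member of the other
  set.\<close>

lemma csup_add_le:
  assumes A: "bdd A" and B: "bdd B" and c: "c \<in> Cn" and le: "\<And>a b. a \<in> A ==> b \<in> B ==> a \<oplus> b \<preceq> c"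
  shows "csup A \<oplus> csup B \<preceq> c"
proof -
  note cl = CnD[OF c] CnD[OF csup_Cn[OF A]] CnD[OF csup_Cn[OF B]]
  have aB: "a \<oplus> csup B \<preceq> c" if a: "a \<in> A" for a
  proof -
    have aC: "a \<in> Cn" using A a by (rule bddD)
    have b: "b \<preceq> c \<ominus> a" if "b \<in> B" for b
      using leD[OF le[OF a that]] bddD[OF B that] aC c by (intro le_by[of "c \<ominus> (a \<oplus> b)"]) auto
    obtain b where bB: "b \<in> B" using B by (auto simp: bdd_def)
    have "c \<ominus> a \<in> Cn" by (rule Cn_le[OF bddD[OF B bB] b[OF bB]]) (use aC c in simp)
    hence "csup B \<preceq> c \<ominus> a" using B b by (intro csup_least)
    from leD[OF this] show ?thesis using aC cl by (intro le_by[of "c \<ominus> a \<ominus> csup B"]) auto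
  qed
  have a: "a \<preceq> c \<ominus> csup B" if "a \<in> A" for a
    using leD[OF aB[OF that]] bddD[OF A that] cl by (intro le_by[of "c \<ominus> (a \<oplus> csup B)"]) auto
  obtain a where aA: "a \<in> A" using A by (auto simp: bdd_def)
  have "c \<ominus> csup B \<in> Cn" by (rule Cn_le[OF bddD[OF A aA] a[OF aA]]) (use cl in simp)
  hence "csup A \<preceq> c \<ominus> csup B" using A a by (intro csup_least)
  from leD[OF this] show ?thesis using cl by (intro le_by[of "c \<ominus> csup B \<ominus> csup A"]) auto
qed

end

section \<open>Multiadditive functions on cones and their variation\<close>

locale avl_family = F: dc_avl F
  for s :: nat and E :: "nat \<Rightarrow> ('k :: real_or_complex, 'a) vlattice" and F :: "('k, 'f) vlattice" +
  assumes avE: "k \<in> {1..s} ==> archimedean_vector_lattice (E k)"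
begin

definition I where "I = {1..s}"

lemma finite_I [simp]: "finite I" by (simp add: I_def)

abbreviation Tu where "Tu \<equiv> tuples s E"
abbreviation PTu where "PTu \<equiv> pos_tuples s E"

lemma avlE: "k \<in> I ==> avl (E k)" using avE unfolding I_def by (rule avl.intro)

lemma PTu_iff: "a \<in> PTu \<longleftrightarrow> (\<forall>k\<in>I. a k \<in> pos_cone (E k)) \<and> a \<in> extensional I"
  and Tu_iff: "a \<in> Tu \<longleftrightarrow> (\<forall>k\<in>I. a k \<in> carrier (E k)) \<and> a \<in> extensional I"
  unfolding pos_tuples_def tuples_def I_def PiE_iff by simp_all

lemma PTu_Tu: "a \<in> PTu ==> a \<in> Tu"
  unfolding PTu_iff Tu_iff pos_cone_def by auto

lemma PTu_upd: "a \<in> PTu ==> k \<in> I ==> x \<in> pos_cone (E k) ==> a(k := x) \<in> PTu"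
  and Tu_upd: "a \<in> Tu ==> k \<in> I ==> x \<in> carrier (E k) ==> a(k := x) \<in> Tu"
  unfolding PTu_iff Tu_iff by (auto simp: extensional_def)

lemma PTuD: "a \<in> PTu ==> k \<in> I ==> a k \<in> pos_cone (E k)" by (simp add: PTu_iff)

text \<open>The properties of \<open>\<lambda>a. modulus F (T a)\<close> on positive tuples, for a
  multilinear \<open>T\<close>. The value 0 at tuples with a zero entry is needed because 0 has the
  empty partition.\<close>

definition subadd where
  "subadd g \<longleftrightarrow> (\<forall>a\<in>PTu. g a \<in> pos_cone F) \<and> (\<forall>a\<in>PTu. \<forall>k\<in>I. g (a(k := \<zero>\<^bsub>E k\<^esub>)) = \<zero>\<^bsub>F\<^esub>) \<and>
    (\<forall>a\<in>PTu. \<forall>k\<in>I. \<forall>x\<in>pos_cone (E k). \<forall>y\<in>pos_cone (E k).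
       vl_le F (g (a(k := x \<oplus>\<^bsub>E k\<^esub> y))) (g (a(k := x)) \<oplus>\<^bsub>F\<^esub> g (a(k := y))))"

definition multiadd where
  "multiadd g \<longleftrightarrow> (\<forall>a\<in>PTu. g a \<in> pos_cone F) \<and>
    (\<forall>a\<in>PTu. \<forall>k\<in>I. \<forall>x\<in>pos_cone (E k). \<forall>y\<in>pos_cone (E k).
       g (a(k := x \<oplus>\<^bsub>E k\<^esub> y)) = g (a(k := x)) \<oplus>\<^bsub>F\<^esub> g (a(k := y)))"

lemma multiadd_zero: assumes "multiadd g" "a \<in> PTu" "k \<in> I" shows "g (a(k := \<zero>\<^bsub>E k\<^esub>)) = \<zero>\<^bsub>F\<^esub>"
proof -
  interpret E: avl "E k" using avlE[OF assms(3)] .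
  have z: "a(k := \<zero>\<^bsub>E k\<^esub>) \<in> PTu" using assms by (intro PTu_upd) auto
  have "g (a(k := \<zero>\<^bsub>E k\<^esub> \<oplus>\<^bsub>E k\<^esub> \<zero>\<^bsub>E k\<^esub>)) = g (a(k := \<zero>\<^bsub>E k\<^esub>)) \<oplus>\<^bsub>F\<^esub> g (a(k := \<zero>\<^bsub>E k\<^esub>))"
    using assms E.Cn_zero unfolding multiadd_def by blast
  hence e: "g (a(k := \<zero>\<^bsub>E k\<^esub>)) = g (a(k := \<zero>\<^bsub>E k\<^esub>)) \<oplus>\<^bsub>F\<^esub> g (a(k := \<zero>\<^bsub>E k\<^esub>))" by simp
  have c: "g (a(k := \<zero>\<^bsub>E k\<^esub>)) \<in> carrier F" using assms(1) z unfolding multiadd_def by auto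
  show ?thesis
  proof (rule F.vec_eqI)
    fix \<phi> assume "\<phi> \<in> functionals F"
    thus "\<phi> (g (a(k := \<zero>\<^bsub>E k\<^esub>))) = \<phi> \<zero>\<^bsub>F\<^esub>" using arg_cong[OF e, of \<phi>] c by simp
  qed (use c in auto)
qed

lemma multiadd_subadd: assumes "multiadd g" shows "subadd g"
proof -
  have "vl_le F (g (a(k := x \<oplus>\<^bsub>E k\<^esub> y))) (g (a(k := x)) \<oplus>\<^bsub>F\<^esub> g (a(k := y)))"
    if "a \<in> PTu" "k \<in> I" "x \<in> pos_cone (E k)" "y \<in> pos_cone (E k)" for a k x y
  proof -
    have "g (a(k := x)) \<in> pos_cone F" "g (a(k := y)) \<in> pos_cone F"
      using assms PTu_upd that unfolding multiadd_def by auto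
    thus ?thesis using assms that unfolding multiadd_def by simp
  qed
  thus ?thesis using assms multiadd_zero[OF assms] unfolding subadd_def multiadd_def by blast
qed

section \<open>Variation sums and their behaviour under refinement\<close>

definition good where "good Xs \<longleftrightarrow> (\<forall>k\<in>I. set (Xs k) \<subseteq> pos_cone (E k))"

definition parts where "parts a = {Xs. \<forall>k\<in>I. Xs k \<in> pos_partitions (E k) (a k)}"

lemma partsD: "Xs \<in> parts a ==> k \<in> I ==> Xs k \<in> pos_partitions (E k) (a k)"
  unfolding parts_def by blast

lemma parts_good: "Xs \<in> parts a ==> good Xs"
  using avl.pos_partitions_iff[OF avlE] unfolding parts_def good_def by blast

lemma good_upd: "good Xs ==> k \<in> I ==> set xs \<subseteq> pos_cone (E k) ==> good (Xs(k := xs))"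
  unfolding good_def by auto

lemma grid_PTu: "good Xs ==> grid I Xs \<subseteq> PTu"
  unfolding grid_def good_def pos_tuples_def I_def[symmetric] by (intro PiE_mono) auto

lemma gsum_cong_I: "(\<And>k. k \<in> I ==> Xs k = Ys k) ==> F.gsum I Xs g = F.gsum I Ys g"
  unfolding F.gsum_def
proof -
  assume e: "\<And>k. k \<in> I ==> Xs k = Ys k"
  have "(\<Pi>\<^sub>E k\<in>I. {..<length (Xs k)}) = (\<Pi>\<^sub>E k\<in>I. {..<length (Ys k)})" using e by (intro PiE_cong) auto
  moreover have "(\<lambda>k\<in>I. Xs k ! n k) = (\<lambda>k\<in>I. Ys k ! n k)" for n using e by auto
  ultimately show "(\<Oplus>\<^bsub>F\<^esub>n\<in>(\<Pi>\<^sub>E k\<in>I. {..<length (Xs k)}). g (\<lambda>k\<in>I. Xs k ! n k)) =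
    (\<Oplus>\<^bsub>F\<^esub>n\<in>(\<Pi>\<^sub>E k\<in>I. {..<length (Ys k)}). g (\<lambda>k\<in>I. Ys k ! n k))" by simp
qed

text \<open>Moves the entry of variable \<open>k\<close> from the list into the summand. Sums for
  different entries then run over the same grid and can be compared term by term.\<close>

lemma gsum_single_upd:
  assumes k: "k \<in> I" and cl: "\<And>y. y \<in> grid I (Xs(k := [z])) ==> g (y(k := x)) \<in> carrier F"
  shows "F.gsum I (Xs(k := [x])) g = F.gsum I (Xs(k := [z])) (\<lambda>y. g (y(k := x)))"
proof -
  let ?A = "(\<Pi>\<^sub>E j\<in>I. {..<length ((Xs(k := [z])) j)})"
  have A: "(\<Pi>\<^sub>E j\<in>I. {..<length ((Xs(k := [x])) j)}) = ?A" by (intro PiE_cong) auto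
  show ?thesis unfolding F.gsum_def A
  proof (rule F.M.finsum_cong')
    show "(\<lambda>n. g ((\<lambda>j\<in>I. (Xs(k := [z])) j ! n j)(k := x))) \<in> ?A \<rightarrow> carrier F"
      by (rule Pi_I) (rule cl[OF F.grid_nth])
    fix n assume n: "n \<in> ?A"
    hence "n k = 0" using k by (auto simp: PiE_iff dest!: bspec[of _ _ k])
    hence "(\<lambda>j\<in>I. (Xs(k := [x])) j ! n j) = (\<lambda>j\<in>I. (Xs(k := [z])) j ! n j)(k := x)" using k by auto
    thus "g (\<lambda>j\<in>I. (Xs(k := [x])) j ! n j) = g ((\<lambda>j\<in>I. (Xs(k := [z])) j ! n j)(k := x))" by simp
  qed simp
qed

context
  fixes g assumes g: "subadd g"
begin

lemma g_Cn: "a \<in> PTu ==> g a \<in> pos_cone F" using g unfolding subadd_def by blast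

lemma gsum_good: "good Xs ==> F.gsum I Xs g \<in> pos_cone F"
  using grid_PTu g_Cn by (intro F.gsum_Cn) blast

lemma gsum_good_upd [simp]: "good Xs ==> k \<in> I ==> set xs \<subseteq> pos_cone (E k) ==> F.gsum I (Xs(k := xs)) g \<in> pos_cone F"
  by (intro gsum_good good_upd)

lemma gsum_sep_good: "good Xs ==> k \<in> I ==> set xs \<subseteq> pos_cone (E k) ==>
  F.gsum I (Xs(k := xs)) g = F.lsum (map (\<lambda>x. F.gsum I (Xs(k := [x])) g) xs)"
  using grid_PTu[OF good_upd] g_Cn by (intro F.gsum_sep) (blast dest: F.CnD)+

lemma gsum_single_good: assumes "good Xs" "k \<in> I" "x \<in> pos_cone (E k)"
  shows "F.gsum I (Xs(k := [x])) g = F.gsum I (Xs(k := [\<zero>\<^bsub>E k\<^esub>])) (\<lambda>y. g (y(k := x)))"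
    "(\<lambda>y. g (y(k := x))) \<in> grid I (Xs(k := [\<zero>\<^bsub>E k\<^esub>])) \<rightarrow> pos_cone F"
proof -
  interpret E: avl "E k" using avlE[OF assms(2)] .
  have G: "grid I (Xs(k := [\<zero>\<^bsub>E k\<^esub>])) \<subseteq> PTu" by (intro grid_PTu good_upd assms) auto
  thus c: "(\<lambda>y. g (y(k := x))) \<in> grid I (Xs(k := [\<zero>\<^bsub>E k\<^esub>])) \<rightarrow> pos_cone F"
    using g_Cn PTu_upd assms by blast
  show "F.gsum I (Xs(k := [x])) g = F.gsum I (Xs(k := [\<zero>\<^bsub>E k\<^esub>])) (\<lambda>y. g (y(k := x)))"
    by (rule gsum_single_upd[OF assms(2)]) (use c in \<open>auto intro: F.CnD\<close>)
qed

lemma grid_zero_PTu: assumes "good Xs" "k \<in> I" "y \<in> grid I (Xs(k := [\<zero>\<^bsub>E k\<^esub>]))" shows "y \<in> PTu"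
proof -
  interpret E: avl "E k" using avlE[OF assms(2)] .
  show ?thesis using grid_PTu[OF good_upd[of Xs k "[\<zero>\<^bsub>E k\<^esub>]"]] assms by auto
qed

lemma gsum_single_subadd:
  assumes "good Xs" "k \<in> I" "x \<in> pos_cone (E k)" "y \<in> pos_cone (E k)"
  shows "vl_le F (F.gsum I (Xs(k := [x \<oplus>\<^bsub>E k\<^esub> y])) g) (F.gsum I (Xs(k := [x])) g \<oplus>\<^bsub>F\<^esub> F.gsum I (Xs(k := [y])) g)"
proof -
  interpret E: avl "E k" using avlE[OF assms(2)] .
  have xy: "x \<oplus>\<^bsub>E k\<^esub> y \<in> pos_cone (E k)" using assms by simp
  note gx = gsum_single_good[OF assms(1,2,3)] and gy = gsum_single_good[OF assms(1,2,4)]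
    and gxy = gsum_single_good[OF assms(1,2) xy]
  have sub: "pos_cone F \<subseteq> carrier F" by (auto intro: F.CnD)
  have c: "(\<lambda>y. g (y(k := x))) \<in> grid I (Xs(k := [\<zero>\<^bsub>E k\<^esub>])) \<rightarrow> carrier F" "(\<lambda>z. g (z(k := y))) \<in> grid I (Xs(k := [\<zero>\<^bsub>E k\<^esub>])) \<rightarrow> carrier F"
    "(\<lambda>z. g (z(k := x \<oplus>\<^bsub>E k\<^esub> y))) \<in> grid I (Xs(k := [\<zero>\<^bsub>E k\<^esub>])) \<rightarrow> carrier F"
    using gx(2) gy(2) gxy(2) sub by blast+
  show ?thesis unfolding gx(1) gy(1) gxy(1) F.gsum_add[OF c(1,2), symmetric]
  proof (rule F.gsum_mono)
    fix z assume "z \<in> grid I (Xs(k := [\<zero>\<^bsub>E k\<^esub>]))"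
    hence "z \<in> PTu" by (rule grid_zero_PTu[OF assms(1,2)])
    thus "vl_le F (g (z(k := x \<oplus>\<^bsub>E k\<^esub> y))) (g (z(k := x)) \<oplus>\<^bsub>F\<^esub> g (z(k := y)))"
      using g assms unfolding subadd_def by blast
  qed (use c in auto)
qed

lemma gsum_cone_fun: assumes "good Xs" "k \<in> I"
  shows "cone_fun (E k) F (\<lambda>x. F.gsum I (Xs(k := [x])) g)"
proof -
  interpret E: avl "E k" using avlE[OF assms(2)] .
  show ?thesis
  proof (unfold_locales)
    fix x assume "x \<in> pos_cone (E k)"
    thus "F.gsum I (Xs(k := [x])) g \<in> pos_cone F" using assms by simp
  next
    have "F.gsum I (Xs(k := [\<zero>\<^bsub>E k\<^esub>])) g = F.gsum I (Xs(k := [\<zero>\<^bsub>E k\<^esub>])) (\<lambda>y. g (y(k := \<zero>\<^bsub>E k\<^esub>)))"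
      using gsum_single_good[of Xs k "\<zero>\<^bsub>E k\<^esub>"] assms by simp
    also have "... = F.gsum I (Xs(k := [\<zero>\<^bsub>E k\<^esub>])) (\<lambda>y. 0 \<odot>\<^bsub>F\<^esub> g y)"
    proof (rule F.gsum_cong)
      fix y assume "y \<in> grid I (Xs(k := [\<zero>\<^bsub>E k\<^esub>]))"
      hence y: "y \<in> PTu" by (rule grid_zero_PTu[OF assms])
      thus "g (y(k := \<zero>\<^bsub>E k\<^esub>)) = 0 \<odot>\<^bsub>F\<^esub> g y" using g g_Cn[OF y] assms unfolding subadd_def by simp
    next
      show "(\<lambda>y. 0 \<odot>\<^bsub>F\<^esub> g y) \<in> grid I (Xs(k := [\<zero>\<^bsub>E k\<^esub>])) \<rightarrow> carrier F"
        using grid_zero_PTu[OF assms] g_Cn by (auto intro!: F.cl F.CnD)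
    qed
    also have "... = \<zero>\<^bsub>F\<^esub>"
      using grid_zero_PTu[OF assms] g_Cn
      by (subst F.gsum_smult) (auto intro!: F.CnD F.sm(2) F.gsum_cl)
    finally show "F.gsum I (Xs(k := [\<zero>\<^bsub>E k\<^esub>])) g = \<zero>\<^bsub>F\<^esub>" .
  qed
qed

lemma gsum_finer1:
  assumes "good Xs" "k \<in> I" "avl.finer (E k) (Xs k) zs"
  shows "vl_le F (F.gsum I Xs g) (F.gsum I (Xs(k := zs)) g)" "set zs \<subseteq> pos_cone (E k)"
proof -
  interpret E: avl "E k" using avlE[OF assms(2)] .
  interpret h: cone_fun "E k" F "\<lambda>x. F.gsum I (Xs(k := [x])) g" using gsum_cone_fun[OF assms(1,2)] .
  have xs: "set (Xs k) \<subseteq> pos_cone (E k)" using assms(1,2) unfolding good_def by blast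
  have "Xs k \<in> pos_partitions (E k) (E.lsum (Xs k))" using xs by (simp add: E.pos_partitions_iff)
  thus zs: "set zs \<subseteq> pos_cone (E k)" using E.finer_partition[OF assms(3)] by (simp add: E.pos_partitions_iff)
  have "F.gsum I (Xs(k := Xs k)) g = F.lsum (map (\<lambda>x. F.gsum I (Xs(k := [x])) g) (Xs k))"
    by (rule gsum_sep_good[OF assms(1,2) xs])
  moreover have "F.gsum I (Xs(k := zs)) g = F.lsum (map (\<lambda>x. F.gsum I (Xs(k := [x])) g) zs)"
    by (rule gsum_sep_good[OF assms(1,2) zs])
  ultimately show "vl_le F (F.gsum I Xs g) (F.gsum I (Xs(k := zs)) g)"
    using h.lsum_subadditive[OF gsum_single_subadd[OF assms(1,2)] assms(3)] by simp
qed

text \<open>One variable is refined at a time, each time by \<open>gsum_finer1\<close>;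
  \<open>K\<close> contains the variables still to be refined.\<close>

lemma gsum_finer:
  assumes "finite K" "K \<subseteq> I" "good Xs" "\<And>k. k \<in> K ==> avl.finer (E k) (Xs k) (Zs k)" "\<And>k. k \<in> I - K ==> Zs k = Xs k"
  shows "vl_le F (F.gsum I Xs g) (F.gsum I Zs g) \<and> good Zs"
  using assms
proof (induction K arbitrary: Xs rule: finite_induct)
  case empty
  hence "F.gsum I Xs g = F.gsum I Zs g" by (intro gsum_cong_I) auto
  moreover have "good Zs" using empty unfolding good_def by auto
  ultimately show ?case using gsum_good[OF \<open>good Zs\<close>] by simp
next
  case (insert k K)
  have k: "k \<in> I" using insert by auto
  have f: "avl.finer (E k) (Xs k) (Zs k)" using insert by auto
  note 1 = gsum_finer1[OF insert.prems(2) k f]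
  have good: "good (Xs(k := Zs k))" by (rule good_upd[OF insert.prems(2) k 1(2)])
  have "vl_le F (F.gsum I (Xs(k := Zs k)) g) (F.gsum I Zs g) \<and> good Zs"
    by (rule insert.IH[OF _ good]) (use insert in auto)
  thus ?case using F.le_trans[OF 1(1)] gsum_good insert.prems(2) good by (meson F.CnD)
qed

lemma gsum_append: assumes "good Xs" "k \<in> I" "set xs \<subseteq> pos_cone (E k)" "set ys \<subseteq> pos_cone (E k)"
  shows "F.gsum I (Xs(k := xs @ ys)) g = F.gsum I (Xs(k := xs)) g \<oplus>\<^bsub>F\<^esub> F.gsum I (Xs(k := ys)) g"
proof -
  have c: "set (map (\<lambda>x. F.gsum I (Xs(k := [x])) g) xs) \<subseteq> carrier F" if "set xs \<subseteq> pos_cone (E k)" for xs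
    using gsum_good_upd[OF assms(1,2)] that by (auto intro!: F.CnD)
  show ?thesis using assms gsum_sep_good[OF assms(1,2)] F.lsum_append[OF c c] by simp
qed

lemma gsum_map2: assumes X: "good Xs" "k \<in> I" and uv: "length us = length vs" "set us \<subseteq> pos_cone (E k)" "set vs \<subseteq> pos_cone (E k)"
  shows "vl_le F (F.gsum I (Xs(k := map2 (\<lambda>u v. u \<oplus>\<^bsub>E k\<^esub> v) us vs)) g)
    (F.gsum I (Xs(k := us)) g \<oplus>\<^bsub>F\<^esub> F.gsum I (Xs(k := vs)) g)"
proof -
  interpret E: avl "E k" using avlE[OF X(2)] .
  define G where "G l = F.gsum I (Xs(k := l)) g" for l
  have e: "G (a # l) = G [a] \<oplus>\<^bsub>F\<^esub> G l" if "a \<in> pos_cone (E k)" "set l \<subseteq> pos_cone (E k)" for a l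
    using gsum_append[OF X, of "[a]" l] that by (simp add: G_def)
  have G: "G l \<in> pos_cone F" if "set l \<subseteq> pos_cone (E k)" for l
    using gsum_good_upd[OF X that] by (simp add: G_def)
  have "vl_le F (G (map2 (\<lambda>u v. u \<oplus>\<^bsub>E k\<^esub> v) us vs)) (G us \<oplus>\<^bsub>F\<^esub> G vs)"
    using uv
  proof (induction us vs rule: list_induct2)
    case Nil
    thus ?case using G[of "[]"] by simp
  next
    case (Cons u us v vs)
    let ?m = "map2 (\<lambda>u v. u \<oplus>\<^bsub>E k\<^esub> v) us vs"
    have c: "u \<in> pos_cone (E k)" "v \<in> pos_cone (E k)" "set us \<subseteq> pos_cone (E k)" "set vs \<subseteq> pos_cone (E k)"
      using Cons by auto
    have cm: "set ?m \<subseteq> pos_cone (E k)" using Cons(1) c(3,4) by (induction us vs rule: list_induct2) auto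
    have uv: "u \<oplus>\<^bsub>E k\<^esub> v \<in> pos_cone (E k)" using c by simp
    note C = G[of "[u]"] G[of "[v]"] G[OF c(3)] G[OF c(4)] G[OF cm] G[of "[u \<oplus>\<^bsub>E k\<^esub> v]"]
    have 1: "vl_le F (G [u \<oplus>\<^bsub>E k\<^esub> v]) (G [u] \<oplus>\<^bsub>F\<^esub> G [v])"
      using gsum_single_subadd[OF X c(1,2)] by (simp add: G_def)
    have "vl_le F (G [u \<oplus>\<^bsub>E k\<^esub> v] \<oplus>\<^bsub>F\<^esub> G ?m) ((G [u] \<oplus>\<^bsub>F\<^esub> G [v]) \<oplus>\<^bsub>F\<^esub> (G us \<oplus>\<^bsub>F\<^esub> G vs))"
      using c uv C Cons.IH by (intro F.le_add[OF 1]) auto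
    also have "(G [u] \<oplus>\<^bsub>F\<^esub> G [v]) \<oplus>\<^bsub>F\<^esub> (G us \<oplus>\<^bsub>F\<^esub> G vs) = G (u # us) \<oplus>\<^bsub>F\<^esub> G (v # vs)"
      unfolding e[OF c(1,3)] e[OF c(2,4)] using c C by (simp add: F.M.add.m_ac)
    finally show ?case using e[OF uv cm] by simp
  qed
  thus ?thesis by (simp add: G_def)
qed

definition bounded_on where "bounded_on = (\<forall>a\<in>PTu. \<exists>b\<in>pos_cone F. \<forall>Xs\<in>parts a. vl_le F (F.gsum I Xs g) b)"

definition var where "var a = F.csup ((\<lambda>Xs. F.gsum I Xs g) ` parts a)"

lemma singleton_parts: "a \<in> PTu ==> (\<lambda>k. [a k]) \<in> parts a"
  using avl.pos_partitions_single[OF avlE] PTuD unfolding parts_def by blast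

lemma parts_upd: "Xs \<in> parts a ==> xs \<in> pos_partitions (E k) x ==> Xs(k := xs) \<in> parts (a(k := x))"
  unfolding parts_def by auto

context
  assumes bd: bounded_on
begin

lemma var_bdd: "a \<in> PTu ==> F.bdd ((\<lambda>Xs. F.gsum I Xs g) ` parts a)"
  using bd singleton_parts[of a] gsum_good[OF parts_good] unfolding bounded_on_def F.bdd_def by blast

lemma var_Cn: "a \<in> PTu ==> var a \<in> pos_cone F" unfolding var_def by (simp add: var_bdd)

lemma gsum_le_var: "a \<in> PTu ==> Xs \<in> parts a ==> vl_le F (F.gsum I Xs g) (var a)"
  unfolding var_def by (intro F.csup_upper var_bdd) auto

lemma var_least: "a \<in> PTu ==> w \<in> pos_cone F ==> (\<And>Xs. Xs \<in> parts a ==> vl_le F (F.gsum I Xs g) w) ==> vl_le F (var a) w"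
  unfolding var_def by (intro F.csup_least var_bdd) auto

lemma var_is_sup: "a \<in> PTu ==> is_cone_sup F ((\<lambda>Xs. F.gsum I Xs g) ` parts a) (var a)"
  unfolding var_def by (intro F.csup var_bdd)

lemma le_var: assumes "a \<in> PTu" shows "vl_le F (g a) (var a)"
proof -
  have r: "restrict a I = a" using assms by (auto simp: PTu_iff extensional_def)
  have "F.gsum I (\<lambda>k. [a k]) g = g (restrict a I)"
    using assms g_Cn by (intro F.gsum_single) (auto simp: r)
  thus ?thesis using gsum_le_var[OF assms singleton_parts[OF assms]] r by simp
qed

text \<open>For the upper estimate every partition of the sum is cut, entry by entry, into
  partitions of \<open>x\<close> and of \<open>y\<close>. For the lower estimate two families of
  partitions are first given the same lists in the other variables by common refinement; then their
  lists at \<open>k\<close> are concatenated.\<close>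

lemma var_add:
  assumes a: "a \<in> PTu" and k: "k \<in> I" and x: "x \<in> pos_cone (E k)" and y: "y \<in> pos_cone (E k)"
  shows "var (a(k := x \<oplus>\<^bsub>E k\<^esub> y)) = var (a(k := x)) \<oplus>\<^bsub>F\<^esub> var (a(k := y))"
proof (rule F.le_antisym)
  interpret E: avl "E k" using avlE[OF k] .
  have xy: "x \<oplus>\<^bsub>E k\<^esub> y \<in> pos_cone (E k)" using x y by simp
  note P = PTu_upd[OF a k x] PTu_upd[OF a k y] PTu_upd[OF a k xy]
  note C = var_Cn[OF P(1)] var_Cn[OF P(2)] var_Cn[OF P(3)]
  show "var (a(k := x \<oplus>\<^bsub>E k\<^esub> y)) \<in> carrier F" "var (a(k := x)) \<oplus>\<^bsub>F\<^esub> var (a(k := y)) \<in> carrier F" using C by auto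
  show "vl_le F (var (a(k := x \<oplus>\<^bsub>E k\<^esub> y))) (var (a(k := x)) \<oplus>\<^bsub>F\<^esub> var (a(k := y)))"
  proof (rule var_least[OF P(3)])
    fix Xs assume Xs: "Xs \<in> parts (a(k := x \<oplus>\<^bsub>E k\<^esub> y))"
    hence "Xs k \<in> pos_partitions (E k) (x \<oplus>\<^bsub>E k\<^esub> y)" using k unfolding parts_def by auto
    then obtain us vs where uv: "us \<in> pos_partitions (E k) x" "vs \<in> pos_partitions (E k) y" "length us = length vs"
      "Xs k = map2 (\<lambda>u v. u \<oplus>\<^bsub>E k\<^esub> v) us vs" using E.split_partition x y by blast
    have c: "set us \<subseteq> pos_cone (E k)" "set vs \<subseteq> pos_cone (E k)" using uv by (auto simp: E.pos_partitions_iff)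
    have "Xs(k := us) \<in> parts (a(k := x))" "Xs(k := vs) \<in> parts (a(k := y))"
      using parts_upd[OF Xs uv(1)] parts_upd[OF Xs uv(2)] by auto
    hence le: "vl_le F (F.gsum I (Xs(k := us)) g) (var (a(k := x)))" "vl_le F (F.gsum I (Xs(k := vs)) g) (var (a(k := y)))"
      using gsum_le_var P by auto
    have g: "good Xs" using parts_good[OF Xs] .
    have 1: "vl_le F (F.gsum I Xs g) (F.gsum I (Xs(k := us)) g \<oplus>\<^bsub>F\<^esub> F.gsum I (Xs(k := vs)) g)"
      using gsum_map2[OF g k uv(3) c] by (simp flip: uv(4))
    show "vl_le F (F.gsum I Xs g) (var (a(k := x)) \<oplus>\<^bsub>F\<^esub> var (a(k := y)))"
      using F.le_trans[OF 1 F.le_add[OF le]] C gsum_good[OF g] gsum_good_upd[OF g k] c by simp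
  qed (use C in auto)
  show "vl_le F (var (a(k := x)) \<oplus>\<^bsub>F\<^esub> var (a(k := y))) (var (a(k := x \<oplus>\<^bsub>E k\<^esub> y)))"
    unfolding var_def[of "a(k := x)"] var_def[of "a(k := y)"]
  proof (rule F.csup_add_le)
    fix b c assume "b \<in> (\<lambda>Xs. F.gsum I Xs g) ` parts (a(k := x))" "c \<in> (\<lambda>Xs. F.gsum I Xs g) ` parts (a(k := y))"
    then obtain Xs Ys where X: "Xs \<in> parts (a(k := x))" "b = F.gsum I Xs g" and Y: "Ys \<in> parts (a(k := y))" "c = F.gsum I Ys g"
      by auto
    \<comment> \<open>Only variables other than \<open>k\<close> are refined; at \<open>k\<close>
      the lists partition different elements.\<close>
    have "\<exists>z. z \<in> pos_partitions (E j) (a j) \<and> avl.finer (E j) (Xs j) z \<and> avl.finer (E j) (Ys j) z" if "j \<in> I - {k}" for j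
    proof -
      have "Xs j \<in> pos_partitions (E j) (a j)" "Ys j \<in> pos_partitions (E j) (a j)" using partsD[OF X(1), of j] partsD[OF Y(1), of j] that by auto
      thus ?thesis using avl.common_finer[OF avlE] that by (metis DiffD1)
    qed
    then obtain Zs where Z: "\<And>j. j \<in> I - {k} ==> Zs j \<in> pos_partitions (E j) (a j) \<and> avl.finer (E j) (Xs j) (Zs j) \<and> avl.finer (E j) (Ys j) (Zs j)"
      by metis
    have gX: "good Xs" and gY: "good Ys" using X Y parts_good by auto
    have xk: "Xs k \<in> pos_partitions (E k) x" "Ys k \<in> pos_partitions (E k) y" using X Y k unfolding parts_def by force+
    hence c: "set (Xs k) \<subseteq> pos_cone (E k)" "set (Ys k) \<subseteq> pos_cone (E k)" by (auto simp: E.pos_partitions_iff)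
    have 1: "vl_le F b (F.gsum I (Zs(k := Xs k)) g) \<and> good (Zs(k := Xs k))" unfolding X(2)
      by (rule gsum_finer[of "I - {k}"]) (use Z gX in auto)
    have 2: "vl_le F c (F.gsum I (Zs(k := Ys k)) g) \<and> good (Zs(k := Ys k))" unfolding Y(2)
      by (rule gsum_finer[of "I - {k}"]) (use Z gY in auto)
    have e: "F.gsum I (Zs(k := Xs k @ Ys k)) g = F.gsum I (Zs(k := Xs k)) g \<oplus>\<^bsub>F\<^esub> F.gsum I (Zs(k := Ys k)) g"
      using gsum_append[OF conjunct2[OF 1] k c] by simp
    have p: "Zs(k := Xs k @ Ys k) \<in> parts (a(k := x \<oplus>\<^bsub>E k\<^esub> y))"
      using Z xk unfolding parts_def by (auto simp: E.pos_partitions_iff E.lsum_append E.Cn_subset)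
    have 3: "vl_le F (b \<oplus>\<^bsub>F\<^esub> c) (F.gsum I (Zs(k := Xs k @ Ys k)) g)" unfolding e
      using 1 2 gsum_good gX gY X(2) Y(2) by (intro F.le_add) auto
    show "vl_le F (b \<oplus>\<^bsub>F\<^esub> c) (var (a(k := x \<oplus>\<^bsub>E k\<^esub> y)))"
      using F.le_trans[OF 3 gsum_le_var[OF P(3) p]] gsum_good[OF parts_good[OF p]] C(3)
        gsum_good[OF gX] gsum_good[OF gY] X(2) Y(2) by simp
  qed (use P C var_bdd in auto)
qed

lemma var_multiadd: "multiadd var"
  unfolding multiadd_def using var_Cn var_add by blast

end
end

text \<open>No refinement changes a sum of a multiadditive function. The induction is on the set of
  variables whose lists may differ from the singleton of \<open>a k\<close>.\<close>

lemma gsum_multiadd: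
  assumes g: "multiadd g" and "a \<in> PTu" "Xs \<in> parts a"
  shows "F.gsum I Xs g = g a"
proof -
  note sg = multiadd_subadd[OF g]
  have "F.gsum I Xs g = g a" if "finite K" "K \<subseteq> I" "a \<in> PTu" "Xs \<in> parts a" "\<forall>k\<in>I - K. Xs k = [a k]" for K a Xs
    using that
  proof (induction K arbitrary: a Xs rule: finite_induct)
    case empty
    have r: "restrict a I = a" using empty by (auto simp: PTu_iff extensional_def)
    have "F.gsum I Xs g = g (restrict a I)"
      using empty g_Cn[OF sg] by (intro F.gsum_single) (auto simp: r)
    thus ?case by (simp add: r)
  next
    case (insert k K)
    have k: "k \<in> I" using insert by auto
    interpret E: avl "E k" using avlE[OF k] .
    have xk: "set (Xs k) \<subseteq> pos_cone (E k)" "E.lsum (Xs k) = a k" using partsD[OF insert.prems(3) k]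
      by (simp_all add: E.pos_partitions_iff)
    have 1: "F.gsum I (Xs(k := [x])) g = g (a(k := x))" if "x \<in> set (Xs k)" for x
    proof (rule insert.IH)
      have x: "x \<in> pos_cone (E k)" using that xk by auto
      show "a(k := x) \<in> PTu" using insert k x by (intro PTu_upd) auto
      show "Xs(k := [x]) \<in> parts (a(k := x))" using x insert by (intro parts_upd[OF sg]) auto
    qed (use insert in auto)
    interpret h: cone_fun "E k" F "\<lambda>x. g (a(k := x))"
      using insert.prems(2) k g multiadd_zero[OF g] PTu_upd unfolding multiadd_def by unfold_locales auto
    have "F.gsum I (Xs(k := Xs k)) g = F.lsum (map (\<lambda>x. F.gsum I (Xs(k := [x])) g) (Xs k))"
      by (rule gsum_sep_good[OF sg parts_good[OF insert.prems(3)] k xk(1)])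
    also have "map (\<lambda>x. F.gsum I (Xs(k := [x])) g) (Xs k) = map (\<lambda>x. g (a(k := x))) (Xs k)" using 1 by simp
    also have "F.lsum ... = g (a(k := E.lsum (Xs k)))"
      using g insert.prems(2) k unfolding multiadd_def by (intro h.lsum_additive[OF _ xk(1), symmetric]) blast
    finally show ?case by (simp add: xk)
  qed
  from this[of I a Xs] assms show ?thesis by auto
qed

end

section \<open>Extending functions from cones to whole spaces\<close>

context avl
begin

lemma Ip_real: "x \<in> Rl ==> kI \<odot> Ip x = \<zero>"
proof -
  assume x: "x \<in> Rl"
  have "x = x \<oplus> kI \<odot> Ip x" using Rp_Ip[of x] Rp_real[OF x] x by simp
  thus ?thesis using x
    by (intro vec_eqI) (auto dest: arg_cong[where f = "\<phi>" for \<phi>])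
qed

lemma Ip_add: "x \<in> Vc ==> y \<in> Vc ==> Ip (x \<oplus> y) = Ip x \<oplus> Ip y"
  by (simp add: Ip_def smult_r_distr Rp_add)

lemma carrier_four: assumes "x \<in> Vc"
  shows "\<exists>a\<in>Cn. \<exists>b\<in>Cn. \<exists>c\<in>Cn. \<exists>d\<in>Cn. x = (a \<ominus> b) \<oplus> kI \<odot> (c \<ominus> d)"
proof -
  obtain a b where "a \<in> Cn" "b \<in> Cn" "Rp x = a \<ominus> b" using RlE[OF Rp_Rl[OF assms]] .
  moreover obtain c d where "c \<in> Cn" "d \<in> Cn" "Ip x = c \<ominus> d" using RlE[OF Ip_Rl[OF assms]] .
  ultimately show ?thesis using Rp_Ip[OF assms] by metis
qed

end

text \<open>An additive map between cones is monotone and respects natural multiples. Squeezing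
  \<open>r\<close> between rationals and using the Archimedean property gives all nonnegative
  multiples.\<close>

lemma (in cone_fun) positive_homogeneous:
  assumes add: "\<And>x y. x \<in> pos_cone V ==> y \<in> pos_cone V ==> g (x \<oplus>\<^bsub>V\<^esub> y) = g x \<oplus>\<^bsub>W\<^esub> g y"
    and x: "x \<in> pos_cone V" and r: "r \<ge> 0"
  shows "g (V.rs r x) = W.rs r (g x)"
proof -
  have mono: "vl_le W (g a) (g b)" if "a \<in> pos_cone V" "b \<in> pos_cone V" "vl_le V a b" for a b
  proof -
    have c: "b \<ominus>\<^bsub>V\<^esub> a \<in> pos_cone V" by (rule V.leD[OF that(3)])
    have "b = a \<oplus>\<^bsub>V\<^esub> (b \<ominus>\<^bsub>V\<^esub> a)" using that by (intro V.vec_eqI) auto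
    hence "g b = g a \<oplus>\<^bsub>W\<^esub> g (b \<ominus>\<^bsub>V\<^esub> a)" using add[OF that(1) c] by simp
    thus ?thesis using that c by simp
  qed
  have nat: "g (V.rs (real n) a) = W.rs (real n) (g a)" if a: "a \<in> pos_cone V" for n a
  proof (induction n)
    case (Suc n)
    have "V.rs (real (Suc n)) a = V.rs (real n) a \<oplus>\<^bsub>V\<^esub> a" using a by (intro V.vec_eqI) (auto simp: algebra_simps)
    moreover have "W.rs (real (Suc n)) (g a) = W.rs (real n) (g a) \<oplus>\<^bsub>W\<^esub> g a"
      using a by (intro W.vec_eqI) (auto simp: algebra_simps)
    ultimately show ?case using Suc a add by simp
  qed (use a g_zero in simp)
  note gx = g_Cn[OF x] and grx = g_Cn[OF V.Cn_smult[OF x r]]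
  have both: "vl_le W (W.rs r (g x)) (g (V.rs r x) \<oplus>\<^bsub>W\<^esub> W.rs e (g x)) \<and> vl_le W (g (V.rs r x)) (W.rs r (g x) \<oplus>\<^bsub>W\<^esub> W.rs e (g x))"
    if e: "e > 0" for e
  proof -
    \<comment> \<open>With \<open>m = floor (n r)\<close> the factor \<open>r\<close> lies between
      \<open>m / n\<close> and \<open>(m + 1) / n\<close>, and \<open>1 / n \<le> e\<close> bounds
      the gap.\<close>
    obtain n :: nat where n: "real n > 1 / e" using reals_Archimedean2 by blast
    have n0: "real n > 0" using n e by (meson divide_pos_pos less_trans zero_less_one)
    have ne: "1 / real n \<le> e" using n e n0 by (simp add: field_simps)
    define m where "m = nat \<lfloor>real n * r\<rfloor>"
    have m: "real m \<le> real n * r" "real n * r \<le> real (Suc m)"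
    proof -
      have "0 \<le> \<lfloor>real n * r\<rfloor>" using r n0 by simp
      hence e: "real m = real_of_int \<lfloor>real n * r\<rfloor>" by (simp add: m_def)
      show "real m \<le> real n * r" "real n * r \<le> real (Suc m)" using floor_correct[of "real n * r"] unfolding of_nat_Suc e by linarith+
    qed
    have "vl_le W (g (V.rs (real m) x)) (g (V.rs (real n) (V.rs r x)))" "vl_le W (g (V.rs (real n) (V.rs r x))) (g (V.rs (real (Suc m)) x))"
      using m x r n0 by (auto intro!: mono V.le_rs_mono)
    hence 1: "vl_le W (W.rs (real m) (g x)) (W.rs (real n) (g (V.rs r x)))" "vl_le W (W.rs (real n) (g (V.rs r x))) (W.rs (real (Suc m)) (g x))"
      using nat[OF x] nat[of "V.rs r x"] x r by (simp_all del: V.rs_simps of_nat_Suc)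
    have "r \<le> real m / real n + 1 / real n" "real m / real n \<le> r" "real (Suc m) / real n = real m / real n + 1 / real n"
      using m n0 by (simp_all add: field_simps)
    hence q: "0 \<le> e - r + 1 / real n * real m" "0 \<le> r + e - 1 / real n * real (Suc m)" using ne by simp_all
    have cN: "of_real c * (of_real N * z) = z" if "c * N = 1" for c N :: real and z :: 'k
    proof -
      have "of_real c * (of_real N * z) = of_real (c * N) * z" by (simp add: mult.assoc)
      thus ?thesis using that by (simp only: of_real_1 mult_1_left)
    qed
    have lower: "vl_le W (W.rs r B) (A \<oplus>\<^bsub>W\<^esub> W.rs e B)" and upper: "vl_le W B' (W.rs r A' \<oplus>\<^bsub>W\<^esub> W.rs e A')"
      if "c * N = 1" "0 \<le> c" "A \<in> carrier W" "B \<in> pos_cone W" "A' \<in> pos_cone W" "B' \<in> carrier W"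
        "W.rs N A \<ominus>\<^bsub>W\<^esub> W.rs M B \<in> pos_cone W" "0 \<le> e - r + c * M" "W.rs M' A' \<ominus>\<^bsub>W\<^esub> W.rs N B' \<in> pos_cone W" "0 \<le> r + e - c * M'"
      for c N M M' :: real and A B A' B'
    proof -
      show "vl_le W (W.rs r B) (A \<oplus>\<^bsub>W\<^esub> W.rs e B)"
      proof (rule W.le_by)
        show "W.rs c (W.rs N A \<ominus>\<^bsub>W\<^esub> W.rs M B) \<oplus>\<^bsub>W\<^esub> W.rs (e - r + c * M) B \<in> pos_cone W"
          by (rule W.Cn_add[OF W.Cn_smult[OF that(7)] W.Cn_smult[OF that(4)]]) (use that in simp_all)
      qed (use that(2-) in \<open>simp_all add: ring_distribs mult.assoc cN[OF that(1)]\<close>)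
      show "vl_le W B' (W.rs r A' \<oplus>\<^bsub>W\<^esub> W.rs e A')"
      proof (rule W.le_by)
        show "W.rs c (W.rs M' A' \<ominus>\<^bsub>W\<^esub> W.rs N B') \<oplus>\<^bsub>W\<^esub> W.rs (r + e - c * M') A' \<in> pos_cone W"
          by (rule W.Cn_add[OF W.Cn_smult[OF that(9)] W.Cn_smult[OF that(5)]]) (use that in simp_all)
      qed (use that(2-) in \<open>simp_all add: ring_distribs mult.assoc cN[OF that(1)]\<close>)
    qed
    note args = W.CnD[OF grx] gx gx W.CnD[OF grx] W.leD[OF 1(1)] q(1) W.leD[OF 1(2)] q(2)
    have "1 / real n * real n = 1" "0 \<le> 1 / real n" using n0 by simp_all
    thus ?thesis using lower[OF _ _ args] upper[OF _ _ args] by blast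
  qed
  show ?thesis
  proof (rule W.le_antisym)
    show "vl_le W (g (V.rs r x)) (W.rs r (g x))" by (rule W.le_archimedean[where g = "g x"]) (use both gx grx in auto)
    show "vl_le W (W.rs r (g x)) (g (V.rs r x))" by (rule W.le_archimedean[where g = "g x"]) (use both gx grx in auto)
  qed (use gx grx in auto)
qed

definition linear_extension ::
  "('k::real_or_complex, 'a) vlattice \<Rightarrow> ('k, 'b) vlattice \<Rightarrow> ('a \<Rightarrow> 'b) \<Rightarrow> 'a \<Rightarrow> 'b" where
  "linear_extension V W g x =
     (g (avl.pp V (avl.Rp V x)) \<ominus>\<^bsub>W\<^esub> g (avl.pp V (\<ominus>\<^bsub>V\<^esub> avl.Rp V x))) \<oplus>\<^bsub>W\<^esub>
     kI \<odot>\<^bsub>W\<^esub> (g (avl.pp V (avl.Ip V x)) \<ominus>\<^bsub>W\<^esub> g (avl.pp V (\<ominus>\<^bsub>V\<^esub> avl.Ip V x)))"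

locale cone_linear = V: avl V + W: avl W
  for V :: "('k :: real_or_complex, 'a) vlattice" and W :: "('k, 'b) vlattice" +
  fixes g :: "'a \<Rightarrow> 'b"
  assumes g_cl [simp]: "x \<in> pos_cone V ==> g x \<in> carrier W"
    and g_add: "x \<in> pos_cone V ==> y \<in> pos_cone V ==> g (x \<oplus>\<^bsub>V\<^esub> y) = g x \<oplus>\<^bsub>W\<^esub> g y"
    and g_rs: "x \<in> pos_cone V ==> r \<ge> 0 ==> g (V.rs r x) = W.rs r (g x)"
begin

lemma g_zero [simp]: "g \<zero>\<^bsub>V\<^esub> = \<zero>\<^bsub>W\<^esub>" using g_rs[of "\<zero>\<^bsub>V\<^esub>" 0] by simp

definition h where "h u = g (V.pp u) \<ominus>\<^bsub>W\<^esub> g (V.pp (\<ominus>\<^bsub>V\<^esub> u))"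

lemma h_cl [simp]: "u \<in> V.Rl ==> h u \<in> carrier W" by (simp add: h_def)

text \<open>Two representations of a real element as a difference give one identity of sums in the
  cone, where \<open>g\<close> is additive. Hence the canonical parts in \<open>h\<close> may be
  replaced by any others.\<close>

lemma h_diff: assumes ab: "a \<in> pos_cone V" "b \<in> pos_cone V" shows "h (a \<ominus>\<^bsub>V\<^esub> b) = g a \<ominus>\<^bsub>W\<^esub> g b"
proof -
  let ?p = "V.pp (a \<ominus>\<^bsub>V\<^esub> b)" and ?q = "V.pp (\<ominus>\<^bsub>V\<^esub> (a \<ominus>\<^bsub>V\<^esub> b))"
  have pq: "?p \<in> pos_cone V" "?q \<in> pos_cone V" using ab by simp_all
  have "\<phi> ?p - \<phi> ?q = \<phi> (a \<ominus>\<^bsub>V\<^esub> b)" if "\<phi> \<in> functionals V" for \<phi>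
    using arg_cong[OF V.pp_diff[of "a \<ominus>\<^bsub>V\<^esub> b"], of \<phi>] ab that pq by simp
  hence "?p \<oplus>\<^bsub>V\<^esub> b = a \<oplus>\<^bsub>V\<^esub> ?q" using ab pq by (intro V.vec_eqI) (auto simp: algebra_simps)
  hence e: "g ?p \<oplus>\<^bsub>W\<^esub> g b = g a \<oplus>\<^bsub>W\<^esub> g ?q" using g_add pq ab by metis
  have "\<psi> (g ?p) + \<psi> (g b) = \<psi> (g a) + \<psi> (g ?q)" if "\<psi> \<in> functionals W" for \<psi>
    using arg_cong[OF e, of \<psi>] that pq ab by simp
  thus ?thesis unfolding h_def using pq ab by (intro W.vec_eqI) (auto simp: algebra_simps)
qed

lemma h_add: assumes "u \<in> V.Rl" "v \<in> V.Rl" shows "h (u \<oplus>\<^bsub>V\<^esub> v) = h u \<oplus>\<^bsub>W\<^esub> h v"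
proof -
  obtain a b where ab: "a \<in> pos_cone V" "b \<in> pos_cone V" "u = a \<ominus>\<^bsub>V\<^esub> b" using V.RlE[OF assms(1)] .
  obtain c d where cd: "c \<in> pos_cone V" "d \<in> pos_cone V" "v = c \<ominus>\<^bsub>V\<^esub> d" using V.RlE[OF assms(2)] .
  have "u \<oplus>\<^bsub>V\<^esub> v = (a \<oplus>\<^bsub>V\<^esub> c) \<ominus>\<^bsub>V\<^esub> (b \<oplus>\<^bsub>V\<^esub> d)" using ab cd by (intro V.vec_eqI) auto
  hence "h (u \<oplus>\<^bsub>V\<^esub> v) = g (a \<oplus>\<^bsub>V\<^esub> c) \<ominus>\<^bsub>W\<^esub> g (b \<oplus>\<^bsub>V\<^esub> d)" using h_diff ab cd by simp
  also have "... = h u \<oplus>\<^bsub>W\<^esub> h v" using ab cd h_diff by (intro W.vec_eqI) (auto simp: g_add)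
  finally show ?thesis .
qed

lemma h_rs: assumes "u \<in> V.Rl" shows "h (V.rs r u) = W.rs r (h u)"
proof -
  obtain a b where ab: "a \<in> pos_cone V" "b \<in> pos_cone V" "u = a \<ominus>\<^bsub>V\<^esub> b" using V.RlE[OF assms(1)] .
  show ?thesis
  proof (cases "r \<ge> 0")
    case True
    have "V.rs r u = V.rs r a \<ominus>\<^bsub>V\<^esub> V.rs r b" using ab by (intro V.vec_eqI) (auto simp: algebra_simps)
    thus ?thesis using ab True by (intro W.vec_eqI) (auto simp: h_diff g_rs algebra_simps)
  next
    case False
    have "V.rs r u = V.rs (-r) b \<ominus>\<^bsub>V\<^esub> V.rs (-r) a" using ab by (intro V.vec_eqI) (auto simp: algebra_simps)
    thus ?thesis using ab False by (intro W.vec_eqI) (auto simp: h_diff g_rs algebra_simps)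
  qed
qed

lemma linear_extension_eq: "linear_extension V W g x = h (V.Rp x) \<oplus>\<^bsub>W\<^esub> kI \<odot>\<^bsub>W\<^esub> h (V.Ip x)"
  by (simp add: linear_extension_def h_def)

lemma h_Cn: "x \<in> pos_cone V ==> h x = g x"
  using h_diff[of x "\<zero>\<^bsub>V\<^esub>"] by simp

lemma kI_h_Ip: "x \<in> carrier V ==> (kI::'k) = 0 \<or> V.Ip x = \<zero>\<^bsub>V\<^esub> ==> kI \<odot>\<^bsub>W\<^esub> h (V.Ip x) = \<zero>\<^bsub>W\<^esub>"
  using h_Cn[of "\<zero>\<^bsub>V\<^esub>"] by auto

text \<open>The imaginary part of a positive element is killed by \<open>kI\<close>. Over the
  complex numbers it is therefore 0, and over the reals the factor \<open>kI\<close> is 0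
  itself.\<close>

lemma linear_extension_Cn: assumes x: "x \<in> pos_cone V" shows "linear_extension V W g x = g x"
proof -
  have "kI \<odot>\<^bsub>V\<^esub> V.Ip x = \<zero>\<^bsub>V\<^esub>" using x by (intro V.Ip_real) simp
  hence "kI \<odot>\<^bsub>V\<^esub> (kI \<odot>\<^bsub>V\<^esub> V.Ip x) = \<zero>\<^bsub>V\<^esub>" by simp
  hence "(kI::'k) = 0 \<or> V.Ip x = \<zero>\<^bsub>V\<^esub>"
    using x V.smult_minus1[of "V.Ip x"] V.M.minus_minus[of "V.Ip x"] by (cases rule: kI_cases[where 'k='k]) auto
  thus ?thesis using x by (simp add: linear_extension_eq V.Rp_real kI_h_Ip h_Cn)
qed

lemma linear_extension_linear: "linear_map V W (linear_extension V W g)"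
  unfolding linear_map_def
proof (intro conjI ballI allI Pi_I)
  fix x y assume xy: "x \<in> carrier V" "y \<in> carrier V"
  show "linear_extension V W g x \<in> carrier W" using xy by (simp add: linear_extension_eq)
  show "linear_extension V W g (x \<oplus>\<^bsub>V\<^esub> y) = linear_extension V W g x \<oplus>\<^bsub>W\<^esub> linear_extension V W g y"
    using xy by (intro W.vec_eqI) (auto simp: linear_extension_eq V.Rp_add V.Ip_add h_add algebra_simps)
next
  fix \<alpha> :: 'k and x assume x: "x \<in> carrier V"
  define a b where "a = kre \<alpha>" and "b = kim \<alpha>"
  have \<alpha>: "\<alpha> = of_real a + of_real b * kI" unfolding a_def b_def by (rule k_decomp)
  have R: "h (V.Rp (\<alpha> \<odot>\<^bsub>V\<^esub> x)) = W.rs a (h (V.Rp x)) \<ominus>\<^bsub>W\<^esub> W.rs b (h (V.Ip x))"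
  proof -
    have e: "V.Rp (\<alpha> \<odot>\<^bsub>V\<^esub> x) = V.rs a (V.Rp x) \<oplus>\<^bsub>V\<^esub> V.rs (- b) (V.Ip x)"
      unfolding \<alpha> V.Rp_complex[OF x] using x by (intro V.vec_eqI) auto
    show ?thesis unfolding e using x by (intro W.vec_eqI) (auto simp: h_add h_rs)
  qed
  show "linear_extension V W g (\<alpha> \<odot>\<^bsub>V\<^esub> x) = \<alpha> \<odot>\<^bsub>W\<^esub> linear_extension V W g x"
  proof (cases rule: kI_cases[where 'k='k])
    case 1
    have "\<alpha> = of_real a" using \<alpha> 1 by simp
    moreover have "V.Ip x = \<zero>\<^bsub>V\<^esub>" using 1 x V.Rp_real[of "\<zero>\<^bsub>V\<^esub>"] by (simp add: V.Ip_def)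
    ultimately show ?thesis using 1 x R h_Cn[of "\<zero>\<^bsub>V\<^esub>"] unfolding linear_extension_eq
      by (intro W.vec_eqI) auto
  next
    case 2
    have I: "h (V.Ip (\<alpha> \<odot>\<^bsub>V\<^esub> x)) = W.rs a (h (V.Ip x)) \<oplus>\<^bsub>W\<^esub> W.rs b (h (V.Rp x))"
      unfolding \<alpha> V.Ip_complex[OF x 2] using x by (simp add: h_add h_rs)
    show ?thesis unfolding linear_extension_eq R I
    proof (rule W.vec_eqI)
      fix \<phi> assume \<phi>: "\<phi> \<in> functionals W"
      have k: "of_real b * kI * (kI * \<phi> (h (V.Ip x))) = of_real b * (kI * kI) * \<phi> (h (V.Ip x))" by (simp only: mult.assoc)
      have "(of_real a + of_real b * kI) * (\<phi> (h (V.Rp x)) + kI * \<phi> (h (V.Ip x))) =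
        of_real a * \<phi> (h (V.Rp x)) - of_real b * \<phi> (h (V.Ip x)) + kI * (of_real a * \<phi> (h (V.Ip x)) + of_real b * \<phi> (h (V.Rp x)))"
        using k 2 by (simp add: algebra_simps)
      thus "\<phi> ((W.rs a (h (V.Rp x)) \<ominus>\<^bsub>W\<^esub> W.rs b (h (V.Ip x))) \<oplus>\<^bsub>W\<^esub> kI \<odot>\<^bsub>W\<^esub> (W.rs a (h (V.Ip x)) \<oplus>\<^bsub>W\<^esub> W.rs b (h (V.Rp x)))) =
        \<phi> (\<alpha> \<odot>\<^bsub>W\<^esub> (h (V.Rp x) \<oplus>\<^bsub>W\<^esub> kI \<odot>\<^bsub>W\<^esub> h (V.Ip x)))"
        using \<phi> x by (subst \<alpha>) simp
    qed (use x in auto)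
  qed
qed

end

context avl_family
begin

section \<open>Extension from positive tuples, one variable at a time\<close>

definition Sj where "Sj K j = (if j \<in> K then carrier (E j) else pos_cone (E j))"
definition Aj :: "nat set \<Rightarrow> nat \<Rightarrow> 'k set" where "Aj K j = (if j \<in> K then UNIV else of_real ` {0..})"
text \<open>\<open>K\<close> is the set of variables in which linearity on the whole space has been
  reached. In the other variables arguments come from the cone and scalars are nonnegative reals, so
  \<open>mixed {}\<close> are the positive tuples and \<open>mixed I\<close> all tuples.\<close>

definition mixed where "mixed K = (\<Pi>\<^sub>E j\<in>I. Sj K j)"

definition lin_on where
  "lin_on K W \<longleftrightarrow> (\<forall>f\<in>mixed K. W f \<in> carrier F) \<and>
     (\<forall>f\<in>mixed K. \<forall>j\<in>I. \<forall>x\<in>Sj K j. \<forall>y\<in>Sj K j. W (f(j := x \<oplus>\<^bsub>E j\<^esub> y)) = W (f(j := x)) \<oplus>\<^bsub>F\<^esub> W (f(j := y))) \<and>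
     (\<forall>f\<in>mixed K. \<forall>j\<in>I. \<forall>x\<in>Sj K j. \<forall>\<alpha>\<in>Aj K j. W (f(j := \<alpha> \<odot>\<^bsub>E j\<^esub> x)) = \<alpha> \<odot>\<^bsub>F\<^esub> W (f(j := x)))"

lemma mixed_iff: "f \<in> mixed K \<longleftrightarrow> (\<forall>j\<in>I. f j \<in> Sj K j) \<and> f \<in> extensional I"
  by (auto simp: mixed_def PiE_iff)

lemma mixed_upd: "f \<in> mixed K ==> j \<in> I ==> x \<in> Sj K j ==> f(j := x) \<in> mixed K"
  unfolding mixed_iff by (auto simp: extensional_def)

lemma mixed_insert: "f \<in> mixed (insert k K) ==> k \<in> I ==> k \<notin> K ==> x \<in> pos_cone (E k) ==> f(k := x) \<in> mixed K"
  unfolding mixed_iff Sj_def by (auto simp: extensional_def)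

lemma mixed_empty: "mixed {} = PTu" and mixed_I: "mixed I = Tu"
  by (auto simp: mixed_iff PTu_iff Tu_iff Sj_def)

lemma Sj_carrier: "x \<in> Sj K j ==> x \<in> carrier (E j)"
  unfolding Sj_def pos_cone_def by (auto split: if_splits)

lemma mixed_Tu: "mixed K \<subseteq> Tu"
proof
  fix f assume f: "f \<in> mixed K"
  hence "\<forall>j\<in>I. f j \<in> carrier (E j)" using Sj_carrier[of _ K] unfolding mixed_iff by blast
  thus "f \<in> Tu" using f by (simp add: mixed_iff Tu_iff)
qed

text \<open>Carries properties of positive tuples to all tuples. In the step an entry is replaced,
  usually by writing it as a combination of four positive elements.\<close>

lemma tuple_induct [consumes 1, case_names base step]:
  assumes f: "f \<in> Tu" and base: "\<And>a. a \<in> PTu ==> Q a"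
    and step: "\<And>f k x. f \<in> Tu ==> k \<in> I ==> x \<in> carrier (E k) ==> (\<And>y. y \<in> pos_cone (E k) ==> Q (f(k := y))) ==> Q (f(k := x))"
  shows "Q f"
proof -
  have "\<forall>f\<in>mixed K. Q f" if "finite K" "K \<subseteq> I" for K
    using that
  proof (induction K rule: finite_induct)
    case empty thus ?case using base by (simp add: mixed_empty)
  next
    case (insert k K)
    show ?case
    proof
      fix f assume f: "f \<in> mixed (insert k K)"
      have k: "k \<in> I" using insert by auto
      have "Q (f(k := f k))"
      proof (rule step[OF _ k])
        show "f \<in> Tu" using f mixed_Tu by auto
        show "f k \<in> carrier (E k)" using f k by (auto simp: mixed_iff Sj_def)
        show "Q (f(k := y))" if "y \<in> pos_cone (E k)" for y
          using mixed_insert[OF f k _ that] insert by auto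
      qed
      thus "Q f" by simp
    qed
  qed
  from this[of I] f show ?thesis by (simp add: mixed_I)
qed

text \<open>Without variables the condition of multilinearity is vacuous and does not even place the
  values in \<open>F\<close>; hence the exception.\<close>

lemma multilinear_iff: "multilinear_map s E F T \<longleftrightarrow> lin_on I T \<or> I = {}"
proof -
  have "multilinear_map s E F T \<longleftrightarrow> (\<forall>k\<in>I. \<forall>f\<in>Tu. linear_map (E k) F (\<lambda>x. T (f(k := x))))"
    by (simp add: multilinear_map_def I_def)
  also have "... \<longleftrightarrow> lin_on I T \<or> I = {}"
  proof
    assume L: "\<forall>k\<in>I. \<forall>f\<in>Tu. linear_map (E k) F (\<lambda>x. T (f(k := x)))"
    show "lin_on I T \<or> I = {}"
    proof (cases "I = {}")
      case False
      then obtain k where k: "k \<in> I" by auto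
      have "T f \<in> carrier F" if "f \<in> Tu" for f
      proof -
        have "T (f(k := f k)) \<in> carrier F" using L k that unfolding linear_map_def by (auto simp: Tu_iff Pi_iff simp del: fun_upd_triv)
        thus ?thesis by simp
      qed
      thus ?thesis using L unfolding lin_on_def mixed_I linear_map_def Sj_def Aj_def by auto
    qed simp
  next
    assume R: "lin_on I T \<or> I = {}"
    show "\<forall>k\<in>I. \<forall>f\<in>Tu. linear_map (E k) F (\<lambda>x. T (f(k := x)))"
      using R Tu_upd unfolding lin_on_def mixed_I linear_map_def Sj_def Aj_def by auto
  qed
  finally show ?thesis .
qed

text \<open>In variable \<open>k\<close> the extension is linear by construction. In another
  variable linearity survives because the extension is a fixed linear combination of values of
  \<open>W\<close> at tuples whose entry at \<open>k\<close> is positive.\<close>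

lemma lin_on_step:
  assumes L: "lin_on K W" and k: "k \<in> I" "k \<notin> K"
  shows "lin_on (insert k K) (\<lambda>f. linear_extension (E k) F (\<lambda>y. W (f(k := y))) (f k))"
    and "f \<in> mixed K ==> linear_extension (E k) F (\<lambda>y. W (f(k := y))) (f k) = W f"
proof -
  interpret E: avl "E k" using avlE[OF k(1)] .
  have Wcl: "W f \<in> carrier F" if "f \<in> mixed K" for f using L that unfolding lin_on_def by blast
  have cl: "cone_linear (E k) F (\<lambda>y. W (f(k := y)))" if f: "f \<in> mixed (insert k K)" for f
  proof unfold_locales
    have f0: "f(k := \<zero>\<^bsub>E k\<^esub>) \<in> mixed K" using f k by (intro mixed_insert) auto
    have S: "Sj K k = pos_cone (E k)" and A: "Aj K k = of_real ` {0..}" using k by (auto simp: Sj_def Aj_def)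
    fix x assume x: "x \<in> pos_cone (E k)"
    show "W (f(k := x)) \<in> carrier F" using mixed_insert[OF f k x] by (rule Wcl)
    fix y assume y: "y \<in> pos_cone (E k)"
    have "W ((f(k := \<zero>\<^bsub>E k\<^esub>))(k := x \<oplus>\<^bsub>E k\<^esub> y)) = W ((f(k := \<zero>\<^bsub>E k\<^esub>))(k := x)) \<oplus>\<^bsub>F\<^esub> W ((f(k := \<zero>\<^bsub>E k\<^esub>))(k := y))"
      using L f0 k(1) x y S unfolding lin_on_def by blast
    thus "W (f(k := x \<oplus>\<^bsub>E k\<^esub> y)) = W (f(k := x)) \<oplus>\<^bsub>F\<^esub> W (f(k := y))" by simp
  next
    have f0: "f(k := \<zero>\<^bsub>E k\<^esub>) \<in> mixed K" using f k by (intro mixed_insert) auto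
    have S: "Sj K k = pos_cone (E k)" and A: "Aj K k = of_real ` {0..}" using k by (auto simp: Sj_def Aj_def)
    fix x and r :: real assume x: "x \<in> pos_cone (E k)" and r: "0 \<le> r"
    have rA: "of_real r \<in> Aj K k" using r by (simp add: A)
    have "W ((f(k := \<zero>\<^bsub>E k\<^esub>))(k := of_real r \<odot>\<^bsub>E k\<^esub> x)) = of_real r \<odot>\<^bsub>F\<^esub> W ((f(k := \<zero>\<^bsub>E k\<^esub>))(k := x))"
      using L f0 k(1) x[folded S] rA unfolding lin_on_def by blast
    thus "W (f(k := E.rs r x)) = F.rs r (W (f(k := x)))" by (simp add: E.rs_def F.rs_def)
  qed
  show "linear_extension (E k) F (\<lambda>y. W (f(k := y))) (f k) = W f" if f: "f \<in> mixed K"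
  proof -
    have fk: "f k \<in> pos_cone (E k)" using f k by (auto simp: mixed_iff Sj_def)
    have "f \<in> mixed (insert k K)" using f fk unfolding mixed_iff Sj_def by auto
    from cone_linear.linear_extension_Cn[OF cl[OF this] fk] show ?thesis by simp
  qed
  let ?W = "\<lambda>f. linear_extension (E k) F (\<lambda>y. W (f(k := y))) (f k)"
  have clW: "?W f \<in> carrier F" if f: "f \<in> mixed (insert k K)" for f
  proof -
    have "f k \<in> carrier (E k)" using subsetD[OF mixed_Tu f] k(1) by (simp add: Tu_iff)
    thus ?thesis using cone_linear.linear_extension_linear[OF cl[OF f]] unfolding linear_map_def by blast
  qed
  show "lin_on (insert k K) ?W" unfolding lin_on_def
  proof (intro conjI ballI clW)
    fix f j x y assume f: "f \<in> mixed (insert k K)" and j: "j \<in> I" and x: "x \<in> Sj (insert k K) j" and y: "y \<in> Sj (insert k K) j"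
    show "?W (f(j := x \<oplus>\<^bsub>E j\<^esub> y)) = ?W (f(j := x)) \<oplus>\<^bsub>F\<^esub> ?W (f(j := y))"
    proof (cases "j = k")
      case True
      have "linear_map (E k) F (linear_extension (E k) F (\<lambda>z. W (f(k := z))))"
        by (rule cone_linear.linear_extension_linear[OF cl[OF f]])
      thus ?thesis using x y True unfolding linear_map_def by (simp add: Sj_def)
    next
      case False
      hence S: "Sj (insert k K) j = Sj K j" by (auto simp: Sj_def)
      have fk: "f k \<in> carrier (E k)" using f k by (auto simp: mixed_iff Sj_def)
      have 1: "W ((f(j := x \<oplus>\<^bsub>E j\<^esub> y))(k := z)) = W ((f(j := x))(k := z)) \<oplus>\<^bsub>F\<^esub> W ((f(j := y))(k := z))"
        "W ((f(j := x))(k := z)) \<in> carrier F" "W ((f(j := y))(k := z)) \<in> carrier F" if "z \<in> pos_cone (E k)" for z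
      proof -
        have m: "f(k := z) \<in> mixed K" by (rule mixed_insert[OF f k that])
        hence "W ((f(k := z))(j := x \<oplus>\<^bsub>E j\<^esub> y)) = W ((f(k := z))(j := x)) \<oplus>\<^bsub>F\<^esub> W ((f(k := z))(j := y))"
          using L j x y S unfolding lin_on_def by blast
        thus "W ((f(j := x \<oplus>\<^bsub>E j\<^esub> y))(k := z)) = W ((f(j := x))(k := z)) \<oplus>\<^bsub>F\<^esub> W ((f(j := y))(k := z))"
          using False by (simp add: fun_upd_twist)
        show "W ((f(j := x))(k := z)) \<in> carrier F" "W ((f(j := y))(k := z)) \<in> carrier F"
          using Wcl mixed_upd[OF m j] x y S False by (simp_all add: fun_upd_twist)
      qed
      show ?thesis unfolding linear_extension_def using False fk 1
        by (intro F.vec_eqI) (auto simp: algebra_simps)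
    qed
  next
    fix f j x \<alpha> assume f: "f \<in> mixed (insert k K)" and j: "j \<in> I" and x: "x \<in> Sj (insert k K) j" and \<alpha>: "\<alpha> \<in> Aj (insert k K) j"
    show "?W (f(j := \<alpha> \<odot>\<^bsub>E j\<^esub> x)) = \<alpha> \<odot>\<^bsub>F\<^esub> ?W (f(j := x))"
    proof (cases "j = k")
      case True
      have "linear_map (E k) F (linear_extension (E k) F (\<lambda>z. W (f(k := z))))"
        by (rule cone_linear.linear_extension_linear[OF cl[OF f]])
      thus ?thesis using x True unfolding linear_map_def by (simp add: Sj_def)
    next
      case False
      hence S: "Sj (insert k K) j = Sj K j" "Aj (insert k K) j = Aj K j" by (auto simp: Sj_def Aj_def)
      have fk: "f k \<in> carrier (E k)" using f k by (auto simp: mixed_iff Sj_def)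
      have 1: "W ((f(j := \<alpha> \<odot>\<^bsub>E j\<^esub> x))(k := z)) = \<alpha> \<odot>\<^bsub>F\<^esub> W ((f(j := x))(k := z))"
        "W ((f(j := x))(k := z)) \<in> carrier F" if "z \<in> pos_cone (E k)" for z
      proof -
        have m: "f(k := z) \<in> mixed K" by (rule mixed_insert[OF f k that])
        hence "W ((f(k := z))(j := \<alpha> \<odot>\<^bsub>E j\<^esub> x)) = \<alpha> \<odot>\<^bsub>F\<^esub> W ((f(k := z))(j := x))"
          using L j x \<alpha> S unfolding lin_on_def by blast
        thus "W ((f(j := \<alpha> \<odot>\<^bsub>E j\<^esub> x))(k := z)) = \<alpha> \<odot>\<^bsub>F\<^esub> W ((f(j := x))(k := z))"
          using False by (simp add: fun_upd_twist)
        show "W ((f(j := x))(k := z)) \<in> carrier F"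
          using Wcl mixed_upd[OF m j] x S False by (simp_all add: fun_upd_twist)
      qed
      show ?thesis unfolding linear_extension_def using False fk 1
        by (intro F.vec_eqI) (auto simp: algebra_simps)
    qed
  qed
qed

lemma multiadd_homogeneous:
  assumes g: "multiadd g" and a: "a \<in> PTu" and k: "k \<in> I" and x: "x \<in> pos_cone (E k)" and r: "r \<ge> 0"
  shows "g (a(k := of_real r \<odot>\<^bsub>E k\<^esub> x)) = of_real r \<odot>\<^bsub>F\<^esub> g (a(k := x))"
proof -
  interpret E: avl "E k" using avlE[OF k] .
  interpret h: cone_fun "E k" F "\<lambda>x. g (a(k := x))"
    using a k g multiadd_zero[OF g] PTu_upd unfolding multiadd_def by unfold_locales auto
  have "g (a(k := E.rs r x)) = F.rs r (g (a(k := x)))"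
    using g a k x r unfolding multiadd_def by (intro h.positive_homogeneous) auto
  thus ?thesis by (simp add: E.rs_def F.rs_def)
qed

lemma multilinear_extension:
  assumes g: "multiadd g"
  shows "\<exists>U. U \<in> extensional Tu \<and> lin_on I U \<and> (\<forall>a\<in>PTu. U a = g a)"
proof -
  have "\<exists>W. lin_on K W \<and> (\<forall>a\<in>PTu. W a = g a)" if "finite K" "K \<subseteq> I" for K
    using that
  proof (induction K rule: finite_induct)
    case empty
    have "lin_on {} g" using g multiadd_homogeneous[OF g]
      unfolding lin_on_def mixed_empty multiadd_def by (auto simp: Sj_def Aj_def)
    thus ?case by blast
  next
    case (insert k K)
    then obtain W where W: "lin_on K W" "\<forall>a\<in>PTu. W a = g a" by auto
    have k: "k \<in> I" "k \<notin> K" using insert by auto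
    have sub: "PTu \<subseteq> mixed K" unfolding mixed_empty[symmetric] mixed_iff subset_iff Sj_def pos_cone_def by auto
    have "linear_extension (E k) F (\<lambda>y. W (a(k := y))) (a k) = g a" if "a \<in> PTu" for a
      using lin_on_step(2)[OF W(1) k, of a] sub that W(2) by auto
    thus ?case using lin_on_step(1)[OF W(1) k] by blast
  qed
  from this[of I] obtain W where W: "lin_on I W" "\<forall>a\<in>PTu. W a = g a" by auto
  have e: "restrict W Tu f = W f" if "f \<in> Tu" for f using that by simp
  have "lin_on I (restrict W Tu)"
    unfolding lin_on_def mixed_I
  proof (intro conjI ballI)
    fix f j x y assume a: "f \<in> Tu" "j \<in> I" "x \<in> Sj I j" "y \<in> Sj I j"
    interpret E: avl "E j" using avlE[OF a(2)] .
    have "x \<in> carrier (E j)" "y \<in> carrier (E j)" using a by (auto simp: Sj_def)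
    thus "restrict W Tu (f(j := x \<oplus>\<^bsub>E j\<^esub> y)) = restrict W Tu (f(j := x)) \<oplus>\<^bsub>F\<^esub> restrict W Tu (f(j := y))"
      using W(1) a Tu_upd unfolding lin_on_def mixed_I by simp
  next
    fix f j x \<alpha> assume a: "f \<in> Tu" "j \<in> I" "x \<in> Sj I j" "\<alpha> \<in> Aj I j"
    interpret E: avl "E j" using avlE[OF a(2)] .
    have "x \<in> carrier (E j)" using a by (auto simp: Sj_def)
    thus "restrict W Tu (f(j := \<alpha> \<odot>\<^bsub>E j\<^esub> x)) = \<alpha> \<odot>\<^bsub>F\<^esub> restrict W Tu (f(j := x))"
      using W(1) a Tu_upd unfolding lin_on_def mixed_I by simp
  qed (use W(1) in \<open>simp add: lin_on_def mixed_I\<close>)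
  moreover have "restrict W Tu a = g a" if "a \<in> PTu" for a using W(2) PTu_Tu that by simp
  ultimately show ?thesis by (intro exI[of _ "restrict W Tu"]) auto
qed

end

section \<open>The lattice of multilinear maps of order bounded variation\<close>

context avl_family
begin

lemma mlin_cl: "lin_on I T ==> f \<in> Tu ==> T f \<in> carrier F"
  and mlin_add: "lin_on I T ==> f \<in> Tu ==> j \<in> I ==> x \<in> carrier (E j) ==> y \<in> carrier (E j) ==>
    T (f(j := x \<oplus>\<^bsub>E j\<^esub> y)) = T (f(j := x)) \<oplus>\<^bsub>F\<^esub> T (f(j := y))"
  and mlin_smult: "lin_on I T ==> f \<in> Tu ==> j \<in> I ==> x \<in> carrier (E j) ==>
    T (f(j := \<alpha> \<odot>\<^bsub>E j\<^esub> x)) = \<alpha> \<odot>\<^bsub>F\<^esub> T (f(j := x))"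
  unfolding lin_on_def mixed_I Sj_def Aj_def by simp_all

lemma mlin_zero: assumes "lin_on I T" "f \<in> Tu" "j \<in> I" shows "T (f(j := \<zero>\<^bsub>E j\<^esub>)) = \<zero>\<^bsub>F\<^esub>"
proof -
  interpret E: avl "E j" using avlE[OF assms(3)] .
  have "T (f(j := 0 \<odot>\<^bsub>E j\<^esub> \<zero>\<^bsub>E j\<^esub>)) = 0 \<odot>\<^bsub>F\<^esub> T (f(j := \<zero>\<^bsub>E j\<^esub>))" by (rule mlin_smult[OF assms]) simp
  thus ?thesis using mlin_cl[OF assms(1) Tu_upd[OF assms(2,3), of "\<zero>\<^bsub>E j\<^esub>"]] by simp
qed

lemma mlin_four:
  assumes T: "lin_on I T" and f: "f \<in> Tu" and j: "j \<in> I"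
    and c: "a \<in> pos_cone (E j)" "b \<in> pos_cone (E j)" "c \<in> pos_cone (E j)" "d \<in> pos_cone (E j)"
  shows "T (f(j := (a \<ominus>\<^bsub>E j\<^esub> b) \<oplus>\<^bsub>E j\<^esub> kI \<odot>\<^bsub>E j\<^esub> (c \<ominus>\<^bsub>E j\<^esub> d))) =
    (T (f(j := a)) \<ominus>\<^bsub>F\<^esub> T (f(j := b))) \<oplus>\<^bsub>F\<^esub> kI \<odot>\<^bsub>F\<^esub> (T (f(j := c)) \<ominus>\<^bsub>F\<^esub> T (f(j := d)))"
proof -
  interpret E: avl "E j" using avlE[OF j] .
  have cl: "T (f(j := x)) \<in> carrier F" if "x \<in> carrier (E j)" for x using mlin_cl[OF T Tu_upd[OF f j that]] .
  have neg: "T (f(j := \<ominus>\<^bsub>E j\<^esub> x)) = \<ominus>\<^bsub>F\<^esub> T (f(j := x))" if "x \<in> carrier (E j)" for x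
    using mlin_smult[OF T f j that, of "-1"] cl that by (simp add: E.smult_minus1 F.smult_minus1)
  show ?thesis using c cl by (simp add: mlin_add[OF T f j] mlin_smult[OF T f j] neg a_minus_def)
qed

lemma mlin_eqI:
  assumes S: "lin_on I S" and T: "lin_on I T" and eq: "\<And>a. a \<in> PTu ==> S a = T a" and f: "f \<in> Tu"
  shows "S f = T f"
  using f
proof (induction rule: tuple_induct)
  case (step f k x)
  have 1: "S (f(k := y)) = T (f(k := y))" if "y \<in> pos_cone (E k)" for y using step(4)[OF that] .
  obtain a b c d where "a \<in> pos_cone (E k)" "b \<in> pos_cone (E k)" "c \<in> pos_cone (E k)" "d \<in> pos_cone (E k)"
    "x = (a \<ominus>\<^bsub>E k\<^esub> b) \<oplus>\<^bsub>E k\<^esub> kI \<odot>\<^bsub>E k\<^esub> (c \<ominus>\<^bsub>E k\<^esub> d)"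
    using avl.carrier_four[OF avlE[OF step(2)] step(3)] by blast
  hence "S (f(k := x)) = T (f(k := x))" using mlin_four[OF S step(1,2)] mlin_four[OF T step(1,2)] 1 by simp
  thus ?case .
qed (rule eq)

lemma ext_eqI:
  assumes "S \<in> extensional Tu" "T \<in> extensional Tu" "lin_on I S" "lin_on I T" "\<And>a. a \<in> PTu ==> S a = T a"
  shows "S = T"
  using assms mlin_eqI[OF assms(3-5)] by (intro extensionalityI) auto

lemma mlin_subadd: assumes T: "lin_on I T" shows "subadd (\<lambda>a. modulus F (T a))"
  unfolding subadd_def
proof (intro conjI ballI)
  fix a assume a: "a \<in> PTu"
  note aT = PTu_Tu[OF a]
  show "modulus F (T a) \<in> pos_cone F" using mlin_cl[OF T aT] by simp
  fix k assume k: "k \<in> I"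
  interpret E: avl "E k" using avlE[OF k] .
  show "modulus F (T (a(k := \<zero>\<^bsub>E k\<^esub>))) = \<zero>\<^bsub>F\<^esub>" using mlin_zero[OF T aT k] by simp
  fix x y assume "x \<in> pos_cone (E k)" "y \<in> pos_cone (E k)"
  thus "vl_le F (modulus F (T (a(k := x \<oplus>\<^bsub>E k\<^esub> y)))) (modulus F (T (a(k := x))) \<oplus>\<^bsub>F\<^esub> modulus F (T (a(k := y))))"
    using F.am_triangle mlin_cl[OF T Tu_upd[OF aT k]] by (simp add: mlin_add[OF T aT k])
qed

lemma pos_mlin_multiadd: assumes T: "lin_on I T" and pos: "\<And>a. a \<in> PTu ==> T a \<in> pos_cone F" shows "multiadd T"
  unfolding multiadd_def using pos mlin_add[OF T PTu_Tu] avl.CnD[OF avlE] by blast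

lemma variation_sums_eq: "variation_sums s E F T a = (\<lambda>Xs. F.gsum I Xs (\<lambda>y. modulus F (T y))) ` parts a"
  unfolding variation_sums_def F.gsum_def parts_def I_def by blast

lemma variation_sums_Cn: assumes T: "lin_on I T" shows "variation_sums s E F T a \<subseteq> pos_cone F"
  unfolding variation_sums_eq using gsum_good[OF mlin_subadd[OF T] parts_good] by blast

lemma bounded_variation_iff:
  assumes T: "lin_on I T"
  shows "bounded_variation s E F T \<longleftrightarrow> bounded_on (\<lambda>a. modulus F (T a))"
  unfolding bounded_variation_def bounded_on_def[OF mlin_subadd[OF T]]
  by (simp add: F.order_bounded_Cn[OF variation_sums_Cn[OF T, unfolded variation_sums_eq]] variation_sums_eq)

end

locale avl_family_ne = avl_family + assumes s_pos: "s \<ge> 1"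
begin

lemma I_ne: "I \<noteq> {}" using s_pos by (auto simp: I_def)

lemma bv_iff: "T \<in> bv_maps s E F \<longleftrightarrow> T \<in> extensional Tu \<and> lin_on I T \<and> bounded_on (\<lambda>a. modulus F (T a))"
  using bounded_variation_iff I_ne by (auto simp: bv_maps_def multilinear_iff)

lemma bvD: "T \<in> bv_maps s E F ==> lin_on I T" "T \<in> bv_maps s E F ==> T \<in> extensional Tu"
  "T \<in> bv_maps s E F ==> bounded_on (\<lambda>a. modulus F (T a))"
  by (auto simp: bv_iff)

lemma bounded_onI:
  assumes T: "lin_on I T" and "\<And>a. a \<in> PTu ==> b a \<in> pos_cone F"
    "\<And>a Xs. a \<in> PTu ==> Xs \<in> parts a ==> vl_le F (F.gsum I Xs (\<lambda>a. modulus F (T a))) (b a)"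
  shows "bounded_on (\<lambda>a. modulus F (T a))"
  unfolding bounded_on_def[OF mlin_subadd[OF T]] using assms(2,3) by blast

lemma parts_grid: "Xs \<in> parts a ==> y \<in> grid I Xs ==> y \<in> PTu"
  using grid_PTu[of Xs] avl.pos_partitions_iff[OF avlE] unfolding parts_def good_def by blast

text \<open>A positive multilinear map is additive in each variable on the cones, so all its
  variation sums over partitions of \<open>a\<close> equal \<open>T a\<close>; bounded variation is
  automatic.\<close>

lemma pos_bv_iff: "T \<in> pos_bv_maps s E F \<longleftrightarrow> T \<in> extensional Tu \<and> lin_on I T \<and> (\<forall>a\<in>PTu. T a \<in> pos_cone F)"
proof -
  have "bounded_on (\<lambda>a. modulus F (T a))" if T: "lin_on I T" "\<forall>a\<in>PTu. T a \<in> pos_cone F"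
  proof (rule bounded_onI[OF T(1), of T])
    fix a Xs assume a: "a \<in> PTu" "Xs \<in> parts a"
    have "F.gsum I Xs (\<lambda>a. modulus F (T a)) = F.gsum I Xs T"
      using parts_grid[OF a(2)] T(2) F.Cn_am by (intro F.gsum_cong) auto
    also have "... = T a" using gsum_multiadd[OF pos_mlin_multiadd[OF T(1)] a] T(2) by simp
    finally show "vl_le F (F.gsum I Xs (\<lambda>a. modulus F (T a))) (T a)" using T a by simp
  qed (use T in auto)
  thus ?thesis unfolding pos_bv_maps_def by (auto simp: bv_iff)
qed

definition vr where "vr T = var (\<lambda>a. modulus F (T a))"

text \<open>The candidate for the modulus of \<open>T\<close>. The variation \<open>vr T\<close> is
  multiadditive on positive tuples and extends to a multilinear map; the extension is unique because
  a multilinear map is determined by its values there.\<close>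

definition bvm where "bvm T = (SOME U. U \<in> pos_bv_maps s E F \<and> (\<forall>a\<in>PTu. U a = vr T a))"

lemma pos_extension:
  assumes g: "multiadd g" shows "\<exists>U. U \<in> pos_bv_maps s E F \<and> (\<forall>a\<in>PTu. U a = g a)"
proof -
  obtain U where "U \<in> extensional Tu" "lin_on I U" "\<forall>a\<in>PTu. U a = g a" using multilinear_extension[OF g] by auto
  thus ?thesis using g unfolding pos_bv_iff multiadd_def by auto
qed

context
  fixes T assumes T: "T \<in> bv_maps s E F"
begin

lemmas Tsub = mlin_subadd[OF bvD(1)[OF T]]

lemma vr_multiadd: "multiadd (vr T)"
  unfolding vr_def by (rule var_multiadd[OF Tsub bvD(3)[OF T]])

lemma bvm: "bvm T \<in> pos_bv_maps s E F" "a \<in> PTu ==> bvm T a = vr T a"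
proof -
  have "bvm T \<in> pos_bv_maps s E F \<and> (\<forall>a\<in>PTu. bvm T a = vr T a)"
    unfolding bvm_def by (rule someI_ex[OF pos_extension[OF vr_multiadd]])
  thus "bvm T \<in> pos_bv_maps s E F" "a \<in> PTu ==> bvm T a = vr T a" by auto
qed

lemma vr_sup: "a \<in> PTu ==> is_cone_sup F (variation_sums s E F T a) (vr T a)"
  unfolding variation_sums_eq vr_def by (rule var_is_sup[OF Tsub bvD(3)[OF T]])

lemma vr_least: "a \<in> PTu ==> w \<in> pos_cone F ==> (\<And>Xs. Xs \<in> parts a ==> vl_le F (F.gsum I Xs (\<lambda>a. modulus F (T a))) w) ==> vl_le F (vr T a) w"
  unfolding vr_def by (rule var_least[OF Tsub bvD(3)[OF T]])

lemma vr_ge: "a \<in> PTu ==> Xs \<in> parts a ==> vl_le F (F.gsum I Xs (\<lambda>a. modulus F (T a))) (vr T a)"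
  unfolding vr_def by (rule gsum_le_var[OF Tsub bvD(3)[OF T]])

lemma am_le_vr: "a \<in> PTu ==> vl_le F (modulus F (T a)) (vr T a)"
  unfolding vr_def by (rule le_var[OF Tsub bvD(3)[OF T]])

lemma vr_Cn: "a \<in> PTu ==> vr T a \<in> pos_cone F"
  unfolding vr_def by (rule var_Cn[OF Tsub bvD(3)[OF T]])

lemma bv_cl: "f \<in> Tu ==> T f \<in> carrier F" by (rule mlin_cl[OF bvD(1)[OF T]])

lemma bv_gsum_Cn: "Xs \<in> parts a ==> F.gsum I Xs (\<lambda>a. modulus F (T a)) \<in> pos_cone F"
  by (rule gsum_good[OF Tsub parts_good])

lemma bv_grid: "Xs \<in> parts a ==> (\<lambda>a. modulus F (T a)) \<in> grid I Xs \<rightarrow> carrier F"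
  using parts_grid PTu_Tu bv_cl by auto

end

section \<open>The vector space of maps of bounded variation and its modulus\<close>

abbreviation B0 where "B0 \<equiv> pointwise_space Tu (bv_maps s E F) F"

lemma B0_simps [simp]: "carrier B0 = bv_maps s E F" "\<zero>\<^bsub>B0\<^esub> = (\<lambda>x\<in>Tu. \<zero>\<^bsub>F\<^esub>)"
  "S \<oplus>\<^bsub>B0\<^esub> T = (\<lambda>x\<in>Tu. S x \<oplus>\<^bsub>F\<^esub> T x)" "\<alpha> \<odot>\<^bsub>B0\<^esub> T = (\<lambda>x\<in>Tu. \<alpha> \<odot>\<^bsub>F\<^esub> T x)"
  by (simp_all add: pointwise_space_def)

lemma lin_on_add:
  assumes S: "lin_on I S" and T: "lin_on I T" shows "lin_on I (\<lambda>x\<in>Tu. S x \<oplus>\<^bsub>F\<^esub> T x)"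
  unfolding lin_on_def mixed_I
proof (intro conjI ballI)
  fix f assume f: "f \<in> Tu"
  thus "(\<lambda>x\<in>Tu. S x \<oplus>\<^bsub>F\<^esub> T x) f \<in> carrier F" using mlin_cl[OF S] mlin_cl[OF T] by simp
  fix j x assume j: "j \<in> I" and x: "x \<in> Sj I j"
  interpret E: avl "E j" using avlE[OF j] .
  have xc: "x \<in> carrier (E j)" using x by (rule Sj_carrier)
  note c = mlin_cl[OF S Tu_upd[OF f j]] mlin_cl[OF T Tu_upd[OF f j]]
  show "(\<lambda>x\<in>Tu. S x \<oplus>\<^bsub>F\<^esub> T x) (f(j := x \<oplus>\<^bsub>E j\<^esub> y)) = (\<lambda>x\<in>Tu. S x \<oplus>\<^bsub>F\<^esub> T x) (f(j := x)) \<oplus>\<^bsub>F\<^esub> (\<lambda>x\<in>Tu. S x \<oplus>\<^bsub>F\<^esub> T x) (f(j := y))"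
    if "y \<in> Sj I j" for y
    using xc Sj_carrier[OF that] c Tu_upd[OF f j]
    by (simp add: mlin_add[OF S f j] mlin_add[OF T f j] F.M.add.m_ac)
  show "(\<lambda>x\<in>Tu. S x \<oplus>\<^bsub>F\<^esub> T x) (f(j := \<alpha> \<odot>\<^bsub>E j\<^esub> x)) = \<alpha> \<odot>\<^bsub>F\<^esub> (\<lambda>x\<in>Tu. S x \<oplus>\<^bsub>F\<^esub> T x) (f(j := x))" for \<alpha>
    using xc c Tu_upd[OF f j]
    by (simp add: mlin_smult[OF S f j] mlin_smult[OF T f j] F.smult_r_distr)
qed

lemma lin_on_smult:
  assumes T: "lin_on I T" shows "lin_on I (\<lambda>x\<in>Tu. \<beta> \<odot>\<^bsub>F\<^esub> T x)"
  unfolding lin_on_def mixed_I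
proof (intro conjI ballI)
  fix f assume f: "f \<in> Tu"
  thus "(\<lambda>x\<in>Tu. \<beta> \<odot>\<^bsub>F\<^esub> T x) f \<in> carrier F" using mlin_cl[OF T] by simp
  fix j x assume j: "j \<in> I" and x: "x \<in> Sj I j"
  interpret E: avl "E j" using avlE[OF j] .
  have xc: "x \<in> carrier (E j)" using x by (rule Sj_carrier)
  note c = mlin_cl[OF T Tu_upd[OF f j]]
  show "(\<lambda>x\<in>Tu. \<beta> \<odot>\<^bsub>F\<^esub> T x) (f(j := x \<oplus>\<^bsub>E j\<^esub> y)) = (\<lambda>x\<in>Tu. \<beta> \<odot>\<^bsub>F\<^esub> T x) (f(j := x)) \<oplus>\<^bsub>F\<^esub> (\<lambda>x\<in>Tu. \<beta> \<odot>\<^bsub>F\<^esub> T x) (f(j := y))"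
    if "y \<in> Sj I j" for y
    using xc Sj_carrier[OF that] c Tu_upd[OF f j]
    by (simp add: mlin_add[OF T f j] F.smult_r_distr)
  show "(\<lambda>x\<in>Tu. \<beta> \<odot>\<^bsub>F\<^esub> T x) (f(j := \<alpha> \<odot>\<^bsub>E j\<^esub> x)) = \<alpha> \<odot>\<^bsub>F\<^esub> (\<lambda>x\<in>Tu. \<beta> \<odot>\<^bsub>F\<^esub> T x) (f(j := x))" for \<alpha>
    using xc c Tu_upd[OF f j]
    by (simp add: mlin_smult[OF T f j] mult.commute)
qed

lemma gsum_am_add_le:
  assumes S: "S \<in> bv_maps s E F" and T: "T \<in> bv_maps s E F" and a: "a \<in> PTu" "Xs \<in> parts a"
  shows "vl_le F (F.gsum I Xs (\<lambda>a. modulus F ((\<lambda>x\<in>Tu. S x \<oplus>\<^bsub>F\<^esub> T x) a))) (vr S a \<oplus>\<^bsub>F\<^esub> vr T a)"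
proof -
  have g: "y \<in> Tu" if "y \<in> grid I Xs" for y using parts_grid[OF a(2) that] PTu_Tu by auto
  note c = bv_cl[OF S] bv_cl[OF T]
  have "vl_le F (F.gsum I Xs (\<lambda>a. modulus F ((\<lambda>x\<in>Tu. S x \<oplus>\<^bsub>F\<^esub> T x) a)))
     (F.gsum I Xs (\<lambda>a. modulus F (S a) \<oplus>\<^bsub>F\<^esub> modulus F (T a)))"
    using g c F.am_triangle by (intro F.gsum_mono) auto
  also have "F.gsum I Xs (\<lambda>a. modulus F (S a) \<oplus>\<^bsub>F\<^esub> modulus F (T a)) =
     F.gsum I Xs (\<lambda>a. modulus F (S a)) \<oplus>\<^bsub>F\<^esub> F.gsum I Xs (\<lambda>a. modulus F (T a))"
    by (rule F.gsum_add[OF bv_grid[OF S a(2)] bv_grid[OF T a(2)]])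
  finally have 1: "vl_le F (F.gsum I Xs (\<lambda>a. modulus F ((\<lambda>x\<in>Tu. S x \<oplus>\<^bsub>F\<^esub> T x) a)))
     (F.gsum I Xs (\<lambda>a. modulus F (S a)) \<oplus>\<^bsub>F\<^esub> F.gsum I Xs (\<lambda>a. modulus F (T a)))" .
  have "(\<lambda>a. modulus F ((\<lambda>x\<in>Tu. S x \<oplus>\<^bsub>F\<^esub> T x) a)) \<in> grid I Xs \<rightarrow> carrier F" using g c by auto
  note c2 = F.gsum_cl[OF this] F.CnD[OF bv_gsum_Cn[OF S a(2)]] F.CnD[OF bv_gsum_Cn[OF T a(2)]] F.CnD[OF vr_Cn[OF S a(1)]] F.CnD[OF vr_Cn[OF T a(1)]]
  show ?thesis
    by (rule F.le_trans[OF 1 F.le_add[OF vr_ge[OF S a] vr_ge[OF T a]]]) (use c2 in simp_all)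
qed

lemma gsum_am_smult:
  assumes T: "T \<in> bv_maps s E F" and a: "Xs \<in> parts a"
  shows "F.gsum I Xs (\<lambda>a. modulus F ((\<lambda>x\<in>Tu. \<alpha> \<odot>\<^bsub>F\<^esub> T x) a)) = F.rs (norm \<alpha>) (F.gsum I Xs (\<lambda>a. modulus F (T a)))"
proof -
  have g: "y \<in> Tu" if "y \<in> grid I Xs" for y using parts_grid[OF a that] PTu_Tu by auto
  note c = bv_cl[OF T]
  have "F.gsum I Xs (\<lambda>a. modulus F ((\<lambda>x\<in>Tu. \<alpha> \<odot>\<^bsub>F\<^esub> T x) a)) = F.gsum I Xs (\<lambda>a. of_real (norm \<alpha>) \<odot>\<^bsub>F\<^esub> modulus F (T a))"
    using g c by (intro F.gsum_cong) (auto simp: F.modulus_smult)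
  also have "... = F.rs (norm \<alpha>) (F.gsum I Xs (\<lambda>a. modulus F (T a)))"
    unfolding F.rs_def by (rule F.gsum_smult[OF bv_grid[OF T a]])
  finally show ?thesis .
qed

lemma bv_add: assumes S: "S \<in> bv_maps s E F" and T: "T \<in> bv_maps s E F"
  shows "(\<lambda>x\<in>Tu. S x \<oplus>\<^bsub>F\<^esub> T x) \<in> bv_maps s E F"
  unfolding bv_iff
proof (intro conjI)
  show L: "lin_on I (\<lambda>x\<in>Tu. S x \<oplus>\<^bsub>F\<^esub> T x)" using bvD(1) S T by (intro lin_on_add)
  show "bounded_on (\<lambda>a. modulus F ((\<lambda>x\<in>Tu. S x \<oplus>\<^bsub>F\<^esub> T x) a))"
    by (rule bounded_onI[OF L, of "\<lambda>a. vr S a \<oplus>\<^bsub>F\<^esub> vr T a"]) (use vr_Cn[OF S] vr_Cn[OF T] gsum_am_add_le[OF S T] in auto)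
qed simp

lemma bv_smult: assumes T: "T \<in> bv_maps s E F" shows "(\<lambda>x\<in>Tu. \<alpha> \<odot>\<^bsub>F\<^esub> T x) \<in> bv_maps s E F"
  unfolding bv_iff
proof (intro conjI)
  show L: "lin_on I (\<lambda>x\<in>Tu. \<alpha> \<odot>\<^bsub>F\<^esub> T x)" using bvD(1) T by (intro lin_on_smult)
  show "bounded_on (\<lambda>a. modulus F ((\<lambda>x\<in>Tu. \<alpha> \<odot>\<^bsub>F\<^esub> T x) a))"
  proof (rule bounded_onI[OF L, of "\<lambda>a. F.rs (norm \<alpha>) (vr T a)"])
    fix a Xs assume a: "a \<in> PTu" "Xs \<in> parts a"
    show "vl_le F (F.gsum I Xs (\<lambda>a. modulus F ((\<lambda>x\<in>Tu. \<alpha> \<odot>\<^bsub>F\<^esub> T x) a))) (F.rs (norm \<alpha>) (vr T a))"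
      unfolding gsum_am_smult[OF T a(2)]
      using vr_ge[OF T a] bv_gsum_Cn[OF T a(2)] vr_Cn[OF T a(1)] by (intro F.le_smult) auto
  qed (use vr_Cn[OF T] in auto)
qed simp

lemma pos_bv: "T \<in> pos_bv_maps s E F ==> T \<in> bv_maps s E F"
  and pos_bv_Cn: "T \<in> pos_bv_maps s E F ==> a \<in> PTu ==> T a \<in> pos_cone F"
  unfolding pos_bv_maps_def by auto

lemma bv_eqI: "S \<in> bv_maps s E F ==> T \<in> bv_maps s E F ==> (\<And>a. a \<in> PTu ==> S a = T a) ==> S = T"
  by (intro ext_eqI bvD)

lemma zero_pos_bv: "(\<lambda>x\<in>Tu. \<zero>\<^bsub>F\<^esub>) \<in> pos_bv_maps s E F"
proof -
  have "lin_on I (\<lambda>x\<in>Tu. \<zero>\<^bsub>F\<^esub>)"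
    unfolding lin_on_def mixed_I
  proof (intro conjI ballI)
    fix f j x y assume a: "f \<in> Tu" "j \<in> I" "x \<in> Sj I j" "y \<in> Sj I j"
    interpret E: avl "E j" using avlE[OF a(2)] .
    show "(\<lambda>x\<in>Tu. \<zero>\<^bsub>F\<^esub>) (f(j := x \<oplus>\<^bsub>E j\<^esub> y)) = (\<lambda>x\<in>Tu. \<zero>\<^bsub>F\<^esub>) (f(j := x)) \<oplus>\<^bsub>F\<^esub> (\<lambda>x\<in>Tu. \<zero>\<^bsub>F\<^esub>) (f(j := y))"
      using a Sj_carrier Tu_upd[OF a(1,2)] by simp
  next
    fix f j x \<alpha> assume a: "f \<in> Tu" "j \<in> I" "x \<in> Sj I j"
    interpret E: avl "E j" using avlE[OF a(2)] .
    show "(\<lambda>x\<in>Tu. \<zero>\<^bsub>F\<^esub>) (f(j := \<alpha> \<odot>\<^bsub>E j\<^esub> x)) = \<alpha> \<odot>\<^bsub>F\<^esub> (\<lambda>x\<in>Tu. \<zero>\<^bsub>F\<^esub>) (f(j := x))"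
      using a Sj_carrier Tu_upd[OF a(1,2)] by simp
  qed simp
  thus ?thesis using PTu_Tu by (auto simp: pos_bv_iff)
qed

lemma B0_kmodule: "kmodule B0"
proof (rule kmoduleI)
  note c = bv_cl
  show "\<zero>\<^bsub>B0\<^esub> \<in> carrier B0" using pos_bv[OF zero_pos_bv] by simp
  fix x y z \<alpha> \<beta> assume x: "x \<in> carrier B0"
  hence xe: "x \<in> extensional Tu" by (simp add: bv_iff)
  show "\<alpha> \<odot>\<^bsub>B0\<^esub> x \<in> carrier B0" using x bv_smult by simp
  show "\<zero>\<^bsub>B0\<^esub> \<oplus>\<^bsub>B0\<^esub> x = x" "1 \<odot>\<^bsub>B0\<^esub> x = x" "(-1) \<odot>\<^bsub>B0\<^esub> x \<oplus>\<^bsub>B0\<^esub> x = \<zero>\<^bsub>B0\<^esub>"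
    using x xe c by (auto intro!: extensionalityI[of _ Tu] simp: F.smult_minus1 F.M.l_neg)
  show "(\<alpha> + \<beta>) \<odot>\<^bsub>B0\<^esub> x = \<alpha> \<odot>\<^bsub>B0\<^esub> x \<oplus>\<^bsub>B0\<^esub> \<beta> \<odot>\<^bsub>B0\<^esub> x" "(\<alpha> * \<beta>) \<odot>\<^bsub>B0\<^esub> x = \<alpha> \<odot>\<^bsub>B0\<^esub> (\<beta> \<odot>\<^bsub>B0\<^esub> x)"
    using x xe c by (auto intro!: extensionalityI[of _ Tu] simp: F.smult_add_left)
  assume y: "y \<in> carrier B0"
  show "x \<oplus>\<^bsub>B0\<^esub> y \<in> carrier B0" using x y bv_add by simp
  show "x \<oplus>\<^bsub>B0\<^esub> y = y \<oplus>\<^bsub>B0\<^esub> x" "\<alpha> \<odot>\<^bsub>B0\<^esub> (x \<oplus>\<^bsub>B0\<^esub> y) = \<alpha> \<odot>\<^bsub>B0\<^esub> x \<oplus>\<^bsub>B0\<^esub> \<alpha> \<odot>\<^bsub>B0\<^esub> y"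
    using x y c by (auto intro!: extensionalityI[of _ Tu] simp: F.smult_r_distr F.M.add.m_comm)
  assume z: "z \<in> carrier B0"
  show "x \<oplus>\<^bsub>B0\<^esub> y \<oplus>\<^bsub>B0\<^esub> z = x \<oplus>\<^bsub>B0\<^esub> (y \<oplus>\<^bsub>B0\<^esub> z)"
    using x y z c by (auto intro!: extensionalityI[of _ Tu] simp: F.M.add.m_assoc)
qed

lemma B0_minus: assumes "S \<in> bv_maps s E F" "T \<in> bv_maps s E F" "f \<in> Tu"
  shows "(S \<ominus>\<^bsub>B0\<^esub> T) f = S f \<ominus>\<^bsub>F\<^esub> T f"
proof -
  interpret B: kmodule B0 by (rule B0_kmodule)
  have "\<ominus>\<^bsub>B0\<^esub> T = (-1) \<odot>\<^bsub>B0\<^esub> T" using B.smult_minus1[of T] assms by simp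
  thus ?thesis using assms bv_cl by (simp add: a_minus_def F.smult_minus1)
qed

lemma am_bvm_smult: assumes T: "T \<in> bv_maps s E F"
  shows "bvm (\<alpha> \<odot>\<^bsub>B0\<^esub> T) = of_real (norm \<alpha>) \<odot>\<^bsub>B0\<^esub> bvm T"
proof (rule bv_eqI)
  let ?S = "\<lambda>x\<in>Tu. \<alpha> \<odot>\<^bsub>F\<^esub> T x"
  have S: "?S \<in> bv_maps s E F" by (rule bv_smult[OF T])
  show "bvm (\<alpha> \<odot>\<^bsub>B0\<^esub> T) \<in> bv_maps s E F" using bvm(1)[OF S] pos_bv by simp
  show "of_real (norm \<alpha>) \<odot>\<^bsub>B0\<^esub> bvm T \<in> bv_maps s E F" using bv_smult[OF pos_bv[OF bvm(1)[OF T]]] by simp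
  fix a assume a: "a \<in> PTu"
  have C: "vr ?S a \<in> pos_cone F" "vr T a \<in> pos_cone F" using vr_Cn[OF S a] vr_Cn[OF T a] by auto
  have "vr ?S a = F.rs (norm \<alpha>) (vr T a)"
  proof (rule F.le_antisym)
    show "vl_le F (vr ?S a) (F.rs (norm \<alpha>) (vr T a))"
    proof (rule vr_least[OF S a])
      fix Xs assume X: "Xs \<in> parts a"
      show "vl_le F (F.gsum I Xs (\<lambda>a. modulus F (?S a))) (F.rs (norm \<alpha>) (vr T a))"
        unfolding gsum_am_smult[OF T X] using vr_ge[OF T a X] bv_gsum_Cn[OF T X] C by (intro F.le_smult) auto
    qed (use C in simp)
    show "vl_le F (F.rs (norm \<alpha>) (vr T a)) (vr ?S a)"
    proof (cases "norm \<alpha> = 0")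
      case True thus ?thesis using C by (simp add: F.zero_le)
    next
      case False
      hence n: "norm \<alpha> > 0" by simp
      have "vl_le F (vr T a) (F.rs (1 / norm \<alpha>) (vr ?S a))"
      proof (rule vr_least[OF T a])
        fix Xs assume X: "Xs \<in> parts a"
        have "vl_le F (F.rs (1 / norm \<alpha>) (F.gsum I Xs (\<lambda>a. modulus F (?S a)))) (F.rs (1 / norm \<alpha>) (vr ?S a))"
          using vr_ge[OF S a X] n C bv_gsum_Cn[OF S X] by (intro F.le_smult) auto
        thus "vl_le F (F.gsum I Xs (\<lambda>a. modulus F (T a))) (F.rs (1 / norm \<alpha>) (vr ?S a))"
          unfolding gsum_am_smult[OF T X] using n bv_gsum_Cn[OF T X] by simp
      qed (use C n in simp)
      hence "vl_le F (F.rs (norm \<alpha>) (vr T a)) (F.rs (norm \<alpha>) (F.rs (1 / norm \<alpha>) (vr ?S a)))"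
        using C by (intro F.le_smult) auto
      thus ?thesis using n C by simp
    qed
  qed (use C in auto)
  thus "bvm (\<alpha> \<odot>\<^bsub>B0\<^esub> T) a = (of_real (norm \<alpha>) \<odot>\<^bsub>B0\<^esub> bvm T) a"
    using bvm(2)[OF S a] bvm(2)[OF T a] PTu_Tu[OF a] by (simp add: F.rs_def)
qed

lemma bvm_pos: assumes T: "T \<in> pos_bv_maps s E F" shows "bvm T = T"
proof (rule bv_eqI)
  note Tb = pos_bv[OF T]
  show "bvm T \<in> bv_maps s E F" "T \<in> bv_maps s E F" using bvm(1)[OF Tb] pos_bv Tb by auto
  have m: "multiadd T" using pos_mlin_multiadd[OF bvD(1)[OF Tb]] pos_bv_Cn[OF T] by blast
  fix a assume a: "a \<in> PTu"
  have "F.gsum I Xs (\<lambda>a. modulus F (T a)) = T a" if X: "Xs \<in> parts a" for Xs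
  proof -
    have "F.gsum I Xs (\<lambda>a. modulus F (T a)) = F.gsum I Xs T"
      using parts_grid[OF X] pos_bv_Cn[OF T] F.Cn_am by (intro F.gsum_cong) auto
    thus ?thesis using gsum_multiadd[OF m a X] by simp
  qed
  hence "vl_le F (vr T a) (T a)" using pos_bv_Cn[OF T a] by (intro vr_least[OF Tb a]) auto
  moreover have "vl_le F (T a) (vr T a)" using am_le_vr[OF Tb a] pos_bv_Cn[OF T a] by (simp add: F.Cn_am)
  ultimately show "bvm T a = T a" using bvm(2)[OF Tb a] vr_Cn[OF Tb a] pos_bv_Cn[OF T a] by (intro F.le_antisym) auto
qed

lemma pos_bv_minusI:
  assumes "S \<in> bv_maps s E F" "T \<in> bv_maps s E F" "\<And>a. a \<in> PTu ==> vl_le F (T a) (S a)"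
  shows "S \<ominus>\<^bsub>B0\<^esub> T \<in> pos_bv_maps s E F"
proof -
  interpret B: kmodule B0 by (rule B0_kmodule)
  have "S \<ominus>\<^bsub>B0\<^esub> T \<in> bv_maps s E F" using assms B.cl(3)[of S T] by simp
  moreover have "(S \<ominus>\<^bsub>B0\<^esub> T) a \<in> pos_cone F" if "a \<in> PTu" for a
    using B0_minus[OF assms(1,2) PTu_Tu[OF that]] F.leD[OF assms(3)[OF that]] by simp
  ultimately show ?thesis by (auto simp: pos_bv_maps_def)
qed

text \<open>On positive tuples the variation dominates the modulus of \<open>T\<close>, so adding it
  to the real or imaginary part of \<open>T\<close> gives positive multiadditive functions.
  Subtracting \<open>bvm T\<close> from their extensions recovers \<open>T\<close>.\<close>

lemma bv_four: assumes T: "T \<in> bv_maps s E F"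
  shows "\<exists>a\<in>pos_bv_maps s E F. \<exists>b\<in>pos_bv_maps s E F. \<exists>c\<in>pos_bv_maps s E F. \<exists>d\<in>pos_bv_maps s E F.
    T = (a \<ominus>\<^bsub>B0\<^esub> b) \<oplus>\<^bsub>B0\<^esub> kI \<odot>\<^bsub>B0\<^esub> (c \<ominus>\<^bsub>B0\<^esub> d)"
proof -
  interpret B: kmodule B0 by (rule B0_kmodule)
  note L = bvD(1)[OF T] and c = bv_cl[OF T]
  \<comment> \<open>Stated for a general \<open>p\<close>, to be used with the real and with the
    imaginary part in \<open>F\<close>; both are additive and do not increase the modulus.\<close>
  have m: "multiadd (\<lambda>a. vr T a \<oplus>\<^bsub>F\<^esub> p (T a))"
    if p: "\<And>x. x \<in> carrier F ==> p x \<in> F.Rl" "\<And>x y. x \<in> carrier F ==> y \<in> carrier F ==> p (x \<oplus>\<^bsub>F\<^esub> y) = p x \<oplus>\<^bsub>F\<^esub> p y"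
      "\<And>x. x \<in> carrier F ==> vl_le F (modulus F (p x)) (modulus F x)" for p
    unfolding multiadd_def
  proof (intro conjI ballI)
    fix a assume a: "a \<in> PTu"
    note Ta = c[OF PTu_Tu[OF a]]
    have "vl_le F (modulus F (p (T a))) (vr T a)"
      by (rule F.le_trans[OF p(3)[OF Ta] am_le_vr[OF T a]]) (use p(1)[OF Ta] Ta vr_Cn[OF T a] in auto)
    hence "vl_le F (\<ominus>\<^bsub>F\<^esub> p (T a)) (vr T a)"
      using F.le_trans[OF F.neg_le_am[OF p(1)[OF Ta]]] p(1)[OF Ta] vr_Cn[OF T a] by simp
    from F.leD[OF this] show "vr T a \<oplus>\<^bsub>F\<^esub> p (T a) \<in> pos_cone F"
      using p(1)[OF Ta] vr_Cn[OF T a] by - (rule F.Cn_by[of "vr T a \<ominus>\<^bsub>F\<^esub> \<ominus>\<^bsub>F\<^esub> p (T a)"]; simp)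
    fix k x y assume k: "k \<in> I" and xy: "x \<in> pos_cone (E k)" "y \<in> pos_cone (E k)"
    interpret E: avl "E k" using avlE[OF k] .
    have 1: "vr T (a(k := x \<oplus>\<^bsub>E k\<^esub> y)) = vr T (a(k := x)) \<oplus>\<^bsub>F\<^esub> vr T (a(k := y))"
      using vr_multiadd[OF T] a k xy unfolding multiadd_def by blast
    have 2: "T (a(k := x \<oplus>\<^bsub>E k\<^esub> y)) = T (a(k := x)) \<oplus>\<^bsub>F\<^esub> T (a(k := y))"
      using mlin_add[OF L PTu_Tu[OF a] k] xy by simp
    note P = PTu_upd[OF a k xy(1)] PTu_upd[OF a k xy(2)]
    note C = vr_Cn[OF T P(1)] vr_Cn[OF T P(2)] c[OF PTu_Tu[OF P(1)]] c[OF PTu_Tu[OF P(2)]]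
    show "vr T (a(k := x \<oplus>\<^bsub>E k\<^esub> y)) \<oplus>\<^bsub>F\<^esub> p (T (a(k := x \<oplus>\<^bsub>E k\<^esub> y))) =
      (vr T (a(k := x)) \<oplus>\<^bsub>F\<^esub> p (T (a(k := x)))) \<oplus>\<^bsub>F\<^esub> (vr T (a(k := y)) \<oplus>\<^bsub>F\<^esub> p (T (a(k := y))))"
      unfolding 1 2 using C p(1)[OF C(3)] p(1)[OF C(4)] p(2)[OF C(3,4)] by (intro F.vec_eqI) auto
  qed
  obtain A where A: "A \<in> pos_bv_maps s E F" "\<forall>a\<in>PTu. A a = vr T a \<oplus>\<^bsub>F\<^esub> F.Rp (T a)"
    using pos_extension[OF m[of F.Rp]] F.Rp_add F.am_Rp_le by auto
  obtain A' where A': "A' \<in> pos_bv_maps s E F" "\<forall>a\<in>PTu. A' a = vr T a \<oplus>\<^bsub>F\<^esub> F.Ip (T a)"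
    using pos_extension[OF m[of F.Ip]] F.Ip_add F.am_Ip_le by auto
  note M = bvm(1)[OF T]
  have "T = (A \<ominus>\<^bsub>B0\<^esub> bvm T) \<oplus>\<^bsub>B0\<^esub> kI \<odot>\<^bsub>B0\<^esub> (A' \<ominus>\<^bsub>B0\<^esub> bvm T)"
  proof (rule bv_eqI[OF T])
    have cl: "A \<ominus>\<^bsub>B0\<^esub> bvm T \<in> carrier B0" "A' \<ominus>\<^bsub>B0\<^esub> bvm T \<in> carrier B0"
      using pos_bv[OF A(1)] pos_bv[OF A'(1)] pos_bv[OF M] by (intro B.cl; simp)+
    thus "(A \<ominus>\<^bsub>B0\<^esub> bvm T) \<oplus>\<^bsub>B0\<^esub> kI \<odot>\<^bsub>B0\<^esub> (A' \<ominus>\<^bsub>B0\<^esub> bvm T) \<in> bv_maps s E F"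
      using B.cl(2)[OF cl(1) B.cl(5)[OF cl(2)]] by simp
    fix a assume a: "a \<in> PTu"
    have aT: "a \<in> Tu" using a by (rule PTu_Tu)
    have e: "((A \<ominus>\<^bsub>B0\<^esub> bvm T) \<oplus>\<^bsub>B0\<^esub> kI \<odot>\<^bsub>B0\<^esub> (A' \<ominus>\<^bsub>B0\<^esub> bvm T)) a =
       (A a \<ominus>\<^bsub>F\<^esub> bvm T a) \<oplus>\<^bsub>F\<^esub> kI \<odot>\<^bsub>F\<^esub> (A' a \<ominus>\<^bsub>F\<^esub> bvm T a)"
      using aT by (simp add: B0_minus pos_bv[OF A(1)] pos_bv[OF A'(1)] pos_bv[OF M])
    show "T a = ((A \<ominus>\<^bsub>B0\<^esub> bvm T) \<oplus>\<^bsub>B0\<^esub> kI \<odot>\<^bsub>B0\<^esub> (A' \<ominus>\<^bsub>B0\<^esub> bvm T)) a"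
      unfolding e using A(2) A'(2) a bvm(2)[OF T a] vr_Cn[OF T a] c[OF aT]
      by (intro F.vec_eqI) (auto simp: F.fun_Rp_Ip[of _ "T a"])
  qed
  thus ?thesis using A(1) A'(1) M by blast
qed

definition bvmod where "bvmod = restrict bvm (bv_maps s E F)"

lemma bv_structure:
  "archimedean_vector_lattice (attach_modulus B0 bvmod)" "pos_cone (attach_modulus B0 bvmod) = pos_bv_maps s E F"
proof -
  interpret B: kmodule B0 by (rule B0_kmodule)
  note ax = archimedean_vector_lattice_attachI[OF B0_kmodule, of "pos_bv_maps s E F" bvmod]
  have P: "pos_bv_maps s E F \<subseteq> carrier B0" using pos_bv by auto
  have 1: "bvmod x \<in> pos_bv_maps s E F" if "x \<in> carrier B0" for x using bvm(1) that by (simp add: bvmod_def)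
  have 2: "bvmod x = x" if "x \<in> pos_bv_maps s E F" for x using bvm_pos[OF that] pos_bv[OF that] by (simp add: bvmod_def)
  have 3: "x \<oplus>\<^bsub>B0\<^esub> y \<in> pos_bv_maps s E F" if "x \<in> pos_bv_maps s E F" "y \<in> pos_bv_maps s E F" for x y
    using that bv_add[OF pos_bv[OF that(1)] pos_bv[OF that(2)]] PTu_Tu
      pos_bv_Cn[OF that(1)] pos_bv_Cn[OF that(2)] by (auto simp: pos_bv_maps_def)
  have 4: "bvmod (\<alpha> \<odot>\<^bsub>B0\<^esub> x) = of_real (norm \<alpha>) \<odot>\<^bsub>B0\<^esub> bvmod x" if "x \<in> carrier B0" for \<alpha> x
    using am_bvm_smult[of x \<alpha>] bv_smult[of x \<alpha>] that by (simp add: bvmod_def)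
  have 5: "bvmod x \<oplus>\<^bsub>B0\<^esub> bvmod y \<ominus>\<^bsub>B0\<^esub> bvmod (x \<oplus>\<^bsub>B0\<^esub> y) \<in> pos_bv_maps s E F" if "x \<in> carrier B0" "y \<in> carrier B0" for x y
  proof (rule pos_bv_minusI)
    have xy: "x \<in> bv_maps s E F" "y \<in> bv_maps s E F" using that by auto
    note xy' = bv_add[OF xy]
    show "bvmod x \<oplus>\<^bsub>B0\<^esub> bvmod y \<in> bv_maps s E F" "bvmod (x \<oplus>\<^bsub>B0\<^esub> y) \<in> bv_maps s E F"
      using 3 1[OF that(1)] 1[OF that(2)] 1[of "x \<oplus>\<^bsub>B0\<^esub> y"] that pos_bv xy' by (simp_all only: B0_simps)
    fix a assume a: "a \<in> PTu"
    have "vl_le F (vr (\<lambda>z\<in>Tu. x z \<oplus>\<^bsub>F\<^esub> y z) a) (vr x a \<oplus>\<^bsub>F\<^esub> vr y a)"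
      by (rule vr_least[OF xy' a]) (use vr_Cn[OF xy(1) a] vr_Cn[OF xy(2) a] gsum_am_add_le[OF xy a] in auto)
    thus "vl_le F (bvmod (x \<oplus>\<^bsub>B0\<^esub> y) a) ((bvmod x \<oplus>\<^bsub>B0\<^esub> bvmod y) a)"
      using xy xy' PTu_Tu[OF a] by (simp add: bvmod_def bvm(2)[OF _ a])
  qed
  have 6: "\<exists>a\<in>pos_bv_maps s E F. \<exists>b\<in>pos_bv_maps s E F. \<exists>c\<in>pos_bv_maps s E F. \<exists>d\<in>pos_bv_maps s E F.
    x = (a \<ominus>\<^bsub>B0\<^esub> b) \<oplus>\<^bsub>B0\<^esub> kI \<odot>\<^bsub>B0\<^esub> (c \<ominus>\<^bsub>B0\<^esub> d)" if "x \<in> carrier B0" for x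
    using bv_four that by (simp only: B0_simps(1))
  have 7: "f = \<zero>\<^bsub>B0\<^esub>" if fg: "f \<in> pos_bv_maps s E F" "g \<in> pos_bv_maps s E F" "\<And>n::nat. g \<ominus>\<^bsub>B0\<^esub> of_nat n \<odot>\<^bsub>B0\<^esub> f \<in> pos_bv_maps s E F" for f g
  proof (rule bv_eqI)
    show "f \<in> bv_maps s E F" "\<zero>\<^bsub>B0\<^esub> \<in> bv_maps s E F" using pos_bv[OF fg(1)] pos_bv[OF zero_pos_bv] by simp_all
    fix a assume a: "a \<in> PTu"
    have "f a = \<zero>\<^bsub>F\<^esub>"
    proof (rule F.archimedean_Cn[of _ "g a"])
      fix n :: nat
      have "(g \<ominus>\<^bsub>B0\<^esub> of_nat n \<odot>\<^bsub>B0\<^esub> f) a \<in> pos_cone F" by (rule pos_bv_Cn[OF fg(3) a])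
      moreover have "of_nat n \<odot>\<^bsub>B0\<^esub> f \<in> bv_maps s E F" using bv_smult[OF pos_bv[OF fg(1)]] by simp
      ultimately have "g a \<ominus>\<^bsub>F\<^esub> of_nat n \<odot>\<^bsub>F\<^esub> f a \<in> pos_cone F"
        using B0_minus[OF pos_bv[OF fg(2)], of "of_nat n \<odot>\<^bsub>B0\<^esub> f" a] PTu_Tu[OF a] by simp
      thus "vl_le F (F.rs (real n) (f a)) (g a)" by (simp add: vl_le_def F.rs_def)
    qed (use pos_bv_Cn fg a in auto)
    thus "f a = \<zero>\<^bsub>B0\<^esub> a" using PTu_Tu[OF a] by simp
  qed
  have 8: "x = \<zero>\<^bsub>B0\<^esub>" if x: "x \<in> carrier B0" "bvmod x = \<zero>\<^bsub>B0\<^esub>" for x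
  proof (rule bv_eqI)
    show xb: "x \<in> bv_maps s E F" "\<zero>\<^bsub>B0\<^esub> \<in> bv_maps s E F" using x pos_bv[OF zero_pos_bv] by simp_all
    fix a assume a: "a \<in> PTu"
    have "vr x a = \<zero>\<^bsub>F\<^esub>" using x(2) bvm(2)[OF xb(1) a] xb PTu_Tu[OF a] by (simp add: bvmod_def)
    hence "modulus F (x a) = \<zero>\<^bsub>F\<^esub>" using am_le_vr[OF xb(1) a] bv_cl[OF xb(1) PTu_Tu[OF a]] by (intro F.le_zero) auto
    hence "x a = \<zero>\<^bsub>F\<^esub>" by (rule F.am_eq_zero[OF bv_cl[OF xb(1) PTu_Tu[OF a]]])
    thus "x a = \<zero>\<^bsub>B0\<^esub> a" using PTu_Tu[OF a] by simp
  qed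
  show "archimedean_vector_lattice (attach_modulus B0 bvmod)"
    by (rule ax(1)[OF P]; fact 1 2 3 4 5 6 7 8)
  show "pos_cone (attach_modulus B0 bvmod) = pos_bv_maps s E F"
    by (rule ax(2)[OF P]; fact 1 2 3 4 5 6 7 8)
qed

lemma bv_lattice_eq: "bv_lattice s E F = attach_modulus B0 bvmod"
  unfolding bv_lattice_def
  by (rule lattice_of_cone_eq[OF bv_structure]) (simp add: bvmod_def)

lemma bv_lattice_avl: "archimedean_vector_lattice (bv_lattice s E F)"
  and bv_lattice_cone: "pos_cone (bv_lattice s E F) = pos_bv_maps s E F"
  unfolding bv_lattice_eq by (rule bv_structure)+

lemma bv_lattice_simps [simp]: "carrier (bv_lattice s E F) = bv_maps s E F" "\<zero>\<^bsub>bv_lattice s E F\<^esub> = (\<lambda>x\<in>Tu. \<zero>\<^bsub>F\<^esub>)"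
  "S \<oplus>\<^bsub>bv_lattice s E F\<^esub> T = (\<lambda>x\<in>Tu. S x \<oplus>\<^bsub>F\<^esub> T x)" "\<alpha> \<odot>\<^bsub>bv_lattice s E F\<^esub> T = (\<lambda>x\<in>Tu. \<alpha> \<odot>\<^bsub>F\<^esub> T x)"
  by (simp_all add: bv_lattice_eq)

lemma modulus_formula:
  assumes "T \<in> bv_maps s E F" "a \<in> PTu"
  shows "is_cone_sup F (variation_sums s E F T a) (modulus (bv_lattice s E F) T a)"
  using vr_sup[OF assms] bvm(2)[OF assms] assms by (simp add: bv_lattice_eq bvmod_def)

end

section \<open>Suprema of directed families of maps\<close>

context avl_family
begin

text \<open>Neither estimate asks the members of \<open>H\<close> to be additive: \<open>up\<close>
  and \<open>low\<close> require it only up to passing to another member. This admits the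
  truncations in \<open>band_component\<close>, which are additive in one variable only in the
  limit.\<close>

lemma directed_sup_multiadd:
  assumes ne: "H \<noteq> {}" and Cn: "\<And>f a. f \<in> H ==> a \<in> PTu ==> f a \<in> pos_cone F"
    and bd: "\<And>a. a \<in> PTu ==> b a \<in> pos_cone F" "\<And>f a. f \<in> H ==> a \<in> PTu ==> vl_le F (f a) (b a)"
    and up: "\<And>f a k x y. f \<in> H ==> a \<in> PTu ==> k \<in> I ==> x \<in> pos_cone (E k) ==> y \<in> pos_cone (E k) ==>
       \<exists>h\<in>H. vl_le F (f (a(k := x \<oplus>\<^bsub>E k\<^esub> y))) (h (a(k := x)) \<oplus>\<^bsub>F\<^esub> h (a(k := y)))"
    and low: "\<And>f g a k x y. f \<in> H ==> g \<in> H ==> a \<in> PTu ==> k \<in> I ==> x \<in> pos_cone (E k) ==> y \<in> pos_cone (E k) ==>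
       \<exists>h\<in>H. vl_le F (f (a(k := x)) \<oplus>\<^bsub>F\<^esub> g (a(k := y))) (h (a(k := x \<oplus>\<^bsub>E k\<^esub> y)))"
  defines "U \<equiv> \<lambda>a. F.csup ((\<lambda>f. f a) ` H)"
  shows "multiadd U" "\<And>a. a \<in> PTu ==> F.bdd ((\<lambda>f. f a) ` H)"
proof -
  have Ud: "U a = F.csup ((\<lambda>f. f a) ` H)" for a by (simp add: U_def)
  show B: "F.bdd ((\<lambda>f. f a) ` H)" if "a \<in> PTu" for a
    by (rule F.bddI[where b = "b a"]) (use that ne Cn bd in auto)
  have U_Cn: "U a \<in> pos_cone F" if "a \<in> PTu" for a unfolding Ud using B[OF that] by simp
  have up': "vl_le F (f a) (U a)" if "f \<in> H" "a \<in> PTu" for f a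
    unfolding Ud using B[OF that(2)] that by (intro F.csup_upper) auto
  show "multiadd U" unfolding multiadd_def
  proof (intro conjI ballI U_Cn)
    fix a k x y assume a: "a \<in> PTu" and k: "k \<in> I" and xy: "x \<in> pos_cone (E k)" "y \<in> pos_cone (E k)"
    interpret E: avl "E k" using avlE[OF k] .
    have "x \<oplus>\<^bsub>E k\<^esub> y \<in> pos_cone (E k)" using xy by simp
    note P = PTu_upd[OF a k xy(1)] PTu_upd[OF a k xy(2)] PTu_upd[OF a k this]
    note C = U_Cn[OF P(1)] U_Cn[OF P(2)] U_Cn[OF P(3)]
    show "U (a(k := x \<oplus>\<^bsub>E k\<^esub> y)) = U (a(k := x)) \<oplus>\<^bsub>F\<^esub> U (a(k := y))"
    proof (rule F.le_antisym)
      have "vl_le F (f (a(k := x \<oplus>\<^bsub>E k\<^esub> y))) (U (a(k := x)) \<oplus>\<^bsub>F\<^esub> U (a(k := y)))" if f: "f \<in> H" for f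
      proof -
        obtain h where h: "h \<in> H" "vl_le F (f (a(k := x \<oplus>\<^bsub>E k\<^esub> y))) (h (a(k := x)) \<oplus>\<^bsub>F\<^esub> h (a(k := y)))"
          using up[OF f a k xy] by auto
        show ?thesis
          by (rule F.le_trans[OF h(2) F.le_add[OF up'[OF h(1) P(1)] up'[OF h(1) P(2)]]])
            (use Cn[OF h(1) P(1)] Cn[OF h(1) P(2)] Cn[OF f P(3)] C in simp_all)
      qed
      thus "vl_le F (U (a(k := x \<oplus>\<^bsub>E k\<^esub> y))) (U (a(k := x)) \<oplus>\<^bsub>F\<^esub> U (a(k := y)))"
        unfolding Ud[of "a(k := x \<oplus>\<^bsub>E k\<^esub> y)"] using C by (intro F.csup_least B P(3)) (auto simp: Ud)
      show "vl_le F (U (a(k := x)) \<oplus>\<^bsub>F\<^esub> U (a(k := y))) (U (a(k := x \<oplus>\<^bsub>E k\<^esub> y)))"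
        unfolding Ud[of "a(k := x)"] Ud[of "a(k := y)"]
      proof (rule F.csup_add_le[OF B[OF P(1)] B[OF P(2)] C(3)])
        fix u v assume "u \<in> (\<lambda>f. f (a(k := x))) ` H" "v \<in> (\<lambda>f. f (a(k := y))) ` H"
        then obtain f g where fg: "f \<in> H" "u = f (a(k := x))" "g \<in> H" "v = g (a(k := y))" by auto
        obtain h where h: "h \<in> H" "vl_le F (f (a(k := x)) \<oplus>\<^bsub>F\<^esub> g (a(k := y))) (h (a(k := x \<oplus>\<^bsub>E k\<^esub> y)))"
          using low[OF fg(1,3) a k xy] by auto
        show "vl_le F (u \<oplus>\<^bsub>F\<^esub> v) (U (a(k := x \<oplus>\<^bsub>E k\<^esub> y)))" unfolding fg(2,4)
          by (rule F.le_trans[OF h(2) up'[OF h(1) P(3)]])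
            (use Cn[OF fg(1) P(1)] Cn[OF fg(3) P(2)] Cn[OF h(1) P(3)] C in simp_all)
      qed
    qed (use C in simp_all)
  qed
qed

end

context avl_family_ne
begin

section \<open>Order in the lattice of maps and Dedekind completeness\<close>

abbreviation L where "L \<equiv> bv_lattice s E F"

sublocale L: avl L by (rule avl.intro[OF bv_lattice_avl])

lemma L_minus: "S \<in> bv_maps s E F ==> T \<in> bv_maps s E F ==> f \<in> Tu ==> (S \<ominus>\<^bsub>L\<^esub> T) f = S f \<ominus>\<^bsub>F\<^esub> T f"
proof -
  assume a: "S \<in> bv_maps s E F" "T \<in> bv_maps s E F" "f \<in> Tu"
  have "\<ominus>\<^bsub>L\<^esub> T = (-1) \<odot>\<^bsub>L\<^esub> T" using L.smult_minus1[of T] a by simp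
  thus ?thesis using a bv_cl by (simp add: a_minus_def F.smult_minus1)
qed

lemma L_le_iff:
  assumes "S \<in> bv_maps s E F" "T \<in> bv_maps s E F"
  shows "vl_le L S T \<longleftrightarrow> (\<forall>a\<in>PTu. vl_le F (S a) (T a))"
proof -
  have "T \<ominus>\<^bsub>L\<^esub> S \<in> bv_maps s E F" using L.cl(3)[of T S] assms by simp
  hence "T \<ominus>\<^bsub>L\<^esub> S \<in> pos_cone L \<longleftrightarrow> (\<forall>a\<in>PTu. (T \<ominus>\<^bsub>L\<^esub> S) a \<in> pos_cone F)"
    unfolding bv_lattice_cone pos_bv_maps_def by auto
  thus ?thesis using L_minus[OF assms(2,1) PTu_Tu] by (simp add: vl_le_def)
qed

lemma bv_dedekind_complete: "dedekind_complete L"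
  unfolding dedekind_complete_def
proof (intro allI impI)
  fix A assume A: "A \<subseteq> pos_cone L \<and> A \<noteq> {} \<and> order_bounded L A"
  then obtain W0 where W0: "W0 \<in> pos_cone L" "\<forall>S\<in>A. vl_le L S W0" using L.order_bounded_Cn by auto
  \<comment> \<open>All positive maps below every positive upper bound of \<open>A\<close>. This set
    contains \<open>A\<close>, has the same upper bounds and is closed under joins, so it is
    directed and its supremum can be formed pointwise on positive tuples.\<close>
  define D where "D = {T \<in> pos_cone L. \<forall>W\<in>pos_cone L. (\<forall>S\<in>A. vl_le L S W) \<longrightarrow> vl_le L T W}"
  have AD: "A \<subseteq> D" using A by (auto simp: D_def)
  have Db: "T \<in> pos_bv_maps s E F" if "T \<in> D" for T using that by (simp add: D_def bv_lattice_cone)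
  note W0' = W0(1)[unfolded bv_lattice_cone]
  have join: "L.join S T \<in> D" if "S \<in> D" "T \<in> D" for S T
  proof -
    have c: "S \<in> pos_cone L" "T \<in> pos_cone L" using that by (auto simp: D_def)
    have "L.join S T \<in> pos_cone L"
      by (rule L.Cn_le[OF c(1) L.join_ge1]) (use c L.join_cl[OF L.CnD[OF c(1)] L.CnD[OF c(2)]] in auto)
    moreover have "vl_le L (L.join S T) W" if "W \<in> pos_cone L" "\<forall>S\<in>A. vl_le L S W" for W
      using \<open>S \<in> D\<close> \<open>T \<in> D\<close> that c by (intro L.join_lub) (auto simp: D_def)
    ultimately show ?thesis by (simp add: D_def)
  qed
  define U where "U = (\<lambda>a. F.csup ((\<lambda>f. f a) ` D))"
  have U: "multiadd U" "F.bdd ((\<lambda>f. f a) ` D)" if "a \<in> PTu" for a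
    unfolding U_def
  proof -
    have H: "D \<noteq> {}" "\<And>f a. f \<in> D ==> a \<in> PTu ==> f a \<in> pos_cone F" "\<And>a. a \<in> PTu ==> W0 a \<in> pos_cone F"
      using AD A pos_bv_Cn[OF Db] pos_bv_Cn[OF W0'] by auto
    have H2: "vl_le F (f a) (W0 a)" if "f \<in> D" "a \<in> PTu" for f a
    proof -
      have "vl_le L f W0" using that W0 by (auto simp: D_def)
      thus ?thesis using L_le_iff[OF pos_bv[OF Db[OF that(1)]] pos_bv[OF W0']] that by simp
    qed
    have add: "f (a(k := x \<oplus>\<^bsub>E k\<^esub> y)) = f (a(k := x)) \<oplus>\<^bsub>F\<^esub> f (a(k := y))"
      if "f \<in> D" "a \<in> PTu" "k \<in> I" "x \<in> pos_cone (E k)" "y \<in> pos_cone (E k)" for f a k x y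
      using pos_mlin_multiadd[OF bvD(1)[OF pos_bv[OF Db[OF that(1)]]] pos_bv_Cn[OF Db[OF that(1)]]] that
      unfolding multiadd_def by blast
    have H3: "\<exists>h\<in>D. vl_le F (f (a(k := x \<oplus>\<^bsub>E k\<^esub> y))) (h (a(k := x)) \<oplus>\<^bsub>F\<^esub> h (a(k := y)))"
      if h: "f \<in> D" "a \<in> PTu" "k \<in> I" "x \<in> pos_cone (E k)" "y \<in> pos_cone (E k)" for f a k x y
    proof -
      have "f (a(k := x)) \<in> pos_cone F" "f (a(k := y)) \<in> pos_cone F" using H(2) PTu_upd h by auto
      thus ?thesis using add[OF h] h(1) by (intro bexI[of _ f]) auto
    qed
    have H4: "\<exists>h\<in>D. vl_le F (f (a(k := x)) \<oplus>\<^bsub>F\<^esub> g (a(k := y))) (h (a(k := x \<oplus>\<^bsub>E k\<^esub> y)))"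
      if h: "f \<in> D" "g \<in> D" "a \<in> PTu" "k \<in> I" "x \<in> pos_cone (E k)" "y \<in> pos_cone (E k)" for f g a k x y
    proof (intro bexI[of _ "L.join f g"] join h)
      note fb = pos_bv[OF Db[OF h(1)]] and gb = pos_bv[OF Db[OF h(2)]] and jb = pos_bv[OF Db[OF join[OF h(1,2)]]]
      have "f \<in> L.Rl" "g \<in> L.Rl" using h by (auto simp: D_def)
      hence le: "vl_le L f (L.join f g)" "vl_le L g (L.join f g)" using L.join_ge1 L.join_ge2 by auto
      have P: "a(k := x) \<in> PTu" "a(k := y) \<in> PTu" using PTu_upd h by auto
      show "vl_le F (f (a(k := x)) \<oplus>\<^bsub>F\<^esub> g (a(k := y))) (L.join f g (a(k := x \<oplus>\<^bsub>E k\<^esub> y)))"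
        unfolding add[OF join[OF h(1,2)] h(3-6)]
        using le P L_le_iff[OF fb jb] L_le_iff[OF gb jb] bv_cl[OF fb] bv_cl[OF gb] bv_cl[OF jb] PTu_Tu
        by (intro F.le_add) auto
    qed
    show "multiadd (\<lambda>a. F.csup ((\<lambda>f. f a) ` D))"
      by (rule directed_sup_multiadd(1)[where b = W0]) (use H H2 H3 H4 in blast)+
    show "F.bdd ((\<lambda>f. f a) ` D)"
      by (rule F.bddI[where b = "W0 a"]) (use H H2 that in auto)
  qed
  have ex: "\<exists>a. a \<in> PTu"
  proof -
    have "(\<lambda>k\<in>I. \<zero>\<^bsub>E k\<^esub>) \<in> PTu" using avl.Cn_zero[OF avlE] by (simp add: PTu_iff)
    thus ?thesis by blast
  qed
  then obtain Us where Us: "Us \<in> pos_bv_maps s E F" "\<forall>a\<in>PTu. Us a = U a" using pos_extension U(1) by blast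
  have "is_cone_sup L A Us" unfolding L.is_cone_sup_iff
  proof (intro conjI ballI impI)
    show "A \<subseteq> pos_cone L" "Us \<in> pos_cone L" using A Us by (auto simp: bv_lattice_cone)
    fix S assume S: "S \<in> A"
    hence "S \<in> D" using AD by auto
    thus "vl_le L S Us" using Us U(2)
      by (subst L_le_iff[OF pos_bv[OF Db] pos_bv[OF Us(1)]]) (auto simp: U_def intro!: F.csup_upper)
  next
    fix W assume W: "W \<in> pos_cone L" "\<forall>a\<in>A. vl_le L a W"
    note Wp = W(1)[unfolded bv_lattice_cone]
    have "vl_le F (U a) (W a)" if a: "a \<in> PTu" for a
      unfolding U_def
    proof (rule F.csup_least[OF U(2)[OF a] pos_bv_Cn[OF Wp a]])
      fix u assume "u \<in> (\<lambda>f. f a) ` D"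
      then obtain T where T: "T \<in> D" "u = T a" by auto
      hence "vl_le L T W" using W by (auto simp: D_def)
      thus "vl_le F u (W a)" using L_le_iff[OF pos_bv[OF Db[OF T(1)]] pos_bv[OF Wp]] a T(2) by simp
    qed
    thus "vl_le L Us W" using L_le_iff[OF pos_bv[OF Us(1)] pos_bv[OF Wp]] Us(2) by simp
  qed
  thus "\<exists>u. is_cone_sup L A u" by blast
qed

section \<open>Components and evaluation functionals\<close>

text \<open>The part of a positive map \<^term>\<open>T\<close> that lives, in the variable \<open>k\<close>, on the band generated by \<open>v\<close>.\<close>

lemma band_component:
  assumes T: "T \<in> pos_bv_maps s E F" and k: "k \<in> I" and v: "v \<in> pos_cone (E k)"
  shows "\<exists>T1\<in>pos_bv_maps s E F. \<exists>T2\<in>pos_bv_maps s E F. T = T1 \<oplus>\<^bsub>L\<^esub> T2 \<and>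
    (\<forall>a\<in>PTu. T2 (a(k := v)) = \<zero>\<^bsub>F\<^esub>) \<and> (\<forall>a\<in>PTu. \<forall>b\<in>pos_cone (E k). avl.dj (E k) v b \<longrightarrow> T1 (a(k := b)) = \<zero>\<^bsub>F\<^esub>)"
proof -
  interpret E: avl "E k" using avlE[OF k] .
  note Tb = pos_bv[OF T] and TC = pos_bv_Cn[OF T]
  note Tm = pos_mlin_multiadd[OF bvD(1)[OF Tb] TC]
  have Tadd: "T (a(j := x \<oplus>\<^bsub>E j\<^esub> y)) = T (a(j := x)) \<oplus>\<^bsub>F\<^esub> T (a(j := y))"
    if "a \<in> PTu" "j \<in> I" "x \<in> pos_cone (E j)" "y \<in> pos_cone (E j)" for a j x y
    using Tm that unfolding multiadd_def by blast
  have Tmono: "vl_le F (T (a(k := x))) (T (a(k := y)))" if a: "a \<in> PTu" and xy: "x \<in> pos_cone (E k)" "y \<in> pos_cone (E k)" "vl_le (E k) x y" for a x y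
  proof -
    have d: "y \<ominus>\<^bsub>E k\<^esub> x \<in> pos_cone (E k)" by (rule E.leD[OF xy(3)])
    have "y = x \<oplus>\<^bsub>E k\<^esub> (y \<ominus>\<^bsub>E k\<^esub> x)" using xy by (intro E.vec_eqI) auto
    hence "T (a(k := y)) = T (a(k := x)) \<oplus>\<^bsub>F\<^esub> T (a(k := y \<ominus>\<^bsub>E k\<^esub> x))" using Tadd[OF a k xy(1) d] by simp
    thus ?thesis using TC PTu_upd[OF a k] xy d by simp
  qed
  define nv where "nv n = E.rs (real n) v" for n :: nat
  have nv: "nv n \<in> pos_cone (E k)" for n using v by (simp add: nv_def)
  have nv_add: "nv (n + m) = nv n \<oplus>\<^bsub>E k\<^esub> nv m" for n m
    unfolding nv_def using v by (intro E.vec_eqI) (auto simp: algebra_simps)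
  have mC: "E.meet x (nv n) \<in> pos_cone (E k)" if "x \<in> pos_cone (E k)" for x n using that nv by simp
  \<comment> \<open>Truncation of the variable \<open>k\<close> at \<open>n v\<close>. The supremum
    over \<open>n\<close> is the component \<open>T1\<close> on the band of \<open>v\<close>; it is
    a supremum of values in \<open>F\<close>.\<close>
  define f where "f n a = T (a(k := E.meet (a k) (nv n)))" for n :: nat and a
  have fC: "f n a \<in> pos_cone F" if "a \<in> PTu" for n a
    unfolding f_def using that PTuD[OF that k] k mC by (intro TC PTu_upd)
  have fT: "vl_le F (f n a) (T a)" if "a \<in> PTu" for n a
    using Tmono[OF that mC[OF PTuD[OF that k]] PTuD[OF that k], of n] PTuD[OF that k] nv by (simp add: f_def)
  have glb: "vl_le (E k) c (E.meet a b)" if "a \<in> pos_cone (E k)" "b \<in> pos_cone (E k)" "c \<in> pos_cone (E k)" "vl_le (E k) c a" "vl_le (E k) c b" for a b c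
    using that by (intro E.meet_glb) auto
  \<comment> \<open>A Riesz decomposition of the left side along \<open>x\<close> and
    \<open>y\<close> has both pieces below \<open>nv n\<close>.\<close>
  have meet_up: "vl_le (E k) (E.meet (x \<oplus>\<^bsub>E k\<^esub> y) (nv n)) (E.meet x (nv n) \<oplus>\<^bsub>E k\<^esub> E.meet y (nv n))"
    if x: "x \<in> pos_cone (E k)" and y: "y \<in> pos_cone (E k)" for x y n
  proof -
    let ?z = "E.meet (x \<oplus>\<^bsub>E k\<^esub> y) (nv n)"
    have z: "?z \<in> pos_cone (E k)" "vl_le (E k) ?z (x \<oplus>\<^bsub>E k\<^esub> y)" "vl_le (E k) ?z (nv n)" using x y nv by auto
    obtain z1 z2 where z12: "z1 \<in> pos_cone (E k)" "z2 \<in> pos_cone (E k)" "?z = z1 \<oplus>\<^bsub>E k\<^esub> z2" "vl_le (E k) z1 x" "vl_le (E k) z2 y"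
      using E.riesz_decomposition[OF z(1) x y z(2)] by blast
    have "vl_le (E k) z1 ?z" "vl_le (E k) z2 ?z" unfolding z12(3) using z12 by auto
    hence "vl_le (E k) z1 (nv n)" "vl_le (E k) z2 (nv n)" using z nv z12 E.le_trans by (meson E.CnD)+
    hence "vl_le (E k) z1 (E.meet x (nv n))" "vl_le (E k) z2 (E.meet y (nv n))" using z12 x y nv by (auto intro: glb)
    thus ?thesis unfolding z12(3) using z12 x y nv by (intro E.le_add) auto
  qed
  \<comment> \<open>Superadditivity needs the larger truncation \<open>n + m\<close>, which is why
    the second estimate passes to another member of the family.\<close>
  have meet_low: "vl_le (E k) (E.meet x (nv n) \<oplus>\<^bsub>E k\<^esub> E.meet y (nv m)) (E.meet (x \<oplus>\<^bsub>E k\<^esub> y) (nv (n + m)))"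
    if x: "x \<in> pos_cone (E k)" and y: "y \<in> pos_cone (E k)" for x y n m
    unfolding nv_add using x y nv by (intro glb E.Cn_add mC E.le_add) auto
  have meet_mono: "vl_le (E k) (E.meet x (nv n)) (E.meet x (nv (n + m)))" if x: "x \<in> pos_cone (E k)" for x n m
  proof -
    have "vl_le (E k) (E.meet x (nv n)) (nv n)" "vl_le (E k) (nv n) (nv n \<oplus>\<^bsub>E k\<^esub> nv m)" using x nv by auto
    hence "vl_le (E k) (E.meet x (nv n)) (nv n \<oplus>\<^bsub>E k\<^esub> nv m)" using E.le_trans x nv by (meson E.CnD E.Cn_add mC)
    thus ?thesis unfolding nv_add using x nv by (intro glb) auto
  qed
  have fmono: "vl_le F (f n a) (f (n + m) a)" if "a \<in> PTu" for n m a
    unfolding f_def by (intro Tmono that mC meet_mono PTuD[OF that k])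
  let ?H = "range f"
  define U where "U = (\<lambda>a. F.csup ((\<lambda>h. h a) ` ?H))"
  have H3: "\<exists>h\<in>?H. vl_le F (g (a(j := x \<oplus>\<^bsub>E j\<^esub> y))) (h (a(j := x)) \<oplus>\<^bsub>F\<^esub> h (a(j := y)))"
    if g: "g \<in> ?H" and a: "a \<in> PTu" and j: "j \<in> I" and xy: "x \<in> pos_cone (E j)" "y \<in> pos_cone (E j)" for g a j x y
  proof -
    obtain n where n: "g = f n" using g by auto
    interpret Ej: avl "E j" using avlE[OF j] .
    have xyC: "x \<oplus>\<^bsub>E j\<^esub> y \<in> pos_cone (E j)" using xy by simp
    note P = PTu_upd[OF a j xy(1)] PTu_upd[OF a j xy(2)] PTu_upd[OF a j xyC]
    have "vl_le F (f n (a(j := x \<oplus>\<^bsub>E j\<^esub> y))) (f n (a(j := x)) \<oplus>\<^bsub>F\<^esub> f n (a(j := y)))"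
    proof (cases "j = k")
      case True
      have xy': "x \<in> pos_cone (E k)" "y \<in> pos_cone (E k)" using xy True by auto
      have "vl_le F (T (a(k := E.meet (x \<oplus>\<^bsub>E k\<^esub> y) (nv n)))) (T (a(k := E.meet x (nv n) \<oplus>\<^bsub>E k\<^esub> E.meet y (nv n))))"
        using xy' by (intro Tmono a mC meet_up E.Cn_add)
      thus ?thesis using Tadd[OF a k mC[OF xy'(1)] mC[OF xy'(2)]] True by (simp add: f_def)
    next
      case False
      have "a(k := E.meet (a k) (nv n)) \<in> PTu" using PTu_upd[OF a k mC[OF PTuD[OF a k]]] .
      from Tadd[OF this j xy] have "f n (a(j := x \<oplus>\<^bsub>E j\<^esub> y)) = f n (a(j := x)) \<oplus>\<^bsub>F\<^esub> f n (a(j := y))"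
        using False by (simp add: f_def fun_upd_twist)
      thus ?thesis using fC[OF P(1)] fC[OF P(2)] by simp
    qed
    thus ?thesis using n by blast
  qed
  have H4: "\<exists>h\<in>?H. vl_le F (g (a(j := x)) \<oplus>\<^bsub>F\<^esub> g' (a(j := y))) (h (a(j := x \<oplus>\<^bsub>E j\<^esub> y)))"
    if g: "g \<in> ?H" "g' \<in> ?H" and a: "a \<in> PTu" and j: "j \<in> I" and xy: "x \<in> pos_cone (E j)" "y \<in> pos_cone (E j)" for g g' a j x y
  proof -
    obtain n m where n: "g = f n" "g' = f m" using g by auto
    interpret Ej: avl "E j" using avlE[OF j] .
    have xyC: "x \<oplus>\<^bsub>E j\<^esub> y \<in> pos_cone (E j)" using xy by simp
    note P = PTu_upd[OF a j xy(1)] PTu_upd[OF a j xy(2)] PTu_upd[OF a j xyC]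
    have "vl_le F (f n (a(j := x)) \<oplus>\<^bsub>F\<^esub> f m (a(j := y))) (f (n + m) (a(j := x \<oplus>\<^bsub>E j\<^esub> y)))"
    proof (cases "j = k")
      case True
      have xy': "x \<in> pos_cone (E k)" "y \<in> pos_cone (E k)" using xy True by auto
      have "vl_le F (T (a(k := E.meet x (nv n) \<oplus>\<^bsub>E k\<^esub> E.meet y (nv m)))) (T (a(k := E.meet (x \<oplus>\<^bsub>E k\<^esub> y) (nv (n + m)))))"
        using xy' by (intro Tmono a mC meet_low E.Cn_add)
      thus ?thesis using Tadd[OF a k mC[OF xy'(1)] mC[OF xy'(2)]] True by (simp add: f_def)
    next
      case False
      have "a(k := E.meet (a k) (nv (n + m))) \<in> PTu" using PTu_upd[OF a k mC[OF PTuD[OF a k]]] .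
      from Tadd[OF this j xy] have "f (n + m) (a(j := x \<oplus>\<^bsub>E j\<^esub> y)) = f (n + m) (a(j := x)) \<oplus>\<^bsub>F\<^esub> f (n + m) (a(j := y))"
        using False by (simp add: f_def fun_upd_twist)
      thus ?thesis using fmono[OF P(1), of n m] fmono[OF P(2), of m n] fC[OF P(1)] fC[OF P(2)]
        by (auto intro!: F.le_add simp: add.commute)
    qed
    thus ?thesis using n by blast
  qed
  have U: "multiadd U" unfolding U_def
    by (rule directed_sup_multiadd(1)[where b = T]) (use fC fT TC H3 H4 in blast)+
  have Ub: "F.bdd ((\<lambda>h. h a) ` ?H)" if "a \<in> PTu" for a
    by (rule F.bddI[where b = "T a"]) (use that fC fT TC in auto)
  obtain T1 where T1: "T1 \<in> pos_bv_maps s E F" "\<forall>a\<in>PTu. T1 a = U a" using pos_extension[OF U] by auto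
  have UT: "vl_le F (U a) (T a)" if "a \<in> PTu" for a
    unfolding U_def using Ub[OF that] fT[OF that] TC[OF that] by (intro F.csup_least) auto
  define T2 where "T2 = T \<ominus>\<^bsub>L\<^esub> T1"
  have "vl_le L T1 T" using UT T1 by (subst L_le_iff[OF pos_bv[OF T1(1)] Tb]) auto
  hence T2: "T2 \<in> pos_bv_maps s E F" unfolding T2_def using L.leD by (simp add: bv_lattice_cone)
  have "T = T1 \<oplus>\<^bsub>L\<^esub> T2" unfolding T2_def
    using Tb pos_bv[OF T1(1)] L.minus_add[of T T1] L.M.add.m_comm[of T1 "T \<ominus>\<^bsub>L\<^esub> T1"] L.cl(3)[of T T1] by (simp del: bv_lattice_simps(3))
  moreover have "T2 (a(k := v)) = \<zero>\<^bsub>F\<^esub>" if a: "a \<in> PTu" for a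
  proof -
    note P = PTu_upd[OF a k v]
    \<comment> \<open>At \<open>v\<close> the truncation with \<open>n = 1\<close> already changes
      nothing, so \<open>T1\<close> and \<open>T\<close> agree there and the remainder
      \<open>T2\<close> vanishes.\<close>
    have "E.meet v (nv 1) = v" using v by (simp add: nv_def E.meet_def E.minus_self E.pp_def)
    hence "f 1 (a(k := v)) = T (a(k := v))" by (simp add: f_def)
    hence "T (a(k := v)) \<in> (\<lambda>h. h (a(k := v))) ` ?H" by (intro image_eqI[of _ _ "f 1"]) simp_all
    hence "vl_le F (T (a(k := v))) (U (a(k := v)))" unfolding U_def by (rule F.csup_upper[OF Ub[OF P]])
    hence "T1 (a(k := v)) = T (a(k := v))" using UT[OF P] T1 P TC[OF P] pos_bv_Cn[OF T1(1) P] by (intro F.le_antisym) auto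
    thus ?thesis unfolding T2_def using L_minus[OF Tb pos_bv[OF T1(1)] PTu_Tu[OF P]] TC[OF P] by (simp add: F.minus_self)
  qed
  moreover have "T1 (a(k := b)) = \<zero>\<^bsub>F\<^esub>" if a: "a \<in> PTu" and b: "b \<in> pos_cone (E k)" and dj: "E.dj v b" for a b
  proof -
    note P = PTu_upd[OF a k b]
    have "f n (a(k := b)) = \<zero>\<^bsub>F\<^esub>" for n
    proof -
      have "E.dj (nv n) b" unfolding nv_def using dj v b by (intro E.dj_smult) auto
      hence "E.meet b (nv n) = \<zero>\<^bsub>E k\<^esub>" by (rule E.dj_meet[OF E.dj_sym b nv])
      thus ?thesis using multiadd_zero[OF Tm a k] by (simp add: f_def)
    qed
    hence "vl_le F u \<zero>\<^bsub>F\<^esub>" if "u \<in> (\<lambda>h. h (a(k := b))) ` ?H" for u using that by auto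
    hence "vl_le F (U (a(k := b))) \<zero>\<^bsub>F\<^esub>" unfolding U_def by (rule F.csup_least[OF Ub[OF P] F.Cn_zero])
    hence "vl_le F (T1 (a(k := b))) \<zero>\<^bsub>F\<^esub>" using T1(2) P by simp
    thus ?thesis by (rule F.le_zero[OF pos_bv_Cn[OF T1(1) P]])
  qed
  ultimately show ?thesis using T1(1) T2 by blast
qed

end

section \<open>Transport of structure and spaces of order bounded operators\<close>

text \<open>Applied to the space of operators, identified with maps of one variable, and to copies
  of a lattice inside another type.\<close>

lemma avl_transport:
  fixes V :: "('k :: real_or_complex, 'a) module" and W :: "('k, 'b) vlattice"
  assumes W: "archimedean_vector_lattice W" and bij: "bij_betw \<theta> (carrier V) (carrier W)"
    and z: "\<zero>\<^bsub>V\<^esub> \<in> carrier V" "\<theta> \<zero>\<^bsub>V\<^esub> = \<zero>\<^bsub>W\<^esub>"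
    and add: "\<And>x y. x \<in> carrier V ==> y \<in> carrier V ==> x \<oplus>\<^bsub>V\<^esub> y \<in> carrier V"
      "\<And>x y. x \<in> carrier V ==> y \<in> carrier V ==> \<theta> (x \<oplus>\<^bsub>V\<^esub> y) = \<theta> x \<oplus>\<^bsub>W\<^esub> \<theta> y"
    and sm: "\<And>\<alpha> x. x \<in> carrier V ==> \<alpha> \<odot>\<^bsub>V\<^esub> x \<in> carrier V" "\<And>\<alpha> x. x \<in> carrier V ==> \<theta> (\<alpha> \<odot>\<^bsub>V\<^esub> x) = \<alpha> \<odot>\<^bsub>W\<^esub> \<theta> x"
  defines "m \<equiv> restrict (\<lambda>x. inv_into (carrier V) \<theta> (modulus W (\<theta> x))) (carrier V)"
  shows "archimedean_vector_lattice (attach_modulus V m)"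
    and "pos_cone (attach_modulus V m) = {x \<in> carrier V. \<theta> x \<in> pos_cone W}"
proof -
  interpret W: avl W using W by (rule avl.intro)
  have inj: "x = y" if "x \<in> carrier V" "y \<in> carrier V" "\<theta> x = \<theta> y" for x y
    using bij that by (auto simp: bij_betw_def inj_on_def)
  have \<theta>: "\<theta> x \<in> carrier W" if "x \<in> carrier V" for x using bij that by (auto simp: bij_betw_def)
  have K: "kmodule V"
    by (rule kmoduleI; (intro z(1) add(1) sm(1))?;
        (rule inj; simp add: z add sm \<theta> W.M.add.m_ac W.smult_add_left W.smult_r_distr W.smult_minus1 W.M.r_neg)?)
  interpret V: kmodule V by (rule K)
  let ?i = "inv_into (carrier V) \<theta>"
  have i: "?i y \<in> carrier V" "\<theta> (?i y) = y" if "y \<in> carrier W" for y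
    using bij that by (auto simp: bij_betw_def intro: inv_into_into f_inv_into_f)
  have neg: "\<theta> (\<ominus>\<^bsub>V\<^esub> x) = \<ominus>\<^bsub>W\<^esub> \<theta> x" if "x \<in> carrier V" for x
    using sm(2)[OF that, of "-1"] that \<theta> by (simp add: V.smult_minus1 W.smult_minus1)
  have minus: "\<theta> (x \<ominus>\<^bsub>V\<^esub> y) = \<theta> x \<ominus>\<^bsub>W\<^esub> \<theta> y" if "x \<in> carrier V" "y \<in> carrier V" for x y
    using add(2) neg that by (simp add: a_minus_def)
  let ?C = "{x \<in> carrier V. \<theta> x \<in> pos_cone W}"
  have m: "m x \<in> carrier V" "\<theta> (m x) = modulus W (\<theta> x)" if "x \<in> carrier V" for x
    using i[of "modulus W (\<theta> x)"] \<theta>[OF that] that by (simp_all add: m_def)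
  have "archimedean_vector_lattice (attach_modulus V m) \<and> pos_cone (attach_modulus V m) = ?C"
  proof (rule conjI; rule archimedean_vector_lattice_attachI[OF K])
    show "?C \<subseteq> carrier V" "?C \<subseteq> carrier V" by auto
    show C1: "m x \<in> ?C" if "x \<in> carrier V" for x using m[OF that] \<theta>[OF that] by simp
    thus "m x \<in> ?C" if "x \<in> carrier V" for x using that .
    show C2: "m x = x" if "x \<in> ?C" for x by (rule inj) (use that m W.Cn_am in auto)
    thus "m x = x" if "x \<in> ?C" for x using that .
    show C3: "x \<oplus>\<^bsub>V\<^esub> y \<in> ?C" if "x \<in> ?C" "y \<in> ?C" for x y using that add by simp
    thus "x \<oplus>\<^bsub>V\<^esub> y \<in> ?C" if "x \<in> ?C" "y \<in> ?C" for x y using that .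
    show C4: "m (\<alpha> \<odot>\<^bsub>V\<^esub> x) = of_real (norm \<alpha>) \<odot>\<^bsub>V\<^esub> m x" if "x \<in> carrier V" for \<alpha> x
      by (rule inj) (use that m \<theta> in \<open>auto simp: sm W.modulus_smult\<close>)
    thus "m (\<alpha> \<odot>\<^bsub>V\<^esub> x) = of_real (norm \<alpha>) \<odot>\<^bsub>V\<^esub> m x" if "x \<in> carrier V" for \<alpha> x using that .
    show C5: "m x \<oplus>\<^bsub>V\<^esub> m y \<ominus>\<^bsub>V\<^esub> m (x \<oplus>\<^bsub>V\<^esub> y) \<in> ?C" if "x \<in> carrier V" "y \<in> carrier V" for x y
      using that m \<theta> W.leD[OF W.am_triangle[of "\<theta> x" "\<theta> y"]] by (simp add: minus add)
    thus "m x \<oplus>\<^bsub>V\<^esub> m y \<ominus>\<^bsub>V\<^esub> m (x \<oplus>\<^bsub>V\<^esub> y) \<in> ?C" if "x \<in> carrier V" "y \<in> carrier V" for x y using that .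
    show C6: "\<exists>a\<in>?C. \<exists>b\<in>?C. \<exists>c\<in>?C. \<exists>d\<in>?C. x = (a \<ominus>\<^bsub>V\<^esub> b) \<oplus>\<^bsub>V\<^esub> kI \<odot>\<^bsub>V\<^esub> (c \<ominus>\<^bsub>V\<^esub> d)" if x: "x \<in> carrier V" for x
    proof -
      obtain a b c d where W: "a \<in> pos_cone W" "b \<in> pos_cone W" "c \<in> pos_cone W" "d \<in> pos_cone W"
        "\<theta> x = (a \<ominus>\<^bsub>W\<^esub> b) \<oplus>\<^bsub>W\<^esub> kI \<odot>\<^bsub>W\<^esub> (c \<ominus>\<^bsub>W\<^esub> d)" using W.carrier_four[OF \<theta>[OF x]] by blast
      have "?i a \<in> ?C" "?i b \<in> ?C" "?i c \<in> ?C" "?i d \<in> ?C" using W i by auto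
      moreover have "x = (?i a \<ominus>\<^bsub>V\<^esub> ?i b) \<oplus>\<^bsub>V\<^esub> kI \<odot>\<^bsub>V\<^esub> (?i c \<ominus>\<^bsub>V\<^esub> ?i d)"
        by (rule inj) (use W i x in \<open>auto simp: minus add sm\<close>)
      ultimately show ?thesis by blast
    qed
    thus "\<exists>a\<in>?C. \<exists>b\<in>?C. \<exists>c\<in>?C. \<exists>d\<in>?C. x = (a \<ominus>\<^bsub>V\<^esub> b) \<oplus>\<^bsub>V\<^esub> kI \<odot>\<^bsub>V\<^esub> (c \<ominus>\<^bsub>V\<^esub> d)" if "x \<in> carrier V" for x using that .
    show C7: "f = \<zero>\<^bsub>V\<^esub>" if fg: "f \<in> ?C" "g \<in> ?C" "\<And>n::nat. g \<ominus>\<^bsub>V\<^esub> of_nat n \<odot>\<^bsub>V\<^esub> f \<in> ?C" for f g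
    proof (rule inj)
      have "\<theta> f = \<zero>\<^bsub>W\<^esub>"
      proof (rule W.archimedean_Cn[of _ "\<theta> g"])
        fix n :: nat
        have "\<theta> (g \<ominus>\<^bsub>V\<^esub> of_nat n \<odot>\<^bsub>V\<^esub> f) \<in> pos_cone W" using fg(3)[of n] by simp
        thus "vl_le W (W.rs (real n) (\<theta> f)) (\<theta> g)" using fg(1,2) by (simp add: minus sm vl_le_def W.rs_def)
      qed (use fg in auto)
      thus "\<theta> f = \<theta> \<zero>\<^bsub>V\<^esub>" by (simp add: z)
    qed (use fg in auto)
    thus "f = \<zero>\<^bsub>V\<^esub>" if "f \<in> ?C" "g \<in> ?C" "\<And>n::nat. g \<ominus>\<^bsub>V\<^esub> of_nat n \<odot>\<^bsub>V\<^esub> f \<in> ?C" for f g using that by blast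
    show C8: "x = \<zero>\<^bsub>V\<^esub>" if x: "x \<in> carrier V" "m x = \<zero>\<^bsub>V\<^esub>" for x
      by (rule inj) (use x m[OF x(1)] W.am_eq_zero[OF \<theta>[OF x(1)]] in \<open>auto simp: z\<close>)
    thus "x = \<zero>\<^bsub>V\<^esub>" if "x \<in> carrier V" "m x = \<zero>\<^bsub>V\<^esub>" for x using that .
  qed
  thus "archimedean_vector_lattice (attach_modulus V m)" "pos_cone (attach_modulus V m) = ?C" by auto
qed

text \<open>Since \<open>|w|\<close> is the supremum of \<open>w\<close> and \<open>- w\<close>, a
  sum of moduli is bounded as soon as all sign combinations are. The added \<open>v\<close> carries
  the signs already chosen through the induction.\<close>

lemma (in avl) lsum_am_le:
  "set ws \<subseteq> Rl ==> v \<in> Rl ==> b \<in> Vc ==>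
   (\<And>\<sigma>. length \<sigma> = length ws ==> set \<sigma> \<subseteq> {1, -1} ==> v \<oplus> lsum (map2 rs \<sigma> ws) \<preceq> b) ==> v \<oplus> lsum (map am ws) \<preceq> b"
proof (induction ws arbitrary: v)
  case Nil
  from Nil(4)[of "[]"] show ?case by simp
next
  case (Cons w ws)
  have w: "w \<in> Rl" "set ws \<subseteq> Rl" using Cons by auto
  have wc: "set ws \<subseteq> Vc" using w by (auto intro: RlD)
  hence sc: "set (map am ws) \<subseteq> Vc" by auto
  define S where "S = lsum (map am ws)"
  have S: "S \<in> Vc" using sc by (simp add: S_def del: set_map)
  have step: "(v \<oplus> \<tau> *r w) \<oplus> S \<preceq> b" if \<tau>: "\<tau> = 1 \<or> \<tau> = -1" for \<tau>
    unfolding S_def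
  proof (rule Cons.IH[OF w(2) _ Cons.prems(3)])
    show "v \<oplus> \<tau> *r w \<in> Rl" using w Cons by simp
    fix \<sigma> assume \<sigma>: "length \<sigma> = length ws" "set \<sigma> \<subseteq> {1, -1 :: real}"
    have m: "set (map2 rs \<sigma> ws) \<subseteq> Vc" using \<sigma>(1) wc by (induction \<sigma> ws rule: list_induct2) auto
    have "v \<oplus> lsum (map2 rs (\<tau> # \<sigma>) (w # ws)) \<preceq> b" using \<sigma> \<tau> by (intro Cons.prems(4)) auto
    moreover have "lsum (map2 rs (\<tau> # \<sigma>) (w # ws)) = \<tau> *r w \<oplus> lsum (map2 rs \<sigma> ws)"
      using lsum_Cons[of "\<tau> *r w", OF _ m] w by simp
    ultimately show "(v \<oplus> \<tau> *r w) \<oplus> lsum (map2 rs \<sigma> ws) \<preceq> b"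
      using w Cons.prems(2) lsum_cl[OF m] by (simp add: M.add.m_assoc)
  qed
  have "am w \<preceq> b \<ominus> v \<ominus> S"
  proof (rule am_lub)
    show "w \<preceq> b \<ominus> v \<ominus> S" using leD[OF step[of 1]] w S Cons.prems(2,3) by (intro le_by[of "b \<ominus> ((v \<oplus> 1 *r w) \<oplus> S)"]) auto
    show "\<ominus> w \<preceq> b \<ominus> v \<ominus> S" using leD[OF step[of "-1"]] w S Cons.prems(2,3) by (intro le_by[of "b \<ominus> ((v \<oplus> (-1) *r w) \<oplus> S)"]) auto
  qed (use w S Cons.prems in auto)
  from leD[OF this] have "v \<oplus> (am w \<oplus> S) \<preceq> b" using w S Cons.prems(2,3) by (intro le_by[of "b \<ominus> v \<ominus> S \<ominus> am w"]) auto
  thus ?case using w sc by (simp add: lsum_Cons S_def)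
qed

text \<open>All sign combinations of a partition of \<^term>\<open>a\<close> lie in the order interval around zero given by \<^term>\<open>a\<close>.\<close>

lemma lsum_am_real_linear_le:
  assumes V: "avl V" and W: "avl W"
    and q: "\<And>x. x \<in> carrier V ==> q x \<in> avl.Rl W" "\<And>x y. x \<in> carrier V ==> y \<in> carrier V ==> q (x \<oplus>\<^bsub>V\<^esub> y) = q x \<oplus>\<^bsub>W\<^esub> q y"
      "\<And>x r. x \<in> carrier V ==> q (avl.rs V r x) = avl.rs W r (q x)"
    and b: "b \<in> carrier W" "\<And>y. y \<in> carrier V ==> vl_le V (modulus V y) a ==> vl_le W (q y) b"
    and xs: "xs \<in> pos_partitions V a"
  shows "vl_le W (kmodule.lsum W (map (\<lambda>x. modulus W (q x)) xs)) b"
proof -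
  interpret V: avl V by (rule V)
  interpret W: avl W by (rule W)
  have xsC: "set xs \<subseteq> pos_cone V" "V.lsum xs = a" using xs by (auto simp: V.pos_partitions_iff)
  have q0: "q \<zero>\<^bsub>V\<^esub> = \<zero>\<^bsub>W\<^esub>" using q(3)[of "\<zero>\<^bsub>V\<^esub>" 0] q(1)[of "\<zero>\<^bsub>V\<^esub>"] by simp
  have R: "set (map q xs) \<subseteq> W.Rl" using xsC q(1) by auto
  have "vl_le W (\<zero>\<^bsub>W\<^esub> \<oplus>\<^bsub>W\<^esub> W.lsum (map (modulus W) (map q xs))) b"
  proof (rule W.lsum_am_le[OF R _ b(1)])
    fix \<sigma> :: "real list" assume "length \<sigma> = length (map q xs)" "set \<sigma> \<subseteq> {1, -1}"
    hence \<sigma>: "length \<sigma> = length xs" "set \<sigma> \<subseteq> {1, -1}" by auto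
    have *: "set (map2 V.rs \<sigma> xs) \<subseteq> carrier V \<and> V.lsum (map2 V.rs \<sigma> xs) \<in> carrier V \<and>
        vl_le V (modulus V (V.lsum (map2 V.rs \<sigma> xs))) (V.lsum xs) \<and>
        set (map2 W.rs \<sigma> (map q xs)) \<subseteq> carrier W \<and>
        W.lsum (map2 W.rs \<sigma> (map q xs)) = q (V.lsum (map2 V.rs \<sigma> xs))"
      using \<sigma> xsC(1)
    proof (induction \<sigma> xs rule: list_induct2)
      case (Cons t \<sigma> x xs)
      have x: "x \<in> pos_cone V" "set xs \<subseteq> pos_cone V" "t = 1 \<or> t = -1" using Cons by auto
      let ?m = "map2 V.rs \<sigma> xs"
      have IH: "set ?m \<subseteq> carrier V" "V.lsum ?m \<in> carrier V" "vl_le V (modulus V (V.lsum ?m)) (V.lsum xs)"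
        "set (map2 W.rs \<sigma> (map q xs)) \<subseteq> carrier W" "W.lsum (map2 W.rs \<sigma> (map q xs)) = q (V.lsum ?m)" using Cons by auto
      have l: "V.lsum (map2 V.rs (t # \<sigma>) (x # xs)) = V.rs t x \<oplus>\<^bsub>V\<^esub> V.lsum ?m"
        using V.lsum_Cons[of "V.rs t x", OF _ IH(1)] x by simp
      have lW: "W.lsum (map2 W.rs (t # \<sigma>) (map q (x # xs))) = W.rs t (q x) \<oplus>\<^bsub>W\<^esub> W.lsum (map2 W.rs \<sigma> (map q xs))"
        using W.lsum_Cons[of "W.rs t (q x)", OF _ IH(4)] x q(1)[of x] by simp
      have "modulus V (V.rs t x) = x" using x by (auto simp: V.Cn_am)
      hence "vl_le V (modulus V (V.rs t x \<oplus>\<^bsub>V\<^esub> V.lsum ?m)) (x \<oplus>\<^bsub>V\<^esub> modulus V (V.lsum ?m))"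
        using V.am_triangle[of "V.rs t x" "V.lsum ?m"] x IH by simp
      moreover have "vl_le V (x \<oplus>\<^bsub>V\<^esub> modulus V (V.lsum ?m)) (x \<oplus>\<^bsub>V\<^esub> V.lsum xs)"
        using IH x by (intro V.le_add) auto
      ultimately have "vl_le V (modulus V (V.rs t x \<oplus>\<^bsub>V\<^esub> V.lsum ?m)) (x \<oplus>\<^bsub>V\<^esub> V.lsum xs)"
        by (rule V.le_trans) (use IH x in auto)
      moreover have "V.lsum (x # xs) = x \<oplus>\<^bsub>V\<^esub> V.lsum xs" using x by (simp add: V.lsum_Cons V.Cn_subset)
      moreover have "q (V.rs t x \<oplus>\<^bsub>V\<^esub> V.lsum ?m) = W.rs t (q x) \<oplus>\<^bsub>W\<^esub> q (V.lsum ?m)" using x IH q by simp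
      ultimately show ?case unfolding l lW IH(5) using x IH q(1)[of x] by simp
    qed (simp add: q0)
    have mem: "V.lsum (map2 V.rs \<sigma> xs) \<in> carrier V" and le: "vl_le V (modulus V (V.lsum (map2 V.rs \<sigma> xs))) a"
      using * xsC(2) by auto
    have "vl_le W (q (V.lsum (map2 V.rs \<sigma> xs))) b" by (rule b(2)[OF mem le])
    thus "vl_le W (\<zero>\<^bsub>W\<^esub> \<oplus>\<^bsub>W\<^esub> W.lsum (map2 W.rs \<sigma> (map q xs))) b" using * q(1)[OF mem] by simp
  qed simp
  moreover have "set (map (\<lambda>x. modulus W (q x)) xs) \<subseteq> carrier W" using xsC q(1) by auto
  ultimately show ?thesis by (simp add: comp_def)
qed

declare One_nat_def [simp del]

text \<open>An operator on \<open>G\<close> is regarded as a map on tuples of length 1. The lattice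
  of order bounded operators is then obtained from the lattice of maps of bounded variation, the
  link being \<open>ob_iff_bv\<close>.\<close>

locale ob_space = G: avl G + F: dc_avl F
  for G :: "('k :: real_or_complex, 'a) vlattice" and F :: "('k, 'f) vlattice"
begin

definition pt :: "'a \<Rightarrow> nat \<Rightarrow> 'a" where "pt x = (\<lambda>k\<in>{1..1}. x)"

abbreviation Gt where "Gt \<equiv> tuples 1 (\<lambda>_. G)"
abbreviation one_bv where "one_bv \<equiv> bv_maps 1 (\<lambda>_. G) F"

definition on_tuples :: "('a \<Rightarrow> 'f) \<Rightarrow> (nat \<Rightarrow> 'a) \<Rightarrow> 'f" where "on_tuples S = (\<lambda>f\<in>Gt. S (f 1))"

lemma one_family: "avl_family_ne 1 (\<lambda>_. G) F"
  by unfold_locales simp_all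

lemma pt_upd: "(pt x)(1 := y) = pt y" and pt_1: "pt x 1 = x" by (auto simp: pt_def)

lemma Gt_eq: "Gt = pt ` carrier G"
proof -
  have "f = pt (f 1)" if "f \<in> Gt" for f using that
    by (intro extensionalityI[of _ "{1..1}"]) (auto simp: tuples_def pt_def PiE_iff)
  moreover have "f 1 \<in> carrier G" if "f \<in> Gt" for f using that by (auto simp: tuples_def)
  moreover have "pt x \<in> Gt" if "x \<in> carrier G" for x using that by (auto simp: tuples_def pt_def)
  ultimately show ?thesis by blast
qed

lemma pos_Gt_eq: "pos_tuples 1 (\<lambda>_. G) = pt ` pos_cone G"
proof -
  have "f = pt (f 1)" if "f \<in> pos_tuples 1 (\<lambda>_. G)" for f using that
    by (intro extensionalityI[of _ "{1..1}"]) (auto simp: pos_tuples_def pt_def PiE_iff)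
  moreover have "f 1 \<in> pos_cone G" if "f \<in> pos_tuples 1 (\<lambda>_. G)" for f using that by (auto simp: pos_tuples_def)
  moreover have "pt x \<in> pos_tuples 1 (\<lambda>_. G)" if "x \<in> pos_cone G" for x using that by (auto simp: pos_tuples_def pt_def)
  ultimately show ?thesis by blast
qed

lemma on_tuples_pt: "x \<in> carrier G ==> on_tuples S (pt x) = S x"
  using Gt_eq by (simp add: on_tuples_def pt_1)

lemma linear_iff: "linear_map G F S \<longleftrightarrow> avl_family.lin_on 1 (\<lambda>_. G) F (avl_family.I 1) (on_tuples S)"
proof -
  interpret O: avl_family_ne 1 "\<lambda>_. G" F by (rule one_family)
  have I: "O.I = {1}" by (simp add: O.I_def)
  have "O.lin_on O.I (on_tuples S) \<longleftrightarrow> multilinear_map 1 (\<lambda>_. G) F (on_tuples S)"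
    using O.multilinear_iff O.I_ne by simp
  also have "... \<longleftrightarrow> (\<forall>x\<in>carrier G. linear_map G F (\<lambda>y. on_tuples S (pt y)))"
    unfolding multilinear_map_def Gt_eq using pt_upd by simp
  also have "... \<longleftrightarrow> linear_map G F (\<lambda>y. on_tuples S (pt y))" using G.cl(1) by blast
  also have "... \<longleftrightarrow> linear_map G F S" unfolding linear_map_def by (simp add: on_tuples_pt Pi_iff)
  finally show ?thesis by simp
qed

text \<open>Monotonicity and \<open>am_T_le\<close> show that the image of a bound of
  \<open>A\<close> bounds the image of \<open>A\<close>.\<close>

lemma pos_linear_ob:
  assumes lin: "linear_map G F S" and pos: "\<And>x. x \<in> pos_cone G ==> S x \<in> pos_cone F"
    and A: "order_bounded G A"
  shows "order_bounded F (S ` A)"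
proof -
  interpret S: avl_map G F S using lin by unfold_locales
  obtain w where w: "w \<in> pos_cone G" "\<And>a. a \<in> A ==> vl_le G (modulus G a) w" "A \<subseteq> carrier G"
    using A unfolding order_bounded_def by blast
  have "vl_le F (modulus F (S a)) (S w)" if "a \<in> A" for a
  proof (rule F.le_trans)
    have aG: "a \<in> carrier G" using that w by auto
    show "vl_le F (modulus F (S a)) (S (modulus G a))" using pos aG by (intro S.am_T_le) auto
    show "vl_le F (S (modulus G a)) (S w)" using pos w that aG by (intro S.T_mono) auto
  qed (use that w in auto)
  hence "\<exists>f\<in>pos_cone F. \<forall>b\<in>S ` A. vl_le F (modulus F b) f" using pos[OF w(1)] by auto
  moreover have "S ` A \<subseteq> carrier F" using w(3) by auto
  ultimately show ?thesis unfolding order_bounded_def by blast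
qed

lemma ob_four:
  assumes lin: "linear_map G F S" and A: "\<And>i. i < 4 ==> order_bounded F (T i ` A)" "A \<subseteq> carrier G"
    and eq: "\<And>x. x \<in> A ==> S x = (T 0 x \<ominus>\<^bsub>F\<^esub> T 1 x) \<oplus>\<^bsub>F\<^esub> kI \<odot>\<^bsub>F\<^esub> (T 2 x \<ominus>\<^bsub>F\<^esub> T (3::nat) x)"
  shows "order_bounded F (S ` A)"
proof -
  have "\<exists>w. w \<in> pos_cone F \<and> (\<forall>x\<in>A. T i x \<in> carrier F \<and> vl_le F (modulus F (T i x)) w)" if "i < 4" for i
    using A(1)[OF that] unfolding order_bounded_def by blast
  then obtain w where w: "\<And>i. i < 4 ==> w i \<in> pos_cone F" "\<And>i x. i < 4 ==> x \<in> A ==> T i x \<in> carrier F"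
    "\<And>i x. i < 4 ==> x \<in> A ==> vl_le F (modulus F (T i x)) (w i)" by metis
  have "vl_le F (modulus F (S x)) ((w 0 \<oplus>\<^bsub>F\<^esub> w 1) \<oplus>\<^bsub>F\<^esub> (w 2 \<oplus>\<^bsub>F\<^esub> w 3))" if x: "x \<in> A" for x
  proof -
    have c: "T 0 x \<in> carrier F" "T 1 x \<in> carrier F" "T 2 x \<in> carrier F" "T 3 x \<in> carrier F" using w(2)[OF _ x] by auto
    have W: "w 0 \<in> pos_cone F" "w 1 \<in> pos_cone F" "w 2 \<in> pos_cone F" "w 3 \<in> pos_cone F" using w(1) by auto
    have l: "vl_le F (modulus F (T 0 x)) (w 0)" "vl_le F (modulus F (T 1 x)) (w 1)"
      "vl_le F (modulus F (T 2 x)) (w 2)" "vl_le F (modulus F (T 3 x)) (w 3)" using w(3)[OF _ x] by auto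
    have a: "vl_le F (modulus F (T 0 x \<ominus>\<^bsub>F\<^esub> T 1 x)) (w 0 \<oplus>\<^bsub>F\<^esub> w 1)"
      by (rule F.le_trans[OF F.am_triangle_minus[OF c(1,2)] F.le_add[OF l(1,2)]]) (use c W in auto)
    have b: "vl_le F (modulus F (T 2 x \<ominus>\<^bsub>F\<^esub> T 3 x)) (w 2 \<oplus>\<^bsub>F\<^esub> w 3)"
      by (rule F.le_trans[OF F.am_triangle_minus[OF c(3,4)] F.le_add[OF l(3,4)]]) (use c W in auto)
    have "vl_le F (F.rs (norm (kI::'k)) (modulus F (T 2 x \<ominus>\<^bsub>F\<^esub> T 3 x))) (F.rs 1 (modulus F (T 2 x \<ominus>\<^bsub>F\<^esub> T 3 x)))"
      using norm_kI c by (intro F.le_rs_mono) auto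
    hence "vl_le F (modulus F (kI \<odot>\<^bsub>F\<^esub> (T 2 x \<ominus>\<^bsub>F\<^esub> T 3 x))) (modulus F (T 2 x \<ominus>\<^bsub>F\<^esub> T 3 x))" using c by (simp add: F.am_smult)
    from F.le_trans[OF this b] have b': "vl_le F (modulus F (kI \<odot>\<^bsub>F\<^esub> (T 2 x \<ominus>\<^bsub>F\<^esub> T 3 x))) (w 2 \<oplus>\<^bsub>F\<^esub> w 3)" using c W by simp
    show ?thesis unfolding eq[OF x]
      by (rule F.le_trans[OF F.am_triangle F.le_add[OF a b']]) (use c W in auto)
  qed
  moreover have "S ` A \<subseteq> carrier F" using lin A(2) unfolding linear_map_def by auto
  moreover have "(w 0 \<oplus>\<^bsub>F\<^esub> w 1) \<oplus>\<^bsub>F\<^esub> (w 2 \<oplus>\<^bsub>F\<^esub> w 3) \<in> pos_cone F" using w(1) by auto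
  ultimately show ?thesis unfolding order_bounded_def by blast
qed

text \<open>A sign combination of a partition of \<open>g\<close> has modulus at most
  \<open>g\<close>, so an order bounded operator is bounded on all of them at once; this bounds sums
  of moduli, separately for real and imaginary parts. Conversely a map of bounded variation is a
  combination of four positive maps, which are order bounded.\<close>

lemma ob_iff_bv: assumes S: "S \<in> extensional (carrier G)"
  shows "S \<in> ob_maps G F \<longleftrightarrow> on_tuples S \<in> one_bv"
proof
  interpret O: avl_family_ne 1 "\<lambda>_. G" F by (rule one_family)
  have I: "O.I = {1}" by (simp add: O.I_def)
  {
    assume "S \<in> ob_maps G F"
    hence lin: "linear_map G F S" and ob: "\<And>A. order_bounded G A ==> order_bounded F (S ` A)" by (auto simp: ob_maps_def)
    interpret S: avl_map G F S using lin by unfold_locales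
    have L: "O.lin_on O.I (on_tuples S)" using lin linear_iff by simp
    have "\<exists>b\<in>pos_cone F. \<forall>Xs\<in>O.parts a. vl_le F (F.gsum O.I Xs (\<lambda>a. modulus F (on_tuples S a))) b" if a: "a \<in> O.PTu" for a
    proof -
      obtain g where g: "g \<in> pos_cone G" "a = pt g" using a pos_Gt_eq by auto
      have "order_bounded G {y \<in> carrier G. vl_le G (modulus G y) g}" using g by (auto simp: order_bounded_def)
      from ob[OF this] obtain b where b: "b \<in> pos_cone F"
        "\<And>y. y \<in> carrier G ==> vl_le G (modulus G y) g ==> vl_le F (modulus F (S y)) b" unfolding order_bounded_def by blast
      \<comment> \<open>The bound \<open>b\<close> of \<open>S\<close> on the order interval of
        \<open>g\<close> is used twice, once for the real and once for the imaginary parts.\<close>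
      have "vl_le F (F.gsum O.I Xs (\<lambda>a. modulus F (on_tuples S a))) (b \<oplus>\<^bsub>F\<^esub> b)" if X: "Xs \<in> O.parts a" for Xs
      proof -
        have X1: "Xs 1 \<in> pos_partitions G g" using X g(2) pt_1 I unfolding O.parts_def by auto
        hence X1C: "set (Xs 1) \<subseteq> pos_cone G" by (auto simp: G.pos_partitions_iff)
        have X1c: "set (Xs 1) \<subseteq> carrier G" using X1C by (rule G.Cn_subset)
        note sub = O.mlin_subadd[OF L]
        have "F.gsum O.I (Xs(1 := Xs 1)) (\<lambda>a. modulus F (on_tuples S a)) =
          F.lsum (map (\<lambda>x. F.gsum O.I (Xs(1 := [x])) (\<lambda>a. modulus F (on_tuples S a))) (Xs 1))"
          by (rule O.gsum_sep_good[OF sub O.parts_good[OF X]]) (use I X1C in auto)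
        moreover have "F.gsum O.I (Xs(1 := [x])) (\<lambda>a. modulus F (on_tuples S a)) = modulus F (S x)" if "x \<in> set (Xs 1)" for x
        proof -
          have x: "x \<in> carrier G" using that X1c by auto
          have r: "restrict (\<lambda>_. x) O.I = pt x" by (simp add: pt_def O.I_def)
          have "F.gsum O.I (Xs(1 := [x])) (\<lambda>a. modulus F (on_tuples S a)) = modulus F (on_tuples S (restrict (\<lambda>_. x) O.I))"
          proof (rule F.gsum_single)
            show "modulus F (on_tuples S (restrict (\<lambda>_. x) O.I)) \<in> carrier F" unfolding r on_tuples_pt[OF x] using x by simp
          qed (use I in simp)
          thus ?thesis using x by (simp add: r on_tuples_pt)
        qed
        ultimately have e: "F.gsum O.I Xs (\<lambda>a. modulus F (on_tuples S a)) = F.lsum (map (\<lambda>x. modulus F (S x)) (Xs 1))"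
          by (simp cong: map_cong)
        have Rs: "vl_le F (F.lsum (map (\<lambda>x. modulus F (F.Rp (S x))) (Xs 1))) b"
        proof (rule lsum_am_real_linear_le[OF G.avl_axioms F.avl_axioms])
          fix y assume y: "y \<in> carrier G" "vl_le G (modulus G y) g"
          show "vl_le F (F.Rp (S y)) b" by (rule F.le_trans[OF F.Rp_le_am b(2)[OF y]]) (use y b in auto)
        qed (use b X1 in \<open>auto simp: S.T_add S.T_rs F.Rp_add F.Rp_rs\<close>)
        have Is: "vl_le F (F.lsum (map (\<lambda>x. modulus F (F.Ip (S x))) (Xs 1))) b"
        proof (rule lsum_am_real_linear_le[OF G.avl_axioms F.avl_axioms])
          fix y assume y: "y \<in> carrier G" "vl_le G (modulus G y) g"
          have "vl_le F (F.Ip (S y)) (modulus F (S y))"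
            by (rule F.le_trans[OF F.le_am F.am_Ip_le]) (use y in auto)
          thus "vl_le F (F.Ip (S y)) b" by (rule F.le_trans[OF _ b(2)[OF y]]) (use y b in auto)
        next
          fix x r assume "x \<in> carrier G"
          thus "F.Ip (S (G.rs r x)) = F.rs r (F.Ip (S x))"
            using F.Rp_rs[of "(- kI) \<odot>\<^bsub>F\<^esub> S x" r] by (simp add: S.T_rs F.Ip_def F.rs_def mult.commute)
        qed (use b X1 in \<open>auto simp: S.T_add F.Ip_add\<close>)
        have "vl_le F (F.lsum (map (\<lambda>x. modulus F (S x)) xs))
           (F.lsum (map (\<lambda>x. modulus F (F.Rp (S x))) xs) \<oplus>\<^bsub>F\<^esub> F.lsum (map (\<lambda>x. modulus F (F.Ip (S x))) xs))
           \<and> F.lsum (map (\<lambda>x. modulus F (S x)) xs) \<in> carrier F \<and> F.lsum (map (\<lambda>x. modulus F (F.Rp (S x))) xs) \<in> carrier F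
           \<and> F.lsum (map (\<lambda>x. modulus F (F.Ip (S x))) xs) \<in> carrier F"
          if "set xs \<subseteq> carrier G" for xs
          using that
        proof (induction xs)
          case (Cons x xs)
          hence x: "x \<in> carrier G" "set xs \<subseteq> carrier G" by auto
          have s: "set (map (\<lambda>x. modulus F (S x)) xs) \<subseteq> carrier F" "set (map (\<lambda>x. modulus F (F.Rp (S x))) xs) \<subseteq> carrier F"
            "set (map (\<lambda>x. modulus F (F.Ip (S x))) xs) \<subseteq> carrier F" using x by auto
          have IH: "vl_le F (F.lsum (map (\<lambda>x. modulus F (S x)) xs))
             (F.lsum (map (\<lambda>x. modulus F (F.Rp (S x))) xs) \<oplus>\<^bsub>F\<^esub> F.lsum (map (\<lambda>x. modulus F (F.Ip (S x))) xs))"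
            using Cons by auto
          note l = F.lsum_Cons[OF _ s(1)] F.lsum_Cons[OF _ s(2)] F.lsum_Cons[OF _ s(3)]
          note lc = F.lsum_cl[OF s(1)] F.lsum_cl[OF s(2)] F.lsum_cl[OF s(3)]
          have "vl_le F (modulus F (S x) \<oplus>\<^bsub>F\<^esub> F.lsum (map (\<lambda>x. modulus F (S x)) xs))
            ((modulus F (F.Rp (S x)) \<oplus>\<^bsub>F\<^esub> modulus F (F.Ip (S x))) \<oplus>\<^bsub>F\<^esub>
            (F.lsum (map (\<lambda>x. modulus F (F.Rp (S x))) xs) \<oplus>\<^bsub>F\<^esub> F.lsum (map (\<lambda>x. modulus F (F.Ip (S x))) xs)))"
            using x lc by (intro F.le_add[OF F.am_le_Rp_Ip IH]) auto
          thus ?case using x lc by (simp add: l F.M.add.m_ac)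
        qed simp
        note split = this[OF X1c]
        have bb: "b \<in> carrier F" using b by simp
        show ?thesis unfolding e
          by (rule F.le_trans[OF conjunct1[OF split] F.le_add[OF Rs Is]]) (use split bb in auto)
      qed
      thus ?thesis using b(1) by (intro bexI[of _ "b \<oplus>\<^bsub>F\<^esub> b"]) auto
    qed
    hence "O.bounded_on (\<lambda>a. modulus F (on_tuples S a))" unfolding O.bounded_on_def[OF O.mlin_subadd[OF L]] by blast
    thus "on_tuples S \<in> one_bv" unfolding O.bv_iff using L by (simp add: on_tuples_def)
  }
  {
    assume T: "on_tuples S \<in> one_bv"
    hence lin: "linear_map G F S" using O.bvD(1) linear_iff by blast
    interpret S: avl_map G F S using lin by unfold_locales
    obtain a b c d where p: "a \<in> pos_bv_maps 1 (\<lambda>_. G) F" "b \<in> pos_bv_maps 1 (\<lambda>_. G) F" "c \<in> pos_bv_maps 1 (\<lambda>_. G) F"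
      "d \<in> pos_bv_maps 1 (\<lambda>_. G) F" "on_tuples S = (a \<ominus>\<^bsub>O.B0\<^esub> b) \<oplus>\<^bsub>O.B0\<^esub> kI \<odot>\<^bsub>O.B0\<^esub> (c \<ominus>\<^bsub>O.B0\<^esub> d)"
      using O.bv_four[OF T] by blast
    have pob: "order_bounded F ((\<lambda>x. u (pt x)) ` A)" if "u \<in> pos_bv_maps 1 (\<lambda>_. G) F" "order_bounded G A" for u A
    proof (rule pos_linear_ob[OF _ _ that(2)])
      have "on_tuples (\<lambda>x. u (pt x)) = u"
      proof (rule extensionalityI[of _ Gt])
        show "on_tuples (\<lambda>x. u (pt x)) f = u f" if "f \<in> Gt" for f using that Gt_eq on_tuples_pt by auto
      qed (use O.bvD(2)[OF O.pos_bv[OF that(1)]] in \<open>auto simp: on_tuples_def\<close>)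
      thus "linear_map G F (\<lambda>x. u (pt x))" using linear_iff O.bvD(1)[OF O.pos_bv[OF that(1)]] by simp
      show "u (pt x) \<in> pos_cone F" if "x \<in> pos_cone G" for x
        using O.pos_bv_Cn[OF \<open>u \<in> _\<close>] pos_Gt_eq that by auto
    qed
    have "order_bounded F (S ` A)" if A: "order_bounded G A" for A
    proof (rule ob_four[where T = "\<lambda>i x. if i = 0 then a (pt x) else if i = 1 then b (pt x) else if i = 2 then c (pt x) else d (pt x)"])
      show AG: "A \<subseteq> carrier G" using A by (auto simp: order_bounded_def)
      fix x assume "x \<in> A"
      hence x: "x \<in> carrier G" and px: "pt x \<in> Gt" using AG Gt_eq by auto
      have "S x = ((a \<ominus>\<^bsub>O.B0\<^esub> b) \<oplus>\<^bsub>O.B0\<^esub> kI \<odot>\<^bsub>O.B0\<^esub> (c \<ominus>\<^bsub>O.B0\<^esub> d)) (pt x)"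
        using on_tuples_pt[OF x, of S] p(5) by simp
      also have "... = (a (pt x) \<ominus>\<^bsub>F\<^esub> b (pt x)) \<oplus>\<^bsub>F\<^esub> kI \<odot>\<^bsub>F\<^esub> (c (pt x) \<ominus>\<^bsub>F\<^esub> d (pt x))"
        using px p by (simp add: O.B0_minus O.pos_bv)
      finally show "S x = ((if 0 = (0::nat) then a (pt x) else if 0 = (1::nat) then b (pt x) else if 0 = (2::nat) then c (pt x) else d (pt x)) \<ominus>\<^bsub>F\<^esub>
        (if 1 = (0::nat) then a (pt x) else if 1 = (1::nat) then b (pt x) else if 1 = (2::nat) then c (pt x) else d (pt x))) \<oplus>\<^bsub>F\<^esub>
        kI \<odot>\<^bsub>F\<^esub> ((if 2 = (0::nat) then a (pt x) else if 2 = (1::nat) then b (pt x) else if 2 = (2::nat) then c (pt x) else d (pt x)) \<ominus>\<^bsub>F\<^esub>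
        (if 3 = (0::nat) then a (pt x) else if 3 = (1::nat) then b (pt x) else if 3 = (2::nat) then c (pt x) else d (pt x)))" by simp
    next
      fix i :: nat assume "i < 4"
      show "order_bounded F ((\<lambda>x. if i = 0 then a (pt x) else if i = 1 then b (pt x) else if i = 2 then c (pt x) else d (pt x)) ` A)"
        using pob[OF p(1) A] pob[OF p(2) A] pob[OF p(3) A] pob[OF p(4) A] by auto
    qed (rule lin)
    thus "S \<in> ob_maps G F" using S lin by (simp add: ob_maps_def)
  }
qed

abbreviation OB0 where "OB0 \<equiv> pointwise_space (carrier G) (ob_maps G F) F"

lemma OB0_simps: "carrier OB0 = ob_maps G F" "\<zero>\<^bsub>OB0\<^esub> = (\<lambda>x\<in>carrier G. \<zero>\<^bsub>F\<^esub>)"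
  "S \<oplus>\<^bsub>OB0\<^esub> T = (\<lambda>x\<in>carrier G. S x \<oplus>\<^bsub>F\<^esub> T x)" "\<alpha> \<odot>\<^bsub>OB0\<^esub> T = (\<lambda>x\<in>carrier G. \<alpha> \<odot>\<^bsub>F\<^esub> T x)"
  by (simp_all add: pointwise_space_def)

lemma ob_lattice_structure:
  "archimedean_vector_lattice (ob_lattice G F)" "pos_cone (ob_lattice G F) = pos_ob_maps G F"
  "\<exists>m. ob_lattice G F = attach_modulus OB0 m"
proof -
  interpret O: avl_family_ne 1 "\<lambda>_. G" F by (rule one_family)
  let ?L = "bv_lattice 1 (\<lambda>_. G) F"
  have ext: "S \<in> extensional (carrier G)" if "S \<in> ob_maps G F" for S using that by (simp add: ob_maps_def)
  have inv: "(\<lambda>x\<in>carrier G. T (pt x)) \<in> ob_maps G F" "on_tuples (\<lambda>x\<in>carrier G. T (pt x)) = T" if T: "T \<in> one_bv" for T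
  proof -
    show e: "on_tuples (\<lambda>x\<in>carrier G. T (pt x)) = T"
    proof (rule extensionalityI[of _ Gt])
      show "on_tuples (\<lambda>x\<in>carrier G. T (pt x)) f = T f" if "f \<in> Gt" for f using that Gt_eq on_tuples_pt by auto
    qed (use O.bvD(2)[OF T] in \<open>auto simp: on_tuples_def\<close>)
    show "(\<lambda>x\<in>carrier G. T (pt x)) \<in> ob_maps G F" using ob_iff_bv[of "\<lambda>x\<in>carrier G. T (pt x)"] e T by simp
  qed
  have bij: "bij_betw on_tuples (carrier OB0) (carrier ?L)"
  proof (rule bij_betwI[where g = "\<lambda>T. \<lambda>x\<in>carrier G. T (pt x)"])
    show "on_tuples \<in> carrier OB0 \<rightarrow> carrier ?L" using ob_iff_bv ext by (auto simp: OB0_simps)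
    show "(\<lambda>T. \<lambda>x\<in>carrier G. T (pt x)) \<in> carrier ?L \<rightarrow> carrier OB0" using inv by (auto simp: OB0_simps)
    show "(\<lambda>x\<in>carrier G. on_tuples S (pt x)) = S" if "S \<in> carrier OB0" for S
      using ext[of S] that by (intro extensionalityI[of _ "carrier G"]) (auto simp: on_tuples_pt OB0_simps)
    show "on_tuples (\<lambda>x\<in>carrier G. T (pt x)) = T" if "T \<in> carrier ?L" for T using inv that by simp
  qed
  have z: "on_tuples (\<lambda>x\<in>carrier G. \<zero>\<^bsub>F\<^esub>) = \<zero>\<^bsub>?L\<^esub>"
    using Gt_eq by (auto simp: on_tuples_def pt_1 intro!: extensionalityI[of _ Gt])
  have add: "on_tuples (\<lambda>x\<in>carrier G. S x \<oplus>\<^bsub>F\<^esub> T x) = on_tuples S \<oplus>\<^bsub>?L\<^esub> on_tuples T" for S T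
    using Gt_eq by (auto simp: on_tuples_def pt_1 intro!: extensionalityI[of _ Gt])
  have sm: "on_tuples (\<lambda>x\<in>carrier G. \<alpha> \<odot>\<^bsub>F\<^esub> S x) = \<alpha> \<odot>\<^bsub>?L\<^esub> on_tuples S" for S \<alpha>
    using Gt_eq by (auto simp: on_tuples_def pt_1 intro!: extensionalityI[of _ Gt])
  have zc: "(\<lambda>x\<in>carrier G. \<zero>\<^bsub>F\<^esub>) \<in> ob_maps G F"
    using ob_iff_bv[of "\<lambda>x\<in>carrier G. \<zero>\<^bsub>F\<^esub>"] z O.pos_bv[OF O.zero_pos_bv] by simp
  have ac: "(\<lambda>x\<in>carrier G. S x \<oplus>\<^bsub>F\<^esub> T x) \<in> ob_maps G F" if "S \<in> ob_maps G F" "T \<in> ob_maps G F" for S T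
    using ob_iff_bv[of "\<lambda>x\<in>carrier G. S x \<oplus>\<^bsub>F\<^esub> T x"] add[of S T] O.bv_add that ob_iff_bv[OF ext] by simp
  have sc: "(\<lambda>x\<in>carrier G. \<alpha> \<odot>\<^bsub>F\<^esub> S x) \<in> ob_maps G F" if "S \<in> ob_maps G F" for S \<alpha>
    using ob_iff_bv[of "\<lambda>x\<in>carrier G. \<alpha> \<odot>\<^bsub>F\<^esub> S x"] sm[of \<alpha> S] O.bv_smult that ob_iff_bv[OF ext] by simp
  define m where "m = restrict (\<lambda>x. inv_into (carrier OB0) on_tuples (modulus ?L (on_tuples x))) (carrier OB0)"
  have tr: "archimedean_vector_lattice (attach_modulus OB0 m)"
    "pos_cone (attach_modulus OB0 m) = {x \<in> carrier OB0. on_tuples x \<in> pos_cone ?L}"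
    unfolding m_def
    by (rule avl_transport[OF O.bv_lattice_avl bij]; simp only: OB0_simps; (intro zc ac sc z add sm; assumption)?)+
  have "{x \<in> carrier OB0. on_tuples x \<in> pos_cone ?L} = pos_ob_maps G F"
  proof -
    have "on_tuples S \<in> pos_cone ?L \<longleftrightarrow> S \<in> pos_cone G \<rightarrow> pos_cone F" if S: "S \<in> ob_maps G F" for S
      using S ob_iff_bv[OF ext[OF S]] on_tuples_pt
      by (auto simp: O.bv_lattice_cone pos_bv_maps_def pos_Gt_eq Pi_iff)
    thus ?thesis by (auto simp: pos_ob_maps_def OB0_simps)
  qed
  note tr2 = tr(2)[unfolded this]
  have e: "ob_lattice G F = attach_modulus OB0 m"
    unfolding ob_lattice_def by (rule lattice_of_cone_eq[OF tr(1) tr2]) (simp add: m_def)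
  show "archimedean_vector_lattice (ob_lattice G F)" "pos_cone (ob_lattice G F) = pos_ob_maps G F"
    unfolding e by (fact tr tr2)+
  show "\<exists>m. ob_lattice G F = attach_modulus OB0 m" using e by blast
qed

lemma ob_lattice_simps: "carrier (ob_lattice G F) = ob_maps G F" "\<zero>\<^bsub>ob_lattice G F\<^esub> = (\<lambda>x\<in>carrier G. \<zero>\<^bsub>F\<^esub>)"
  "S \<oplus>\<^bsub>ob_lattice G F\<^esub> T = (\<lambda>x\<in>carrier G. S x \<oplus>\<^bsub>F\<^esub> T x)" "\<alpha> \<odot>\<^bsub>ob_lattice G F\<^esub> T = (\<lambda>x\<in>carrier G. \<alpha> \<odot>\<^bsub>F\<^esub> T x)"
  using ob_lattice_structure(3) by (auto simp: OB0_simps)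

end

context avl_family_ne
begin

section \<open>Evaluation as a vector lattice s-morphism\<close>

lemma L_ob: "ob_space L F" by unfold_locales

definition ev where "ev f = (\<lambda>T\<in>bv_maps s E F. T f)"

abbreviation G2 where "G2 \<equiv> ob_lattice L F"

lemma ev_linear: "f \<in> Tu ==> linear_map L F (ev f)"
  unfolding linear_map_def using bv_cl bv_add bv_smult by (auto simp: ev_def)

lemma ev_mult:
  assumes f: "f \<in> Tu" and k: "k \<in> I" and T: "T \<in> bv_maps s E F"
  shows "x \<in> carrier (E k) ==> y \<in> carrier (E k) ==> ev (f(k := x \<oplus>\<^bsub>E k\<^esub> y)) T = ev (f(k := x)) T \<oplus>\<^bsub>F\<^esub> ev (f(k := y)) T"
    and "x \<in> carrier (E k) ==> ev (f(k := \<alpha> \<odot>\<^bsub>E k\<^esub> x)) T = \<alpha> \<odot>\<^bsub>F\<^esub> ev (f(k := x)) T"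
  using mlin_add[OF bvD(1)[OF T] f k] mlin_smult[OF bvD(1)[OF T] f k] T by (simp_all add: ev_def)

text \<open>At a positive tuple evaluation is a positive operator, hence order bounded. Other tuples
  are reached one variable at a time through combinations of four positive entries.\<close>

lemma ev_ob: assumes f: "f \<in> Tu" shows "ev f \<in> ob_maps L F"
proof -
  interpret B: ob_space L F by (rule L_ob)
  have "order_bounded L A \<longrightarrow> order_bounded F (ev f ` A)" for A
    using f
  proof (induction rule: tuple_induct)
    case (base a)
    show ?case
    proof
      assume "order_bounded L A"
      moreover have "ev a x \<in> pos_cone F" if "x \<in> pos_cone L" for x
        using that pos_bv pos_bv_Cn[OF _ base] by (auto simp: bv_lattice_cone ev_def)
      ultimately show "order_bounded F (ev a ` A)" using ev_linear[OF PTu_Tu[OF base]] B.pos_linear_ob by blast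
    qed
  next
    case (step f k x)
    interpret Ek: avl "E k" using avlE[OF step(2)] .
    obtain a b c d where p: "a \<in> pos_cone (E k)" "b \<in> pos_cone (E k)" "c \<in> pos_cone (E k)" "d \<in> pos_cone (E k)"
      "x = (a \<ominus>\<^bsub>E k\<^esub> b) \<oplus>\<^bsub>E k\<^esub> kI \<odot>\<^bsub>E k\<^esub> (c \<ominus>\<^bsub>E k\<^esub> d)"
      using Ek.carrier_four[OF step(3)] by blast
    have 1: "order_bounded F (ev (f(k := y)) ` A)" if "order_bounded L A" "y \<in> pos_cone (E k)" for y
      using step(4)[OF that(2)] that(1) by blast
    have "order_bounded F (ev (f(k := x)) ` A)" if A: "order_bounded L A"
    proof (rule B.ob_four[where T = "\<lambda>i. if i = 0 then ev (f(k := a)) else if i = 1 then ev (f(k := b)) else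
          if i = 2 then ev (f(k := c)) else ev (f(k := d))"])
      show "linear_map L F (ev (f(k := x)))" using ev_linear Tu_upd step by blast
      show AL: "A \<subseteq> carrier L" using A by (auto simp: order_bounded_def)
      fix T assume "T \<in> A"
      hence T: "T \<in> bv_maps s E F" using AL by auto
      have "ev (f(k := x)) T = (ev (f(k := a)) T \<ominus>\<^bsub>F\<^esub> ev (f(k := b)) T) \<oplus>\<^bsub>F\<^esub> kI \<odot>\<^bsub>F\<^esub> (ev (f(k := c)) T \<ominus>\<^bsub>F\<^esub> ev (f(k := d)) T)"
        using mlin_four[OF bvD(1)[OF T] step(1,2) p(1-4)] T by (simp add: ev_def p(5))
      thus "ev (f(k := x)) T = ((if 0 = (0::nat) then ev (f(k := a)) else if 0 = (1::nat) then ev (f(k := b)) else if 0 = (2::nat) then ev (f(k := c)) else ev (f(k := d))) T \<ominus>\<^bsub>F\<^esub>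
        (if 1 = (0::nat) then ev (f(k := a)) else if 1 = (1::nat) then ev (f(k := b)) else if 1 = (2::nat) then ev (f(k := c)) else ev (f(k := d))) T) \<oplus>\<^bsub>F\<^esub> kI \<odot>\<^bsub>F\<^esub>
        ((if 2 = (0::nat) then ev (f(k := a)) else if 2 = (1::nat) then ev (f(k := b)) else if 2 = (2::nat) then ev (f(k := c)) else ev (f(k := d))) T \<ominus>\<^bsub>F\<^esub>
        (if 3 = (0::nat) then ev (f(k := a)) else if 3 = (1::nat) then ev (f(k := b)) else if 3 = (2::nat) then ev (f(k := c)) else ev (f(k := d))) T)" by simp
    next
      fix i :: nat
      show "order_bounded F ((if i = 0 then ev (f(k := a)) else if i = 1 then ev (f(k := b)) else if i = 2 then ev (f(k := c)) else ev (f(k := d))) ` A)"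
        using 1[OF A] p by auto
    qed
    hence "order_bounded L A \<longrightarrow> order_bounded F (ev (f(k := x)) ` A)" by blast
    thus ?case .
  qed
  thus ?thesis using ev_linear[OF f] by (auto simp: ob_maps_def ev_def)
qed

lemma ev_pos: assumes a: "a \<in> PTu" shows "ev a \<in> pos_ob_maps L F"
  using ev_ob[OF PTu_Tu[OF a]] pos_bv pos_bv_Cn[OF _ a] by (auto simp: pos_ob_maps_def bv_lattice_cone ev_def)

lemma ev_disjoint:
  assumes a: "a \<in> PTu" and k: "k \<in> I" and xy: "x \<in> pos_cone (E k)" "y \<in> pos_cone (E k)" and dj: "avl.dj (E k) x y"
  shows "avl.dj G2 (ev (a(k := x))) (ev (a(k := y)))"
proof -
  interpret B: ob_space L F by (rule L_ob)
  interpret G: avl G2 by (rule avl.intro) (rule B.ob_lattice_structure)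
  note P = PTu_upd[OF a k xy(1)] PTu_upd[OF a k xy(2)]
  show ?thesis unfolding G.dj_def
  proof (intro ballI impI)
    fix Y assume Y: "Y \<in> pos_cone G2" "vl_le G2 Y (ev (a(k := x)))" "vl_le G2 Y (ev (a(k := y)))"
    have Yob: "Y \<in> ob_maps L F" and Ypos: "\<And>T. T \<in> pos_bv_maps s E F ==> Y T \<in> pos_cone F"
      using Y(1) by (auto simp: B.ob_lattice_structure(2) pos_ob_maps_def bv_lattice_cone)
    have Ylin: "linear_map L F Y" using Yob by (simp add: ob_maps_def)
    then interpret Y: avl_map L F Y by unfold_locales
    have le: "vl_le F (Y T) (Z T)" if "vl_le G2 Y Z" "Z \<in> ob_maps L F" "T \<in> pos_bv_maps s E F" for Z T
    proof -
      have "linear_map L F Z" using that(2) by (simp add: ob_maps_def)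
      then interpret Z: avl_map L F Z by unfold_locales
      have Tb: "T \<in> carrier L" using pos_bv[OF that(3)] by simp
      have c: "Z \<ominus>\<^bsub>G2\<^esub> Y \<in> pos_cone G2" by (rule G.leD[OF that(1)])
      have Yc: "Y \<in> carrier G2" using Yob by (simp add: B.ob_lattice_simps)
      have "\<ominus>\<^bsub>G2\<^esub> Y = (-1) \<odot>\<^bsub>G2\<^esub> Y" using G.smult_minus1[OF Yc] by simp
      hence "(Z \<ominus>\<^bsub>G2\<^esub> Y) T = Z T \<ominus>\<^bsub>F\<^esub> Y T" using Tb Yc
        by (simp add: a_minus_def B.ob_lattice_simps F.smult_minus1 del: bv_lattice_simps)
      moreover have "(Z \<ominus>\<^bsub>G2\<^esub> Y) T \<in> pos_cone F"
        using c that(3) by (auto simp: B.ob_lattice_structure(2) pos_ob_maps_def bv_lattice_cone)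
      ultimately show ?thesis by (simp add: vl_le_def)
    qed
    have Y0: "Y T = \<zero>\<^bsub>F\<^esub>" if T: "T \<in> pos_bv_maps s E F" for T
    proof -
      \<comment> \<open>The component on the band of \<open>x\<close> vanishes at \<open>y\<close>
        and the other one vanishes at \<open>x\<close>. So \<open>Y\<close> is 0 on both, being
        below both evaluations.\<close>
      obtain T1 T2 where T12: "T1 \<in> pos_bv_maps s E F" "T2 \<in> pos_bv_maps s E F" "T = T1 \<oplus>\<^bsub>L\<^esub> T2"
        "T2 (a(k := x)) = \<zero>\<^bsub>F\<^esub>" "T1 (a(k := y)) = \<zero>\<^bsub>F\<^esub>"
        using band_component[OF T k xy(1)] a xy(2) dj by blast
      note b1 = pos_bv[OF T12(1)] and b2 = pos_bv[OF T12(2)]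
      have "vl_le F (Y T1) (ev (a(k := y)) T1)" by (rule le[OF Y(3) ev_ob[OF PTu_Tu[OF P(2)]] T12(1)])
      hence 1: "Y T1 = \<zero>\<^bsub>F\<^esub>" using T12(5) b1 by (intro F.le_zero[OF Ypos[OF T12(1)]]) (simp add: ev_def)
      have "vl_le F (Y T2) (ev (a(k := x)) T2)" by (rule le[OF Y(2) ev_ob[OF PTu_Tu[OF P(1)]] T12(2)])
      hence 2: "Y T2 = \<zero>\<^bsub>F\<^esub>" using T12(4) b2 by (intro F.le_zero[OF Ypos[OF T12(2)]]) (simp add: ev_def)
      show ?thesis using T12(3) Y.T_add[of T1 T2] b1 b2 1 2 by (simp del: bv_lattice_simps(3))
    qed
    show "Y = \<zero>\<^bsub>G2\<^esub>"
    proof (rule extensionalityI[of _ "carrier L"])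
      show "Y \<in> extensional (carrier L)" using Yob by (simp add: ob_maps_def)
      show "\<zero>\<^bsub>G2\<^esub> \<in> extensional (carrier L)" by (simp add: B.ob_lattice_simps)
      fix T assume T: "T \<in> carrier L"
      obtain a b c d where p: "a \<in> pos_cone L" "b \<in> pos_cone L" "c \<in> pos_cone L" "d \<in> pos_cone L"
        "T = (a \<ominus>\<^bsub>L\<^esub> b) \<oplus>\<^bsub>L\<^esub> kI \<odot>\<^bsub>L\<^esub> (c \<ominus>\<^bsub>L\<^esub> d)" using L.carrier_four[OF T] by blast
      have z: "Y a = \<zero>\<^bsub>F\<^esub>" "Y b = \<zero>\<^bsub>F\<^esub>" "Y c = \<zero>\<^bsub>F\<^esub>" "Y d = \<zero>\<^bsub>F\<^esub>" using Y0 p by (auto simp: bv_lattice_cone)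
      have pc: "a \<in> carrier L" "b \<in> carrier L" "c \<in> carrier L" "d \<in> carrier L" using p L.CnD by blast+
      have "Y T = (Y a \<ominus>\<^bsub>F\<^esub> Y b) \<oplus>\<^bsub>F\<^esub> kI \<odot>\<^bsub>F\<^esub> (Y c \<ominus>\<^bsub>F\<^esub> Y d)"
        unfolding p(5) using pc by (simp add: Y.T_add Y.T_smult Y.T_minus del: bv_lattice_simps)
      thus "Y T = \<zero>\<^bsub>G2\<^esub> T" using T by (simp add: z F.minus_self B.ob_lattice_simps)
    qed
  qed
qed

lemma ev_s_morphism: "s_morphism s E G2 ev"
proof -
  interpret B: ob_space L F by (rule L_ob)
  interpret G: avl G2 by (rule avl.intro) (rule B.ob_lattice_structure)
  have lin: "linear_map (E k) G2 (\<lambda>x. ev (f(k := x)))" if k: "k \<in> I" and f: "f \<in> Tu" for k f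
    unfolding linear_map_def
  proof (intro conjI ballI allI Pi_I)
    interpret Ek: avl "E k" using avlE[OF k] .
    fix x assume x: "x \<in> carrier (E k)"
    show "ev (f(k := x)) \<in> carrier G2" using ev_ob[OF Tu_upd[OF f k x]] by (simp add: B.ob_lattice_simps)
    show "ev (f(k := x \<oplus>\<^bsub>E k\<^esub> y)) = ev (f(k := x)) \<oplus>\<^bsub>G2\<^esub> ev (f(k := y))" if y: "y \<in> carrier (E k)" for y
      by (rule extensionalityI[of _ "carrier L"]) (use ev_mult(1)[OF f k _ x y] in \<open>auto simp: B.ob_lattice_simps ev_def\<close>)
    show "ev (f(k := \<alpha> \<odot>\<^bsub>E k\<^esub> x)) = \<alpha> \<odot>\<^bsub>G2\<^esub> ev (f(k := x))" for \<alpha>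
      by (rule extensionalityI[of _ "carrier L"]) (use ev_mult(2)[OF f k _ x] in \<open>auto simp: B.ob_lattice_simps ev_def\<close>)
  qed
  have "vl_hom (E k) G2 (\<lambda>x. ev (f(k := x)))" if k: "k \<in> I" and f: "f \<in> Tu" and fp: "\<forall>j\<in>I - {k}. f j \<in> pos_cone (E j)" for k f
  proof -
    interpret Ek: avl "E k" using avlE[OF k] .
    interpret H: avl_map "E k" G2 "\<lambda>x. ev (f(k := x))" using lin[OF k f] by unfold_locales
    \<comment> \<open>Nothing is assumed about \<open>f k\<close>, but the entry at \<open>k\<close>
      is replaced by a positive one.\<close>
    have P: "f(k := x) \<in> PTu" if "x \<in> pos_cone (E k)" for x using f fp that k by (auto simp: PTu_iff Tu_iff extensional_def)
    have e: "(f(k := \<zero>\<^bsub>E k\<^esub>))(k := x) = f(k := x)" for x by simp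
    show ?thesis
    proof (rule H.vl_hom_if_disjoint)
      show "(\<lambda>x. ev (f(k := x))) \<in> pos_cone (E k) \<rightarrow> pos_cone G2"
        using ev_pos P by (auto simp: B.ob_lattice_structure(2))
      fix a b assume "a \<in> pos_cone (E k)" "b \<in> pos_cone (E k)" "Ek.dj a b"
      from ev_disjoint[OF P[OF Ek.Cn_zero] k this] show "G.dj (ev (f(k := a))) (ev (f(k := b)))" by simp
    qed
  qed
  thus ?thesis using lin unfolding s_morphism_def multilinear_map_def I_def by blast
qed

end

section \<open>Partitions of unity and the modulus of a sum with almost constant coefficients\<close>

context avl
begin

text \<open>Near a fixed \<open>w z\<close> all coefficients may be replaced by \<open>c z\<close>:
  the error is at most \<open>\<delta>\<close> times the total \<open>W\<close>, apart from terms
  disjoint from \<open>w z\<close>. Hence the excess \<open>d\<close> is bounded by elements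
  disjoint from \<open>w z\<close>, for each \<open>z\<close>, so \<open>d^+\<close> is disjoint
  from \<open>W\<close>. It is also bounded by a multiple of \<open>W\<close>, and so vanishes.
  Replacing coefficients happens twice, in \<open>q\<close> and in \<open>r\<close>; this is the
  factor 2.\<close>

lemma am_sum_close:
  assumes fin: "finite Y" and w: "\<And>y. y \<in> Y ==> w y \<in> Cn" and d: "\<delta> \<ge> 0"
    and close: "\<And>y z. y \<in> Y ==> z \<in> Y ==> dj (w y) (w z) \<or> norm (c y - c z) \<le> \<delta>"
  shows "am (am (\<Oplus>y\<in>Y. c y \<odot> w y) \<ominus> (\<Oplus>y\<in>Y. norm (c y) *r w y)) \<preceq> (2 * \<delta>) *r (\<Oplus>y\<in>Y. w y)"
proof -
  define q where "q = (\<Oplus>y\<in>Y. c y \<odot> w y)"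
  define r where "r = (\<Oplus>y\<in>Y. norm (c y) *r w y)"
  define W where "W = (\<Oplus>y\<in>Y. w y)"
  have wc: "w \<in> Y \<rightarrow> Vc" using w by auto
  have q: "q \<in> Vc" unfolding q_def using wc by (intro M.finsum_closed) auto
  have r: "r \<in> Cn" unfolding r_def using w by (intro Cn_sum) auto
  have W: "W \<in> Cn" unfolding W_def using w by (intro Cn_sum) auto
  have qr: "am q \<preceq> r"
  proof -
    have "am q \<preceq> (\<Oplus>y\<in>Y. am (c y \<odot> w y))" unfolding q_def using wc by (intro am_sum) auto
    also have "(\<Oplus>y\<in>Y. am (c y \<odot> w y)) = r" unfolding r_def
      using w by (intro M.finsum_cong') (auto simp: am_smult Cn_am)
    finally show ?thesis .
  qed
  define B where "B = (\<Sum>y\<in>Y. norm (c y))"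
  have cB: "norm (c y) \<le> B" if "y \<in> Y" for y unfolding B_def using fin that by (intro member_le_sum) auto
  have B0: "B \<ge> 0" unfolding B_def by (intro sum_nonneg) auto
  define d where "d = r \<ominus> am q \<ominus> (2 * \<delta>) *r W"
  have dR: "d \<in> Rl" unfolding d_def using r q W by auto
  \<comment> \<open>The part of \<open>W\<close> that consists of the pieces disjoint from
    \<open>w z\<close>, where nothing is known about the coefficients beyond the bound
    \<open>B\<close>.\<close>
  define N where "N z = (\<Oplus>y\<in>Y. (if dj (w y) (w z) then w y else \<zero>))" for z
  have NC: "N z \<in> Cn" for z unfolding N_def using w by (intro Cn_sum) auto
  have key: "d \<preceq> (3 * B) *r N z" if z: "z \<in> Y" for z
  proof -
    have aW: "am (norm (c z) *r W) = norm (c z) *r W" using W by (simp add: Cn_am)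
    have 1: "am (c z \<odot> W) \<preceq> am q \<oplus> am (c z \<odot> W \<ominus> q)" using q W by (intro am_triangle') auto
    have e: "c z \<odot> W \<ominus> q = (\<Oplus>y\<in>Y. (c z - c y) \<odot> w y)"
    proof (rule vec_eqI)
      fix \<phi> assume \<phi>: "\<phi> \<in> functionals V"
      have c: "(\<lambda>y. c y \<odot> w y) \<in> Y \<rightarrow> Vc" "(\<lambda>y. (c z - c y) \<odot> w y) \<in> Y \<rightarrow> Vc" using wc by auto
      show "\<phi> (c z \<odot> W \<ominus> q) = \<phi> (\<Oplus>y\<in>Y. (c z - c y) \<odot> w y)"
        using \<phi> q W w fun_sum[OF \<phi> wc] fun_sum[OF \<phi> c(1)] fun_sum[OF \<phi> c(2)]
        unfolding q_def W_def by (simp add: sum_distrib_left sum_subtractf[symmetric] left_diff_distrib)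
    qed (use q W wc in \<open>auto intro!: M.finsum_closed\<close>)
    have 2: "am (c z \<odot> W \<ominus> q) \<preceq> (\<Oplus>y\<in>Y. \<delta> *r w y \<oplus> (2 * B) *r (if dj (w y) (w z) then w y else \<zero>))"
    proof -
      have cl: "(\<lambda>y. (c z - c y) \<odot> w y) \<in> Y \<rightarrow> Vc" using wc by auto
      have "am (\<Oplus>y\<in>Y. (c z - c y) \<odot> w y) \<preceq> (\<Oplus>y\<in>Y. am ((c z - c y) \<odot> w y))" by (rule am_sum[OF cl])
      moreover have "(\<Oplus>y\<in>Y. am ((c z - c y) \<odot> w y)) \<preceq> (\<Oplus>y\<in>Y. \<delta> *r w y \<oplus> (2 * B) *r (if dj (w y) (w z) then w y else \<zero>))"
      proof (rule le_sum)
        fix y assume y: "y \<in> Y"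
        have a: "am ((c z - c y) \<odot> w y) = norm (c z - c y) *r w y" using w[OF y] by (simp add: am_smult Cn_am)
        show "am ((c z - c y) \<odot> w y) \<preceq> \<delta> *r w y \<oplus> (2 * B) *r (if dj (w y) (w z) then w y else \<zero>)"
        proof (cases "dj (w y) (w z)")
          case True
          have "norm (c z - c y) \<le> \<delta> + 2 * B" using cB[OF y] cB[OF z] norm_triangle_ineq4[of "c z" "c y"] \<open>\<delta> \<ge> 0\<close> by linarith
          hence "norm (c z - c y) *r w y \<preceq> (\<delta> + 2 * B) *r w y" using w[OF y] by (intro le_rs_mono) auto
          moreover have "(\<delta> + 2 * B) *r w y = \<delta> *r w y \<oplus> (2 * B) *r w y" using w[OF y] by (intro vec_eqI) (auto simp: algebra_simps)
          ultimately show ?thesis using a True by simp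
        next
          case False
          hence "norm (c z - c y) \<le> \<delta>" using close[OF y z] by (simp add: norm_minus_commute)
          thus ?thesis using a False w[OF y] by (simp add: le_rs_mono)
        qed
      qed (use w in auto)
      ultimately show ?thesis unfolding e by (rule le_trans) (use w cl in \<open>auto intro!: M.finsum_closed\<close>)
    qed
    have 3: "r \<preceq> (\<Oplus>y\<in>Y. (norm (c z) + \<delta>) *r w y \<oplus> B *r (if dj (w y) (w z) then w y else \<zero>))" unfolding r_def
    proof (rule le_sum)
      fix y assume y: "y \<in> Y"
      show "norm (c y) *r w y \<preceq> (norm (c z) + \<delta>) *r w y \<oplus> B *r (if dj (w y) (w z) then w y else \<zero>)"
      proof (cases "dj (w y) (w z)")
        case True
        have "norm (c y) *r w y \<preceq> (norm (c z) + \<delta> + B) *r w y" using w[OF y] cB[OF y] \<open>\<delta> \<ge> 0\<close>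
          by (intro le_rs_mono) (auto simp: add_increasing)
        moreover have "(norm (c z) + \<delta> + B) *r w y = (norm (c z) + \<delta>) *r w y \<oplus> B *r w y" using w[OF y] by (intro vec_eqI) (auto simp: algebra_simps)
        ultimately show ?thesis using True by simp
      next
        case False
        hence "norm (c y) \<le> norm (c z) + \<delta>" using close[OF y z] norm_triangle_ineq2[of "c y" "c z"] by simp
        thus ?thesis using False w[OF y] by (simp add: le_rs_mono)
      qed
    qed (use w in auto)
    have ifc: "(\<lambda>y. if dj (w y) (w z) then w y else \<zero>) \<in> Y \<rightarrow> Vc" using w by auto
    have s: "(\<Oplus>y\<in>Y. a *r w y \<oplus> b *r (if dj (w y) (w z) then w y else \<zero>)) = a *r W \<oplus> b *r N z" for a b
    proof (rule vec_eqI)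
      fix \<phi> assume \<phi>: "\<phi> \<in> functionals V"
      have c: "(\<lambda>y. a *r w y \<oplus> b *r (if dj (w y) (w z) then w y else \<zero>)) \<in> Y \<rightarrow> Vc" using w by auto
      have "\<phi> (\<Oplus>y\<in>Y. a *r w y \<oplus> b *r (if dj (w y) (w z) then w y else \<zero>)) =
        (\<Sum>y\<in>Y. of_real a * \<phi> (w y) + of_real b * \<phi> (if dj (w y) (w z) then w y else \<zero>))"
        unfolding fun_sum[OF \<phi> c] using \<phi> w by (intro sum.cong) auto
      also have "... = \<phi> (a *r W \<oplus> b *r N z)"
        using \<phi> W NC fun_sum[OF \<phi> wc] fun_sum[OF \<phi> ifc] unfolding W_def N_def
        by (simp add: sum.distrib sum_distrib_left)
      finally show "\<phi> (\<Oplus>y\<in>Y. a *r w y \<oplus> b *r (if dj (w y) (w z) then w y else \<zero>)) = \<phi> (a *r W \<oplus> b *r N z)" .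
    qed (use w W NC in \<open>auto intro!: M.finsum_closed\<close>)
    note 2 = 2[unfolded s] and 3 = 3[unfolded s]
    have 1: "norm (c z) *r W \<preceq> am q \<oplus> am (c z \<odot> W \<ominus> q)" using 1 W by (simp add: am_smult Cn_am)
    let ?c = "(am q \<oplus> am (c z \<odot> W \<ominus> q) \<ominus> norm (c z) *r W) \<oplus> (\<delta> *r W \<oplus> (2 * B) *r N z \<ominus> am (c z \<odot> W \<ominus> q)) \<oplus>
      ((norm (c z) + \<delta>) *r W \<oplus> B *r N z \<ominus> r)"
    show ?thesis
    proof (rule le_by[of ?c])
      show "?c \<in> Cn" by (intro Cn_add leD 1 2 3)
    qed (use q r W NC dR in \<open>auto simp: d_def algebra_simps\<close>)
  qed
  have dj: "dj (pp d) (w z)" if z: "z \<in> Y" for z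
  proof -
    have "dj (N z) (w z)" unfolding N_def using fin w z by (intro dj_sum) auto
    hence "dj ((3 * B) *r N z) (w z)" using NC B0 w[OF z] by (intro dj_smult) auto
    moreover have "pp d \<preceq> (3 * B) *r N z" using key[OF z] dR NC B0 by (intro pp_lub) auto
    ultimately show ?thesis using NC dR by (intro dj_mono[of _ "w z" "pp d"]) auto
  qed
  have "dj W (pp d)" unfolding W_def using fin w dj dR by (intro dj_sum) (auto intro: dj_sym)
  moreover have "r \<preceq> B *r W"
  proof -
    have "r \<preceq> (\<Oplus>y\<in>Y. B *r w y)" unfolding r_def using w cB by (intro le_sum le_rs_mono) auto
    also have "(\<Oplus>y\<in>Y. B *r w y) = B *r W" unfolding W_def rs_def using fin wc by (simp add: finsum_smult_ldistr)
    finally show ?thesis .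
  qed
  hence "d \<preceq> B *r W" using q r W \<open>\<delta> \<ge> 0\<close>
    by (intro le_by[of "(B *r W \<ominus> r) \<oplus> am q \<oplus> (2 * \<delta>) *r W"]) (auto simp: d_def dest: leD)
  hence "pp d \<preceq> B *r W" using dR W B0 by (intro pp_lub) auto
  ultimately have "pp d = \<zero>" using dj_smult[of W "pp d" B] dR W B0 by (intro djD[of "B *r W" "pp d"]) auto
  hence "d \<preceq> \<zero>" using le_pp[OF dR] by simp
  hence d0: "r \<ominus> am q \<preceq> (2 * \<delta>) *r W" using leD[of d \<zero>] q r W
    by (intro le_by[of "\<zero> \<ominus> d"]) (auto simp: d_def)
  have "am (am q \<ominus> r) \<preceq> (2 * \<delta>) *r W"
  proof (rule am_lub)
    show "am q \<ominus> r \<preceq> (2 * \<delta>) *r W"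
      using leD[OF qr] q r W \<open>\<delta> \<ge> 0\<close> by (intro le_by[of "(r \<ominus> am q) \<oplus> (2 * \<delta>) *r W"]) auto
    show "\<ominus> (am q \<ominus> r) \<preceq> (2 * \<delta>) *r W"
      using leD[OF d0] q r W by (intro le_by[of "(2 * \<delta>) *r W \<ominus> (r \<ominus> am q)"]) auto
  qed (use q r W in auto)
  thus ?thesis unfolding q_def r_def W_def .
qed

section \<open>Labelled partitions and partitions of unity\<close>

definition wsum :: "('c \<Rightarrow> 'k) \<Rightarrow> ('c \<times> 'a) list \<Rightarrow> 'a" where "wsum w Xs = lsum (map (\<lambda>(c, u). w c \<odot> u) Xs)"

lemma wsum_closed: "snd ` set Xs \<subseteq> Vc ==> set (map (\<lambda>(c, u). w c \<odot> u) Xs) \<subseteq> Vc"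
  by auto

lemma wsum_cl [simp]: "snd ` set Xs \<subseteq> Vc ==> wsum w Xs \<in> Vc"
  unfolding wsum_def by (intro lsum_cl wsum_closed)

lemma fun_wsum: assumes "\<phi> \<in> functionals V" "snd ` set Xs \<subseteq> Vc"
  shows "\<phi> (wsum w Xs) = (\<Sum>(c, u)\<leftarrow>Xs. w c * \<phi> u)"
proof -
  have "map \<phi> (map (\<lambda>(c, u). w c \<odot> u) Xs) = map (\<lambda>(c, u). w c * \<phi> u) Xs" using assms by (auto simp: subset_eq)
  thus ?thesis unfolding wsum_def by (simp only: fun_lsum[OF assms(1) wsum_closed[OF assms(2)]])
qed

text \<open>A common refinement in which each piece carries the labels of the two pieces it comes
  from. The identities for arbitrary weights say that forgetting one label gives back the other
  partition; the inequalities let disjointness pass to the smaller pieces.\<close>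

lemma wsum_refinement:
  "snd ` set Xs \<subseteq> Cn ==> snd ` set Ys \<subseteq> Cn ==> lsum (map snd Xs) = lsum (map snd Ys) ==>
   \<exists>Zs. snd ` set Zs \<subseteq> Cn \<and>
     (\<forall>((c, d), z)\<in>set Zs. (\<exists>u. (c, u) \<in> set Xs \<and> z \<preceq> u) \<and> (\<exists>v. (d, v) \<in> set Ys \<and> z \<preceq> v)) \<and>
     (\<forall>w. wsum (\<lambda>(c, d). w c) Zs = wsum w Xs) \<and> (\<forall>w. wsum (\<lambda>(c, d). w d) Zs = wsum w Ys)"
proof (induction Xs arbitrary: Ys)
  case Nil
  have Y: "set (map snd Ys) \<subseteq> Cn" "lsum (map snd Ys) = \<zero>" using Nil by auto
  have "list_all2 (\<lambda>x l. l \<in> pos_partitions V x) (map snd Ys) (map (\<lambda>_. []) (map snd Ys))" by (rule lsum_zero[OF Y])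
  hence z: "v = \<zero>" if "(d, v) \<in> set Ys" for d v using that by (auto simp: list_all2_conv_all_nth pos_partitions_iff in_set_conv_nth)
  have "wsum w Ys = \<zero>" for w
  proof -
    have c: "snd ` set Ys \<subseteq> Vc" using Nil(2) by (auto intro: CnD)
    show ?thesis
    proof (rule vec_eqI)
      fix \<phi> assume \<phi>: "\<phi> \<in> functionals V"
      have "w d * \<phi> v = 0" if "(d, v) \<in> set Ys" for d v using z[OF that] \<phi> by simp
      hence "map (\<lambda>(c, u). w c * \<phi> u) Ys = map (\<lambda>_. 0) Ys" by (intro map_cong refl) force
      hence "(\<Sum>(c, u)\<leftarrow>Ys. w c * \<phi> u) = sum_list (map (\<lambda>_. 0) Ys)" by (simp only:)
      thus "\<phi> (wsum w Ys) = \<phi> \<zero>" using \<phi> by (simp add: fun_wsum[OF \<phi> c])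
    qed (use c in simp_all)
  qed
  thus ?case by (intro exI[of _ "[]"]) (simp add: wsum_def)
next
  case (Cons p Xs)
  obtain c u where p: "p = (c, u)" by (cases p)
  have X: "u \<in> Cn" "snd ` set Xs \<subseteq> Cn" "set (map snd Xs) \<subseteq> Cn" using Cons.prems(1) p by auto
  have Y: "set (map snd Ys) \<subseteq> Cn" using Cons.prems(2) by auto
  have e: "u \<oplus> lsum (map snd Xs) = lsum (map snd Ys)" using Cons.prems(3) X p by (simp add: lsum_Cons Cn_subset del: set_map)
  have le: "u \<preceq> lsum (map snd Ys)" unfolding e[symmetric] using X by (simp del: set_map)
  obtain us vs where uv: "length us = length vs" "set us \<subseteq> Cn" "set vs \<subseteq> Cn" "lsum us = u"
    "map snd Ys = map2 (\<lambda>u v. u \<oplus> v) us vs" using list_decomposition[OF X(1) Y le] by blast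
  have ly: "length Ys = length vs" using arg_cong[OF uv(5), of length] uv(1) by simp
  \<comment> \<open>\<open>Y'\<close> keeps what is left of \<open>Ys\<close> after the first piece
    \<open>u\<close> has been distributed, and \<open>Zu\<close> holds the shares of
    \<open>u\<close>, labelled by both origins.\<close>
  define Y' where "Y' = zip (map fst Ys) vs"
  define Zu where "Zu = map2 (\<lambda>d z. ((c, d), z)) (map fst Ys) us"
  have Y'C: "snd ` set Y' \<subseteq> Cn" using uv(3) by (auto simp: Y'_def dest: set_zip_rightD)
  have sY': "map snd Y' = vs" using ly by (simp add: Y'_def)
  have "u \<oplus> lsum (map snd Xs) = u \<oplus> lsum vs" using lsum_map2[of us vs] uv e by (simp add: Cn_subset)
  hence "lsum (map snd Xs) = lsum (map snd Y')" using X uv(3) by (simp add: Cn_subset sY' del: set_map)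
  from Cons.IH[OF X(2) Y'C this] obtain Zs where Z: "snd ` set Zs \<subseteq> Cn"
     "\<forall>((c, d), z)\<in>set Zs. (\<exists>u. (c, u) \<in> set Xs \<and> z \<preceq> u) \<and> (\<exists>v. (d, v) \<in> set Y' \<and> z \<preceq> v)"
     "\<forall>w. wsum (\<lambda>(c, d). w c) Zs = wsum w Xs" "\<forall>w. wsum (\<lambda>(c, d). w d) Zs = wsum w Y'" by blast
  have Ynth: "Ys ! i = (fst (Ys ! i), us ! i \<oplus> vs ! i)" if "i < length Ys" for i
    using arg_cong[OF uv(5), of "\<lambda>l. l ! i"] that uv(1) ly by (simp add: prod_eq_iff)
  have ZuC: "snd ` set Zu \<subseteq> Cn" using uv(2) by (auto simp: Zu_def dest: set_zip_rightD)
  have usC: "us ! i \<in> Cn" "vs ! i \<in> Cn" if "i < length Ys" for i using uv(1-3) ly that by (auto simp: subset_eq)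
  show ?case
  proof (intro exI[of _ "Zu @ Zs"] conjI allI)
    show "snd ` set (Zu @ Zs) \<subseteq> Cn" using ZuC Z(1) by auto
    show "\<forall>((c', d), z)\<in>set (Zu @ Zs). (\<exists>u. (c', u) \<in> set (p # Xs) \<and> z \<preceq> u) \<and> (\<exists>v. (d, v) \<in> set Ys \<and> z \<preceq> v)"
    proof (clarify)
      fix c' d z assume "((c', d), z) \<in> set (Zu @ Zs)"
      then consider "((c', d), z) \<in> set Zu" | "((c', d), z) \<in> set Zs" by auto
      thus "(\<exists>u. (c', u) \<in> set (p # Xs) \<and> z \<preceq> u) \<and> (\<exists>v. (d, v) \<in> set Ys \<and> z \<preceq> v)"
      proof cases
        case 1
        then obtain i where i: "i < length Ys" "c' = c" "d = fst (Ys ! i)" "z = us ! i"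
          using ly uv(1) by (auto simp: Zu_def in_set_conv_nth)
        have "us ! i \<preceq> us ! i \<oplus> vs ! i" using usC[OF i(1)] by simp
        moreover have "(d, us ! i \<oplus> vs ! i) \<in> set Ys" using Ynth[OF i(1)] i nth_mem[OF i(1)] by metis
        moreover have "us ! i \<preceq> u"
        proof -
          have "us ! i \<in> set us" using i(1) ly uv(1) by simp
          then obtain xs ys where s: "us = xs @ us ! i # ys" by (meson split_list)
          have C: "set xs \<subseteq> Cn" "us ! i \<in> Cn" "set ys \<subseteq> Cn" using uv(2) by (subst (asm) s; auto)+
          have "u = lsum xs \<oplus> (us ! i \<oplus> lsum ys)" using arg_cong[OF s, of lsum] uv(4) C
            by (simp add: lsum_append lsum_Cons Cn_subset)
          hence "u = us ! i \<oplus> (lsum xs \<oplus> lsum ys)" using C by (simp add: M.add.m_ac)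
          thus ?thesis using C by simp
        qed
        ultimately show ?thesis using i p by auto
      next
        case 2
        hence 3: "\<exists>u. (c', u) \<in> set Xs \<and> z \<preceq> u" "\<exists>v. (d, v) \<in> set Y' \<and> z \<preceq> v" using Z(2) by auto
        then obtain v where v: "(d, v) \<in> set Y'" "z \<preceq> v" by auto
        then obtain i where i: "i < length Ys" "d = fst (Ys ! i)" "v = vs ! i" using ly by (auto simp: Y'_def in_set_conv_nth)
        have zC: "z \<in> Cn" using Z(1) 2 by force
        have "vs ! i \<preceq> us ! i \<oplus> vs ! i" using usC[OF i(1)] by simp
        hence "z \<preceq> us ! i \<oplus> vs ! i" using le_trans[OF v(2)] i usC[OF i(1)] zC by simp
        moreover have "(d, us ! i \<oplus> vs ! i) \<in> set Ys" using Ynth[OF i(1)] i nth_mem[OF i(1)] by metis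
        ultimately show ?thesis using 3(1) by auto
      qed
    qed
    have cl: "snd ` set Zu \<subseteq> Vc" "snd ` set Zs \<subseteq> Vc" "snd ` set (p # Xs) \<subseteq> Vc" "snd ` set Xs \<subseteq> Vc" "snd ` set Y' \<subseteq> Vc" "snd ` set Ys \<subseteq> Vc" "snd ` set (Zu @ Zs) \<subseteq> Vc"
      using ZuC Z(1) Cons.prems(1,2) X(2) Y'C by (auto intro!: CnD)
    have sumZ: "(\<Sum>((c, d), z)\<leftarrow>Zu. w c d * \<phi> z) = (\<Sum>i<length Ys. w c (fst (Ys ! i)) * \<phi> (us ! i))" for w \<phi>
      using ly uv(1) by (simp add: Zu_def sum_list_sum_nth atLeast0LessThan)
    fix w
    show "wsum (\<lambda>(c, d). w c) (Zu @ Zs) = wsum w (p # Xs)"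
    proof (rule vec_eqI)
      fix \<phi> assume \<phi>: "\<phi> \<in> functionals V"
      have "(\<Sum>i<length Ys. \<phi> (us ! i)) = \<phi> u"
        using fun_lsum[OF \<phi>, of us] uv(1,2,4) ly by (simp add: Cn_subset sum_list_sum_nth atLeast0LessThan)
      hence "(\<Sum>((c, d), z)\<leftarrow>Zu. w c * \<phi> z) = w c * \<phi> u" using sumZ[of "\<lambda>c d. w c" \<phi>] by (simp flip: sum_distrib_left)
      moreover have "(\<Sum>((c, d), z)\<leftarrow>Zs. w c * \<phi> z) = (\<Sum>(c, u)\<leftarrow>Xs. w c * \<phi> u)"
        using arg_cong[OF Z(3)[rule_format, of w], of \<phi>] by (simp add: fun_wsum[OF \<phi> cl(2)] fun_wsum[OF \<phi> cl(4)] split_def)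
      ultimately show "\<phi> (wsum (\<lambda>(c, d). w c) (Zu @ Zs)) = \<phi> (wsum w (p # Xs))"
        by (simp add: fun_wsum[OF \<phi> cl(7)] fun_wsum[OF \<phi> cl(3)[unfolded p]] p split_def)
    qed (use cl in simp_all)
  next
    have cl: "snd ` set Zu \<subseteq> Vc" "snd ` set Zs \<subseteq> Vc" "snd ` set (p # Xs) \<subseteq> Vc" "snd ` set Xs \<subseteq> Vc" "snd ` set Y' \<subseteq> Vc" "snd ` set Ys \<subseteq> Vc" "snd ` set (Zu @ Zs) \<subseteq> Vc"
      using ZuC Z(1) Cons.prems(1,2) X(2) Y'C by (auto intro!: CnD)
    fix w
    show "wsum (\<lambda>(c, d). w d) (Zu @ Zs) = wsum w Ys"
    proof (rule vec_eqI)
      fix \<phi> assume \<phi>: "\<phi> \<in> functionals V"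
      have 1: "(\<Sum>((c, d), z)\<leftarrow>Zu. w d * \<phi> z) = (\<Sum>i<length Ys. w (fst (Ys ! i)) * \<phi> (us ! i))"
        using ly uv(1) by (simp add: Zu_def sum_list_sum_nth atLeast0LessThan)
      have 2: "(\<Sum>(d, v)\<leftarrow>Y'. w d * \<phi> v) = (\<Sum>i<length Ys. w (fst (Ys ! i)) * \<phi> (vs ! i))"
        using ly uv(1) by (simp add: Y'_def sum_list_sum_nth atLeast0LessThan)
      have "(\<Sum>(d, v)\<leftarrow>Ys. w d * \<phi> v) = (\<Sum>i<length Ys. w (fst (Ys ! i)) * \<phi> (us ! i \<oplus> vs ! i))"
        unfolding sum_list_sum_nth length_map atLeast0LessThan
        by (intro sum.cong refl) (subst nth_map, simp, subst Ynth, simp, simp)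
      also have "... = (\<Sum>i<length Ys. w (fst (Ys ! i)) * \<phi> (us ! i)) + (\<Sum>i<length Ys. w (fst (Ys ! i)) * \<phi> (vs ! i))"
        unfolding sum.distrib[symmetric] using \<phi> usC by (intro sum.cong refl) (simp add: algebra_simps)
      finally have 3: "(\<Sum>(d, v)\<leftarrow>Ys. w d * \<phi> v) = (\<Sum>((c, d), z)\<leftarrow>Zu. w d * \<phi> z) + (\<Sum>(d, v)\<leftarrow>Y'. w d * \<phi> v)" using 1 2 by simp
      have 4: "(\<Sum>((c, d), z)\<leftarrow>Zs. w d * \<phi> z) = (\<Sum>(d, v)\<leftarrow>Y'. w d * \<phi> v)"
        using arg_cong[OF Z(4)[rule_format, of w], of \<phi>] by (simp add: fun_wsum[OF \<phi> cl(2)] fun_wsum[OF \<phi> cl(5)] split_def)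
      have "\<phi> (wsum (\<lambda>(c, d). w d) (Zu @ Zs)) = (\<Sum>((c, d), z)\<leftarrow>Zu. w d * \<phi> z) + (\<Sum>((c, d), z)\<leftarrow>Zs. w d * \<phi> z)"
        by (simp add: fun_wsum[OF \<phi> cl(7)] split_def)
      thus "\<phi> (wsum (\<lambda>(c, d). w d) (Zu @ Zs)) = \<phi> (wsum w Ys)" using 3 4 by (simp add: fun_wsum[OF \<phi> cl(6)])
    qed (use cl in simp_all)
  qed
qed

end

context avl
begin

lemma le_lsum: "set xs \<subseteq> Cn ==> x \<in> set xs ==> x \<preceq> lsum xs"
proof (induction xs)
  case (Cons y ys)
  have C: "y \<in> Cn" "set ys \<subseteq> Cn" using Cons by auto
  show ?case
  proof (cases "x = y")
    case True thus ?thesis using C by (simp add: lsum_Cons Cn_subset)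
  next
    case False
    hence "x \<in> set ys" using Cons by auto
    hence "x \<preceq> lsum ys" "x \<in> Cn" using Cons.IH C by auto
    hence "\<zero> \<oplus> x \<preceq> y \<oplus> lsum ys" using C by (intro le_add) (auto simp: zero_le)
    thus ?thesis using C \<open>x \<in> Cn\<close> by (simp add: lsum_Cons Cn_subset)
  qed
qed simp

lemma wsum_one: "snd ` set Xs \<subseteq> Vc ==> wsum (\<lambda>_. 1) Xs = lsum (map snd Xs)"
proof -
  assume "snd ` set Xs \<subseteq> Vc"
  hence "map (\<lambda>(c, u). 1 \<odot> u) Xs = map snd Xs" by auto
  thus ?thesis by (simp only: wsum_def)
qed

lemma pp_pp_minus: assumes "x \<in> Rl" "e \<in> Cn" shows "pp (pp x \<ominus> e) = pp (x \<ominus> e)"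
proof (rule le_antisym)
  have c: "pp x \<in> Cn" "pp (x \<ominus> e) \<in> Cn" "pp (pp x \<ominus> e) \<in> Cn" using assms by auto
  have "x \<preceq> pp (x \<ominus> e) \<oplus> e" using le_move[OF le_pp[of "x \<ominus> e"]] assms c by simp
  hence "pp x \<preceq> pp (x \<ominus> e) \<oplus> e" using assms c by (intro pp_lub) auto
  from leD[OF this] have "pp x \<ominus> e \<preceq> pp (x \<ominus> e)" using c assms by (intro le_by[of "pp (x \<ominus> e) \<oplus> e \<ominus> pp x"]) auto
  thus "pp (pp x \<ominus> e) \<preceq> pp (x \<ominus> e)" using c assms by (intro pp_lub) auto
  have "x \<ominus> e \<preceq> pp x \<ominus> e" using leD[OF le_pp[OF assms(1)]] assms c by (intro le_by[of "pp x \<ominus> x"]) auto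
  hence "x \<ominus> e \<preceq> pp (pp x \<ominus> e)" using le_trans[OF _ le_pp[of "pp x \<ominus> e"]] assms c by simp
  thus "pp (x \<ominus> e) \<preceq> pp (pp x \<ominus> e)" using c assms by (intro pp_lub) auto
qed (use assms in auto)

lemma pp_mono: assumes "x \<in> Rl" "y \<in> Rl" "x \<preceq> y" shows "pp x \<preceq> pp y"
  by (rule pp_lub) (use assms le_trans[OF assms(3) le_pp[OF assms(2)]] in auto)

lemma meet_mono: assumes "x \<in> Rl" "y \<in> Rl" "z \<in> Rl" "x \<preceq> y" shows "meet x z \<preceq> meet y z"
proof -
  have m: "meet x z \<in> Rl" "meet y z \<in> Rl" using assms by (auto simp: meet_def)
  have "meet x z \<preceq> y" by (rule le_trans[OF meet_le1[OF assms(1,3)] assms(4)]) (use assms m in auto)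
  thus ?thesis using assms m by (intro meet_glb) auto
qed

text \<open>Hat functions: second differences of \<^term>\<open>pp (n *r f \<ominus> j *r e)\<close> in \<open>j\<close>.\<close>

lemma hat_partition:
  assumes f: "f \<in> Cn" and e: "e \<in> Cn" and fe: "f \<preceq> e" and n: "n \<ge> 1"
  shows "\<exists>Ys :: (nat \<times> 'a) list. snd ` set Ys \<subseteq> Cn \<and> lsum (map snd Ys) = e \<and> wsum of_nat Ys = real n *r f \<and>
    (\<forall>(i, u)\<in>set Ys. \<forall>(j, v)\<in>set Ys. dj u v \<or> (i \<le> Suc j \<and> j \<le> Suc i)) \<and> (\<forall>(i, u)\<in>set Ys. i \<le> n)"
proof -
  define x where "x j = real n *r f \<ominus> real j *r e" for j
  define p where "p j = pp (x j)" for j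
  have x: "x j \<in> Rl" and p: "p j \<in> Cn" for j using f e by (auto simp: x_def p_def)
  have x_Suc: "x (Suc j) = x j \<ominus> e" for j unfolding x_def using f e by (intro vec_eqI) (auto simp: algebra_simps)
  have p_Suc: "p (Suc j) = pp (p j \<ominus> e)" for j using pp_pp_minus[OF x e] by (simp add: p_def x_Suc)
  have meet: "meet (p j) e = p j \<ominus> p (Suc j)" for j by (simp add: meet_def p_Suc)
  have p_dec: "p (Suc j) \<preceq> p j" for j unfolding p_def x_Suc using x[of j] e by (intro pp_mono) auto
  have p_le: "p (j + d) \<preceq> p j" for j d
  proof (induction d)
    case (Suc d) thus ?case using le_trans[OF p_dec[of "j + d"] Suc] p by simp
  qed (use p in simp)
  have p0: "p 0 = real n *r f" using f e by (simp add: p_def x_def pp_Cn_eq)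
  have pn: "p n = \<zero>"
  proof -
    have "x n \<preceq> \<zero>" using leD[OF fe] f e by (intro le_by[of "real n *r (e \<ominus> f)"]) (auto simp: x_def algebra_simps)
    hence "pp (x n) \<preceq> \<zero>" using x by (intro pp_lub) auto
    thus ?thesis unfolding p_def using le_zero[of "pp (x n)"] x by simp
  qed
  have pSn: "p (Suc n) = \<zero>" using p_dec[of n] pn le_zero[OF p] by simp
  \<comment> \<open>The first differences of \<open>p\<close>, preceded by \<open>e\<close>; the
    differences \<open>u\<close> of \<open>g\<close> are the hats. Their sum telescopes to
    \<open>e\<close>, and weighted by \<open>j\<close> it telescopes to \<open>p 0 - p n\<close>,
    which is \<open>n f\<close>: the hats reproduce \<open>f\<close> exactly.\<close>
  define g where "g j = (case j of 0 \<Rightarrow> e | Suc i \<Rightarrow> meet (p i) e)" for j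
  have g: "g j \<in> Cn" for j using p e by (cases j) (auto simp: g_def)
  have g_dec: "g (Suc j) \<preceq> g j" for j
    using p e p_dec by (cases j) (auto simp: g_def intro!: meet_mono)
  define u where "u j = g j \<ominus> g (Suc j)" for j
  have u: "u j \<in> Cn" for j unfolding u_def by (rule leD[OF g_dec])
  define Ys where "Ys = map (\<lambda>j. (j, u j)) [0..<Suc n]"
  have YsC: "snd ` set Ys \<subseteq> Cn" "snd ` set Ys \<subseteq> Vc" using u by (auto simp: Ys_def simp del: upt_Suc)
  have gn: "g (Suc n) = \<zero>" using meet[of n] by (simp add: g_def pn pSn minus_self)
  have "lsum (map snd Ys) = e"
  proof (rule vec_eqI)
    fix \<phi> assume \<phi>: "\<phi> \<in> functionals V"
    have s: "set (map snd Ys) \<subseteq> Vc" using YsC by auto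
    have "\<phi> (lsum (map snd Ys)) = (\<Sum>j<Suc n. \<phi> (g j) - \<phi> (g (Suc j)))"
      unfolding fun_lsum[OF \<phi> s] using \<phi> g
      by (simp add: Ys_def interv_sum_list_conv_sum_set_nat u_def comp_def atLeast0LessThan del: upt_Suc sum.lessThan_Suc)
    also have "... = \<phi> (g 0) - \<phi> (g (Suc n))" by (rule sum_lessThan_telescope'[of "\<lambda>j. \<phi> (g j)"])
    also have "... = \<phi> e" using gn \<phi> by (simp add: g_def[of 0])
    finally show "\<phi> (lsum (map snd Ys)) = \<phi> e" .
  qed (use YsC e in auto)
  moreover have "wsum of_nat Ys = real n *r f"
  proof (rule vec_eqI)
    fix \<phi> assume \<phi>: "\<phi> \<in> functionals V"
    have abel: "(\<Sum>j<Suc m. of_nat j * (G j - G (Suc j))) = (\<Sum>j<m. G (Suc j)) - of_nat m * G (Suc m)" for m and G :: "nat \<Rightarrow> 'k"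
      by (induction m) (simp_all add: algebra_simps)
    have "\<phi> (wsum of_nat Ys) = (\<Sum>j<Suc n. of_nat j * (\<phi> (g j) - \<phi> (g (Suc j))))"
      unfolding fun_wsum[OF \<phi> YsC(2)] using \<phi> g
      by (simp add: Ys_def interv_sum_list_conv_sum_set_nat u_def comp_def atLeast0LessThan del: upt_Suc sum.lessThan_Suc)
    also have "... = (\<Sum>j<n. \<phi> (g (Suc j))) - of_nat n * \<phi> (g (Suc n))" by (rule abel[of "\<lambda>j. \<phi> (g j)"])
    also have "... = (\<Sum>j<n. \<phi> (g (Suc j)))" using gn \<phi> by simp
    also have "... = (\<Sum>j<n. \<phi> (p j) - \<phi> (p (Suc j)))" using \<phi> p by (intro sum.cong) (auto simp: g_def meet)
    also have "... = \<phi> (p 0) - \<phi> (p n)" by (rule sum_lessThan_telescope'[of "\<lambda>j. \<phi> (p j)"])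
    also have "... = \<phi> (p 0)" using pn \<phi> by simp
    finally show "\<phi> (wsum of_nat Ys) = \<phi> (real n *r f)" using p0 by simp
  qed (use YsC f in auto)
  \<comment> \<open>Two hats that are not neighbours are separated by the sign of
    \<open>x (Suc j)\<close>: the later one lies below its positive part, the earlier one below its
    negative part.\<close>
  moreover have dju: "dj (u i) (u j)" if ij: "Suc j < i" for i j
  proof -
    obtain d where d: "i = Suc (Suc j + d)" using less_imp_Suc_add[OF ij] by blast
    note C = CnD[OF u] CnD[OF g] CnD[OF p]
    have "u i \<preceq> g i" by (rule le_by[OF g[of "Suc i"]]) (use C in \<open>auto simp: u_def\<close>)
    moreover have "g i \<preceq> p (Suc j + d)" unfolding d g_def using p e by simp
    ultimately have "u i \<preceq> p (Suc j + d)" by (rule le_trans) (rule C)+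
    hence 1: "u i \<preceq> p (Suc j)" by (rule le_trans[OF _ p_le]) (rule C)+
    have "e \<ominus> g (Suc j) \<preceq> pp (\<ominus> x (Suc j))"
    proof (rule le_by[OF leD[OF le_pp[OF x[of j]]]])
      fix \<phi> assume \<phi>: "\<phi> \<in> functionals V"
      have a: "\<phi> (x (Suc j)) = \<phi> (x j) - \<phi> e" using \<phi> x e by (simp add: x_Suc)
      have b: "\<phi> (pp (\<ominus> x (Suc j))) = \<phi> (p (Suc j)) - \<phi> (x (Suc j))"
        using arg_cong[OF pp_diff[of "x (Suc j)"], of \<phi>] \<phi> x[of "Suc j"] p[of "Suc j"] by (auto simp: p_def algebra_simps)
      have c: "\<phi> (g (Suc j)) = \<phi> (p j) - \<phi> (p (Suc j))" using \<phi> p by (simp add: g_def meet)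
      show "\<phi> (pp (\<ominus> x (Suc j))) - \<phi> (e \<ominus> g (Suc j)) = \<phi> (pp (x j) \<ominus> x j)"
        using \<phi> x[of j] e g[of "Suc j"] by (simp add: a b c p_def)
    qed (use e g x in auto)
    moreover have "g j \<preceq> e" using p e by (cases j) (auto simp: g_def)
    hence "u j \<preceq> e \<ominus> g (Suc j)" using leD[of "g j" e] g e by (intro le_by[of "e \<ominus> g j"]) (auto simp: u_def)
    moreover have "pp (\<ominus> x (Suc j)) \<in> Cn" using x[of "Suc j"] by auto
    ultimately have 2: "u j \<preceq> pp (\<ominus> x (Suc j))" using C e by - (rule le_trans, assumption, assumption, simp, simp, simp)
    have "dj (p (Suc j)) (pp (\<ominus> x (Suc j)))" unfolding p_def by (rule dj_pp[OF x])
    hence "dj (u i) (pp (\<ominus> x (Suc j)))" by (rule dj_mono) (use 1 p u in auto)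
    hence "dj (pp (\<ominus> x (Suc j))) (u i)" by (rule dj_sym)
    hence "dj (u j) (u i)" by (rule dj_mono) (use 2 u x in auto)
    thus ?thesis by (rule dj_sym)
  qed
  have "\<forall>(i, a)\<in>set Ys. \<forall>(j, b)\<in>set Ys. dj a b \<or> (i \<le> Suc j \<and> j \<le> Suc i)"
  proof (clarify)
    fix i a j b assume "(i, a) \<in> set Ys" "(j, b) \<in> set Ys" "\<not> (i \<le> Suc j \<and> j \<le> Suc i)"
    hence "a = u i" "b = u j" "Suc j < i \<or> Suc i < j" by (auto simp: Ys_def simp del: upt_Suc)
    thus "dj a b" using dju dj_sym by blast
  qed
  moreover have "\<forall>(i, u)\<in>set Ys. i \<le> n" by (auto simp: Ys_def simp del: upt_Suc)
  ultimately show ?thesis using YsC(1) by blast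
qed

text \<open>A label \<open>c\<close> assigns to a piece the approximate values
  \<open>c i / n\<close> of all functions \<open>f i\<close> relative to \<open>e\<close>. The
  induction refines the partition for the first \<open>m\<close> functions by the hats of the next
  one.\<close>

lemma partition_of_unity:
  assumes e: "e \<in> Cn" and n: "n \<ge> 1"
  shows "(\<forall>i<m. f i \<in> Cn \<and> f i \<preceq> e) ==>
    \<exists>Xs :: ((nat \<Rightarrow> nat) \<times> 'a) list. snd ` set Xs \<subseteq> Cn \<and> wsum (\<lambda>_. 1) Xs = e \<and>
      (\<forall>i<m. wsum (\<lambda>c. of_nat (c i)) Xs = real n *r f i) \<and>
      (\<forall>(c, u)\<in>set Xs. \<forall>(d, v)\<in>set Xs. dj u v \<or> (\<forall>i<m. c i \<le> Suc (d i) \<and> d i \<le> Suc (c i))) \<and>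
      (\<forall>(c, u)\<in>set Xs. \<forall>i<m. c i \<le> n)"
proof (induction m)
  case 0
  show ?case by (rule exI[of _ "[(\<lambda>_. 0, e)]"]) (use e in \<open>simp add: wsum_def lsum_Cons\<close>)
next
  case (Suc m)
  then obtain Xs :: "((nat \<Rightarrow> nat) \<times> 'a) list" where X: "snd ` set Xs \<subseteq> Cn" "wsum (\<lambda>_. 1) Xs = e"
    "\<forall>i<m. wsum (\<lambda>c. of_nat (c i)) Xs = real n *r f i"
    "\<forall>(c, u)\<in>set Xs. \<forall>(d, v)\<in>set Xs. dj u v \<or> (\<forall>i<m. c i \<le> Suc (d i) \<and> d i \<le> Suc (c i))"
    "\<forall>(c, u)\<in>set Xs. \<forall>i<m. c i \<le> n" by auto
  obtain Ys :: "(nat \<times> 'a) list" where Y: "snd ` set Ys \<subseteq> Cn" "lsum (map snd Ys) = e" "wsum of_nat Ys = real n *r f m"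
    "\<forall>(i, u)\<in>set Ys. \<forall>(j, v)\<in>set Ys. dj u v \<or> (i \<le> Suc j \<and> j \<le> Suc i)" "\<forall>(i, u)\<in>set Ys. i \<le> n"
    using hat_partition[of "f m" e n] Suc.prems e n by auto
  have XV: "snd ` set Xs \<subseteq> Vc" and YV: "snd ` set Ys \<subseteq> Vc" using X(1) Y(1) by (auto intro: CnD)
  have "lsum (map snd Xs) = lsum (map snd Ys)" using wsum_one[OF XV] X(2) Y(2) by simp
  from wsum_refinement[OF X(1) Y(1) this] obtain Zs where Z: "snd ` set Zs \<subseteq> Cn"
     "\<forall>((c, d), z)\<in>set Zs. (\<exists>u. (c, u) \<in> set Xs \<and> z \<preceq> u) \<and> (\<exists>v. (d, v) \<in> set Ys \<and> z \<preceq> v)"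
     "\<forall>w. wsum (\<lambda>(c, d). w c) Zs = wsum w Xs" "\<forall>w. wsum (\<lambda>(c, d). w d) Zs = wsum w Ys" by blast
  \<comment> \<open>The pair of labels becomes one label, with the hat index stored at the new
    position \<open>m\<close>.\<close>
  define h where "h = (\<lambda>((c, d), z). (c(m := d) :: nat \<Rightarrow> nat, z :: 'a))"
  define Ws where "Ws = map h Zs"
  have ws: "wsum w Ws = wsum (\<lambda>(c, d). w (c(m := d))) Zs" for w
    by (simp add: wsum_def Ws_def h_def split_def comp_def)
  have mem: "\<exists>c d. c' = c(m := d) \<and> ((c, d), z) \<in> set Zs" if "(c', z) \<in> set Ws" for c' z
    using that by (auto simp: Ws_def h_def)
  show ?case
  proof (intro exI[of _ Ws] conjI)
    show "snd ` set Ws \<subseteq> Cn" using Z(1) by (force simp: Ws_def h_def)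
    show "wsum (\<lambda>_. 1) Ws = e" using ws[of "\<lambda>_. 1"] Z(3)[rule_format, of "\<lambda>_. 1"] X(2) by (simp add: split_def)
    show "\<forall>i<Suc m. wsum (\<lambda>c. of_nat (c i)) Ws = real n *r f i"
    proof (intro allI impI)
      fix i assume i: "i < Suc m"
      show "wsum (\<lambda>c. of_nat (c i)) Ws = real n *r f i"
      proof (cases "i = m")
        case True thus ?thesis using ws[of "\<lambda>c. of_nat (c i)"] Z(4)[rule_format, of of_nat] Y(3) by (simp add: split_def)
      next
        case False
        hence "i < m" using i by simp
        thus ?thesis using ws[of "\<lambda>c. of_nat (c i)"] Z(3)[rule_format, of "\<lambda>c. of_nat (c i)"] X(3) False by (simp add: split_def)
      qed
    qed
    show "\<forall>(c, u)\<in>set Ws. \<forall>(d, v)\<in>set Ws. dj u v \<or> (\<forall>i<Suc m. c i \<le> Suc (d i) \<and> d i \<le> Suc (c i))"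
    proof -
      have "dj u v" if a: "(c', u) \<in> set Ws" "(d', v) \<in> set Ws" and nd: "\<not> (\<forall>i<Suc m. c' i \<le> Suc (d' i) \<and> d' i \<le> Suc (c' i))"
        for c' u d' v
      proof -
      obtain c i where c: "c' = c(m := i)" "((c, i), u) \<in> set Zs" using mem[OF a(1)] by auto
      obtain d j where d: "d' = d(m := j)" "((d, j), v) \<in> set Zs" using mem[OF a(2)] by auto
      have uv: "u \<in> Cn" "v \<in> Cn" using Z(1) c(2) d(2) by force+
      obtain u1 u2 where u12: "(c, u1) \<in> set Xs" "u \<preceq> u1" "(i, u2) \<in> set Ys" "u \<preceq> u2" using Z(2) c(2) by blast
      obtain v1 v2 where v12: "(d, v1) \<in> set Xs" "v \<preceq> v1" "(j, v2) \<in> set Ys" "v \<preceq> v2" using Z(2) d(2) by blast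
      have C: "u1 \<in> Vc" "u2 \<in> Vc" "v1 \<in> Vc" "v2 \<in> Vc" using XV YV u12 v12 by force+
      have "dj u1 v1 \<or> dj u2 v2"
      proof (rule ccontr)
        assume "\<not> (dj u1 v1 \<or> dj u2 v2)"
        hence "\<forall>i<m. c i \<le> Suc (d i) \<and> d i \<le> Suc (c i)" "i \<le> Suc j \<and> j \<le> Suc i" using X(4) Y(4) u12 v12 by blast+
        thus False using nd c(1) d(1) by (auto simp: less_Suc_eq)
      qed
      moreover have "dj u v" if "dj a b" "u \<preceq> a" "v \<preceq> b" "a \<in> Vc" "b \<in> Vc" for a b
        using dj_mono[OF dj_sym[OF dj_mono[OF that(1,2)]] that(3)] that(4,5) uv dj_sym by auto
      ultimately show "dj u v" using u12 v12 C by blast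
      qed
      thus ?thesis by blast
    qed
    show "\<forall>(c, u)\<in>set Ws. \<forall>i<Suc m. c i \<le> n"
    proof (clarify)
      fix c' u i assume a: "(c', u) \<in> set Ws" "i < Suc m"
      obtain c j where c: "c' = c(m := j)" "((c, j), u) \<in> set Zs" using mem[OF a(1)] by auto
      obtain u1 u2 where "(c, u1) \<in> set Xs" "(j, u2) \<in> set Ys" using Z(2) c(2) by blast
      thus "c' i \<le> n" using X(5) Y(5) c(1) a(2) by (auto simp: less_Suc_eq)
    qed
  qed
qed

text \<open>Subtracting a common lower bound \<open>y\<close> from both elements leaves the
  difference unchanged but lowers the bound for its modulus by \<open>2 y\<close>.\<close>

lemma dj_if_am: assumes "p \<in> Cn" "q \<in> Cn" "am (p \<ominus> q) = p \<oplus> q" shows "dj p q"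
  unfolding dj_def
proof (intro ballI impI)
  fix y assume y: "y \<in> Cn" "y \<preceq> p" "y \<preceq> q"
  have c: "p \<ominus> y \<in> Cn" "q \<ominus> y \<in> Cn" using y leD by auto
  have "p \<ominus> q = (p \<ominus> y) \<ominus> (q \<ominus> y)" using assms y by (intro vec_eqI) auto
  hence "p \<oplus> q \<preceq> (p \<ominus> y) \<oplus> (q \<ominus> y)" using am_triangle_minus[of "p \<ominus> y" "q \<ominus> y"] c assms(3) by (simp add: Cn_am)
  from leD[OF this] have "y \<preceq> \<zero>" using y assms
    by (intro le_by[of "(1/2) *r ((p \<ominus> y) \<oplus> (q \<ominus> y) \<ominus> (p \<oplus> q))"]) (auto simp: field_simps)
  thus "y = \<zero>" using y le_zero by blast
qed

end

section \<open>Universal property\<close>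

text \<open>The universal property speaks of lattices over one fixed type. An injection of carriers
  moves any other lattice there.\<close>

lemma vl_image:
  fixes V :: "('k :: real_or_complex, 'a) vlattice" and g :: "'a \<Rightarrow> 'u"
  assumes V: "archimedean_vector_lattice V" and g: "inj g"
  shows "\<exists>G :: ('k, 'u) vlattice. archimedean_vector_lattice G \<and> vl_iso V G g"
proof -
  interpret V: avl V using V by (rule avl.intro)
  define B :: "('k, 'u) module" where "B = \<lparr>carrier = g ` carrier V, monoid.mult = undefined, monoid.one = undefined,
      ring.zero = g \<zero>\<^bsub>V\<^esub>, ring.add = (\<lambda>x y. g (inv_into UNIV g x \<oplus>\<^bsub>V\<^esub> inv_into UNIV g y)), module.smult = (\<lambda>\<alpha> x. g (\<alpha> \<odot>\<^bsub>V\<^esub> inv_into UNIV g x))\<rparr>"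
  have B: "carrier B = g ` carrier V" "\<zero>\<^bsub>B\<^esub> = g \<zero>\<^bsub>V\<^esub>" "x \<oplus>\<^bsub>B\<^esub> y = g (inv_into UNIV g x \<oplus>\<^bsub>V\<^esub> inv_into UNIV g y)" "\<alpha> \<odot>\<^bsub>B\<^esub> x = g (\<alpha> \<odot>\<^bsub>V\<^esub> inv_into UNIV g x)" for x y \<alpha>
    by (simp_all add: B_def)
  have bij: "bij_betw (inv_into UNIV g) (carrier B) (carrier V)"
    unfolding B by (rule bij_betwI[where g = g]) (use g in auto)
  define m where "m = restrict (\<lambda>x. inv_into (carrier B) (inv_into UNIV g) (modulus V (inv_into UNIV g x))) (carrier B)"
  have tr: "archimedean_vector_lattice (attach_modulus B m)"
    "pos_cone (attach_modulus B m) = {x \<in> carrier B. inv_into UNIV g x \<in> pos_cone V}"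
    unfolding m_def by (rule avl_transport[OF V bij]; (unfold B)?; auto simp: inv_f_f[OF g])+
  have "vl_iso V (attach_modulus B m) g"
  proof (rule vl_iso_if_cone_iso[OF V tr(1)])
    show "linear_map V (attach_modulus B m) g" using g by (auto simp: linear_map_def B)
    show "bij_betw g (carrier V) (carrier (attach_modulus B m))"
      using g by (auto simp: B bij_betw_def inj_on_def)
    show "g x \<in> pos_cone (attach_modulus B m) \<longleftrightarrow> x \<in> pos_cone V" if "x \<in> carrier V" for x
      unfolding tr(2) using g that by (auto simp: B)
  qed
  thus ?thesis using tr(1) by blast
qed

lemma linear_map_comp: "linear_map U V S ==> linear_map V W T ==> linear_map U W (\<lambda>x. T (S x))"
  unfolding linear_map_def by (auto simp: Pi_iff)

lemma vl_hom_comp: "vl_hom U V S ==> vl_hom V W T ==> vl_hom U W (\<lambda>x. T (S x))"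
  unfolding vl_hom_def using linear_map_comp[of U V S W T] by (auto simp: linear_map_def Pi_iff)

lemma s_morphism_comp: assumes "s_morphism s E V t" "vl_hom V W h" shows "s_morphism s E W (\<lambda>f. h (t f))"
  unfolding s_morphism_def multilinear_map_def
proof (intro conjI ballI impI)
  fix k f assume a: "k \<in> {1..s}" "f \<in> tuples s E"
  show "linear_map (E k) W (\<lambda>x. h (t (f(k := x))))"
    using assms a unfolding s_morphism_def multilinear_map_def vl_hom_def
    by - (rule linear_map_comp[of "E k" V "\<lambda>x. t (f(k := x))" W h]; blast)
  assume "\<forall>j\<in>{1..s} - {k}. f j \<in> pos_cone (E j)"
  thus "vl_hom (E k) W (\<lambda>x. h (t (f(k := x))))"
    using assms a unfolding s_morphism_def by - (rule vl_hom_comp[of "E k" V "\<lambda>x. t (f(k := x))" W h]; blast)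
qed

lemma s_morphism_cl: assumes "s_morphism s E V t" "f \<in> tuples s E" "s \<ge> 1" shows "t f \<in> carrier V"
proof -
  have "linear_map (E 1) V (\<lambda>x. t (f(1 := x)))" using assms unfolding s_morphism_def multilinear_map_def by auto
  moreover have "f 1 \<in> carrier (E 1)" using assms by (auto simp: tuples_def)
  ultimately have "t (f(1 := f 1)) \<in> carrier V" unfolding linear_map_def by blast
  thus ?thesis by simp
qed

text \<open>The universal property for targets over any type that embeds into the type of test
  spaces, and without the requirement that maps be extensional.\<close>

lemma tensor_product_lift:
  fixes W :: "('k :: real_or_complex, 'b) vlattice" and g :: "'b \<Rightarrow> 'u"
  assumes tp: "is_tensor_product TYPE('u) s E P t" and s: "s \<ge> 1" and W: "archimedean_vector_lattice W" and g: "inj g"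
  shows "s_morphism s E W T ==> \<exists>h. vl_hom P W h \<and> (\<forall>f\<in>tuples s E. T f = h (t f))"
    and "vl_hom P W h1 ==> vl_hom P W h2 ==> (\<And>f. f \<in> tuples s E ==> h1 (t f) = h2 (t f)) ==> x \<in> carrier P ==> h1 x = h2 x"
proof -
  obtain G :: "('k, 'u) vlattice" where G: "archimedean_vector_lattice G" "vl_iso W G g" using vl_image[OF W g] by blast
  have gh: "vl_hom W G g" and gb: "bij_betw g (carrier W) (carrier G)" using G(2) by (auto simp: vl_iso_def)
  have ts: "s_morphism s E P t" using tp by (simp add: is_tensor_product_def)
  have univ: "\<exists>!h. h \<in> extensional (carrier P) \<and> vl_hom P G h \<and> (\<forall>f\<in>tuples s E. T f = h (t f))" if "s_morphism s E G T" for T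
    using tp that G(1) unfolding is_tensor_product_def by blast
  interpret P: avl P using tp unfolding is_tensor_product_def by (intro avl.intro) auto
  interpret W: avl W using W by (rule avl.intro)
  {
    assume T: "s_morphism s E W T"
    have "s_morphism s E G (\<lambda>f. g (T f))" by (rule s_morphism_comp[OF T gh])
    from ex1_implies_ex[OF univ[OF this]] obtain h where h: "vl_hom P G h" "\<And>f. f \<in> tuples s E ==> g (T f) = h (t f)" by blast
    define k where "k x = inv_into UNIV g (h x)" for x
    have hc: "h x \<in> carrier G" if "x \<in> carrier P" for x using h(1) that by (auto simp: vl_hom_def linear_map_def)
    have k: "k x \<in> carrier W" "g (k x) = h x" if x: "x \<in> carrier P" for x
    proof -
      obtain y where y: "y \<in> carrier W" "h x = g y" using hc[OF x] gb by (auto simp: bij_betw_def)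
      thus "k x \<in> carrier W" "g (k x) = h x" using g by (simp_all add: k_def)
    qed
    have inj: "a = b" if "g a = g b" for a b using g that by (auto simp: inj_def)
    have "vl_hom P W k" unfolding vl_hom_def linear_map_def
    proof (intro conjI ballI allI Pi_I)
      fix x y assume x: "x \<in> carrier P"
      show "k x \<in> carrier W" by (rule k[OF x])
      show "k (\<alpha> \<odot>\<^bsub>P\<^esub> x) = \<alpha> \<odot>\<^bsub>W\<^esub> k x" for \<alpha>
        by (rule inj) (use x k h(1) gh in \<open>simp add: vl_hom_def linear_map_def\<close>)
      show "k (modulus P x) = modulus W (k x)"
        by (rule inj) (use x k h(1) gh in \<open>simp add: vl_hom_def linear_map_def\<close>)
      assume y: "y \<in> carrier P"
      show "k (x \<oplus>\<^bsub>P\<^esub> y) = k x \<oplus>\<^bsub>W\<^esub> k y"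
        by (rule inj) (use x y k h(1) gh in \<open>simp add: vl_hom_def linear_map_def\<close>)
    qed
    moreover have "T f = k (t f)" if "f \<in> tuples s E" for f
      by (rule inj) (use h(2)[OF that] k(2)[OF s_morphism_cl[OF ts that s]] in simp)
    ultimately show "\<exists>h. vl_hom P W h \<and> (\<forall>f\<in>tuples s E. T f = h (t f))" by blast
  }
  {
    assume h: "vl_hom P W h1" "vl_hom P W h2" "\<And>f. f \<in> tuples s E ==> h1 (t f) = h2 (t f)" and x: "x \<in> carrier P"
    have sm: "s_morphism s E G (\<lambda>f. g (h1 (t f)))" by (rule s_morphism_comp[OF ts vl_hom_comp[OF h(1) gh]])
    \<comment> \<open>Uniqueness holds among extensional maps, so both candidates are restricted to
      the carrier before they are compared.\<close>
    have r: "vl_hom P G (\<lambda>x\<in>carrier P. g (h x))" if "vl_hom P W h" for h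
      using vl_hom_comp[OF that gh] by (simp add: vl_hom_def linear_map_def Pi_iff)
    obtain h0 where u: "\<And>h. h \<in> extensional (carrier P) ==> vl_hom P G h ==> (\<forall>f\<in>tuples s E. g (h1 (t f)) = h (t f)) ==> h = h0"
      using univ[OF sm] by (elim ex1E) blast
    have e: "\<forall>f\<in>tuples s E. g (h1 (t f)) = (\<lambda>x\<in>carrier P. g (h1 x)) (t f)" "\<forall>f\<in>tuples s E. g (h1 (t f)) = (\<lambda>x\<in>carrier P. g (h2 x)) (t f)"
      using h(3) s_morphism_cl[OF ts _ s] by simp_all
    have "(\<lambda>x\<in>carrier P. g (h1 x)) = (\<lambda>x\<in>carrier P. g (h2 x))"
      by (rule trans[OF u[OF restrict_extensional r[OF h(1)] e(1)] sym[OF u[OF restrict_extensional r[OF h(2)] e(2)]]])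
    hence "(\<lambda>x\<in>carrier P. g (h1 x)) x = (\<lambda>x\<in>carrier P. g (h2 x)) x" by simp
    thus "h1 x = h2 x" using x g by (simp add: inj_def)
  }
qed

section \<open>Extension of maps of order bounded variation to the tensor product\<close>

locale tensor = avl_family_ne s E F
  for s :: nat and E :: "nat \<Rightarrow> ('k :: real_or_complex, 'a) vlattice" and F :: "('k, 'f) vlattice" +
  fixes P :: "('k, 'p) vlattice" and t :: "(nat \<Rightarrow> 'a) \<Rightarrow> 'p"
  assumes tp: "is_tensor_product TYPE(('a, 'p, 'f) test_universe) s E P t"

sublocale tensor \<subseteq> P: avl P
  using tp unfolding is_tensor_product_def by (intro avl.intro) auto

context tensor
begin

lemma t_morphism: "s_morphism s E P t" using tp by (simp add: is_tensor_product_def)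

lemma t_cl [simp]: "f \<in> Tu ==> t f \<in> carrier P"
  using s_morphism_cl[OF t_morphism _ s_pos] .

lemma t_linear: "k \<in> I ==> f \<in> Tu ==> linear_map (E k) P (\<lambda>x. t (f(k := x)))"
  using t_morphism unfolding s_morphism_def multilinear_map_def I_def by blast

lemma t_add: "f \<in> Tu ==> k \<in> I ==> x \<in> carrier (E k) ==> y \<in> carrier (E k) ==> t (f(k := x \<oplus>\<^bsub>E k\<^esub> y)) = t (f(k := x)) \<oplus>\<^bsub>P\<^esub> t (f(k := y))"
  and t_smult: "f \<in> Tu ==> k \<in> I ==> x \<in> carrier (E k) ==> t (f(k := \<alpha> \<odot>\<^bsub>E k\<^esub> x)) = \<alpha> \<odot>\<^bsub>P\<^esub> t (f(k := x))"
  using t_linear unfolding linear_map_def by blast+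

lemma t_hom: "k \<in> I ==> a \<in> PTu ==> vl_hom (E k) P (\<lambda>x. t (a(k := x)))"
  using t_morphism PTu_Tu PTuD unfolding s_morphism_def I_def by blast

lemma t_pos: assumes a: "a \<in> PTu" shows "t a \<in> pos_cone P"
proof -
  obtain k where k: "k \<in> I" using I_ne by auto
  have "a k \<in> pos_cone (E k)" by (rule PTuD[OF a k])
  hence ak: "a k \<in> carrier (E k)" "modulus (E k) (a k) = a k" unfolding pos_cone_def by blast+
  have "t (a(k := modulus (E k) (a k))) = modulus P (t (a(k := a k)))" using t_hom[OF k a] ak(1) unfolding vl_hom_def by blast
  hence "modulus P (t a) = t a" by (simp only: ak(2) fun_upd_triv)
  thus ?thesis using t_cl[OF PTu_Tu[OF a]] unfolding pos_cone_def by blast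
qed

text \<open>The map \<open>\<lambda>x. t (a(k := x))\<close> preserves the modulus of
  \<open>x - y\<close>, which for disjoint elements is \<open>x + y\<close>; \<open>dj_if_am\<close>
  reads disjointness off the image.\<close>

lemma t_disjoint:
  assumes a: "a \<in> PTu" and k: "k \<in> I" and xy: "x \<in> pos_cone (E k)" "y \<in> pos_cone (E k)" and dj: "avl.dj (E k) x y"
  shows "P.dj (t (a(k := x))) (t (a(k := y)))"
proof -
  interpret E: avl "E k" using avlE[OF k] .
  interpret H: avl_map "E k" P "\<lambda>x. t (a(k := x))" using t_linear[OF k PTu_Tu[OF a]] by unfold_locales
  have "t (a(k := modulus (E k) (x \<ominus>\<^bsub>E k\<^esub> y))) = modulus P (t (a(k := x \<ominus>\<^bsub>E k\<^esub> y)))"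
    using t_hom[OF k a] xy unfolding vl_hom_def by simp
  hence "modulus P (t (a(k := x)) \<ominus>\<^bsub>P\<^esub> t (a(k := y))) = t (a(k := x)) \<oplus>\<^bsub>P\<^esub> t (a(k := y))"
    using E.dj_am[OF dj xy] xy by (simp add: H.T_minus H.T_add)
  thus ?thesis using t_pos PTu_upd[OF a k] xy by (intro P.dj_if_am) auto
qed

text \<open>The entries of \<open>a\<close> are replaced by those of \<open>b\<close> one at a time;
  each replacement adds the image of a positive tuple.\<close>

lemma t_mono:
  assumes a: "a \<in> PTu" and b: "b \<in> PTu" and le: "\<And>k. k \<in> I ==> vl_le (E k) (a k) (b k)"
  shows "vl_le P (t a) (t b)"
proof -
  have "vl_le P (t a) (t (\<lambda>k. if k \<in> K then b k else a k))" if "finite K" "K \<subseteq> I" for K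
    using that
  proof (induction K rule: finite_induct)
    case empty thus ?case using PTu_Tu[OF a] by simp
  next
    case (insert k K)
    have k: "k \<in> I" using insert by auto
    interpret E: avl "E k" using avlE[OF k] .
    let ?f = "\<lambda>j. if j \<in> K then b j else a j"
    have f: "?f \<in> PTu" using a b by (auto simp: PTu_iff extensional_def)
    have ak: "a k \<in> pos_cone (E k)" "b k \<in> pos_cone (E k)" using a b k PTuD by auto
    have d: "b k \<ominus>\<^bsub>E k\<^esub> a k \<in> pos_cone (E k)" by (rule E.leD[OF le[OF k]])
    have "b k = a k \<oplus>\<^bsub>E k\<^esub> (b k \<ominus>\<^bsub>E k\<^esub> a k)" using ak by (intro E.vec_eqI) auto
    hence "t (?f(k := b k)) = t (?f(k := a k)) \<oplus>\<^bsub>P\<^esub> t (?f(k := b k \<ominus>\<^bsub>E k\<^esub> a k))"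
      using t_add[OF PTu_Tu[OF f] k E.CnD[OF ak(1)] E.CnD[OF d]] by (rule subst[OF sym, of "b k"])
    moreover have "?f(k := a k) = ?f" using insert by auto
    moreover have "?f(k := b k) = (\<lambda>j. if j \<in> insert k K then b j else a j)" by auto
    moreover have "t (?f(k := b k \<ominus>\<^bsub>E k\<^esub> a k)) \<in> pos_cone P" by (intro t_pos PTu_upd f k d)
    ultimately have "vl_le P (t ?f) (t (\<lambda>j. if j \<in> insert k K then b j else a j))"
      using P.le_addr[OF t_cl[OF PTu_Tu[OF f]]] by (simp only:)
    moreover have "vl_le P (t a) (t ?f)" using insert by auto
    moreover have b': "(\<lambda>j. if j \<in> insert k K then b j else a j) \<in> PTu" using a b by (auto simp: PTu_iff extensional_def)
    ultimately show ?case
      by - (rule P.le_trans[OF _ _ t_cl[OF PTu_Tu[OF a]] t_cl[OF PTu_Tu[OF f]] t_cl[OF PTu_Tu[OF b']]])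
  qed
  moreover have "(\<lambda>k. if k \<in> I then b k else a k) = b" using a b by (auto simp: PTu_iff extensional_def)
  ultimately show ?thesis using finite_I by (metis order_refl)
qed

text \<open>Multilinear expansion of a tensor of weighted sums. The induction is on the set of
  variables with lists of arbitrary length; outside of it the lists are singletons.\<close>

lemma t_wsum:
  assumes X: "\<And>k. k \<in> I ==> snd ` set (Xs k) \<subseteq> pos_cone (E k)"
  shows "P.gsum I Xs (\<lambda>y. (\<Prod>k\<in>I. w k (fst (y k))) \<odot>\<^bsub>P\<^esub> t (\<lambda>k\<in>I. snd (y k))) = t (\<lambda>k\<in>I. avl.wsum (E k) (w k) (Xs k))"
proof -
  let ?g = "\<lambda>y. (\<Prod>k\<in>I. w k (fst (y k))) \<odot>\<^bsub>P\<^esub> t (\<lambda>k\<in>I. snd (y k))"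
  have u_Tu: "(\<lambda>k\<in>I. snd (y k)) \<in> Tu" if "y \<in> grid I Xs" "\<forall>k\<in>I. snd ` set (Xs k) \<subseteq> pos_cone (E k)" for y Xs
  proof -
    have "snd (y k) \<in> carrier (E k)" if "k \<in> I" for k
      using \<open>y \<in> _\<close> \<open>\<forall>k\<in>I. _\<close> that avl.CnD[OF avlE[OF that]] unfolding grid_def PiE_iff by blast
    thus ?thesis by (simp add: Tu_iff)
  qed
  have g_cl: "?g \<in> grid I Xs \<rightarrow> carrier P" if "\<forall>k\<in>I. snd ` set (Xs k) \<subseteq> pos_cone (E k)" for Xs
    using u_Tu[OF _ that] by auto
  have "P.gsum I Xs ?g = (\<Prod>k\<in>I - K. w k (fst (hd (Xs k)))) \<odot>\<^bsub>P\<^esub> t (\<lambda>k\<in>I. if k \<in> K then avl.wsum (E k) (w k) (Xs k) else snd (hd (Xs k)))"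
    if "finite K" "K \<subseteq> I" "\<forall>k\<in>I. snd ` set (Xs k) \<subseteq> pos_cone (E k)" "\<forall>k\<in>I - K. \<exists>p. Xs k = [p]" for K Xs
    using that
  proof (induction K arbitrary: Xs rule: finite_induct)
    case empty
    have s: "Xs k = [hd (Xs k)]" if "k \<in> I" for k using empty that by force
    have r: "restrict (\<lambda>k. hd (Xs k)) I \<in> grid I Xs" using s unfolding grid_def by (auto simp: PiE_iff) (metis list.set_intros(1))
    have "P.gsum I Xs ?g = ?g (restrict (\<lambda>k. hd (Xs k)) I)"
      using funcset_mem[OF g_cl[OF empty(2)] r] by - (rule P.gsum_single[OF s])
    also have "... = (\<Prod>k\<in>I. w k (fst (hd (Xs k)))) \<odot>\<^bsub>P\<^esub> t (\<lambda>k\<in>I. snd (hd (Xs k)))" by (simp cong: restrict_cong prod.cong)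
    finally show ?case by (simp only: Diff_empty empty_iff if_False)
  next
    case (insert k K)
    have k: "k \<in> I" using insert by auto
    interpret E: avl "E k" using avlE[OF k] .
    define f where "f = (\<lambda>j\<in>I. if j = k then \<zero>\<^bsub>E k\<^esub> else if j \<in> K then avl.wsum (E j) (w j) (Xs j) else snd (hd (Xs j)))"
    define Q where "Q = (\<Prod>j\<in>I - insert k K. w j (fst (hd (Xs j))))"
    have XkC: "snd ` set (Xs k) \<subseteq> pos_cone (E k)" "snd ` set (Xs k) \<subseteq> carrier (E k)" using insert.prems(2) k by (auto intro: E.CnD)
    have f: "f \<in> Tu"
    proof -
      have "f j \<in> carrier (E j)" if j: "j \<in> I" for j
      proof -
        interpret Ej: avl "E j" using avlE[OF j] .
        have C: "snd ` set (Xs j) \<subseteq> carrier (E j)" using insert.prems(2) j by (auto intro: Ej.CnD)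
        show ?thesis
        proof (cases "j = k \<or> j \<in> K")
          case True thus ?thesis using C j by (auto simp: f_def)
        next
          case False
          hence "j \<in> I - insert k K" using j by blast
          then obtain p where "Xs j = [p]" using insert.prems(3) by blast
          thus ?thesis using C False j by (auto simp: f_def)
        qed
      qed
      thus ?thesis by (simp add: Tu_iff f_def)
    qed
    have step: "P.gsum I (Xs(k := [p])) ?g = (w k (fst p) * Q) \<odot>\<^bsub>P\<^esub> t (f(k := snd p))" if p: "p \<in> set (Xs k)" for p
    proof -
      have "P.gsum I (Xs(k := [p])) ?g = (\<Prod>j\<in>I - K. w j (fst (hd ((Xs(k := [p])) j)))) \<odot>\<^bsub>P\<^esub>
        t (\<lambda>j\<in>I. if j \<in> K then avl.wsum (E j) (w j) ((Xs(k := [p])) j) else snd (hd ((Xs(k := [p])) j)))"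
      proof (rule insert.IH)
        show "K \<subseteq> I" using insert.prems(1) by blast
        show "\<forall>j\<in>I. snd ` set ((Xs(k := [p])) j) \<subseteq> pos_cone (E j)"
        proof
          fix j assume "j \<in> I"
          thus "snd ` set ((Xs(k := [p])) j) \<subseteq> pos_cone (E j)"
            using bspec[OF insert.prems(2), of j] XkC(1) p by (cases "j = k") auto
        qed
        show "\<forall>j\<in>I - K. \<exists>q. (Xs(k := [p])) j = [q]"
        proof
          fix j assume "j \<in> I - K"
          thus "\<exists>q. (Xs(k := [p])) j = [q]" using bspec[OF insert.prems(3), of j] by (cases "j = k") simp_all
        qed
      qed
      also have "(\<Prod>j\<in>I - K. w j (fst (hd ((Xs(k := [p])) j)))) = w k (fst p) * Q"
      proof -
        have "I - K = insert k (I - insert k K)" using k insert.hyps by blast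
        hence "(\<Prod>j\<in>I - K. w j (fst (hd ((Xs(k := [p])) j)))) = w k (fst (hd ((Xs(k := [p])) k))) * (\<Prod>j\<in>I - insert k K. w j (fst (hd ((Xs(k := [p])) j))))"
          using finite_I by (simp only: prod.insert finite_Diff Diff_iff insertI1 simp_thms)
        moreover have "(\<Prod>j\<in>I - insert k K. w j (fst (hd ((Xs(k := [p])) j)))) = Q"
          unfolding Q_def by (rule prod.cong) simp_all
        ultimately show ?thesis by simp
      qed
      also have "(\<lambda>j\<in>I. if j \<in> K then avl.wsum (E j) (w j) ((Xs(k := [p])) j) else snd (hd ((Xs(k := [p])) j))) = f(k := snd p)"
        using k insert.hyps by (auto simp: f_def fun_eq_iff)
      finally show ?thesis .
    qed
    have "P.gsum I (Xs(k := Xs k)) ?g = P.lsum (map (\<lambda>p. P.gsum I (Xs(k := [p])) ?g) (Xs k))"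
      by (rule P.gsum_sep[OF k]) (use g_cl[OF insert.prems(2)] in simp)
    also have "map (\<lambda>p. P.gsum I (Xs(k := [p])) ?g) (Xs k) = map (\<lambda>p. (w k (fst p) * Q) \<odot>\<^bsub>P\<^esub> t (f(k := snd p))) (Xs k)"
      using step by (intro map_cong refl)
    also have "P.lsum ... = Q \<odot>\<^bsub>P\<^esub> t (f(k := E.wsum (w k) (Xs k)))"
    proof (rule P.vec_eqI)
      have fc: "t (f(k := x)) \<in> carrier P" if "x \<in> carrier (E k)" for x using Tu_upd[OF f k that] by simp
      have sc: "set (map (\<lambda>p. (w k (fst p) * Q) \<odot>\<^bsub>P\<^esub> t (f(k := snd p))) (Xs k)) \<subseteq> carrier P"
        using fc XkC(2) by auto
      show "P.lsum (map (\<lambda>p. (w k (fst p) * Q) \<odot>\<^bsub>P\<^esub> t (f(k := snd p))) (Xs k)) \<in> carrier P" using sc by (rule P.lsum_cl)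
      show "Q \<odot>\<^bsub>P\<^esub> t (f(k := E.wsum (w k) (Xs k))) \<in> carrier P" using fc XkC by simp
      fix \<phi> assume \<phi>: "\<phi> \<in> functionals P"
      have \<psi>: "(\<lambda>x. \<phi> (t (f(k := x)))) \<in> functionals (E k)"
        unfolding functionals_def using \<phi> fc t_add[OF f k] t_smult[OF f k] by simp
      have "\<phi> (P.lsum (map (\<lambda>p. (w k (fst p) * Q) \<odot>\<^bsub>P\<^esub> t (f(k := snd p))) (Xs k))) = (\<Sum>p\<leftarrow>Xs k. \<phi> ((w k (fst p) * Q) \<odot>\<^bsub>P\<^esub> t (f(k := snd p))))"
        using P.fun_lsum[OF \<phi> sc] by (simp add: comp_def)
      also have "... = (\<Sum>p\<leftarrow>Xs k. Q * (w k (fst p) * \<phi> (t (f(k := snd p)))))"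
        using \<phi> fc XkC(2) by (intro arg_cong[where f = sum_list] map_cong refl) auto
      also have "... = Q * (\<Sum>(c, u)\<leftarrow>Xs k. w k c * \<phi> (t (f(k := u))))" by (simp add: sum_list_const_mult split_def)
      also have "... = Q * \<phi> (t (f(k := E.wsum (w k) (Xs k))))" using E.fun_wsum[OF \<psi> XkC(2)] by simp
      finally show "\<phi> (P.lsum (map (\<lambda>p. (w k (fst p) * Q) \<odot>\<^bsub>P\<^esub> t (f(k := snd p))) (Xs k))) = \<phi> (Q \<odot>\<^bsub>P\<^esub> t (f(k := E.wsum (w k) (Xs k))))"
        using \<phi> fc XkC by simp
    qed
    also have "f(k := E.wsum (w k) (Xs k)) = (\<lambda>j\<in>I. if j \<in> insert k K then avl.wsum (E j) (w j) (Xs j) else snd (hd (Xs j)))"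
      using k by (auto simp: f_def fun_eq_iff)
    finally show ?case by (simp add: Q_def)
  qed
  from this[of I Xs] X have "P.gsum I Xs ?g = 1 \<odot>\<^bsub>P\<^esub> t (\<lambda>k\<in>I. avl.wsum (E k) (w k) (Xs k))" by (simp cong: restrict_cong)
  moreover have "(\<lambda>k\<in>I. avl.wsum (E k) (w k) (Xs k)) \<in> Tu"
  proof -
    have "avl.wsum (E k) (w k) (Xs k) \<in> carrier (E k)" if "k \<in> I" for k
    proof -
      interpret Ek: avl "E k" using avlE[OF that] .
      show ?thesis using X[OF that] by (intro Ek.wsum_cl) (auto intro: Ek.CnD)
    qed
    thus ?thesis by (simp add: Tu_iff)
  qed
  ultimately show ?thesis by simp
qed

text \<open>The common bound \<open>e\<close> lets a single partition of each \<open>e k\<close>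
  serve all tuples of a combination, and \<open>t e\<close> measure all errors.\<close>

definition Sp where
  "Sp e = {P.lsum (map (\<lambda>(\<gamma>, a). \<gamma> \<odot>\<^bsub>P\<^esub> t a) l) | l. \<forall>(\<gamma>, a)\<in>set l. a \<in> PTu \<and> (\<forall>k\<in>I. vl_le (E k) (a k) (e k))}"

lemma Sp_list: "\<forall>(\<gamma>, a)\<in>set l. a \<in> PTu \<and> (\<forall>k\<in>I. vl_le (E k) (a k) (e k)) ==> set (map (\<lambda>(\<gamma>, a). \<gamma> \<odot>\<^bsub>P\<^esub> t a) l) \<subseteq> carrier P"
  using PTu_Tu by (auto intro!: P.cl(5))

lemma Sp_cl: "q \<in> Sp e ==> q \<in> carrier P"
  unfolding Sp_def using P.lsum_cl[OF Sp_list] by blast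

lemma Sp_zero: "\<zero>\<^bsub>P\<^esub> \<in> Sp e" unfolding Sp_def by (auto intro!: exI[of _ "[]"])

lemma Sp_add: assumes "p \<in> Sp e" "q \<in> Sp e" shows "p \<oplus>\<^bsub>P\<^esub> q \<in> Sp e"
proof -
  obtain l where l: "p = P.lsum (map (\<lambda>(\<gamma>, a). \<gamma> \<odot>\<^bsub>P\<^esub> t a) l)" "\<forall>(\<gamma>, a)\<in>set l. a \<in> PTu \<and> (\<forall>k\<in>I. vl_le (E k) (a k) (e k))"
    using assms(1) unfolding Sp_def by blast
  obtain l' where l': "q = P.lsum (map (\<lambda>(\<gamma>, a). \<gamma> \<odot>\<^bsub>P\<^esub> t a) l')" "\<forall>(\<gamma>, a)\<in>set l'. a \<in> PTu \<and> (\<forall>k\<in>I. vl_le (E k) (a k) (e k))"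
    using assms(2) unfolding Sp_def by blast
  have "p \<oplus>\<^bsub>P\<^esub> q = P.lsum (map (\<lambda>(\<gamma>, a). \<gamma> \<odot>\<^bsub>P\<^esub> t a) (l @ l'))"
    using P.lsum_append[OF Sp_list[OF l(2)] Sp_list[OF l'(2)]] l(1) l'(1) by simp
  moreover have "\<forall>(\<gamma>, a)\<in>set (l @ l'). a \<in> PTu \<and> (\<forall>k\<in>I. vl_le (E k) (a k) (e k))"
    unfolding set_append using l(2) l'(2) by blast
  ultimately show ?thesis unfolding Sp_def by blast
qed

lemma Sp_single: assumes "a \<in> PTu" "\<And>k. k \<in> I ==> vl_le (E k) (a k) (e k)" shows "\<gamma> \<odot>\<^bsub>P\<^esub> t a \<in> Sp e"
proof -
  have "\<gamma> \<odot>\<^bsub>P\<^esub> t a = P.lsum (map (\<lambda>(\<gamma>, a). \<gamma> \<odot>\<^bsub>P\<^esub> t a) [(\<gamma>, a)])"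
    using P.lsum_Cons[of "\<gamma> \<odot>\<^bsub>P\<^esub> t a" "[]"] PTu_Tu[OF assms(1)] by simp
  thus ?thesis unfolding Sp_def using assms by (auto intro!: exI[of _ "[(\<gamma>, a)]"])
qed

lemma Sp_induct [consumes 1, case_names zero step]:
  assumes q: "q \<in> Sp e" and z: "Q \<zero>\<^bsub>P\<^esub>"
    and step: "\<And>\<gamma> a q. a \<in> PTu ==> (\<And>k. k \<in> I ==> vl_le (E k) (a k) (e k)) ==> q \<in> Sp e ==> Q q ==> Q (\<gamma> \<odot>\<^bsub>P\<^esub> t a \<oplus>\<^bsub>P\<^esub> q)"
  shows "Q q"
proof -
  have "Q (P.lsum (map (\<lambda>(\<gamma>, a). \<gamma> \<odot>\<^bsub>P\<^esub> t a) l)) \<and> P.lsum (map (\<lambda>(\<gamma>, a). \<gamma> \<odot>\<^bsub>P\<^esub> t a) l) \<in> Sp e"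
    if "\<forall>(\<gamma>, a)\<in>set l. a \<in> PTu \<and> (\<forall>k\<in>I. vl_le (E k) (a k) (e k))" for l
    using that
  proof (induction l)
    case Nil thus ?case using z Sp_zero by simp
  next
    case (Cons p l)
    obtain \<gamma> a where p: "p = (\<gamma>, a)" by (cases p)
    have a: "a \<in> PTu" "\<And>k. k \<in> I ==> vl_le (E k) (a k) (e k)" and l: "\<forall>(\<gamma>, a)\<in>set l. a \<in> PTu \<and> (\<forall>k\<in>I. vl_le (E k) (a k) (e k))"
      using Cons.prems p by auto
    have "P.lsum (map (\<lambda>(\<gamma>, a). \<gamma> \<odot>\<^bsub>P\<^esub> t a) (p # l)) = \<gamma> \<odot>\<^bsub>P\<^esub> t a \<oplus>\<^bsub>P\<^esub> P.lsum (map (\<lambda>(\<gamma>, a). \<gamma> \<odot>\<^bsub>P\<^esub> t a) l)"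
      using P.lsum_Cons[OF _ Sp_list[OF l], of "\<gamma> \<odot>\<^bsub>P\<^esub> t a"] PTu_Tu[OF a(1)] p by simp
    thus ?case using Cons.IH[OF l] step[OF a] Sp_add Sp_single[OF a] by simp
  qed
  thus ?thesis using q unfolding Sp_def by blast
qed

lemma Sp_smult: "q \<in> Sp e ==> \<alpha> \<odot>\<^bsub>P\<^esub> q \<in> Sp e"
proof (induction rule: Sp_induct)
  case (step \<gamma> a q)
  have "\<alpha> \<odot>\<^bsub>P\<^esub> (\<gamma> \<odot>\<^bsub>P\<^esub> t a \<oplus>\<^bsub>P\<^esub> q) = (\<alpha> * \<gamma>) \<odot>\<^bsub>P\<^esub> t a \<oplus>\<^bsub>P\<^esub> \<alpha> \<odot>\<^bsub>P\<^esub> q"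
    using PTu_Tu[OF step(1)] Sp_cl[OF step(3)] by (simp add: P.smult_r_distr)
  thus ?case using Sp_add[OF Sp_single[OF step(1,2)] step(4)] by simp
qed (simp add: Sp_zero)

text \<open>The tensors in a combination are positive, so taking the real part only replaces each
  coefficient by its real part.\<close>

lemma Sp_Rp: "q \<in> Sp e ==> P.Rp q \<in> Sp e"
proof (induction rule: Sp_induct)
  case zero
  thus ?case using P.Rp_real[of "\<zero>\<^bsub>P\<^esub>"] Sp_zero by simp
next
  case (step \<gamma> a q)
  note aP = PTu_Tu[OF step(1)]
  have g: "\<gamma> = of_real (kre \<gamma>) + of_real (kim \<gamma>) * kI" by (rule k_decomp)
  have "P.Rp (\<gamma> \<odot>\<^bsub>P\<^esub> t a) = P.rs (kre \<gamma>) (t a)"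
  proof (rule P.Rp_by[of _ "P.rs (kim \<gamma>) (t a)"])
    fix \<phi> assume \<phi>: "\<phi> \<in> functionals P"
    have "\<gamma> * \<phi> (t a) = (of_real (kre \<gamma>) + of_real (kim \<gamma>) * kI) * \<phi> (t a)" using g by simp
    thus "\<phi> (\<gamma> \<odot>\<^bsub>P\<^esub> t a) = \<phi> (P.rs (kre \<gamma>) (t a)) + kI * \<phi> (P.rs (kim \<gamma>) (t a))"
      using \<phi> aP by (simp add: algebra_simps)
  qed (use t_pos[OF step(1)] in auto)
  hence "P.Rp (\<gamma> \<odot>\<^bsub>P\<^esub> t a \<oplus>\<^bsub>P\<^esub> q) = of_real (kre \<gamma>) \<odot>\<^bsub>P\<^esub> t a \<oplus>\<^bsub>P\<^esub> P.Rp q"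
    using P.Rp_add[of "\<gamma> \<odot>\<^bsub>P\<^esub> t a" q] aP Sp_cl[OF step(3)] by (simp add: P.rs_def)
  thus ?case using Sp_add[OF Sp_single[OF step(1,2)] step(4)] by simp
qed

lemma Sp_sum: "finite Y ==> (\<And>y. y \<in> Y ==> f y \<in> Sp e) ==> (\<Oplus>\<^bsub>P\<^esub>y\<in>Y. f y) \<in> Sp e"
proof (induction Y rule: finite_induct)
  case (insert y Y)
  have "f \<in> Y \<rightarrow> carrier P" "f y \<in> carrier P" using insert Sp_cl by auto
  thus ?case using insert Sp_add by simp
qed (simp add: Sp_zero)

text \<open>The partitions of unity represent every \<open>a i k\<close> exactly, so
  \<open>q\<close> itself is rewritten without error as a sum over products of pieces. An error
  arises only when the modulus is taken, by \<open>am_sum_close\<close>.\<close>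

lemma am_Sp_approx:
  assumes e: "e \<in> PTu" and q: "q \<in> Sp e" and \<epsilon>: "\<epsilon> > 0"
  shows "\<exists>r\<in>Sp e. vl_le P (modulus P (modulus P q \<ominus>\<^bsub>P\<^esub> r)) (P.rs \<epsilon> (t e))"
proof -
  obtain l where l: "q = P.lsum (map (\<lambda>(\<gamma>, a). \<gamma> \<odot>\<^bsub>P\<^esub> t a) l)" "\<forall>(\<gamma>, a)\<in>set l. a \<in> PTu \<and> (\<forall>k\<in>I. vl_le (E k) (a k) (e k))"
    using q unfolding Sp_def by blast
  define m where "m = length l"
  define \<gamma> where "\<gamma> i = fst (l ! i)" for i
  define a where "a i = snd (l ! i)" for i
  have a: "a i \<in> PTu" "\<forall>k\<in>I. vl_le (E k) (a i k) (e k)" if "i < m" for i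
    using l(2) nth_mem[of i l] that unfolding m_def a_def by (cases "l ! i"; fastforce)+
  define B where "B = (\<Sum>i<m. norm (\<gamma> i))"
  have B0: "B \<ge> 0" unfolding B_def by (intro sum_nonneg) auto
  \<comment> \<open>On products of pieces that are neighbours in each variable, the factors
    \<open>c i / n\<close> differ by at most \<open>1 / n\<close>. Products of \<open>s\<close>
    factors of norm at most 1 then differ by at most \<open>s / n\<close>, and the coefficients by
    \<open>B * s / n\<close>.\<close>
  obtain n0 :: nat where n0: "real n0 > 2 * B * s / \<epsilon>" using reals_Archimedean2 by blast
  define n where "n = n0 + 1"
  have n: "n \<ge> 1" "2 * (B * s / n) \<le> \<epsilon>"
  proof -
    have "2 * B * s / \<epsilon> < real n" using n0 by (simp add: n_def)
    hence "2 * B * s < real n * \<epsilon>" using \<epsilon> by (simp add: field_simps)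
    moreover have "real n > 0" by (simp add: n_def)
    ultimately show "2 * (B * s / n) \<le> \<epsilon>" by (simp add: field_simps)
  qed (simp add: n_def)
  define \<delta> where "\<delta> = B * s / n"
  have \<delta>: "\<delta> \<ge> 0" "2 * \<delta> \<le> \<epsilon>" using n B0 by (auto simp: \<delta>_def)
  define part where "part k Xs \<longleftrightarrow> snd ` set Xs \<subseteq> pos_cone (E k) \<and> avl.wsum (E k) (\<lambda>_. 1) Xs = e k \<and>
      (\<forall>i<m. avl.wsum (E k) (\<lambda>c. of_nat (c i)) Xs = avl.rs (E k) (real n) (a i k)) \<and>
      (\<forall>(c, u)\<in>set Xs. \<forall>(d, v)\<in>set Xs. avl.dj (E k) u v \<or> (\<forall>i<m. c i \<le> Suc (d i) \<and> d i \<le> Suc (c i))) \<and>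
      (\<forall>(c, u)\<in>set Xs. \<forall>i<m. c i \<le> n)" for k and Xs :: "((nat \<Rightarrow> nat) \<times> 'a) list"
  have "\<exists>Xs. part k Xs" if k: "k \<in> I" for k
    unfolding part_def
    by (rule avl.partition_of_unity[OF avlE[OF k] PTuD[OF e k] n(1)]) (use a(2) k PTuD[OF a(1)] in blast)
  then obtain Xs where "\<And>k. k \<in> I ==> part k (Xs k)" using bchoice[of I part] by blast
  hence X: "\<And>k. k \<in> I ==> snd ` set (Xs k) \<subseteq> pos_cone (E k)"
      "\<And>k. k \<in> I ==> avl.wsum (E k) (\<lambda>_. 1) (Xs k) = e k"
      "\<And>k i. k \<in> I ==> i < m ==> avl.wsum (E k) (\<lambda>c. of_nat (c i)) (Xs k) = avl.rs (E k) (real n) (a i k)"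
      "\<And>k c u d v. k \<in> I ==> (c, u) \<in> set (Xs k) ==> (d, v) \<in> set (Xs k) ==> avl.dj (E k) u v \<or> (\<forall>i<m. c i \<le> Suc (d i) \<and> d i \<le> Suc (c i))"
      "\<And>k c u i. k \<in> I ==> (c, u) \<in> set (Xs k) ==> i < m ==> c i \<le> n"
    unfolding part_def by blast+
  define N where "N = (\<Pi>\<^sub>E k\<in>I. {..<length (Xs k)})"
  define y where "y \<nu> = (\<lambda>k\<in>I. Xs k ! \<nu> k)" for \<nu>
  define U where "U z = (\<lambda>k\<in>I. snd (z k))" for z :: "nat \<Rightarrow> (nat \<Rightarrow> nat) \<times> 'a"
  \<comment> \<open>The coefficient of \<open>q\<close> on a product of pieces, obtained by
    expanding each \<open>t (a i)\<close> with \<open>t_wsum\<close>.\<close>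
  define C where "C z = (\<Sum>i<m. \<gamma> i * (\<Prod>k\<in>I. of_nat (fst (z k) i) / of_nat n))" for z :: "nat \<Rightarrow> (nat \<Rightarrow> nat) \<times> 'a"
  have fin: "finite N" unfolding N_def by (intro finite_PiE) auto
  have yX: "y \<nu> k \<in> set (Xs k)" if "\<nu> \<in> N" "k \<in> I" for \<nu> k
    using that unfolding N_def y_def by (auto simp: PiE_iff)
  have UC: "U (y \<nu>) k \<in> pos_cone (E k)" if "\<nu> \<in> N" "k \<in> I" for \<nu> k
    using X(1)[OF that(2)] yX[OF that] that(2) by (auto simp: U_def)
  have UP: "U (y \<nu>) \<in> PTu" if "\<nu> \<in> N" for \<nu> using UC[OF that] by (auto simp: PTu_iff U_def)
  have Ule: "vl_le (E k) (U (y \<nu>) k) (e k)" if "\<nu> \<in> N" "k \<in> I" for \<nu> k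
  proof -
    interpret Ek: avl "E k" using avlE[OF that(2)] .
    have c: "set (map snd (Xs k)) \<subseteq> pos_cone (E k)" using X(1)[OF that(2)] by auto
    have "Ek.wsum (\<lambda>_. 1) (Xs k) = Ek.lsum (map snd (Xs k))" using X(1)[OF that(2)] by (intro Ek.wsum_one) (auto intro: Ek.CnD)
    hence "Ek.lsum (map snd (Xs k)) = e k" using X(2)[OF that(2)] by simp
    moreover have "U (y \<nu>) k \<in> set (map snd (Xs k))" using yX[OF that] that(2) by (auto simp: U_def)
    ultimately show ?thesis using Ek.le_lsum[OF c] by metis
  qed
  have wC: "t (U (y \<nu>)) \<in> pos_cone P" if "\<nu> \<in> N" for \<nu> by (rule t_pos[OF UP[OF that]])
  have wc: "(\<lambda>\<nu>. t (U (y \<nu>))) \<in> N \<rightarrow> carrier P" using wC by auto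
  have expand: "(\<Oplus>\<^bsub>P\<^esub>\<nu>\<in>N. (\<Prod>k\<in>I. w k (fst (y \<nu> k))) \<odot>\<^bsub>P\<^esub> t (U (y \<nu>))) = t (\<lambda>k\<in>I. avl.wsum (E k) (w k) (Xs k))" for w :: "nat \<Rightarrow> (nat \<Rightarrow> nat) \<Rightarrow> 'k"
    using t_wsum[OF X(1), of w] unfolding P.gsum_def N_def U_def y_def by simp
  have W: "(\<Oplus>\<^bsub>P\<^esub>\<nu>\<in>N. t (U (y \<nu>))) = t e"
  proof -
    have "(\<Oplus>\<^bsub>P\<^esub>\<nu>\<in>N. (\<Prod>k\<in>I. 1) \<odot>\<^bsub>P\<^esub> t (U (y \<nu>))) = t (\<lambda>k\<in>I. avl.wsum (E k) (\<lambda>_. 1) (Xs k))" by (rule expand)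
    also have "(\<lambda>k\<in>I. avl.wsum (E k) (\<lambda>_. 1) (Xs k)) = e" using X(2) e by (auto simp: fun_eq_iff PTu_iff extensional_def)
    also have "(\<Oplus>\<^bsub>P\<^esub>\<nu>\<in>N. (\<Prod>k\<in>I. 1) \<odot>\<^bsub>P\<^esub> t (U (y \<nu>))) = (\<Oplus>\<^bsub>P\<^esub>\<nu>\<in>N. t (U (y \<nu>)))"
      using wC by (intro P.M.finsum_cong') auto
    finally show ?thesis .
  qed
  have ta: "(\<Oplus>\<^bsub>P\<^esub>\<nu>\<in>N. (\<Prod>k\<in>I. of_nat (fst (y \<nu> k) i) / of_nat n) \<odot>\<^bsub>P\<^esub> t (U (y \<nu>))) = t (a i)" if i: "i < m" for i
  proof -
    have "(\<Oplus>\<^bsub>P\<^esub>\<nu>\<in>N. (\<Prod>k\<in>I. of_nat (fst (y \<nu> k) i) / of_nat n) \<odot>\<^bsub>P\<^esub> t (U (y \<nu>))) = t (\<lambda>k\<in>I. avl.wsum (E k) (\<lambda>c. of_nat (c i) / of_nat n) (Xs k))"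
      by (rule expand)
    also have "(\<lambda>k\<in>I. avl.wsum (E k) (\<lambda>c. of_nat (c i) / of_nat n) (Xs k)) = a i"
    proof (rule extensionalityI[of _ I])
      fix k assume k: "k \<in> I"
      interpret Ek: avl "E k" using avlE[OF k] .
      have c: "snd ` set (Xs k) \<subseteq> carrier (E k)" using X(1)[OF k] by (auto intro: Ek.CnD)
      have ak: "a i k \<in> carrier (E k)" using PTuD[OF a(1)[OF i] k] by simp
      have "Ek.wsum (\<lambda>c. of_nat (c i) / of_nat n) (Xs k) = a i k"
      proof (rule Ek.vec_eqI)
        fix \<phi> assume \<phi>: "\<phi> \<in> functionals (E k)"
        have "\<phi> (Ek.wsum (\<lambda>c. of_nat (c i) / of_nat n) (Xs k)) = (\<Sum>(c, u)\<leftarrow>Xs k. (1 / of_nat n) * (of_nat (c i) * \<phi> u))"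
          by (simp add: Ek.fun_wsum[OF \<phi> c] split_def)
        also have "... = (1 / of_nat n) * \<phi> (Ek.wsum (\<lambda>c. of_nat (c i)) (Xs k))"
          by (simp only: Ek.fun_wsum[OF \<phi> c] sum_list_const_mult split_def)
        also have "... = \<phi> (a i k)" using X(3)[OF k i] \<phi> ak n(1) by simp
        finally show "\<phi> (Ek.wsum (\<lambda>c. of_nat (c i) / of_nat n) (Xs k)) = \<phi> (a i k)" .
      qed (use c ak in auto)
      thus "(\<lambda>k\<in>I. avl.wsum (E k) (\<lambda>c. of_nat (c i) / of_nat n) (Xs k)) k = a i k" using k by simp
    qed (use a(1)[OF i] in \<open>auto simp: PTu_iff\<close>)
    finally show ?thesis .
  qed
  have qC: "q = (\<Oplus>\<^bsub>P\<^esub>\<nu>\<in>N. C (y \<nu>) \<odot>\<^bsub>P\<^esub> t (U (y \<nu>)))"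
  proof (rule P.vec_eqI)
    have c: "(\<lambda>\<nu>. C (y \<nu>) \<odot>\<^bsub>P\<^esub> t (U (y \<nu>))) \<in> N \<rightarrow> carrier P" using wc by auto
    show "q \<in> carrier P" by (rule Sp_cl[OF q])
    show "(\<Oplus>\<^bsub>P\<^esub>\<nu>\<in>N. C (y \<nu>) \<odot>\<^bsub>P\<^esub> t (U (y \<nu>))) \<in> carrier P" using c by (rule P.M.finsum_closed)
    fix \<phi> assume \<phi>: "\<phi> \<in> functionals P"
    have "\<phi> q = (\<Sum>i<m. \<phi> (\<gamma> i \<odot>\<^bsub>P\<^esub> t (a i)))"
      unfolding l(1) P.fun_lsum[OF \<phi> Sp_list[OF l(2)]]
      by (simp add: sum_list_sum_nth atLeast0LessThan m_def \<gamma>_def a_def split_def)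
    also have "... = (\<Sum>i<m. \<gamma> i * (\<Sum>\<nu>\<in>N. (\<Prod>k\<in>I. of_nat (fst (y \<nu> k) i) / of_nat n) * \<phi> (t (U (y \<nu>)))))"
    proof (intro sum.cong refl)
      fix i assume "i \<in> {..<m}"
      hence i: "i < m" by simp
      have c: "(\<lambda>\<nu>. (\<Prod>k\<in>I. of_nat (fst (y \<nu> k) i) / of_nat n) \<odot>\<^bsub>P\<^esub> t (U (y \<nu>))) \<in> N \<rightarrow> carrier P" using wc by auto
      have "\<phi> (\<gamma> i \<odot>\<^bsub>P\<^esub> t (a i)) = \<gamma> i * \<phi> (t (a i))" using \<phi> PTu_Tu[OF a(1)[OF i]] by simp
      also have "\<phi> (t (a i)) = (\<Sum>\<nu>\<in>N. \<phi> ((\<Prod>k\<in>I. of_nat (fst (y \<nu> k) i) / of_nat n) \<odot>\<^bsub>P\<^esub> t (U (y \<nu>))))"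
        unfolding ta[OF i, symmetric] by (rule P.fun_sum[OF \<phi> c])
      also have "... = (\<Sum>\<nu>\<in>N. (\<Prod>k\<in>I. of_nat (fst (y \<nu> k) i) / of_nat n) * \<phi> (t (U (y \<nu>))))"
        using \<phi> wC by (intro sum.cong refl P.fun_smult) auto
      finally show "\<phi> (\<gamma> i \<odot>\<^bsub>P\<^esub> t (a i)) = \<gamma> i * (\<Sum>\<nu>\<in>N. (\<Prod>k\<in>I. of_nat (fst (y \<nu> k) i) / of_nat n) * \<phi> (t (U (y \<nu>))))" .
    qed
    also have "... = (\<Sum>\<nu>\<in>N. C (y \<nu>) * \<phi> (t (U (y \<nu>))))"
      unfolding C_def sum_distrib_left sum_distrib_right by (subst sum.swap) (simp only: mult.assoc)
    also have "... = \<phi> (\<Oplus>\<^bsub>P\<^esub>\<nu>\<in>N. C (y \<nu>) \<odot>\<^bsub>P\<^esub> t (U (y \<nu>)))"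
      unfolding P.fun_sum[OF \<phi> c] using \<phi> wC by (intro sum.cong refl P.fun_smult[symmetric]) auto
    finally show "\<phi> q = \<phi> (\<Oplus>\<^bsub>P\<^esub>\<nu>\<in>N. C (y \<nu>) \<odot>\<^bsub>P\<^esub> t (U (y \<nu>)))" .
  qed
  have close: "P.dj (t (U (y \<nu>))) (t (U (y \<xi>))) \<or> norm (C (y \<nu>) - C (y \<xi>)) \<le> \<delta>" if \<nu>\<xi>: "\<nu> \<in> N" "\<xi> \<in> N" for \<nu> \<xi>
  proof (cases "\<exists>k\<in>I. avl.dj (E k) (U (y \<nu>) k) (U (y \<xi>) k)")
    case True
    then obtain k where k: "k \<in> I" "avl.dj (E k) (U (y \<nu>) k) (U (y \<xi>) k)" by auto
    \<comment> \<open>A positive tuple above both. Outside \<open>k\<close> both tuples are enlarged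
      to \<open>b\<close>, which leaves two tuples that differ only at \<open>k\<close>, where
      \<open>t_disjoint\<close> applies.\<close>
    define b where "b = (\<lambda>j\<in>I. U (y \<nu>) j \<oplus>\<^bsub>E j\<^esub> U (y \<xi>) j)"
    have b: "b \<in> PTu" using avl.Cn_add[OF avlE] UC \<nu>\<xi> by (auto simp: PTu_iff b_def)
    note uk = UC[OF \<nu>\<xi>(1) k(1)] UC[OF \<nu>\<xi>(2) k(1)]
    have le: "vl_le P (t (U (y \<nu>))) (t (b(k := U (y \<nu>) k)))" "vl_le P (t (U (y \<xi>))) (t (b(k := U (y \<xi>) k)))"
    proof -
      have "vl_le (E j) (U (y \<nu>) j) ((b(k := U (y \<nu>) k)) j) \<and> vl_le (E j) (U (y \<xi>) j) ((b(k := U (y \<xi>) k)) j)" if j: "j \<in> I" for j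
      proof -
        interpret Ej: avl "E j" using avlE[OF j] .
        show ?thesis using UC[OF \<nu>\<xi>(1) j] UC[OF \<nu>\<xi>(2) j] j Ej.le_refl Ej.CnD by (cases "j = k") (simp_all add: b_def)
      qed
      thus "vl_le P (t (U (y \<nu>))) (t (b(k := U (y \<nu>) k)))" "vl_le P (t (U (y \<xi>))) (t (b(k := U (y \<xi>) k)))"
        using UP \<nu>\<xi> PTu_upd[OF b k(1)] uk by (auto intro!: t_mono)
    qed
    have "P.dj (t (b(k := U (y \<nu>) k))) (t (b(k := U (y \<xi>) k)))" by (rule t_disjoint[OF b k(1) uk k(2)])
    hence "P.dj (t (U (y \<nu>))) (t (b(k := U (y \<xi>) k)))"
      by (rule P.dj_mono[OF _ le(1)]) (use PTu_upd[OF b k(1)] uk PTu_Tu UP \<nu>\<xi> in auto)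
    hence "P.dj (t (b(k := U (y \<xi>) k))) (t (U (y \<nu>)))" by (rule P.dj_sym)
    hence "P.dj (t (U (y \<xi>))) (t (U (y \<nu>)))"
      by (rule P.dj_mono[OF _ le(2)]) (use PTu_upd[OF b k(1)] uk PTu_Tu UP \<nu>\<xi> in auto)
    thus ?thesis using P.dj_sym by blast
  next
    case False
    have nn: "real n > 0" using n(1) by simp
    have d: "norm (of_nat (fst (y \<nu> k) i) / of_nat n - of_nat (fst (y \<xi> k) i) / of_nat n :: 'k) \<le> 1 / n"
      and b: "norm (of_nat (fst (y \<nu> k) i) / of_nat n :: 'k) \<le> 1" "norm (of_nat (fst (y \<xi> k) i) / of_nat n :: 'k) \<le> 1"
      if k: "k \<in> I" and i: "i < m" for k i
    proof -
      obtain c u where cu: "y \<nu> k = (c, u)" by (cases "y \<nu> k")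
      obtain c' u' where cu': "y \<xi> k = (c', u')" by (cases "y \<xi> k")
      have mem: "(c, u) \<in> set (Xs k)" "(c', u') \<in> set (Xs k)" using yX[OF \<nu>\<xi>(1) k] yX[OF \<nu>\<xi>(2) k] cu cu' by auto
      have "\<not> avl.dj (E k) u u'" using False k cu cu' by (auto simp: U_def)
      hence near: "c i \<le> Suc (c' i)" "c' i \<le> Suc (c i)" using X(4)[OF k mem] i by auto
      have "of_nat (c i) / of_nat n - of_nat (c' i) / of_nat n = (of_real ((real (c i) - real (c' i)) / real n) :: 'k)"
        by (simp add: diff_divide_distrib)
      hence "norm (of_nat (c i) / of_nat n - of_nat (c' i) / of_nat n :: 'k) = \<bar>(real (c i) - real (c' i)) / real n\<bar>"
        by (simp only: norm_of_real)
      also have "... \<le> 1 / n" using near nn by (auto simp: abs_le_iff field_simps)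
      finally show "norm (of_nat (fst (y \<nu> k) i) / of_nat n - of_nat (fst (y \<xi> k) i) / of_nat n :: 'k) \<le> 1 / n" using cu cu' by simp
      show "norm (of_nat (fst (y \<nu> k) i) / of_nat n :: 'k) \<le> 1" "norm (of_nat (fst (y \<xi> k) i) / of_nat n :: 'k) \<le> 1"
        using X(5)[OF k mem(1) i] X(5)[OF k mem(2) i] cu cu' nn by (simp_all add: norm_divide)
    qed
    have "norm (C (y \<nu>) - C (y \<xi>)) = norm (\<Sum>i<m. \<gamma> i * ((\<Prod>k\<in>I. of_nat (fst (y \<nu> k) i) / of_nat n) - (\<Prod>k\<in>I. of_nat (fst (y \<xi> k) i) / of_nat n)))"
      unfolding C_def by (simp only: sum_subtractf[symmetric] right_diff_distrib)
    also have "... \<le> (\<Sum>i<m. norm (\<gamma> i) * (s * (1 / n)))"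
    proof (rule sum_norm_le)
      fix i assume "i \<in> {..<m}"
      hence i: "i < m" by simp
      have "norm ((\<Prod>k\<in>I. of_nat (fst (y \<nu> k) i) / of_nat n) - (\<Prod>k\<in>I. of_nat (fst (y \<xi> k) i) / of_nat n) :: 'k)
         \<le> (\<Sum>k\<in>I. norm (of_nat (fst (y \<nu> k) i) / of_nat n - of_nat (fst (y \<xi> k) i) / of_nat n :: 'k))"
        using b i by (intro norm_prod_diff) auto
      also have "... \<le> (\<Sum>k\<in>I. 1 / n)" using d i by (intro sum_mono) auto
      also have "... = s * (1 / n)" by (simp add: I_def)
      finally show "norm (\<gamma> i * ((\<Prod>k\<in>I. of_nat (fst (y \<nu> k) i) / of_nat n) - (\<Prod>k\<in>I. of_nat (fst (y \<xi> k) i) / of_nat n))) \<le> norm (\<gamma> i) * (s * (1 / n))"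
        unfolding norm_mult by (intro mult_left_mono) auto
    qed
    also have "... = \<delta>" unfolding \<delta>_def B_def sum_distrib_right[symmetric] by simp
    finally show ?thesis by simp
  qed
  define r where "r = (\<Oplus>\<^bsub>P\<^esub>\<nu>\<in>N. P.rs (norm (C (y \<nu>))) (t (U (y \<nu>))))"
  have rS: "r \<in> Sp e" unfolding r_def P.rs_def by (intro Sp_sum fin Sp_single UP Ule)
  have te: "t e \<in> pos_cone P" by (rule t_pos[OF e])
  have "vl_le P (modulus P (modulus P q \<ominus>\<^bsub>P\<^esub> r)) (P.rs (2 * \<delta>) (t e))"
    using P.am_sum_close[of N "\<lambda>\<nu>. t (U (y \<nu>))" \<delta> "\<lambda>\<nu>. C (y \<nu>)", OF fin wC \<delta>(1) close] unfolding qC[symmetric] r_def[symmetric] W .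
  moreover have "vl_le P (P.rs (2 * \<delta>) (t e)) (P.rs \<epsilon> (t e))" using \<delta> te by (intro P.le_rs_mono) auto
  ultimately have "vl_le P (modulus P (modulus P q \<ominus>\<^bsub>P\<^esub> r)) (P.rs \<epsilon> (t e))"
    by (rule P.le_trans) (use Sp_cl[OF q] Sp_cl[OF rS] te in auto)
  thus ?thesis using rS by blast
qed

end

section \<open>Approximation by combinations of elementary tensors\<close>

lemma (in avl) am_diff_le: assumes "x \<in> Vc" "y \<in> Vc" shows "am (am x \<ominus> am y) \<preceq> am (x \<ominus> y)"
proof (rule am_lub)
  have "\<ominus> (x \<ominus> y) = y \<ominus> x" using assms by (intro vec_eqI) auto
  hence yx: "am (y \<ominus> x) = am (x \<ominus> y)" using am_neg[of "x \<ominus> y"] assms by simp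
  show "am x \<ominus> am y \<preceq> am (x \<ominus> y)"
    by (rule le_by[OF leD[OF am_triangle'[of x y]]]) (use assms in auto)
  show "\<ominus> (am x \<ominus> am y) \<preceq> am (x \<ominus> y)"
    by (rule le_by[OF leD[OF am_triangle'[of y x]]]) (use assms in \<open>auto simp: yx\<close>)
qed (use assms in auto)

context tensor
begin

text \<open>Uniform limits relative to the single element \<open>t e\<close>; there is no topology
  on \<open>P\<close>.\<close>

definition apx where
  "apx e x \<longleftrightarrow> x \<in> carrier P \<and> (\<forall>\<epsilon>>0. \<exists>q\<in>Sp e. vl_le P (modulus P (x \<ominus>\<^bsub>P\<^esub> q)) (P.rs \<epsilon> (t e)))"

lemma apx_cl: "apx e x ==> x \<in> carrier P" by (simp add: apx_def)

lemma apxI: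
  assumes "x \<in> carrier P" "\<And>\<epsilon>. \<epsilon> > 0 ==> \<exists>q\<in>Sp e. vl_le P (modulus P (x \<ominus>\<^bsub>P\<^esub> q)) (P.rs \<epsilon> (t e))"
  shows "apx e x"
  using assms unfolding apx_def by blast

lemma apxE:
  assumes "apx e x" "\<epsilon> > 0"
  obtains q where "q \<in> Sp e" "q \<in> carrier P" "vl_le P (modulus P (x \<ominus>\<^bsub>P\<^esub> q)) (P.rs \<epsilon> (t e))"
  using assms Sp_cl unfolding apx_def by blast

context
  fixes e assumes e: "e \<in> PTu"
begin

lemma te: "t e \<in> pos_cone P" by (rule t_pos[OF e])

lemma teC [simp]: "t e \<in> carrier P" by (rule P.CnD[OF te])

lemma half: "P.rs (\<epsilon>/2) (t e) \<oplus>\<^bsub>P\<^esub> P.rs (\<epsilon>/2) (t e) = P.rs \<epsilon> (t e)"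
proof (rule P.vec_eqI)
  fix \<phi> assume \<phi>: "\<phi> \<in> functionals P"
  have "of_real \<epsilon> = (of_real (\<epsilon>/2) + of_real (\<epsilon>/2) :: 'k)" by (simp flip: of_real_add)
  hence "of_real \<epsilon> * \<phi> (t e) = of_real (\<epsilon>/2) * \<phi> (t e) + of_real (\<epsilon>/2) * \<phi> (t e)" by (simp only: distrib_right)
  thus "\<phi> (P.rs (\<epsilon>/2) (t e) \<oplus>\<^bsub>P\<^esub> P.rs (\<epsilon>/2) (t e)) = \<phi> (P.rs \<epsilon> (t e))" using \<phi> by simp
qed auto

lemma apx_two:
  assumes "u \<in> carrier P" "v \<in> carrier P" "vl_le P (modulus P u) (P.rs (\<epsilon>/2) (t e))" "vl_le P (modulus P v) (P.rs (\<epsilon>/2) (t e))"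
  shows "vl_le P (modulus P (u \<oplus>\<^bsub>P\<^esub> v)) (P.rs \<epsilon> (t e))"
proof -
  have "vl_le P (modulus P u \<oplus>\<^bsub>P\<^esub> modulus P v) (P.rs (\<epsilon>/2) (t e) \<oplus>\<^bsub>P\<^esub> P.rs (\<epsilon>/2) (t e))"
    by (rule P.le_add) (use assms in auto)
  hence "vl_le P (modulus P u \<oplus>\<^bsub>P\<^esub> modulus P v) (P.rs \<epsilon> (t e))" by (simp only: half)
  from P.le_trans[OF P.am_triangle[OF assms(1,2)] this] show ?thesis using assms(1,2) by simp
qed

lemma apx_add: assumes x: "apx e x" and y: "apx e y" shows "apx e (x \<oplus>\<^bsub>P\<^esub> y)"
proof (rule apxI)
  note c = apx_cl[OF x] apx_cl[OF y]
  show "x \<oplus>\<^bsub>P\<^esub> y \<in> carrier P" using c by simp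
  fix \<epsilon> :: real assume "\<epsilon> > 0"
  hence h: "0 < \<epsilon>/2" by simp
  obtain p where p: "p \<in> Sp e" "p \<in> carrier P" "vl_le P (modulus P (x \<ominus>\<^bsub>P\<^esub> p)) (P.rs (\<epsilon>/2) (t e))" by (rule apxE[OF x h])
  obtain q where q: "q \<in> Sp e" "q \<in> carrier P" "vl_le P (modulus P (y \<ominus>\<^bsub>P\<^esub> q)) (P.rs (\<epsilon>/2) (t e))" by (rule apxE[OF y h])
  have "(x \<oplus>\<^bsub>P\<^esub> y) \<ominus>\<^bsub>P\<^esub> (p \<oplus>\<^bsub>P\<^esub> q) = (x \<ominus>\<^bsub>P\<^esub> p) \<oplus>\<^bsub>P\<^esub> (y \<ominus>\<^bsub>P\<^esub> q)" using c p(2) q(2) by (intro P.vec_eqI) auto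
  hence "vl_le P (modulus P ((x \<oplus>\<^bsub>P\<^esub> y) \<ominus>\<^bsub>P\<^esub> (p \<oplus>\<^bsub>P\<^esub> q))) (P.rs \<epsilon> (t e))"
    using apx_two[OF _ _ p(3) q(3)] c p(2) q(2) by simp
  thus "\<exists>q\<in>Sp e. vl_le P (modulus P ((x \<oplus>\<^bsub>P\<^esub> y) \<ominus>\<^bsub>P\<^esub> q)) (P.rs \<epsilon> (t e))" using Sp_add[OF p(1) q(1)] by blast
qed

lemma apx_smult: assumes x: "apx e x" shows "apx e (\<alpha> \<odot>\<^bsub>P\<^esub> x)"
proof (rule apxI)
  note c = apx_cl[OF x]
  show "\<alpha> \<odot>\<^bsub>P\<^esub> x \<in> carrier P" using c by simp
  fix \<epsilon> :: real assume e0: "\<epsilon> > 0"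
  define \<delta> where "\<delta> = \<epsilon> / (norm \<alpha> + 1)"
  have n1: "norm \<alpha> + 1 > 0" by (simp add: add_nonneg_pos)
  have \<delta>: "\<delta> > 0" "norm \<alpha> * \<delta> \<le> \<epsilon>"
  proof -
    show "\<delta> > 0" unfolding \<delta>_def using e0 n1 by (rule divide_pos_pos)
    have "norm \<alpha> * \<delta> \<le> (norm \<alpha> + 1) * \<delta>" using \<open>\<delta> > 0\<close> by (intro mult_right_mono) auto
    thus "norm \<alpha> * \<delta> \<le> \<epsilon>" unfolding \<delta>_def using n1 by simp
  qed
  obtain q where q: "q \<in> Sp e" "q \<in> carrier P" "vl_le P (modulus P (x \<ominus>\<^bsub>P\<^esub> q)) (P.rs \<delta> (t e))" by (rule apxE[OF x \<delta>(1)])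
  have "\<alpha> \<odot>\<^bsub>P\<^esub> x \<ominus>\<^bsub>P\<^esub> \<alpha> \<odot>\<^bsub>P\<^esub> q = \<alpha> \<odot>\<^bsub>P\<^esub> (x \<ominus>\<^bsub>P\<^esub> q)" using c q(2) by (intro P.vec_eqI) (auto simp: algebra_simps)
  hence "modulus P (\<alpha> \<odot>\<^bsub>P\<^esub> x \<ominus>\<^bsub>P\<^esub> \<alpha> \<odot>\<^bsub>P\<^esub> q) = P.rs (norm \<alpha>) (modulus P (x \<ominus>\<^bsub>P\<^esub> q))" using c q(2) by (simp add: P.am_smult)
  moreover have "vl_le P (P.rs (norm \<alpha>) (modulus P (x \<ominus>\<^bsub>P\<^esub> q))) (P.rs (norm \<alpha>) (P.rs \<delta> (t e)))"
    by (rule P.le_smult[OF q(3)]) (use c q(2) in auto)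
  moreover have "vl_le P (P.rs (norm \<alpha>) (P.rs \<delta> (t e))) (P.rs \<epsilon> (t e))"
    using P.le_rs_mono[OF \<delta>(2) te] by simp
  ultimately have "vl_le P (modulus P (\<alpha> \<odot>\<^bsub>P\<^esub> x \<ominus>\<^bsub>P\<^esub> \<alpha> \<odot>\<^bsub>P\<^esub> q)) (P.rs \<epsilon> (t e))"
    by (simp only:) (rule P.le_trans, assumption, assumption, use c q(2) in auto)
  thus "\<exists>q\<in>Sp e. vl_le P (modulus P (\<alpha> \<odot>\<^bsub>P\<^esub> x \<ominus>\<^bsub>P\<^esub> q)) (P.rs \<epsilon> (t e))" using Sp_smult[OF q(1)] by blast
qed

lemma apx_am: assumes x: "apx e x" shows "apx e (modulus P x)"
proof (rule apxI)
  note c = apx_cl[OF x]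
  show "modulus P x \<in> carrier P" using c by simp
  fix \<epsilon> :: real assume "\<epsilon> > 0"
  hence h: "0 < \<epsilon>/2" by simp
  obtain q where q: "q \<in> Sp e" "q \<in> carrier P" "vl_le P (modulus P (x \<ominus>\<^bsub>P\<^esub> q)) (P.rs (\<epsilon>/2) (t e))" by (rule apxE[OF x h])
  obtain r where r: "r \<in> Sp e" "vl_le P (modulus P (modulus P q \<ominus>\<^bsub>P\<^esub> r)) (P.rs (\<epsilon>/2) (t e))"
    using am_Sp_approx[OF e q(1) h] by blast
  have rc: "r \<in> carrier P" by (rule Sp_cl[OF r(1)])
  have "vl_le P (modulus P (modulus P x \<ominus>\<^bsub>P\<^esub> modulus P q)) (P.rs (\<epsilon>/2) (t e))"
    by (rule P.le_trans[OF P.am_diff_le q(3)]) (use c q(2) in auto)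
  moreover have "modulus P x \<ominus>\<^bsub>P\<^esub> r = (modulus P x \<ominus>\<^bsub>P\<^esub> modulus P q) \<oplus>\<^bsub>P\<^esub> (modulus P q \<ominus>\<^bsub>P\<^esub> r)"
    using c q(2) rc by (intro P.vec_eqI) auto
  ultimately have "vl_le P (modulus P (modulus P x \<ominus>\<^bsub>P\<^esub> r)) (P.rs \<epsilon> (t e))"
    using apx_two[OF _ _ _ r(2)] c q(2) rc by simp
  thus "\<exists>q\<in>Sp e. vl_le P (modulus P (modulus P x \<ominus>\<^bsub>P\<^esub> q)) (P.rs \<epsilon> (t e))" using r(1) by blast
qed

text \<open>Real and imaginary parts must stay in the space of limits, because its cone has to
  generate it over the scalars.\<close>

lemma apx_Rp: assumes x: "apx e x" shows "apx e (P.Rp x)"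
proof (rule apxI)
  note c = apx_cl[OF x]
  show "P.Rp x \<in> carrier P" using P.RlD[OF P.Rp_Rl[OF c]] .
  fix \<epsilon> :: real assume e0: "\<epsilon> > 0"
  obtain q where q: "q \<in> Sp e" "q \<in> carrier P" "vl_le P (modulus P (x \<ominus>\<^bsub>P\<^esub> q)) (P.rs \<epsilon> (t e))" by (rule apxE[OF x e0])
  have "P.Rp (x \<ominus>\<^bsub>P\<^esub> q) = P.Rp x \<ominus>\<^bsub>P\<^esub> P.Rp q" using c q(2) P.Rp_add[of x "\<ominus>\<^bsub>P\<^esub> q"] P.Rp_neg[of q] by (simp add: a_minus_def)
  hence "vl_le P (modulus P (P.Rp x \<ominus>\<^bsub>P\<^esub> P.Rp q)) (modulus P (x \<ominus>\<^bsub>P\<^esub> q))" using P.am_Rp_le[of "x \<ominus>\<^bsub>P\<^esub> q"] c q(2) by simp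
  hence "vl_le P (modulus P (P.Rp x \<ominus>\<^bsub>P\<^esub> P.Rp q)) (P.rs \<epsilon> (t e))"
    by (rule P.le_trans[OF _ q(3)]) (use c q(2) in auto)
  thus "\<exists>q\<in>Sp e. vl_le P (modulus P (P.Rp x \<ominus>\<^bsub>P\<^esub> q)) (P.rs \<epsilon> (t e))" using Sp_Rp[OF q(1)] by blast
qed

lemma apx_t: "apx e (t e)"
proof (rule apxI)
  fix \<epsilon> :: real assume e0: "\<epsilon> > 0"
  have "vl_le (E k) (e k) (e k)" if "k \<in> I" for k
    by (rule avl.le_refl[OF avlE[OF that] avl.CnD[OF avlE[OF that] PTuD[OF e that]]])
  hence "1 \<odot>\<^bsub>P\<^esub> t e \<in> Sp e" by (rule Sp_single[OF e])
  hence "t e \<in> Sp e" by simp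
  moreover have "vl_le P (modulus P (t e \<ominus>\<^bsub>P\<^esub> t e)) (P.rs \<epsilon> (t e))"
  proof -
    have "modulus P (t e \<ominus>\<^bsub>P\<^esub> t e) = \<zero>\<^bsub>P\<^esub>" using P.minus_self[OF teC] P.am_zero by simp
    thus ?thesis using P.zero_le[of "P.rs \<epsilon> (t e)"] te e0 by simp
  qed
  ultimately show "\<exists>q\<in>Sp e. vl_le P (modulus P (t e \<ominus>\<^bsub>P\<^esub> q)) (P.rs \<epsilon> (t e))" by blast
qed simp

end

text \<open>Limits relative to different tuples can be added because both are limits relative to the
  sum of the tuples, which lies above each of them.\<close>

lemma apx_common:
  assumes e1: "e1 \<in> PTu" and e2: "e2 \<in> PTu"
  shows "\<exists>e\<in>PTu. \<forall>x. apx e1 x \<or> apx e2 x \<longrightarrow> apx e x"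
proof -
  define e where "e = (\<lambda>k\<in>I. e1 k \<oplus>\<^bsub>E k\<^esub> e2 k)"
  have e: "e \<in> PTu" using avl.Cn_add[OF avlE] PTuD[OF e1] PTuD[OF e2] by (auto simp: PTu_iff e_def)
  have le: "vl_le (E k) (e1 k) (e k)" "vl_le (E k) (e2 k) (e k)" if k: "k \<in> I" for k
  proof -
    interpret Ek: avl "E k" using avlE[OF k] .
    show "vl_le (E k) (e1 k) (e k)" "vl_le (E k) (e2 k) (e k)" using PTuD[OF e1 k] PTuD[OF e2 k] k by (simp_all add: e_def)
  qed
  have mono: "apx e x" if d: "d \<in> PTu" and de: "\<And>k. k \<in> I ==> vl_le (E k) (d k) (e k)" and x: "apx d x" for d x
  proof (rule apxI)
    show "x \<in> carrier P" by (rule apx_cl[OF x])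
    have sub: "q \<in> Sp e" if "q \<in> Sp d" for q
      using that
    proof (induction rule: Sp_induct)
      case (step \<gamma> a q)
      have "vl_le (E k) (a k) (e k)" if k: "k \<in> I" for k
      proof -
        interpret Ek: avl "E k" using avlE[OF k] .
        show ?thesis
          by (rule Ek.le_trans[OF step(2)[OF k] de[OF k] Ek.CnD[OF PTuD[OF step(1) k]] Ek.CnD[OF PTuD[OF d k]] Ek.CnD[OF PTuD[OF e k]]])
      qed
      thus ?case using Sp_add[OF Sp_single[OF step(1)] step(4)] by blast
    qed (rule Sp_zero)
    fix \<epsilon> :: real assume e0: "\<epsilon> > 0"
    obtain q where q: "q \<in> Sp d" "q \<in> carrier P" "vl_le P (modulus P (x \<ominus>\<^bsub>P\<^esub> q)) (P.rs \<epsilon> (t d))" by (rule apxE[OF x e0])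
    have "vl_le P (P.rs \<epsilon> (t d)) (P.rs \<epsilon> (t e))"
      by (rule P.le_smult[OF t_mono[OF d e de]]) (use e0 PTu_Tu d e in auto)
    hence "vl_le P (modulus P (x \<ominus>\<^bsub>P\<^esub> q)) (P.rs \<epsilon> (t e))"
      by (rule P.le_trans[OF q(3)]) (use apx_cl[OF x] q(2) PTu_Tu d e in auto)
    thus "\<exists>q\<in>Sp e. vl_le P (modulus P (x \<ominus>\<^bsub>P\<^esub> q)) (P.rs \<epsilon> (t e))" using sub[OF q(1)] by blast
  qed
  show ?thesis using e mono[OF e1 le(1)] mono[OF e2 le(2)] by blast
qed

definition approximable where "approximable = {x. \<exists>e\<in>PTu. apx e x}"

lemma approximable_cl: "x \<in> approximable ==> x \<in> carrier P"
  unfolding approximable_def using apx_cl by blast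

lemma approximable_add: assumes "x \<in> approximable" "y \<in> approximable" shows "x \<oplus>\<^bsub>P\<^esub> y \<in> approximable"
proof -
  obtain e1 e2 where e: "e1 \<in> PTu" "apx e1 x" "e2 \<in> PTu" "apx e2 y" using assms unfolding approximable_def by blast
  obtain c where c: "c \<in> PTu" "\<forall>x. apx e1 x \<or> apx e2 x \<longrightarrow> apx c x" using apx_common[OF e(1,3)] by (rule bexE)
  have "apx c x" "apx c y" using c(2) e(2,4) by blast+
  hence "apx c (x \<oplus>\<^bsub>P\<^esub> y)" by (rule apx_add[OF c(1)])
  thus ?thesis using c(1) unfolding approximable_def by blast
qed

lemma approximable_smult: "x \<in> approximable ==> \<alpha> \<odot>\<^bsub>P\<^esub> x \<in> approximable"
  and approximable_am: "x \<in> approximable ==> modulus P x \<in> approximable"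
  and approximable_Rp: "x \<in> approximable ==> P.Rp x \<in> approximable"
  unfolding approximable_def using apx_smult apx_am apx_Rp by blast+

lemma approximable_minus: assumes "x \<in> approximable" "y \<in> approximable" shows "x \<ominus>\<^bsub>P\<^esub> y \<in> approximable"
proof -
  have "x \<ominus>\<^bsub>P\<^esub> y = x \<oplus>\<^bsub>P\<^esub> (-1) \<odot>\<^bsub>P\<^esub> y" using assms approximable_cl by (intro P.vec_eqI) auto
  thus ?thesis using approximable_add approximable_smult assms by simp
qed

lemma approximable_t: "f \<in> Tu ==> t f \<in> approximable"
proof (induction rule: tuple_induct)
  case (base a)
  thus ?case using apx_t unfolding approximable_def by blast
next
  case (step f k x)
  interpret Ek: avl "E k" using avlE[OF step(2)] .
  interpret H: avl_map "E k" P "\<lambda>x. t (f(k := x))" using t_linear[OF step(2,1)] by unfold_locales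
  obtain a b c d where p: "a \<in> pos_cone (E k)" "b \<in> pos_cone (E k)" "c \<in> pos_cone (E k)" "d \<in> pos_cone (E k)"
    and x: "x = (a \<ominus>\<^bsub>E k\<^esub> b) \<oplus>\<^bsub>E k\<^esub> kI \<odot>\<^bsub>E k\<^esub> (c \<ominus>\<^bsub>E k\<^esub> d)" using Ek.carrier_four[OF step(3)] by blast
  have eq: "t (f(k := x)) = (t (f(k := a)) \<ominus>\<^bsub>P\<^esub> t (f(k := b))) \<oplus>\<^bsub>P\<^esub> kI \<odot>\<^bsub>P\<^esub> (t (f(k := c)) \<ominus>\<^bsub>P\<^esub> t (f(k := d)))"
    unfolding x using p by (simp add: H.T_add H.T_smult H.T_minus)
  have "(t (f(k := a)) \<ominus>\<^bsub>P\<^esub> t (f(k := b))) \<oplus>\<^bsub>P\<^esub> kI \<odot>\<^bsub>P\<^esub> (t (f(k := c)) \<ominus>\<^bsub>P\<^esub> t (f(k := d))) \<in> approximable"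
    by (intro approximable_add approximable_minus approximable_smult step(4) p)
  thus ?case unfolding eq[symmetric] .
qed

end

context tensor
begin

section \<open>The approximable elements as a sublattice of the tensor product\<close>

lemma approximable_lattice:
  defines "B \<equiv> \<lparr>carrier = approximable, monoid.mult = undefined, monoid.one = undefined, ring.zero = \<zero>\<^bsub>P\<^esub>,
      ring.add = (\<lambda>x y. x \<oplus>\<^bsub>P\<^esub> y), module.smult = (\<lambda>\<alpha> x. \<alpha> \<odot>\<^bsub>P\<^esub> x)\<rparr> :: ('k, 'p) module"
  shows "archimedean_vector_lattice (attach_modulus B (modulus P))"
proof -
  have B: "carrier B = approximable" "\<zero>\<^bsub>B\<^esub> = \<zero>\<^bsub>P\<^esub>" "x \<oplus>\<^bsub>B\<^esub> y = x \<oplus>\<^bsub>P\<^esub> y" "\<alpha> \<odot>\<^bsub>B\<^esub> x = \<alpha> \<odot>\<^bsub>P\<^esub> x" for x y \<alpha>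
    by (simp_all add: B_def)
  note cl = approximable_cl
  have z: "\<zero>\<^bsub>P\<^esub> \<in> approximable"
  proof -
    have "\<zero>\<^bsub>E k\<^esub> \<in> carrier (E k)" if "k \<in> I" for k
    proof -
      interpret Ek: avl "E k" using avlE[OF that] .
      show ?thesis by simp
    qed
    hence f: "(\<lambda>k\<in>I. \<zero>\<^bsub>E k\<^esub>) \<in> Tu" by (simp add: Tu_iff)
    hence "0 \<odot>\<^bsub>P\<^esub> t (\<lambda>k\<in>I. \<zero>\<^bsub>E k\<^esub>) \<in> approximable" by (intro approximable_smult approximable_t)
    thus ?thesis using f by simp
  qed
  have kB: "kmodule B"
  proof (rule kmoduleI, unfold B)
    show "x \<oplus>\<^bsub>P\<^esub> y \<oplus>\<^bsub>P\<^esub> z = x \<oplus>\<^bsub>P\<^esub> (y \<oplus>\<^bsub>P\<^esub> z)" if "x \<in> approximable" "y \<in> approximable" "z \<in> approximable" for x y z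
      using cl that by (intro P.vec_eqI) auto
    show "x \<oplus>\<^bsub>P\<^esub> y = y \<oplus>\<^bsub>P\<^esub> x" if "x \<in> approximable" "y \<in> approximable" for x y
      using cl that by (intro P.vec_eqI) auto
    show "(-1) \<odot>\<^bsub>P\<^esub> x \<oplus>\<^bsub>P\<^esub> x = \<zero>\<^bsub>P\<^esub>" if "x \<in> approximable" for x
      using cl that by (intro P.vec_eqI) auto
    show "(\<alpha> + \<beta>) \<odot>\<^bsub>P\<^esub> x = \<alpha> \<odot>\<^bsub>P\<^esub> x \<oplus>\<^bsub>P\<^esub> \<beta> \<odot>\<^bsub>P\<^esub> x" if "x \<in> approximable" for x \<alpha> \<beta>
      using cl that by (intro P.vec_eqI) (auto simp: algebra_simps)
    show "\<alpha> \<odot>\<^bsub>P\<^esub> (x \<oplus>\<^bsub>P\<^esub> y) = \<alpha> \<odot>\<^bsub>P\<^esub> x \<oplus>\<^bsub>P\<^esub> \<alpha> \<odot>\<^bsub>P\<^esub> y" if "x \<in> approximable" "y \<in> approximable" for x y \<alpha>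
      using cl that by (intro P.vec_eqI) (auto simp: algebra_simps)
    show "(\<alpha> * \<beta>) \<odot>\<^bsub>P\<^esub> x = \<alpha> \<odot>\<^bsub>P\<^esub> (\<beta> \<odot>\<^bsub>P\<^esub> x)" if "x \<in> approximable" for x \<alpha> \<beta>
      using cl that by (intro P.vec_eqI) (auto simp: algebra_simps)
  qed (use z cl approximable_add approximable_smult in auto)
  interpret B: kmodule B by (rule kB)
  have minus: "x \<ominus>\<^bsub>B\<^esub> y = x \<ominus>\<^bsub>P\<^esub> y" if "x \<in> approximable" "y \<in> approximable" for x y
  proof -
    have "\<ominus>\<^bsub>B\<^esub> y = (-1) \<odot>\<^bsub>P\<^esub> y" using B.smult_minus1[of y] that by (simp add: B)
    hence "x \<ominus>\<^bsub>B\<^esub> y = x \<oplus>\<^bsub>P\<^esub> (-1) \<odot>\<^bsub>P\<^esub> y" by (simp add: a_minus_def B)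
    thus ?thesis using cl that by (intro P.vec_eqI) auto
  qed
  have pp: "P.pp x \<in> approximable" if "x \<in> approximable" for x
    unfolding P.pp_def P.rs_def using that by (intro approximable_smult approximable_add approximable_am)
  let ?C = "approximable \<inter> pos_cone P"
  show ?thesis
  proof (rule archimedean_vector_lattice_attachI(1)[OF kB, of ?C], unfold B)
    show "?C \<subseteq> approximable" by blast
    fix x assume x: "x \<in> approximable"
    note xc = cl[OF x]
    show "modulus P x \<in> ?C" using approximable_am[OF x] xc by simp
    show "modulus P (\<alpha> \<odot>\<^bsub>P\<^esub> x) = of_real (norm \<alpha>) \<odot>\<^bsub>P\<^esub> modulus P x" for \<alpha> by (rule P.modulus_smult[OF xc])
    show "x = \<zero>\<^bsub>P\<^esub>" if "modulus P x = \<zero>\<^bsub>P\<^esub>" by (rule P.am_eq_zero[OF xc that])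
    show "modulus P x \<oplus>\<^bsub>P\<^esub> modulus P y \<ominus>\<^bsub>B\<^esub> modulus P (x \<oplus>\<^bsub>P\<^esub> y) \<in> ?C" if y: "y \<in> approximable" for y
    proof -
      have "modulus P x \<oplus>\<^bsub>P\<^esub> modulus P y \<ominus>\<^bsub>P\<^esub> modulus P (x \<oplus>\<^bsub>P\<^esub> y) \<in> pos_cone P"
        by (rule P.leD[OF P.am_triangle[OF xc cl[OF y]]])
      thus ?thesis using x y by (simp add: minus approximable_add approximable_am approximable_minus)
    qed
    have I: "P.Ip x \<in> approximable" unfolding P.Ip_def by (intro approximable_Rp approximable_smult x)
    have R: "P.Rp x \<in> approximable" by (rule approximable_Rp[OF x])
    have four: "P.pp y \<in> ?C" "P.pp (\<ominus>\<^bsub>P\<^esub> y) \<in> ?C" "P.pp y \<ominus>\<^bsub>B\<^esub> P.pp (\<ominus>\<^bsub>P\<^esub> y) = y" if "y \<in> approximable" "y \<in> P.Rl" for y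
    proof -
      have "\<ominus>\<^bsub>P\<^esub> y = (-1) \<odot>\<^bsub>P\<^esub> y" using cl[OF that(1)] by (intro P.vec_eqI) auto
      hence n: "\<ominus>\<^bsub>P\<^esub> y \<in> approximable" using approximable_smult[OF that(1)] by simp
      show "P.pp y \<in> ?C" "P.pp (\<ominus>\<^bsub>P\<^esub> y) \<in> ?C" using pp[OF n] pp[OF that(1)] that(2) by auto
      show "P.pp y \<ominus>\<^bsub>B\<^esub> P.pp (\<ominus>\<^bsub>P\<^esub> y) = y" using minus[OF pp[OF that(1)] pp[OF n]] P.pp_diff[OF cl[OF that(1)]] by simp
    qed
    note f1 = four[OF R P.Rp_Rl[OF xc]] and f2 = four[OF I P.Ip_Rl[OF xc]]
    have "x = (P.pp (P.Rp x) \<ominus>\<^bsub>B\<^esub> P.pp (\<ominus>\<^bsub>P\<^esub> P.Rp x)) \<oplus>\<^bsub>P\<^esub> kI \<odot>\<^bsub>P\<^esub> (P.pp (P.Ip x) \<ominus>\<^bsub>B\<^esub> P.pp (\<ominus>\<^bsub>P\<^esub> P.Ip x))"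
      unfolding f1(3) f2(3) by (rule P.Rp_Ip[OF xc])
    thus "\<exists>a\<in>?C. \<exists>b\<in>?C. \<exists>c\<in>?C. \<exists>d\<in>?C. x = (a \<ominus>\<^bsub>B\<^esub> b) \<oplus>\<^bsub>P\<^esub> kI \<odot>\<^bsub>P\<^esub> (c \<ominus>\<^bsub>B\<^esub> d)"
      using f1(1,2) f2(1,2) by blast
  next
    fix f g assume f: "f \<in> ?C" and g: "g \<in> ?C" and le: "\<And>n::nat. g \<ominus>\<^bsub>B\<^esub> of_nat n \<odot>\<^bsub>P\<^esub> f \<in> ?C"
    have "vl_le P (P.rs (real n) f) g" for n :: nat
      unfolding vl_le_def P.rs_def of_real_of_nat_eq using le[of n] minus[of g "of_nat n \<odot>\<^bsub>P\<^esub> f"] approximable_smult[of f "of_nat n"] f g by simp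
    thus "f = \<zero>\<^bsub>P\<^esub>" using f g by - (rule P.archimedean_Cn[of f g]; simp)
  qed (use approximable_add P.Cn_am in auto)
qed

text \<open>The universal property maps \<open>P\<close> into the sublattice of approximable
  elements and fixes elementary tensors. Seen as a map of \<open>P\<close> into itself it agrees
  with the identity on these, hence everywhere; so each \<open>x\<close> equals its image.\<close>

lemma carrier_approximable: assumes x: "x \<in> carrier P" shows "x \<in> approximable"
proof -
  define B where "B = (\<lparr>carrier = approximable, monoid.mult = undefined, monoid.one = undefined, ring.zero = \<zero>\<^bsub>P\<^esub>,
      ring.add = (\<lambda>x y. x \<oplus>\<^bsub>P\<^esub> y), module.smult = (\<lambda>\<alpha> x. \<alpha> \<odot>\<^bsub>P\<^esub> x)\<rparr> :: ('k, 'p) module)"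
  define G where "G = attach_modulus B (modulus P)"
  have G: "carrier G = approximable" "x \<oplus>\<^bsub>G\<^esub> y = x \<oplus>\<^bsub>P\<^esub> y" "\<alpha> \<odot>\<^bsub>G\<^esub> x = \<alpha> \<odot>\<^bsub>P\<^esub> x" "modulus G = modulus P" for x y \<alpha>
    by (simp_all add: G_def B_def)
  have avlG: "archimedean_vector_lattice G" unfolding G_def B_def by (rule approximable_lattice)
  have lin: "linear_map (E k) G (\<lambda>x. t (f(k := x)))" if "k \<in> I" "f \<in> Tu" for k f
    using t_linear[OF that] approximable_t Tu_upd[OF that(2,1)] unfolding linear_map_def G by blast
  have "s_morphism s E G t"
    unfolding s_morphism_def multilinear_map_def I_def[symmetric]
  proof (intro conjI ballI impI)
    fix k f assume k: "k \<in> I" and f: "f \<in> Tu"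
    show "linear_map (E k) G (\<lambda>x. t (f(k := x)))" by (rule lin[OF k f])
    assume "\<forall>j\<in>I - {k}. f j \<in> pos_cone (E j)"
    hence "vl_hom (E k) P (\<lambda>x. t (f(k := x)))"
      using t_morphism k f unfolding s_morphism_def I_def[symmetric] by blast
    thus "vl_hom (E k) G (\<lambda>x. t (f(k := x)))" using lin[OF k f] unfolding vl_hom_def G by blast
  qed
  from tensor_product_lift(1)[OF tp s_pos avlG inj_Inl this]
  obtain h where h: "vl_hom P G h" "\<forall>f\<in>Tu. t f = h (t f)" by blast
  have hP: "vl_hom P P h" using h(1) approximable_cl unfolding vl_hom_def linear_map_def G by blast
  have id: "vl_hom P P (\<lambda>x. x)" unfolding vl_hom_def linear_map_def by blast
  have "h x = x"
    by (rule tensor_product_lift(2)[OF tp s_pos P.archimedean_vector_lattice_axioms inj_Inl hP id _ x]) (use h(2) in simp)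
  moreover have "h x \<in> approximable" using h(1) x unfolding vl_hom_def linear_map_def G by blast
  ultimately show ?thesis by simp
qed

lemma ob_linear: "S \<in> ob_maps P F ==> linear_map P F S" by (simp add: ob_maps_def)

text \<open>If \<open>q\<close> approximates \<open>x\<close> up to \<open>\<epsilon>\<close> times
  \<open>t e\<close>, then \<open>S x\<close> is the value of \<open>S\<close> at
  \<open>x - q\<close>, since \<open>S\<close> vanishes at \<open>q\<close>. Boundedness on the
  order interval of \<open>t e\<close> makes this value at most \<open>\<epsilon> b\<close> in
  modulus, for a fixed \<open>b\<close>.\<close>

lemma ob_zero:
  assumes S: "S \<in> ob_maps P F" and z: "\<And>f. f \<in> Tu ==> S (t f) = \<zero>\<^bsub>F\<^esub>" and x: "x \<in> carrier P"
  shows "S x = \<zero>\<^bsub>F\<^esub>"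
proof -
  interpret S: avl_map P F S using ob_linear[OF S] by unfold_locales
  obtain e where e: "e \<in> PTu" "apx e x" using carrier_approximable[OF x] unfolding approximable_def by blast
  have Sq: "S q = \<zero>\<^bsub>F\<^esub>" if "q \<in> Sp e" for q
    using that
  proof (induction rule: Sp_induct)
    case (step \<gamma> a q)
    thus ?case using z[OF PTu_Tu[OF step(1)]] PTu_Tu[OF step(1)] Sp_cl[OF step(3)] by (simp add: S.T_add S.T_smult)
  qed (rule S.T_zero)
  define Y where "Y = {y \<in> carrier P. vl_le P (modulus P y) (t e)}"
  have "order_bounded P Y" unfolding order_bounded_def Y_def using t_pos[OF e(1)] by blast
  hence "order_bounded F (S ` Y)" using S unfolding ob_maps_def by blast
  then obtain b where b: "b \<in> pos_cone F" "\<And>y. y \<in> Y ==> vl_le F (modulus F (S y)) b" unfolding order_bounded_def by blast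
  have "vl_le F (modulus F (S x)) (F.rs \<epsilon> b)" if \<epsilon>: "\<epsilon> > 0" for \<epsilon>
  proof -
    obtain q where q: "q \<in> Sp e" "q \<in> carrier P" "vl_le P (modulus P (x \<ominus>\<^bsub>P\<^esub> q)) (P.rs \<epsilon> (t e))" by (rule apxE[OF e(2) \<epsilon>])
    \<comment> \<open>The error rescaled into the order interval of \<open>t e\<close>, where the
      bound \<open>b\<close> is valid.\<close>
    define y where "y = P.rs (1/\<epsilon>) (x \<ominus>\<^bsub>P\<^esub> q)"
    have y: "y \<in> carrier P" using x q(2) by (simp add: y_def)
    have "modulus P y = P.rs (1/\<epsilon>) (modulus P (x \<ominus>\<^bsub>P\<^esub> q))"
      unfolding y_def P.rs_def using P.am_smult[of "x \<ominus>\<^bsub>P\<^esub> q" "of_real (1/\<epsilon>)"] x q(2) \<epsilon> by (simp add: P.rs_def norm_divide)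
    moreover have "vl_le P (P.rs (1/\<epsilon>) (modulus P (x \<ominus>\<^bsub>P\<^esub> q))) (P.rs (1/\<epsilon>) (P.rs \<epsilon> (t e)))"
      by (rule P.le_smult[OF q(3)]) (use x q(2) \<epsilon> PTu_Tu[OF e(1)] in auto)
    moreover have "P.rs (1/\<epsilon>) (P.rs \<epsilon> (t e)) = t e" using \<epsilon> PTu_Tu[OF e(1)] by simp
    ultimately have "y \<in> Y" using y unfolding Y_def by simp
    hence le: "vl_le F (modulus F (S y)) b" by (rule b(2))
    have Sy: "S x = F.rs \<epsilon> (S y)"
    proof -
      have "S (x \<ominus>\<^bsub>P\<^esub> q) = S x \<ominus>\<^bsub>F\<^esub> \<zero>\<^bsub>F\<^esub>" using S.T_minus[OF x q(2)] Sq[OF q(1)] by (simp only:)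
      also have "... = S x" using S.T_cl[OF x] by (intro F.vec_eqI) auto
      finally have "S y = F.rs (1/\<epsilon>) (S x)" unfolding y_def using x q(2) by (simp add: S.T_rs)
      thus ?thesis using \<epsilon> x by simp
    qed
    have "modulus F (S x) = F.rs \<epsilon> (modulus F (S y))"
      unfolding Sy F.rs_def using F.am_smult[of "S y" "of_real \<epsilon>"] S.T_cl[OF y] \<epsilon> by (simp add: F.rs_def)
    moreover have "vl_le F (F.rs \<epsilon> (modulus F (S y))) (F.rs \<epsilon> b)"
      by (rule F.le_smult[OF le]) (use \<epsilon> b(1) S.T_cl[OF y] in auto)
    ultimately show ?thesis by simp
  qed
  hence "vl_le F (modulus F (S x)) \<zero>\<^bsub>F\<^esub>"
    by - (rule F.le_zero_archimedean[OF _ b(1)], use S.T_cl[OF x] in auto)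
  hence "modulus F (S x) = \<zero>\<^bsub>F\<^esub>" by - (rule F.le_zero, use S.T_cl[OF x] in auto)
  thus ?thesis by (rule F.am_eq_zero[OF S.T_cl[OF x]])
qed

section \<open>Uniqueness and existence of the extension\<close>

abbreviation Q where "Q \<equiv> ob_lattice P F"

lemma P_ob: "ob_space P F" by unfold_locales

lemmas Q_simps = ob_space.ob_lattice_simps[OF P_ob]

lemma Q_avl: "avl Q" by (rule avl.intro[OF ob_space.ob_lattice_structure(1)[OF P_ob]])

lemma Q_cone: "pos_cone Q = pos_ob_maps P F" by (rule ob_space.ob_lattice_structure(2)[OF P_ob])

lemma Q_add: "S \<in> ob_maps P F ==> S' \<in> ob_maps P F ==> S \<oplus>\<^bsub>Q\<^esub> S' \<in> ob_maps P F"
  and Q_smult: "S \<in> ob_maps P F ==> \<alpha> \<odot>\<^bsub>Q\<^esub> S \<in> ob_maps P F"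
proof -
  interpret Q: avl Q by (rule Q_avl)
  show "S \<in> ob_maps P F ==> S' \<in> ob_maps P F ==> S \<oplus>\<^bsub>Q\<^esub> S' \<in> ob_maps P F"
    "S \<in> ob_maps P F ==> \<alpha> \<odot>\<^bsub>Q\<^esub> S \<in> ob_maps P F"
    unfolding Q_simps(1)[symmetric] by (rule Q.cl; assumption)+
qed

lemma ob_unique:
  assumes S: "S \<in> ob_maps P F" and S': "S' \<in> ob_maps P F" and eq: "\<And>f. f \<in> Tu ==> S (t f) = S' (t f)"
  shows "S = S'"
proof (rule extensionalityI[of _ "carrier P"])
  show "S \<in> extensional (carrier P)" "S' \<in> extensional (carrier P)" using S S' by (auto simp: ob_maps_def)
  interpret S: avl_map P F S using ob_linear[OF S] by unfold_locales
  interpret S': avl_map P F S' using ob_linear[OF S'] by unfold_locales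
  define D where "D = S \<oplus>\<^bsub>Q\<^esub> ((-1) \<odot>\<^bsub>Q\<^esub> S')"
  have D: "D \<in> ob_maps P F" unfolding D_def by (intro Q_add Q_smult S S')
  have Dx: "D x = S x \<oplus>\<^bsub>F\<^esub> (-1) \<odot>\<^bsub>F\<^esub> S' x" if "x \<in> carrier P" for x using that by (simp add: D_def Q_simps)
  have "D (t f) = \<zero>\<^bsub>F\<^esub>" if f: "f \<in> Tu" for f
    unfolding Dx[OF t_cl[OF f]] eq[OF f] using S'.T_cl[OF t_cl[OF f]] by (intro F.vec_eqI) auto
  hence z: "D x = \<zero>\<^bsub>F\<^esub>" if "x \<in> carrier P" for x using ob_zero[OF D _ that] by blast
  fix x assume x: "x \<in> carrier P"
  show "S x = S' x"
  proof (rule F.vec_eqI)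
    fix \<phi> assume \<phi>: "\<phi> \<in> functionals F"
    have "\<phi> (S x \<oplus>\<^bsub>F\<^esub> (-1) \<odot>\<^bsub>F\<^esub> S' x) = \<phi> \<zero>\<^bsub>F\<^esub>" using z[OF x] Dx[OF x] by simp
    thus "\<phi> (S x) = \<phi> (S' x)" using \<phi> S.T_cl[OF x] S'.T_cl[OF x] by simp
  qed (use S.T_cl[OF x] S'.T_cl[OF x] in auto)
qed

text \<open>A homomorphism sends positive \<open>p\<close> to a positive operator
  \<open>h p\<close>, so for positive \<open>T\<close> the extension is positive and therefore order
  bounded. A general \<open>T\<close> is a combination of four positive maps. The clause on positive
  maps is one half of the cone isomorphism.\<close>

lemma ob_exists:
  assumes T0: "T0 \<in> bv_maps s E F"
  shows "\<exists>S\<in>ob_maps P F. (\<forall>f\<in>Tu. T0 f = S (t f)) \<and> (T0 \<in> pos_bv_maps s E F \<longrightarrow> S \<in> pos_ob_maps P F)"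
proof -
  interpret B: ob_space L F by (rule L_ob)
  interpret Po: ob_space P F by (rule P_ob)
  have avlG: "archimedean_vector_lattice G2" by (rule B.ob_lattice_structure(1))
  obtain h where h: "vl_hom P G2 h" and hf: "\<forall>f\<in>Tu. ev f = h (t f)"
    using tensor_product_lift(1)[OF tp s_pos avlG inj_Inr ev_s_morphism] by blast
  have hlin: "linear_map P G2 h" using h by (simp add: vl_hom_def)
  have h_ob: "h p \<in> ob_maps L F" if "p \<in> carrier P" for p
    using hlin that unfolding linear_map_def B.ob_lattice_simps by blast
  have h_lin: "avl_map L F (h p)" if "p \<in> carrier P" for p
    using h_ob[OF that] unfolding ob_maps_def by unfold_locales blast
  define val where "val T = (\<lambda>p\<in>carrier P. h p T)" for T
  have hcl: "h p T \<in> carrier F" if "p \<in> carrier P" "T \<in> bv_maps s E F" for p T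
    using avl_map.T_cl[OF h_lin[OF that(1)], of T] that(2) by simp
  have Xlin: "linear_map P F (val T)" if T: "T \<in> bv_maps s E F" for T
    unfolding linear_map_def
  proof (intro conjI ballI allI)
    show "val T \<in> carrier P \<rightarrow> carrier F" using hcl T by (simp add: val_def)
    fix x \<alpha> assume x: "x \<in> carrier P"
    have "h (\<alpha> \<odot>\<^bsub>P\<^esub> x) = \<alpha> \<odot>\<^bsub>G2\<^esub> h x" using hlin x unfolding linear_map_def by blast
    thus "val T (\<alpha> \<odot>\<^bsub>P\<^esub> x) = \<alpha> \<odot>\<^bsub>F\<^esub> val T x" using x T by (simp add: val_def B.ob_lattice_simps)
    fix y assume y: "y \<in> carrier P"
    have "h (x \<oplus>\<^bsub>P\<^esub> y) = h x \<oplus>\<^bsub>G2\<^esub> h y" using hlin x y unfolding linear_map_def by blast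
    thus "val T (x \<oplus>\<^bsub>P\<^esub> y) = val T x \<oplus>\<^bsub>F\<^esub> val T y" using x y T by (simp add: val_def B.ob_lattice_simps)
  qed
  have Xpos: "val T p \<in> pos_cone F" if T: "T \<in> pos_bv_maps s E F" and p: "p \<in> pos_cone P" for T p
  proof -
    have "h (modulus P p) = modulus G2 (h p)" using h P.CnD[OF p] unfolding vl_hom_def by blast
    hence "modulus G2 (h p) = h p" using P.Cn_am[OF p] by simp
    moreover have "h p \<in> carrier G2" using hlin P.CnD[OF p] unfolding linear_map_def by blast
    ultimately have "h p \<in> pos_cone G2" unfolding pos_cone_def by blast
    hence "h p \<in> pos_ob_maps L F" by (simp only: B.ob_lattice_structure(2))
    hence "h p T \<in> pos_cone F" using T unfolding pos_ob_maps_def bv_lattice_cone by blast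
    thus ?thesis using P.CnD[OF p] by (simp add: val_def)
  qed
  have Xbd: "order_bounded F (val T ` A)" if "T \<in> pos_bv_maps s E F" "order_bounded P A" for T A
    by (rule Po.pos_linear_ob[OF Xlin[OF pos_bv[OF that(1)]] Xpos[OF that(1)] that(2)])
  have Xob: "val T \<in> ob_maps P F" if T: "T \<in> bv_maps s E F" for T
  proof -
    have "T \<in> carrier L" using T by simp
    from L.carrier_four[OF this] obtain a b c d where
      p: "a \<in> pos_cone L" "b \<in> pos_cone L" "c \<in> pos_cone L" "d \<in> pos_cone L"
      and T4: "T = (a \<ominus>\<^bsub>L\<^esub> b) \<oplus>\<^bsub>L\<^esub> kI \<odot>\<^bsub>L\<^esub> (c \<ominus>\<^bsub>L\<^esub> d)" by blast
    note pc = L.CnD[OF p(1)] L.CnD[OF p(2)] L.CnD[OF p(3)] L.CnD[OF p(4)]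
    have cl: "a \<ominus>\<^bsub>L\<^esub> b \<in> carrier L" "c \<ominus>\<^bsub>L\<^esub> d \<in> carrier L" by (rule L.cl(3)[OF pc(1,2)], rule L.cl(3)[OF pc(3,4)])
    have pp: "a \<in> pos_bv_maps s E F" "b \<in> pos_bv_maps s E F" "c \<in> pos_bv_maps s E F" "d \<in> pos_bv_maps s E F"
      using p by (simp_all only: bv_lattice_cone)
    have "order_bounded F (val T ` A)" if A: "order_bounded P A" for A
    proof (rule Po.ob_four[OF Xlin[OF T], of "\<lambda>i. if i = 0 then val a else if i = 1 then val b else if i = 2 then val c else val d"])
      show "order_bounded F ((if i = 0 then val a else if i = 1 then val b else if i = 2 then val c else val d) ` A)" if "i < 4" for i :: nat
        using Xbd[OF _ A] pp by simp
      show AP: "A \<subseteq> carrier P" using A by (simp add: order_bounded_def)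
      fix x assume "x \<in> A"
      hence x: "x \<in> carrier P" using AP by blast
      interpret hx: avl_map L F "h x" by (rule h_lin[OF x])
      have "h x T = (h x a \<ominus>\<^bsub>F\<^esub> h x b) \<oplus>\<^bsub>F\<^esub> kI \<odot>\<^bsub>F\<^esub> (h x c \<ominus>\<^bsub>F\<^esub> h x d)"
        unfolding T4 hx.T_add[OF cl(1) L.cl(5)[OF cl(2)]] hx.T_smult[OF cl(2)] hx.T_minus[OF pc(1,2)] hx.T_minus[OF pc(3,4)] ..
      thus "val T x = ((if (0::nat) = 0 then val a else if (0::nat) = 1 then val b else if (0::nat) = 2 then val c else val d) x \<ominus>\<^bsub>F\<^esub>
         (if (1::nat) = 0 then val a else if (1::nat) = 1 then val b else if (1::nat) = 2 then val c else val d) x) \<oplus>\<^bsub>F\<^esub>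
         kI \<odot>\<^bsub>F\<^esub> ((if (2::nat) = 0 then val a else if (2::nat) = 1 then val b else if (2::nat) = 2 then val c else val d) x \<ominus>\<^bsub>F\<^esub>
         (if (3::nat) = 0 then val a else if (3::nat) = 1 then val b else if (3::nat) = 2 then val c else val d) x)"
        using x by (simp add: val_def)
    qed
    thus ?thesis using Xlin[OF T] unfolding ob_maps_def val_def by auto
  qed
  have "T0 f = val T0 (t f)" if f: "f \<in> Tu" for f
  proof -
    have "ev f T0 = h (t f) T0" by (rule fun_cong[OF bspec[OF hf f]])
    thus ?thesis using T0 f by (simp add: val_def ev_def)
  qed
  moreover have "val T0 \<in> pos_ob_maps P F" if "T0 \<in> pos_bv_maps s E F"
    using Xob[OF T0] Xpos[OF that] unfolding pos_ob_maps_def by blast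
  ultimately show ?thesis using Xob[OF T0] by blast
qed

section \<open>Composition with the tensor map as the inverse of the extension\<close>

definition pullback where "pullback S = (\<lambda>f\<in>Tu. S (t f))"

lemma pullback_lin_on: assumes S: "linear_map P F S" shows "lin_on I (pullback S)"
proof -
  interpret S: avl_map P F S using S by unfold_locales
  have "multilinear_map s E F (pullback S)"
    unfolding multilinear_map_def I_def[symmetric]
  proof (intro ballI)
    fix k f assume k: "k \<in> I" and f: "f \<in> Tu"
    interpret Ek: avl "E k" using avlE[OF k] .
    have u: "f(k := x) \<in> Tu" if "x \<in> carrier (E k)" for x by (rule Tu_upd[OF f k that])
    have c: "pullback S (f(k := x)) = S (t (f(k := x)))" if "x \<in> carrier (E k)" for x
      using u[OF that] unfolding pullback_def by (rule restrict_apply')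
    have tc: "t (f(k := x)) \<in> carrier P" if "x \<in> carrier (E k)" for x by (rule t_cl[OF u[OF that]])
    show "linear_map (E k) F (\<lambda>x. pullback S (f(k := x)))"
      unfolding linear_map_def
    proof (intro conjI ballI allI)
      show "(\<lambda>x. pullback S (f(k := x))) \<in> carrier (E k) \<rightarrow> carrier F"
      proof (rule funcsetI)
        fix x assume x: "x \<in> carrier (E k)"
        show "pullback S (f(k := x)) \<in> carrier F" unfolding c[OF x] by (rule S.T_cl[OF tc[OF x]])
      qed
      fix x \<alpha> assume x: "x \<in> carrier (E k)"
      have \<alpha>x: "\<alpha> \<odot>\<^bsub>E k\<^esub> x \<in> carrier (E k)" using x by simp
      show "pullback S (f(k := \<alpha> \<odot>\<^bsub>E k\<^esub> x)) = \<alpha> \<odot>\<^bsub>F\<^esub> pullback S (f(k := x))"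
        unfolding c[OF x] c[OF \<alpha>x] t_smult[OF f k x] by (rule S.T_smult[OF tc[OF x]])
      fix y assume y: "y \<in> carrier (E k)"
      show "pullback S (f(k := x \<oplus>\<^bsub>E k\<^esub> y)) = pullback S (f(k := x)) \<oplus>\<^bsub>F\<^esub> pullback S (f(k := y))"
        unfolding c[OF x] c[OF y] c[OF Ek.M.a_closed[OF x y]] t_add[OF f k x y] by (rule S.T_add[OF tc[OF x] tc[OF y]])
    qed
  qed
  thus ?thesis using multilinear_iff I_ne by blast
qed

lemma pullback_pos: assumes S: "S \<in> pos_ob_maps P F" shows "pullback S \<in> pos_bv_maps s E F"
proof -
  have "pullback S a \<in> pos_cone F" if a: "a \<in> PTu" for a
  proof -
    have "S (t a) \<in> pos_cone F" using S t_pos[OF a] unfolding pos_ob_maps_def by blast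
    moreover have "pullback S a = S (t a)" unfolding pullback_def by (rule restrict_apply'[OF PTu_Tu[OF a]])
    ultimately show ?thesis by (simp only:)
  qed
  moreover have "lin_on I (pullback S)" by (rule pullback_lin_on[OF ob_linear]) (use S in \<open>simp add: pos_ob_maps_def\<close>)
  ultimately show ?thesis unfolding pos_bv_iff by (simp add: pullback_def)
qed

lemma pullback_add: "pullback (S \<oplus>\<^bsub>Q\<^esub> S') = pullback S \<oplus>\<^bsub>L\<^esub> pullback S'" and pullback_smult: "pullback (\<alpha> \<odot>\<^bsub>Q\<^esub> S) = \<alpha> \<odot>\<^bsub>L\<^esub> pullback S"
  unfolding pullback_def Q_simps bv_lattice_simps by (rule restrict_ext; simp)+

text \<open>A positive operator pulls back to a positive map, which has bounded variation
  automatically; every order bounded operator is a combination of four positive ones.\<close>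

lemma pullback_bv: assumes S: "S \<in> ob_maps P F" shows "pullback S \<in> bv_maps s E F"
proof -
  interpret Q: avl Q by (rule Q_avl)
  have add: "pullback (S \<oplus>\<^bsub>Q\<^esub> S') \<in> carrier L" if "pullback S \<in> carrier L" "pullback S' \<in> carrier L" for S S'
    unfolding pullback_add using that by (rule L.M.a_closed)
  have smult: "pullback (\<alpha> \<odot>\<^bsub>Q\<^esub> S) \<in> carrier L" if "pullback S \<in> carrier L" for S \<alpha>
    unfolding pullback_smult using that by (rule L.cl)
  have minus: "S \<ominus>\<^bsub>Q\<^esub> S' = S \<oplus>\<^bsub>Q\<^esub> (-1) \<odot>\<^bsub>Q\<^esub> S'" if "S \<in> carrier Q" "S' \<in> carrier Q" for S S'
    using that by (intro Q.vec_eqI) auto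
  have pos: "pullback S \<in> carrier L" if "S \<in> pos_cone Q" for S
    using pullback_pos that pos_bv unfolding Q_cone bv_lattice_simps by blast
  have "S \<in> carrier Q" using S by (simp only: Q_simps)
  from Q.carrier_four[OF this] obtain a b c d where
    p: "a \<in> pos_cone Q" "b \<in> pos_cone Q" "c \<in> pos_cone Q" "d \<in> pos_cone Q"
    and S4: "S = (a \<ominus>\<^bsub>Q\<^esub> b) \<oplus>\<^bsub>Q\<^esub> kI \<odot>\<^bsub>Q\<^esub> (c \<ominus>\<^bsub>Q\<^esub> d)" by blast
  have "pullback S \<in> carrier L"
    unfolding S4 minus[OF Q.CnD[OF p(1)] Q.CnD[OF p(2)]] minus[OF Q.CnD[OF p(3)] Q.CnD[OF p(4)]]
    by (intro add smult pos p)
  thus ?thesis by (simp only: bv_lattice_simps)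
qed

abbreviation tensor_ext where "tensor_ext \<equiv> tensor_extension s E P t F"

lemma unique_extension:
  assumes T: "T \<in> bv_maps s E F" shows "\<exists>!S. S \<in> ob_maps P F \<and> (\<forall>f\<in>Tu. T f = S (t f))"
proof -
  obtain S where S: "S \<in> ob_maps P F" "\<forall>f\<in>Tu. T f = S (t f)" using ob_exists[OF T] by blast
  show ?thesis
  proof (rule ex1I[of _ S])
    fix S' assume "S' \<in> ob_maps P F \<and> (\<forall>f\<in>Tu. T f = S' (t f))"
    thus "S' = S" using S by - (rule ob_unique; simp)
  qed (use S in simp)
qed

lemma tensor_ext: "T \<in> bv_maps s E F ==> tensor_ext T \<in> ob_maps P F" "T \<in> bv_maps s E F ==> f \<in> Tu ==> T f = tensor_ext T (t f)"
  using theI'[OF unique_extension[of T]] unfolding tensor_extension_def by auto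

lemma tensor_ext_eqI: "T \<in> bv_maps s E F ==> S \<in> ob_maps P F ==> (\<And>f. f \<in> Tu ==> T f = S (t f)) ==> tensor_ext T = S"
  using ob_unique[of "tensor_ext T" S] tensor_ext[of T] by simp

lemma pullback_tensor_ext: assumes T: "T \<in> bv_maps s E F" shows "pullback (tensor_ext T) = T"
  by (rule extensionalityI[of _ Tu]) (use bvD(2)[OF T] tensor_ext(2)[OF T] in \<open>auto simp: pullback_def\<close>)

lemma tensor_ext_pullback: assumes S: "S \<in> ob_maps P F" shows "tensor_ext (pullback S) = S"
  by (rule tensor_ext_eqI[OF pullback_bv[OF S] S]) (simp add: pullback_def)

lemma tensor_ext_linear: "linear_map L Q tensor_ext"
  unfolding linear_map_def
proof (intro conjI ballI allI)
  show "tensor_ext \<in> carrier L \<rightarrow> carrier Q" using tensor_ext(1) by (simp add: Q_simps)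
  fix T \<alpha> assume "T \<in> carrier L"
  hence T: "T \<in> bv_maps s E F" by simp
  have "pullback (\<alpha> \<odot>\<^bsub>Q\<^esub> tensor_ext T) = \<alpha> \<odot>\<^bsub>L\<^esub> T" by (simp only: pullback_smult pullback_tensor_ext[OF T])
  thus "tensor_ext (\<alpha> \<odot>\<^bsub>L\<^esub> T) = \<alpha> \<odot>\<^bsub>Q\<^esub> tensor_ext T" using tensor_ext_pullback[OF Q_smult[OF tensor_ext(1)[OF T]]] by metis
  fix T' assume "T' \<in> carrier L"
  hence T': "T' \<in> bv_maps s E F" by simp
  have "pullback (tensor_ext T \<oplus>\<^bsub>Q\<^esub> tensor_ext T') = T \<oplus>\<^bsub>L\<^esub> T'" by (simp only: pullback_add pullback_tensor_ext[OF T] pullback_tensor_ext[OF T'])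
  thus "tensor_ext (T \<oplus>\<^bsub>L\<^esub> T') = tensor_ext T \<oplus>\<^bsub>Q\<^esub> tensor_ext T'" using tensor_ext_pullback[OF Q_add[OF tensor_ext(1)[OF T] tensor_ext(1)[OF T']]] by metis
qed

text \<open>A linear bijection that preserves positivity in both directions preserves the modulus.
  One direction is \<open>pullback_pos\<close>; the other uses uniqueness to identify the extension
  with the positive one from \<open>ob_exists\<close>.\<close>

lemma tensor_ext_iso: "vl_iso L Q tensor_ext"
proof (rule vl_iso_if_cone_iso[OF bv_lattice_avl ob_space.ob_lattice_structure(1)[OF P_ob] tensor_ext_linear])
  show "bij_betw tensor_ext (carrier L) (carrier Q)"
    unfolding bv_lattice_simps Q_simps
    by (rule bij_betwI[where g = pullback]) (use tensor_ext(1) pullback_bv pullback_tensor_ext tensor_ext_pullback in auto)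
  fix T assume "T \<in> carrier L"
  hence T: "T \<in> bv_maps s E F" by simp
  show "tensor_ext T \<in> pos_cone Q \<longleftrightarrow> T \<in> pos_cone L"
    unfolding Q_cone bv_lattice_cone
  proof
    assume "tensor_ext T \<in> pos_ob_maps P F"
    from pullback_pos[OF this] show "T \<in> pos_bv_maps s E F" by (simp only: pullback_tensor_ext[OF T])
  next
    assume Tp: "T \<in> pos_bv_maps s E F"
    obtain S where S: "S \<in> ob_maps P F" "\<forall>f\<in>Tu. T f = S (t f)" "S \<in> pos_ob_maps P F"
      using ob_exists[OF T] Tp by blast
    have "tensor_ext T = S" by (rule tensor_ext_eqI[OF T S(1)]) (simp add: S(2))
    thus "tensor_ext T \<in> pos_ob_maps P F" using S(3) by simp
  qed
qed

end

theorem theorem5p7: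
  fixes s :: nat
    and E :: "nat \<Rightarrow> ('k :: real_or_complex, 'a) vlattice"
    and F :: "('k, 'f) vlattice"
    and P :: "('k, 'p) vlattice"
    and t :: "(nat \<Rightarrow> 'a) \<Rightarrow> 'p"
  assumes "s \<ge> 1"
    and "\<And>k. k \<in> {1..s} \<Longrightarrow> archimedean_vector_lattice (E k)"
    and "archimedean_vector_lattice F"
    and "dedekind_complete F"
    and "is_tensor_product TYPE(('a, 'p, 'f) test_universe) s E P t"
  shows
    "(\<forall>T\<in>bv_maps s E F. \<exists>!S. S \<in> ob_maps P F \<and> (\<forall>f\<in>tuples s E. T f = S (t f))) \<and>
     (archimedean_vector_lattice (bv_lattice s E F) \<and>
      pos_cone (bv_lattice s E F) = pos_bv_maps s E F \<and>
      dedekind_complete (bv_lattice s E F) \<and>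
      vl_iso (bv_lattice s E F) (ob_lattice P F) (tensor_extension s E P t F)) \<and>
     (\<forall>T\<in>bv_maps s E F. \<forall>a\<in>pos_tuples s E.
        is_cone_sup F (variation_sums s E F T a) (modulus (bv_lattice s E F) T a))"
proof -
  have "dc_avl F" by (rule dc_avl.intro[OF avl.intro[OF assms(3)]]) (rule dc_avl_axioms.intro[OF assms(4)])
  hence "avl_family s E F" by (rule avl_family.intro) (rule avl_family_axioms.intro, rule assms(2))
  hence "avl_family_ne s E F" by (rule avl_family_ne.intro) (rule avl_family_ne_axioms.intro[OF assms(1)])
  then interpret tensor s E F P t by (rule tensor.intro) (rule tensor_axioms.intro[OF assms(5)])
  show ?thesis
    by (intro conjI ballI; rule unique_extension bv_lattice_avl bv_lattice_cone bv_dedekind_complete tensor_ext_iso modulus_formula; assumption)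
qed



end
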